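(* Let $\mathcal H$ be an SSH structure on $\mathcal C=\mathcal H([1])$. Then $\mathcal H$ canonically defines the structure of a positive self-adjoint Hopf (PSH) algebra on the Grothendieck group $K(\mathcal C)$, with multiplication induced by $m=\mathcal H([2]\to[1])$ (via $K(\mathcal C^{\otimes[2]})\cong K(\mathcal C)\otimes K(\mathcal C)$), comultiplication its adjoint, inner product $\langle[X],[Y]\rangle=\dim\mathrm{Hom}(X,Y)$ and distinguished basis the classes of simple objects.
   Context: **Conventions.** $\Bbbk$ is a field of characteristic $0$; $\mathbf{Vect}$ is the category of finite-dimensional $\Bbbk$-vector spaces; $[n]=\{1,\dots,n\}$. $\mathbf{FinSet}_*$ is the category of pointed finite sets; $[n]_*=\{1,\dots,n,*\}$. **PSH algebra.** A PSH algebra is a graded connected Hopf algebra $A=\bigoplus_{n\ge0}A_n$ over $\mathbb Z$ with an inner product and a distinguished orthogonal $\mathbb Z$-basis, finite in each degree, such that multiplication and comultiplication are adjoint and take elements with non-negative coefficients in the basis to elements with non-negative coefficients. Connected means that the unit and the counit restricted to $A_0$ give an isomorphism of $A_0$ with $\mathbb Z$. **$\mathbf{2Vect}_{gr}$.** A 2-vector space is a semisimple $\Bbbk$-linear category equivalent to a finite sum of copies of $\mathbf{Vect}$. The bicategory $\mathbf{2Vect}_{gr}$ has as objects the sequences $(\mathcal C_n)_{n\ge 0}$ of 2-vector spaces (thought of as graded categories), as 1-morphisms finite sums of exact functors of bounded degree, as 2-morphisms natural transformations. Every 1-morphism has left and right adjoints. $\otimes$ denotes the (graded) Deligne tensor product.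 **$\mathbf{FinSet}^{\sqcup}\to\mathbf{FinSet}_*$.** Objects over $I$: collections $(S_i)_{i\in I}$ of finite sets with $S_{*}$ a point (omitted from notation). Morphisms over $\varphi:I\to J$: collections of maps $S_i\to T_{\varphi(i)}$, $i\in I$. **$\mathbf{2Vect}_{gr}^{\otimes}\to\mathbf{FinSet}_*$.** Objects over $I$: collections $(\mathcal C_i)_{i\in I}$ of objects of $\mathbf{2Vect}_{gr}$ with $\mathcal C_*=0$. A 1-morphism $(\mathcal C_i)\to(\mathcal D_j)$ over $\varphi:I\to J$ is a collection of multi-exact bounded functors $f_j:\prod_{\varphi(i)=j}\mathcal C_i\to\mathcal D_j$ (finite sums of multi-exact functors of non-negative bounded degree; the empty product is $\mathbf{Vect}$, so for empty fibre $f_j$ is an object of $\mathcal D_j$). 2-morphisms are collections of natural transformations. **coCartesian arrows.** For $p:\mathcal E\to B$ a functor from a bicategory to a 1-category, $F:X\to Y$ over $f$ is coCartesian if for all $Z$ and $g:p(Y)\to p(Z)$, precomposition with $F$ is an equivalence from the category of arrows $Y\to Z$ over $g$ to the category of arrows $X\to Z$ over $g f$. **Beck–Chevalley (BC) condition.** For a square with top $g:A\to B$, left $f:A\to C$, right $h:B\to D$, bottom $i:C\to D$ and 2-morphism $\alpha:hg\Rightarrow if$: the left mate is $\alpha_L:i_Lh\to i_Lhgg_L\to i_Lifg_L\to fg_L$, where $g_L,i_L$ are left adjoints; the right mate is $\alpha_R:gf_R\to h_Rhgf_R\to h_Riff_R\to h_Ri$, where $f_R,h_R$ are right adjoints. The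 square satisfies the BC condition if its mates are invertible (the left mate is invertible iff the right mate is, when both exist). **SSH category.** A symmetric self-adjoint Hopf (SSH) category is a pseudofunctor $\mathcal H:\mathbf{FinSet}^\sqcup\to\mathbf{2Vect}_{gr}^\otimes$ over $\mathbf{FinSet}_*$ which (1) takes maps to degree-zero maps, (2) takes coCartesian arrows to coCartesian arrows, (3) takes Cartesian squares in the fibre over $[1]_*$ (i.e. in $\mathbf{FinSet}$) to squares satisfying the BC condition. One says $\mathcal H$ is an SSH structure on $\mathcal C=\mathcal H([1])$. Write $\mathcal C^{\otimes U}=\mathcal H(U)$; by (2) this is a Deligne tensor power of $\mathcal C$. *)

theory Defs
  imports
    "HOL-Library.FuncSet"
    "HOL-Algebra.Free_Abelian_Groups"
    "HOL-Algebra.Elementary_Groups"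
    "Jordan_Normal_Form.VS_Connect"
begin

section \<open>Linear categories\<close>

text \<open>
  The field is the type \<open>'k\<close> of class \<open>field_char_0\<close>.  A category has its objects in the
  type \<open>'o\<close> and its arrows in the type \<open>'m\<close>; \<open>Cmp C g f\<close> is \<open>g\<close> after \<open>f\<close>.  The hom-sets of a
  category are pairwise disjoint because every arrow knows its source and target.
\<close>

record ('o, 'm, 'k) lcat =
  Obj :: "'o set"
  Arr :: "'m set"
  Src :: "'m \<Rightarrow> 'o"
  Tgt :: "'m \<Rightarrow> 'o"
  Ide :: "'o \<Rightarrow> 'm"
  Cmp :: "'m \<Rightarrow> 'm \<Rightarrow> 'm"
  ZeroA :: "'o \<Rightarrow> 'o \<Rightarrow> 'm"
  AddA :: "'m \<Rightarrow> 'm \<Rightarrow> 'm"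
  ScaleA :: "'k \<Rightarrow> 'm \<Rightarrow> 'm"

definition Homs :: "('o, 'm, 'k) lcat \<Rightarrow> 'o \<Rightarrow> 'o \<Rightarrow> 'm set" where
  "Homs C a b = {f \<in> Arr C. Src C f = a \<and> Tgt C f = b}"

text \<open>The components \<open>mult\<close> and \<open>one\<close> of a module record play no role.\<close>

definition hom_space :: "('o, 'm, 'k) lcat \<Rightarrow> 'o \<Rightarrow> 'o \<Rightarrow> ('k, 'm) module" where
  "hom_space C a b = \<lparr>carrier = Homs C a b, monoid.mult = undefined, one = undefined,
     zero = ZeroA C a b, add = AddA C, smult = ScaleA C\<rparr>"

definition hom_dim :: "('o, 'm, 'k::field) lcat \<Rightarrow> 'o \<Rightarrow> 'o \<Rightarrow> nat" where
  "hom_dim C a b = vectorspace.dim (class_ring :: 'k ring) (hom_space C a b)"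

definition category :: "('o, 'm, 'k) lcat \<Rightarrow> bool" where
  "category C \<longleftrightarrow>
     (\<forall>f\<in>Arr C. Src C f \<in> Obj C \<and> Tgt C f \<in> Obj C) \<and>
     (\<forall>a\<in>Obj C. Ide C a \<in> Homs C a a) \<and>
     (\<forall>a b c. \<forall>f\<in>Homs C a b. \<forall>g\<in>Homs C b c. Cmp C g f \<in> Homs C a c) \<and>
     (\<forall>a b. \<forall>f\<in>Homs C a b. Cmp C f (Ide C a) = f \<and> Cmp C (Ide C b) f = f) \<and>
     (\<forall>a b c d. \<forall>f\<in>Homs C a b. \<forall>g\<in>Homs C b c. \<forall>h\<in>Homs C c d.
        Cmp C h (Cmp C g f) = Cmp C (Cmp C h g) f)"

definition linear_category :: "('o, 'm, 'k::field) lcat \<Rightarrow> bool" where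
  "linear_category C \<longleftrightarrow>
     category C \<and>
     (\<forall>a\<in>Obj C. \<forall>b\<in>Obj C. vectorspace (class_ring :: 'k ring) (hom_space C a b)) \<and>
     (\<forall>a b c. \<forall>f\<in>Homs C a b. \<forall>f'\<in>Homs C a b. \<forall>g\<in>Homs C b c. \<forall>g'\<in>Homs C b c. \<forall>r.
        Cmp C g (AddA C f f') = AddA C (Cmp C g f) (Cmp C g f') \<and>
        Cmp C (AddA C g g') f = AddA C (Cmp C g f) (Cmp C g' f) \<and>
        Cmp C g (ScaleA C r f) = ScaleA C r (Cmp C g f) \<and>
        Cmp C (ScaleA C r g) f = ScaleA C r (Cmp C g f))"

definition is_inverse :: "('o, 'm, 'k) lcat \<Rightarrow> 'm \<Rightarrow> 'm \<Rightarrow> bool" where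
  "is_inverse C f g \<longleftrightarrow> f \<in> Arr C \<and> g \<in> Homs C (Tgt C f) (Src C f) \<and>
     Cmp C g f = Ide C (Src C f) \<and> Cmp C f g = Ide C (Tgt C f)"

definition is_iso :: "('o, 'm, 'k) lcat \<Rightarrow> 'm \<Rightarrow> bool" where
  "is_iso C f \<longleftrightarrow> (\<exists>g. is_inverse C f g)"

definition inv_arr :: "('o, 'm, 'k) lcat \<Rightarrow> 'm \<Rightarrow> 'm" where
  "inv_arr C f = (THE g. is_inverse C f g)"

definition isomorphic_in :: "('o, 'm, 'k) lcat \<Rightarrow> 'o \<Rightarrow> 'o \<Rightarrow> bool" where
  "isomorphic_in C a b \<longleftrightarrow> (\<exists>f\<in>Homs C a b. is_iso C f)"

definition is_zero_obj :: "('o, 'm, 'k) lcat \<Rightarrow> 'o \<Rightarrow> bool" where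
  "is_zero_obj C a \<longleftrightarrow> a \<in> Obj C \<and>
     (\<forall>b\<in>Obj C. (\<exists>!f. f \<in> Homs C a b) \<and> (\<exists>!f. f \<in> Homs C b a))"

definition is_mono :: "('o, 'm, 'k) lcat \<Rightarrow> 'm \<Rightarrow> bool" where
  "is_mono C f \<longleftrightarrow> f \<in> Arr C \<and>
     (\<forall>a. \<forall>g\<in>Homs C a (Src C f). \<forall>h\<in>Homs C a (Src C f). Cmp C f g = Cmp C f h \<longrightarrow> g = h)"

text \<open>A simple object is a non-zero object whose only subobjects are zero and itself.\<close>

definition is_simple :: "('o, 'm, 'k) lcat \<Rightarrow> 'o \<Rightarrow> bool" where
  "is_simple C a \<longleftrightarrow> a \<in> Obj C \<and> \<not> is_zero_obj C a \<and>
     (\<forall>b. \<forall>f\<in>Homs C b a. is_mono C f \<longrightarrow> is_zero_obj C b \<or> is_iso C f)"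

definition is_direct_sum :: "('o, 'm, 'k) lcat \<Rightarrow> 'o \<Rightarrow> nat \<Rightarrow> (nat \<Rightarrow> 'o) \<Rightarrow> bool" where
  "is_direct_sum C x n s \<longleftrightarrow>
     x \<in> Obj C \<and> (\<forall>k<n. s k \<in> Obj C) \<and>
     (\<exists>\<iota> \<pi>. (\<forall>k<n. \<iota> k \<in> Homs C (s k) x \<and> \<pi> k \<in> Homs C x (s k)) \<and>
        (\<forall>k<n. \<forall>l<n. Cmp C (\<pi> k) (\<iota> l) = (if k = l then Ide C (s k) else ZeroA C (s l) (s k))) \<and>
        finsum (hom_space C x x) (\<lambda>k. Cmp C (\<iota> k) (\<pi> k)) {..<n} = Ide C x)"

definition semisimple :: "('o, 'm, 'k) lcat \<Rightarrow> bool" where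
  "semisimple C \<longleftrightarrow>
     (\<forall>x\<in>Obj C. \<exists>n s. (\<forall>k<n. is_simple C (s k)) \<and> is_direct_sum C x n s)"

definition is_kernel :: "('o, 'm, 'k) lcat \<Rightarrow> 'm \<Rightarrow> 'm \<Rightarrow> bool" where
  "is_kernel C g f \<longleftrightarrow> f \<in> Arr C \<and> g \<in> Arr C \<and> Tgt C f = Src C g \<and>
     Cmp C g f = ZeroA C (Src C f) (Tgt C g) \<and>
     (\<forall>a. \<forall>h\<in>Homs C a (Src C g). Cmp C g h = ZeroA C a (Tgt C g) \<longrightarrow>
        (\<exists>!u. u \<in> Homs C a (Src C f) \<and> Cmp C f u = h))"

definition is_cokernel :: "('o, 'm, 'k) lcat \<Rightarrow> 'm \<Rightarrow> 'm \<Rightarrow> bool" where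
  "is_cokernel C f g \<longleftrightarrow> f \<in> Arr C \<and> g \<in> Arr C \<and> Tgt C f = Src C g \<and>
     Cmp C g f = ZeroA C (Src C f) (Tgt C g) \<and>
     (\<forall>a. \<forall>h\<in>Homs C (Src C g) a. Cmp C h f = ZeroA C (Src C f) a \<longrightarrow>
        (\<exists>!u. u \<in> Homs C (Tgt C g) a \<and> Cmp C u g = h))"

text \<open>\<open>0 \<rightarrow> \<bullet> \<rightarrow>\<^sub>f \<bullet> \<rightarrow>\<^sub>g \<bullet> \<rightarrow> 0\<close> is a short exact sequence.\<close>

definition short_exact :: "('o, 'm, 'k) lcat \<Rightarrow> 'm \<Rightarrow> 'm \<Rightarrow> bool" where
  "short_exact C f g \<longleftrightarrow> is_kernel C g f \<and> is_cokernel C f g"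

definition prod_cat :: "nat set \<Rightarrow> (nat \<Rightarrow> ('o, 'm, 'k) lcat) \<Rightarrow> (nat \<Rightarrow> 'o, nat \<Rightarrow> 'm, 'k) lcat" where
  "prod_cat I C = \<lparr>
     Obj = (\<Pi>\<^sub>E i\<in>I. Obj (C i)),
     Arr = (\<Pi>\<^sub>E i\<in>I. Arr (C i)),
     Src = (\<lambda>f. \<lambda>i\<in>I. Src (C i) (f i)),
     Tgt = (\<lambda>f. \<lambda>i\<in>I. Tgt (C i) (f i)),
     Ide = (\<lambda>a. \<lambda>i\<in>I. Ide (C i) (a i)),
     Cmp = (\<lambda>g f. \<lambda>i\<in>I. Cmp (C i) (g i) (f i)),
     ZeroA = (\<lambda>a b. \<lambda>i\<in>I. ZeroA (C i) (a i) (b i)),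
     AddA = (\<lambda>f g. \<lambda>i\<in>I. AddA (C i) (f i) (g i)),
     ScaleA = (\<lambda>r f. \<lambda>i\<in>I. ScaleA (C i) r (f i))\<rparr>"

definition full_subcat :: "('o, 'm, 'k) lcat \<Rightarrow> 'o set \<Rightarrow> ('o, 'm, 'k) lcat" where
  "full_subcat C S = C\<lparr>
     Obj := Obj C \<inter> S,
     Arr := {f \<in> Arr C. Src C f \<in> S \<and> Tgt C f \<in> S}\<rparr>"

section \<open>Functors and natural transformations\<close>

record ('o, 'm, 'p, 'q) fctr =
  fob :: "'o \<Rightarrow> 'p"
  far :: "'m \<Rightarrow> 'q"

definition is_functor ::
  "('o, 'm, 'k) lcat \<Rightarrow> ('p, 'q, 'k) lcat \<Rightarrow> ('o, 'm, 'p, 'q) fctr \<Rightarrow> bool" where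
  "is_functor C D F \<longleftrightarrow>
     (\<forall>a\<in>Obj C. fob F a \<in> Obj D \<and> far F (Ide C a) = Ide D (fob F a)) \<and>
     (\<forall>a b. \<forall>f\<in>Homs C a b. far F f \<in> Homs D (fob F a) (fob F b)) \<and>
     (\<forall>a b c. \<forall>f\<in>Homs C a b. \<forall>g\<in>Homs C b c. far F (Cmp C g f) = Cmp D (far F g) (far F f))"

definition fctr_id :: "('o, 'm, 'o, 'm) fctr" where
  "fctr_id = \<lparr>fob = (\<lambda>x. x), far = (\<lambda>f. f)\<rparr>"

definition fctr_comp ::
  "('p, 'q, 'r, 's) fctr \<Rightarrow> ('o, 'm, 'p, 'q) fctr \<Rightarrow> ('o, 'm, 'r, 's) fctr" where
  "fctr_comp G F = \<lparr>fob = fob G \<circ> fob F, far = far G \<circ> far F\<rparr>"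

definition linear_functor ::
  "('o, 'm, 'k) lcat \<Rightarrow> ('p, 'q, 'k) lcat \<Rightarrow> ('o, 'm, 'p, 'q) fctr \<Rightarrow> bool" where
  "linear_functor C D F \<longleftrightarrow> is_functor C D F \<and>
     (\<forall>a b r. \<forall>f\<in>Homs C a b. \<forall>g\<in>Homs C a b.
        far F (AddA C f g) = AddA D (far F f) (far F g) \<and>
        far F (ScaleA C r f) = ScaleA D r (far F f))"

definition exact_functor ::
  "('o, 'm, 'k) lcat \<Rightarrow> ('p, 'q, 'k) lcat \<Rightarrow> ('o, 'm, 'p, 'q) fctr \<Rightarrow> bool" where
  "exact_functor C D F \<longleftrightarrow> linear_functor C D F \<and>
     (\<forall>f g. short_exact C f g \<longrightarrow> short_exact D (far F f) (far F g))"

definition linear_equivalent :: "('o, 'm, 'k) lcat \<Rightarrow> ('p, 'q, 'k) lcat \<Rightarrow> bool" where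
  "linear_equivalent C D \<longleftrightarrow> (\<exists>F. linear_functor C D F \<and>
     (\<forall>a\<in>Obj C. \<forall>b\<in>Obj C. bij_betw (far F) (Homs C a b) (Homs D (fob F a) (fob F b))) \<and>
     (\<forall>d\<in>Obj D. \<exists>a\<in>Obj C. isomorphic_in D (fob F a) d))"

definition nat_trans ::
  "('o, 'm, 'k) lcat \<Rightarrow> ('p, 'q, 'k) lcat \<Rightarrow> ('o, 'm, 'p, 'q) fctr \<Rightarrow> ('o, 'm, 'p, 'q) fctr
     \<Rightarrow> ('o \<Rightarrow> 'q) set" where
  "nat_trans C D F G = {\<alpha> \<in> (\<Pi>\<^sub>E a\<in>Obj C. Homs D (fob F a) (fob G a)).
     \<forall>a b. \<forall>f\<in>Homs C a b. Cmp D (far G f) (\<alpha> a) = Cmp D (\<alpha> b) (far F f)}"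

text \<open>
  A functor out of a product, in the \<open>i\<close>-th variable: all other variables are frozen at the
  objects given by \<open>a\<close>.
\<close>

definition slot ::
  "nat set \<Rightarrow> (nat \<Rightarrow> ('o, 'm, 'k) lcat) \<Rightarrow> (nat \<Rightarrow> 'o) \<Rightarrow> nat \<Rightarrow> ('o, 'm, nat \<Rightarrow> 'o, nat \<Rightarrow> 'm) fctr"
  where
  "slot I C a i = \<lparr>fob = (\<lambda>x. a(i := x)), far = (\<lambda>f. (\<lambda>j\<in>I. Ide (C j) (a j))(i := f))\<rparr>"

text \<open>
  For \<open>I = {}\<close> the product category has a single object, so that a multi-exact functor is just
  an object of \<open>D\<close>.
\<close>

definition multi_exact ::
  "nat set \<Rightarrow> (nat \<Rightarrow> ('o, 'm, 'k) lcat) \<Rightarrow> ('p, 'q, 'k) lcat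
     \<Rightarrow> (nat \<Rightarrow> 'o, nat \<Rightarrow> 'm, 'p, 'q) fctr \<Rightarrow> bool" where
  "multi_exact I C D F \<longleftrightarrow> is_functor (prod_cat I C) D F \<and>
     (\<forall>a\<in>Obj (prod_cat I C). \<forall>i\<in>I. exact_functor (C i) D (fctr_comp F (slot I C a i)))"

section \<open>Graded 2-vector spaces\<close>

text \<open>
  Finite-dimensional vector spaces, each replaced by a coordinate space: the objects are the
  dimensions, and the arrows \<open>n \<rightarrow> m\<close> are the \<open>m \<times> n\<close> matrices, i.e. the linear maps between
  the coordinate spaces of dimensions \<open>n\<close> and \<open>m\<close>.
\<close>

definition Vect :: "(nat, 'k::field mat, 'k) lcat" where
  "Vect = \<lparr>Obj = UNIV, Arr = UNIV, Src = dim_col, Tgt = dim_row, Ide = 1\<^sub>m, Cmp = (*),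
     ZeroA = (\<lambda>n m. 0\<^sub>m m n), AddA = (+), ScaleA = (\<cdot>\<^sub>m)\<rparr>"

definition two_vector_space :: "('o, 'm, 'k::field) lcat \<Rightarrow> bool" where
  "two_vector_space C \<longleftrightarrow> linear_category C \<and> semisimple C \<and>
     (\<exists>r. linear_equivalent C (prod_cat {..<r} (\<lambda>_. Vect :: (nat, 'k mat, 'k) lcat)))"

text \<open>
  All 2-vector spaces below have objects in \<open>'o\<close> and arrows in \<open>'m\<close>, so these two types are the
  universe over which ``for all 2-vector spaces'' ranges.  If some category over \<open>'o\<close> and \<open>'m\<close> is
  equivalent to \<open>Vect\<close>, then \<open>'o\<close> is infinite and \<open>'m\<close> has at least as many elements as \<open>'k\<close>,
  hence every 2-vector space has an equivalent copy over \<open>'o\<close> and \<open>'m\<close>.  For smaller types all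
  2-vector spaces over \<open>'o\<close> and \<open>'m\<close> are zero.
\<close>

type_synonym ('o, 'm, 'k) gcat = "nat \<Rightarrow> ('o, 'm, 'k) lcat"

definition graded_2vect :: "('o, 'm, 'k::field) gcat \<Rightarrow> bool" where
  "graded_2vect C \<longleftrightarrow> (\<forall>n. two_vector_space (C n))"

definition gsupp :: "('o, 'm, 'k) gcat \<Rightarrow> (nat \<Rightarrow> 'o) \<Rightarrow> nat set" where
  "gsupp C x = {n. \<not> is_zero_obj (C n) (x n)}"

text \<open>
  The graded category \<open>\<Oplus>\<^sub>n C\<^sub>n\<close> of a sequence: sequences of objects that are zero in almost all
  degrees.  Functors between graded categories are functors between these direct sums.
\<close>

definition tot :: "('o, 'm, 'k) gcat \<Rightarrow> (nat \<Rightarrow> 'o, nat \<Rightarrow> 'm, 'k) lcat" where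
  "tot C = full_subcat (prod_cat UNIV C) {x. finite (gsupp C x)}"

text \<open>
  The degree of \<open>F\<close> lies between \<open>lo\<close> and \<open>hi\<close>: objects concentrated in degrees \<open>n\<^sub>i\<close> go to
  objects supported in degrees \<open>d + \<Sum> n\<^sub>i\<close>, \<open>lo \<le> d \<le> hi\<close>.  Such an \<open>F\<close> is the finite sum of its
  homogeneous components of degrees \<open>d\<close>, and conversely.
\<close>

definition degree_between ::
  "nat set \<Rightarrow> (nat \<Rightarrow> ('o, 'm, 'k) gcat) \<Rightarrow> ('o, 'm, 'k) gcat
     \<Rightarrow> (nat \<Rightarrow> nat \<Rightarrow> 'o, nat \<Rightarrow> nat \<Rightarrow> 'm, nat \<Rightarrow> 'o, nat \<Rightarrow> 'm) fctr \<Rightarrow> int \<Rightarrow> int \<Rightarrow> bool" where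
  "degree_between I C D F lo hi \<longleftrightarrow>
     (\<forall>x\<in>Obj (prod_cat I (\<lambda>i. tot (C i))). \<forall>n :: nat \<Rightarrow> nat.
        (\<forall>i\<in>I. gsupp (C i) (x i) \<subseteq> {n i}) \<longrightarrow>
        (\<forall>m\<in>gsupp D (fob F x). int m - (\<Sum>i\<in>I. int (n i)) \<in> {lo..hi}))"

subsection \<open>The bicategory of graded 2-vector spaces\<close>

type_synonym ('o, 'm) gfctr = "(nat \<Rightarrow> 'o, nat \<Rightarrow> 'm, nat \<Rightarrow> 'o, nat \<Rightarrow> 'm) fctr"

definition gr_mor :: "('o, 'm, 'k) gcat \<Rightarrow> ('o, 'm, 'k) gcat \<Rightarrow> ('o, 'm) gfctr \<Rightarrow> bool" where
  "gr_mor C D F \<longleftrightarrow> exact_functor (tot C) (tot D) F \<and>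
     (\<exists>N::int. \<forall>x\<in>Obj (tot C). \<forall>n. gsupp C x \<subseteq> {n} \<longrightarrow>
        (\<forall>m\<in>gsupp D (fob F x). \<bar>int m - int n\<bar> \<le> N))"

text \<open>\<open>L : C \<rightarrow> D\<close> is left adjoint to \<open>R : D \<rightarrow> C\<close>, with unit \<open>\<eta>\<close> and counit \<open>\<epsilon>\<close>.\<close>

definition gr_adjunction ::
  "('o, 'm, 'k) gcat \<Rightarrow> ('o, 'm, 'k) gcat \<Rightarrow> ('o, 'm) gfctr \<Rightarrow> ('o, 'm) gfctr
     \<Rightarrow> ((nat \<Rightarrow> 'o) \<Rightarrow> nat \<Rightarrow> 'm) \<Rightarrow> ((nat \<Rightarrow> 'o) \<Rightarrow> nat \<Rightarrow> 'm) \<Rightarrow> bool" where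
  "gr_adjunction C D L R \<eta> \<epsilon> \<longleftrightarrow> gr_mor C D L \<and> gr_mor D C R \<and>
     \<eta> \<in> nat_trans (tot C) (tot C) fctr_id (fctr_comp R L) \<and>
     \<epsilon> \<in> nat_trans (tot D) (tot D) (fctr_comp L R) fctr_id \<and>
     (\<forall>x\<in>Obj (tot C). Cmp (tot D) (\<epsilon> (fob L x)) (far L (\<eta> x)) = Ide (tot D) (fob L x)) \<and>
     (\<forall>y\<in>Obj (tot D). Cmp (tot C) (far R (\<epsilon> y)) (\<eta> (fob R y)) = Ide (tot C) (fob R y))"

text \<open>
  For a square with top \<open>g : A \<rightarrow> B\<close>, left \<open>f : A \<rightarrow> C\<close>, right \<open>h : B \<rightarrow> D\<close>, bottom \<open>i : C \<rightarrow> D\<close> and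
  \<open>\<alpha> : h g \<Rightarrow> i f\<close>, the left mate at an object \<open>y\<close> of \<open>B\<close> is
  \<open>i\<^sub>L h y \<rightarrow> i\<^sub>L h g g\<^sub>L y \<rightarrow> i\<^sub>L i f g\<^sub>L y \<rightarrow> f g\<^sub>L y\<close>, and the right mate at an object \<open>z\<close> of \<open>C\<close> is
  \<open>g f\<^sub>R z \<rightarrow> h\<^sub>R h g f\<^sub>R z \<rightarrow> h\<^sub>R i f f\<^sub>R z \<rightarrow> h\<^sub>R i z\<close>.
\<close>

definition left_mate where
  "left_mate C f h \<alpha> gL \<eta>g iL \<epsilon>i y =
     Cmp (tot C) (\<epsilon>i (fob f (fob gL y)))
       (Cmp (tot C) (far iL (\<alpha> (fob gL y))) (far iL (far h (\<eta>g y))))"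

definition right_mate where
  "right_mate B g i \<alpha> fR \<epsilon>f hR \<eta>h z =
     Cmp (tot B) (far hR (far i (\<epsilon>f z)))
       (Cmp (tot B) (far hR (\<alpha> (fob fR z))) (\<eta>h (fob g (fob fR z))))"

text \<open>
  Every 1-morphism has both adjoints, and these are unique up to unique isomorphism, so invertibility of the mates does not depend
  on the choice of the adjunction data.
\<close>

definition BC_condition ::
  "('o, 'm, 'k) gcat \<Rightarrow> ('o, 'm, 'k) gcat \<Rightarrow> ('o, 'm, 'k) gcat \<Rightarrow> ('o, 'm, 'k) gcat
     \<Rightarrow> ('o, 'm) gfctr \<Rightarrow> ('o, 'm) gfctr \<Rightarrow> ('o, 'm) gfctr \<Rightarrow> ('o, 'm) gfctr
     \<Rightarrow> ((nat \<Rightarrow> 'o) \<Rightarrow> nat \<Rightarrow> 'm) \<Rightarrow> bool" where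
  "BC_condition A B C D g f h i \<alpha> \<longleftrightarrow>
     (\<exists>gL \<eta>g \<epsilon>g iL \<eta>i \<epsilon>i. gr_adjunction B A gL g \<eta>g \<epsilon>g \<and> gr_adjunction D C iL i \<eta>i \<epsilon>i \<and>
        (\<forall>y\<in>Obj (tot B). is_iso (tot C) (left_mate C f h \<alpha> gL \<eta>g iL \<epsilon>i y))) \<and>
     (\<exists>fR \<eta>f \<epsilon>f hR \<eta>h \<epsilon>h. gr_adjunction A C f fR \<eta>f \<epsilon>f \<and> gr_adjunction B D h hR \<eta>h \<epsilon>h \<and>
        (\<forall>z\<in>Obj (tot C). is_iso (tot B) (right_mate B g i \<alpha> fR \<epsilon>f hR \<eta>h z)))"

section \<open>Collections of finite sets over pointed finite sets\<close>

text \<open>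
  A pointed finite set \<open>I \<squnion> {*}\<close> is represented by the finite set \<open>I\<close> of natural numbers, and a
  pointed map \<open>I \<squnion> {*} \<rightarrow> J \<squnion> {*}\<close> by the partial function from \<open>I\<close> to \<open>J\<close> that is defined on the
  elements not sent to the base point.  Composition is \<open>map_comp\<close>.  The finite sets themselves
  are the finite sets of natural numbers.
\<close>

definition pointed_map :: "nat set \<Rightarrow> nat set \<Rightarrow> (nat \<rightharpoonup> nat) \<Rightarrow> bool" where
  "pointed_map I J \<phi> \<longleftrightarrow> dom \<phi> \<subseteq> I \<and> ran \<phi> \<subseteq> J"

definition pointed_id :: "nat set \<Rightarrow> (nat \<rightharpoonup> nat)" where
  "pointed_id I = (\<lambda>i. if i \<in> I then Some i else None)"

definition fib :: "(nat \<rightharpoonup> nat) \<Rightarrow> nat \<Rightarrow> nat set" where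
  "fib \<phi> j = {i. \<phi> i = Some j}"

record fs_obj =
  fs_idx :: "nat set"
  fs_fam :: "nat \<Rightarrow> nat set"

record fs_arr =
  fs_src :: fs_obj
  fs_tgt :: fs_obj
  fs_base :: "nat \<rightharpoonup> nat"
  fs_map :: "nat \<Rightarrow> nat \<Rightarrow> nat"

definition is_fs_obj :: "fs_obj \<Rightarrow> bool" where
  "is_fs_obj S \<longleftrightarrow> finite (fs_idx S) \<and> (\<forall>i\<in>fs_idx S. finite (fs_fam S i)) \<and>
     (\<forall>i. i \<notin> fs_idx S \<longrightarrow> fs_fam S i = {})"

definition fs_hom :: "fs_obj \<Rightarrow> fs_obj \<Rightarrow> (nat \<rightharpoonup> nat) \<Rightarrow> fs_arr set" where
  "fs_hom S T \<phi> = {f. is_fs_obj S \<and> is_fs_obj T \<and> pointed_map (fs_idx S) (fs_idx T) \<phi> \<and>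
     fs_src f = S \<and> fs_tgt f = T \<and> fs_base f = \<phi> \<and>
     fs_map f \<in> (\<Pi>\<^sub>E i\<in>dom \<phi>. fs_fam S i \<rightarrow>\<^sub>E fs_fam T (the (\<phi> i)))}"

definition is_fs_arr :: "fs_arr \<Rightarrow> bool" where
  "is_fs_arr f \<longleftrightarrow> f \<in> fs_hom (fs_src f) (fs_tgt f) (fs_base f)"

definition fs_id :: "fs_obj \<Rightarrow> fs_arr" where
  "fs_id S = \<lparr>fs_src = S, fs_tgt = S, fs_base = pointed_id (fs_idx S),
     fs_map = (\<lambda>i\<in>fs_idx S. \<lambda>x\<in>fs_fam S i. x)\<rparr>"

definition fs_comp :: "fs_arr \<Rightarrow> fs_arr \<Rightarrow> fs_arr" where
  "fs_comp g f = \<lparr>fs_src = fs_src f, fs_tgt = fs_tgt g, fs_base = fs_base g \<circ>\<^sub>m fs_base f,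
     fs_map = (\<lambda>i\<in>dom (fs_base g \<circ>\<^sub>m fs_base f). \<lambda>x\<in>fs_fam (fs_src f) i.
                 fs_map g (the (fs_base f i)) (fs_map f i x))\<rparr>"

text \<open>
  The domain is an ordinary category, so the equivalence of hom-categories in the definition of
  a coCartesian arrow is a bijection of hom-sets.
\<close>

definition fs_cocartesian :: "fs_arr \<Rightarrow> bool" where
  "fs_cocartesian f \<longleftrightarrow> is_fs_arr f \<and>
     (\<forall>Z \<psi>. is_fs_obj Z \<longrightarrow> pointed_map (fs_idx (fs_tgt f)) (fs_idx Z) \<psi> \<longrightarrow>
        bij_betw (\<lambda>g. fs_comp g f) (fs_hom (fs_tgt f) Z \<psi>)
          (fs_hom (fs_src f) Z (\<psi> \<circ>\<^sub>m fs_base f)))"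

text \<open>The fibre over \<open>[1]\<^sub>*\<close> is the category of finite sets.\<close>

definition fs_one :: "nat set \<Rightarrow> fs_obj" where
  "fs_one S = \<lparr>fs_idx = {1}, fs_fam = (\<lambda>i. if i = 1 then S else {})\<rparr>"

definition fs_one_map :: "nat set \<Rightarrow> nat set \<Rightarrow> (nat \<Rightarrow> nat) \<Rightarrow> fs_arr" where
  "fs_one_map S T f = \<lparr>fs_src = fs_one S, fs_tgt = fs_one T, fs_base = pointed_id {1},
     fs_map = (\<lambda>i\<in>{1}. restrict f S)\<rparr>"

definition cartesian_square ::
  "nat set \<Rightarrow> nat set \<Rightarrow> nat set \<Rightarrow> nat set
     \<Rightarrow> (nat \<Rightarrow> nat) \<Rightarrow> (nat \<Rightarrow> nat) \<Rightarrow> (nat \<Rightarrow> nat) \<Rightarrow> (nat \<Rightarrow> nat) \<Rightarrow> bool" where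
  "cartesian_square A B C D g f h i \<longleftrightarrow>
     finite A \<and> finite B \<and> finite C \<and> finite D \<and>
     g \<in> A \<rightarrow>\<^sub>E B \<and> f \<in> A \<rightarrow>\<^sub>E C \<and> h \<in> B \<rightarrow>\<^sub>E D \<and> i \<in> C \<rightarrow>\<^sub>E D \<and>
     (\<forall>a\<in>A. h (g a) = i (f a)) \<and>
     (\<forall>T :: nat set. finite T \<longrightarrow> (\<forall>u\<in>T \<rightarrow>\<^sub>E B. \<forall>v\<in>T \<rightarrow>\<^sub>E C. (\<forall>t\<in>T. h (u t) = i (v t)) \<longrightarrow>
        (\<exists>!w. w \<in> T \<rightarrow>\<^sub>E A \<and> (\<forall>t\<in>T. g (w t) = u t \<and> f (w t) = v t))))"

section \<open>Collections of graded 2-vector spaces over pointed finite sets\<close>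

record ('o, 'm, 'k) tv_obj =
  tv_idx :: "nat set"
  tv_fam :: "nat \<Rightarrow> ('o, 'm, 'k) gcat"

type_synonym ('o, 'm) mfctr =
  "nat \<Rightarrow> (nat \<Rightarrow> nat \<Rightarrow> 'o, nat \<Rightarrow> nat \<Rightarrow> 'm, nat \<Rightarrow> 'o, nat \<Rightarrow> 'm) fctr"

type_synonym ('o, 'm) mtrans = "nat \<Rightarrow> (nat \<Rightarrow> nat \<Rightarrow> 'o) \<Rightarrow> nat \<Rightarrow> 'm"

definition is_tv_obj :: "('o, 'm, 'k::field) tv_obj \<Rightarrow> bool" where
  "is_tv_obj X \<longleftrightarrow> finite (tv_idx X) \<and> (\<forall>i\<in>tv_idx X. graded_2vect (tv_fam X i))"

text \<open>The product of the \<open>X\<^sub>i\<close> over the fibre of \<open>\<phi>\<close> at \<open>j\<close>.\<close>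

definition fib_prod ::
  "('o, 'm, 'k) tv_obj \<Rightarrow> (nat \<rightharpoonup> nat) \<Rightarrow> nat \<Rightarrow> (nat \<Rightarrow> nat \<Rightarrow> 'o, nat \<Rightarrow> nat \<Rightarrow> 'm, 'k) lcat" where
  "fib_prod X \<phi> j = prod_cat (fib \<phi> j) (\<lambda>i. tot (tv_fam X i))"

definition tv_mor ::
  "('o, 'm, 'k) tv_obj \<Rightarrow> ('o, 'm, 'k) tv_obj \<Rightarrow> (nat \<rightharpoonup> nat) \<Rightarrow> ('o, 'm) mfctr \<Rightarrow> bool" where
  "tv_mor X Y \<phi> F \<longleftrightarrow> pointed_map (tv_idx X) (tv_idx Y) \<phi> \<and>
     (\<forall>j\<in>tv_idx Y. multi_exact (fib \<phi> j) (\<lambda>i. tot (tv_fam X i)) (tot (tv_fam Y j)) (F j) \<and>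
        (\<exists>N. degree_between (fib \<phi> j) (tv_fam X) (tv_fam Y j) (F j) 0 N))"

definition tv_degree_zero ::
  "('o, 'm, 'k) tv_obj \<Rightarrow> ('o, 'm, 'k) tv_obj \<Rightarrow> (nat \<rightharpoonup> nat) \<Rightarrow> ('o, 'm) mfctr \<Rightarrow> bool" where
  "tv_degree_zero X Y \<phi> F \<longleftrightarrow>
     (\<forall>j\<in>tv_idx Y. degree_between (fib \<phi> j) (tv_fam X) (tv_fam Y j) (F j) 0 0)"

definition tv_trans ::
  "('o, 'm, 'k) tv_obj \<Rightarrow> ('o, 'm, 'k) tv_obj \<Rightarrow> (nat \<rightharpoonup> nat) \<Rightarrow> ('o, 'm) mfctr \<Rightarrow> ('o, 'm) mfctr
     \<Rightarrow> ('o, 'm) mtrans set" where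
  "tv_trans X Y \<phi> F G =
     (\<Pi>\<^sub>E j\<in>tv_idx Y. nat_trans (fib_prod X \<phi> j) (tot (tv_fam Y j)) (F j) (G j))"

definition tv_iso ::
  "('o, 'm, 'k) tv_obj \<Rightarrow> ('o, 'm, 'k) tv_obj \<Rightarrow> (nat \<rightharpoonup> nat) \<Rightarrow> ('o, 'm) mfctr \<Rightarrow> ('o, 'm) mfctr
     \<Rightarrow> ('o, 'm) mtrans set" where
  "tv_iso X Y \<phi> F G = {\<alpha> \<in> tv_trans X Y \<phi> F G.
     \<forall>j\<in>tv_idx Y. \<forall>x\<in>Obj (fib_prod X \<phi> j). is_iso (tot (tv_fam Y j)) (\<alpha> j x)}"

definition tv_id :: "('o, 'm) mfctr" where
  "tv_id j = \<lparr>fob = (\<lambda>x. x j), far = (\<lambda>f. f j)\<rparr>"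

text \<open>
  Here \<open>F\<close> lies over \<open>\<phi>\<close> and \<open>G\<close> over \<open>\<psi>\<close>; the composite lies over \<open>\<psi> \<circ>\<^sub>m \<phi>\<close>.  It is strictly
  associative, so no associators appear below.
\<close>

definition tv_comp ::
  "(nat \<rightharpoonup> nat) \<Rightarrow> (nat \<rightharpoonup> nat) \<Rightarrow> ('o, 'm) mfctr \<Rightarrow> ('o, 'm) mfctr \<Rightarrow> ('o, 'm) mfctr" where
  "tv_comp \<psi> \<phi> G F k = \<lparr>
     fob = (\<lambda>x. fob (G k) (\<lambda>j\<in>fib \<psi> k. fob (F j) (restrict x (fib \<phi> j)))),
     far = (\<lambda>f. far (G k) (\<lambda>j\<in>fib \<psi> k. far (F j) (restrict f (fib \<phi> j))))\<rparr>"

definition tv_id_trans ::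
  "('o, 'm, 'k) tv_obj \<Rightarrow> ('o, 'm, 'k) tv_obj \<Rightarrow> (nat \<rightharpoonup> nat) \<Rightarrow> ('o, 'm) mfctr
     \<Rightarrow> ('o, 'm) mtrans" where
  "tv_id_trans X Y \<phi> F =
     (\<lambda>j\<in>tv_idx Y. \<lambda>x\<in>Obj (fib_prod X \<phi> j). Ide (tot (tv_fam Y j)) (fob (F j) x))"

definition tv_vcomp ::
  "('o, 'm, 'k) tv_obj \<Rightarrow> ('o, 'm, 'k) tv_obj \<Rightarrow> (nat \<rightharpoonup> nat) \<Rightarrow> ('o, 'm) mtrans \<Rightarrow> ('o, 'm) mtrans
     \<Rightarrow> ('o, 'm) mtrans" where
  "tv_vcomp X Y \<phi> \<beta> \<alpha> =
     (\<lambda>j\<in>tv_idx Y. \<lambda>x\<in>Obj (fib_prod X \<phi> j). Cmp (tot (tv_fam Y j)) (\<beta> j x) (\<alpha> j x))"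

text \<open>
  Whiskering: \<open>G \<alpha>\<close> for \<open>\<alpha>\<close> over \<open>\<phi>\<close> and \<open>G\<close> over \<open>\<psi>\<close>, and \<open>\<beta> F\<close> for \<open>F\<close> over \<open>\<phi>\<close> and \<open>\<beta>\<close> over \<open>\<psi>\<close>;
  \<open>X\<close> is the source and \<open>Z\<close> the target of the composite.
\<close>

definition tv_lwhisker ::
  "('o, 'm, 'k) tv_obj \<Rightarrow> ('o, 'm, 'k) tv_obj \<Rightarrow> (nat \<rightharpoonup> nat) \<Rightarrow> (nat \<rightharpoonup> nat)
     \<Rightarrow> ('o, 'm) mfctr \<Rightarrow> ('o, 'm) mtrans \<Rightarrow> ('o, 'm) mtrans" where
  "tv_lwhisker X Z \<psi> \<phi> G \<alpha> =
     (\<lambda>k\<in>tv_idx Z. \<lambda>x\<in>Obj (fib_prod X (\<psi> \<circ>\<^sub>m \<phi>) k).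
        far (G k) (\<lambda>j\<in>fib \<psi> k. \<alpha> j (restrict x (fib \<phi> j))))"

definition tv_rwhisker ::
  "('o, 'm, 'k) tv_obj \<Rightarrow> ('o, 'm, 'k) tv_obj \<Rightarrow> (nat \<rightharpoonup> nat) \<Rightarrow> (nat \<rightharpoonup> nat)
     \<Rightarrow> ('o, 'm) mtrans \<Rightarrow> ('o, 'm) mfctr \<Rightarrow> ('o, 'm) mtrans" where
  "tv_rwhisker X Z \<psi> \<phi> \<beta> F =
     (\<lambda>k\<in>tv_idx Z. \<lambda>x\<in>Obj (fib_prod X (\<psi> \<circ>\<^sub>m \<phi>) k).
        \<beta> k (\<lambda>j\<in>fib \<psi> k. fob (F j) (restrict x (fib \<phi> j))))"

text \<open>
  Precomposition with \<open>F\<close> is an equivalence from the category of arrows \<open>Y \<rightarrow> Z\<close> over \<open>\<psi>\<close> to the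
  category of arrows \<open>X \<rightarrow> Z\<close> over \<open>\<psi> \<circ>\<^sub>m \<phi>\<close>: it is fully faithful and essentially surjective.
\<close>

definition tv_cocartesian ::
  "('o, 'm, 'k::field) tv_obj \<Rightarrow> ('o, 'm, 'k) tv_obj \<Rightarrow> (nat \<rightharpoonup> nat) \<Rightarrow> ('o, 'm) mfctr \<Rightarrow> bool" where
  "tv_cocartesian X Y \<phi> F \<longleftrightarrow> tv_mor X Y \<phi> F \<and>
     (\<forall>(Z :: ('o, 'm, 'k) tv_obj) \<psi>. is_tv_obj Z \<longrightarrow> pointed_map (tv_idx Y) (tv_idx Z) \<psi> \<longrightarrow>
        (\<forall>G G'. tv_mor Y Z \<psi> G \<longrightarrow> tv_mor Y Z \<psi> G' \<longrightarrow>
           bij_betw (\<lambda>\<beta>. tv_rwhisker X Z \<psi> \<phi> \<beta> F) (tv_trans Y Z \<psi> G G')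
             (tv_trans X Z (\<psi> \<circ>\<^sub>m \<phi>) (tv_comp \<psi> \<phi> G F) (tv_comp \<psi> \<phi> G' F))) \<and>
        (\<forall>K. tv_mor X Z (\<psi> \<circ>\<^sub>m \<phi>) K \<longrightarrow>
           (\<exists>G. tv_mor Y Z \<psi> G \<and> tv_iso X Z (\<psi> \<circ>\<^sub>m \<phi>) (tv_comp \<psi> \<phi> G F) K \<noteq> {})))"

section \<open>SSH categories\<close>

text \<open>
  The data of a pseudofunctor: \<open>cmpH g f : H g \<circ> H f \<Rightarrow> H (g \<circ> f)\<close> and
  \<open>unitH S : id \<Rightarrow> H (id S)\<close> are the structure 2-morphisms.
\<close>

record ('o, 'm, 'k) psfun =
  obH :: "fs_obj \<Rightarrow> ('o, 'm, 'k) tv_obj"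
  arH :: "fs_arr \<Rightarrow> ('o, 'm) mfctr"
  cmpH :: "fs_arr \<Rightarrow> fs_arr \<Rightarrow> ('o, 'm) mtrans"
  unitH :: "fs_obj \<Rightarrow> ('o, 'm) mtrans"

definition pseudofunctor_over :: "('o, 'm, 'k::field) psfun \<Rightarrow> bool" where
  "pseudofunctor_over H \<longleftrightarrow>
     (\<forall>S. is_fs_obj S \<longrightarrow> is_tv_obj (obH H S) \<and> tv_idx (obH H S) = fs_idx S) \<and>
     (\<forall>S T \<phi>. \<forall>f\<in>fs_hom S T \<phi>. tv_mor (obH H S) (obH H T) \<phi> (arH H f)) \<and>
     (\<forall>S. is_fs_obj S \<longrightarrow>
        unitH H S \<in> tv_iso (obH H S) (obH H S) (pointed_id (fs_idx S)) tv_id (arH H (fs_id S))) \<and>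
     (\<forall>S T U \<phi> \<psi>. \<forall>f\<in>fs_hom S T \<phi>. \<forall>g\<in>fs_hom T U \<psi>.
        cmpH H g f \<in> tv_iso (obH H S) (obH H U) (\<psi> \<circ>\<^sub>m \<phi>)
          (tv_comp \<psi> \<phi> (arH H g) (arH H f)) (arH H (fs_comp g f))) \<and>
     (\<forall>S T \<phi>. \<forall>f\<in>fs_hom S T \<phi>.
        tv_vcomp (obH H S) (obH H T) \<phi> (cmpH H f (fs_id S))
          (tv_lwhisker (obH H S) (obH H T) \<phi> (pointed_id (fs_idx S)) (arH H f) (unitH H S))
          = tv_id_trans (obH H S) (obH H T) \<phi> (arH H f) \<and>
        tv_vcomp (obH H S) (obH H T) \<phi> (cmpH H (fs_id T) f)
          (tv_rwhisker (obH H S) (obH H T) (pointed_id (fs_idx T)) \<phi> (unitH H T) (arH H f))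
          = tv_id_trans (obH H S) (obH H T) \<phi> (arH H f)) \<and>
     (\<forall>S T U V \<phi> \<psi> \<chi>. \<forall>f\<in>fs_hom S T \<phi>. \<forall>g\<in>fs_hom T U \<psi>. \<forall>h\<in>fs_hom U V \<chi>.
        tv_vcomp (obH H S) (obH H V) (\<chi> \<circ>\<^sub>m (\<psi> \<circ>\<^sub>m \<phi>)) (cmpH H h (fs_comp g f))
          (tv_lwhisker (obH H S) (obH H V) \<chi> (\<psi> \<circ>\<^sub>m \<phi>) (arH H h) (cmpH H g f)) =
        tv_vcomp (obH H S) (obH H V) (\<chi> \<circ>\<^sub>m (\<psi> \<circ>\<^sub>m \<phi>)) (cmpH H (fs_comp h g) f)
          (tv_rwhisker (obH H S) (obH H V) (\<chi> \<circ>\<^sub>m \<psi>) \<phi> (cmpH H h g) (arH H f)))"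

text \<open>
  On the fibre over \<open>[1]\<^sub>*\<close>: the graded category of a finite set, and the functor of one variable
  given by an arrow over the identity of \<open>[1]\<^sub>*\<close>.
\<close>

definition H_set :: "('o, 'm, 'k) psfun \<Rightarrow> nat set \<Rightarrow> ('o, 'm, 'k) gcat" where
  "H_set H S = tv_fam (obH H (fs_one S)) 1"

definition unary :: "('o, 'm) mfctr \<Rightarrow> ('o, 'm) gfctr" where
  "unary F = \<lparr>fob = (\<lambda>x. fob (F 1) (\<lambda>_\<in>{1}. x)), far = (\<lambda>f. far (F 1) (\<lambda>_\<in>{1}. f))\<rparr>"

text \<open>
  For a commutative square \<open>h \<circ> g = i \<circ> f\<close> of finite sets, the 2-morphism
  \<open>H h \<circ> H g \<Rightarrow> H (h \<circ> g) = H (i \<circ> f) \<Rightarrow> H i \<circ> H f\<close> at the object \<open>x\<close>.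
\<close>

definition square_trans ::
  "('o, 'm, 'k) psfun \<Rightarrow> nat set \<Rightarrow> fs_arr \<Rightarrow> fs_arr \<Rightarrow> fs_arr \<Rightarrow> fs_arr
     \<Rightarrow> (nat \<Rightarrow> 'o) \<Rightarrow> nat \<Rightarrow> 'm" where
  "square_trans H D g f h i x =
     Cmp (tot (H_set H D)) (inv_arr (tot (H_set H D)) (cmpH H i f 1 (\<lambda>_\<in>{1}. x)))
       (cmpH H h g 1 (\<lambda>_\<in>{1}. x))"

definition SSH_category :: "('o, 'm, 'k::field) psfun \<Rightarrow> bool" where
  "SSH_category H \<longleftrightarrow>
     pseudofunctor_over H \<and>
     (\<forall>S T \<phi>. \<forall>f\<in>fs_hom S T \<phi>. tv_degree_zero (obH H S) (obH H T) \<phi> (arH H f)) \<and>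
     (\<forall>f. fs_cocartesian f \<longrightarrow>
        tv_cocartesian (obH H (fs_src f)) (obH H (fs_tgt f)) (fs_base f) (arH H f)) \<and>
     (\<forall>A B C D g f h i. cartesian_square A B C D g f h i \<longrightarrow>
        (let Hg = fs_one_map A B g; Hf = fs_one_map A C f;
             Hh = fs_one_map B D h; Hi = fs_one_map C D i in
         BC_condition (H_set H A) (H_set H B) (H_set H C) (H_set H D)
           (unary (arH H Hg)) (unary (arH H Hf)) (unary (arH H Hh)) (unary (arH H Hi))
           (square_trans H D Hg Hf Hh Hi)))"

section \<open>Tensor products of abelian groups and PSH algebras\<close>

text \<open>Abelian groups are the multiplicatively written commutative groups of HOL-Algebra.\<close>

definition tensor_rels :: "'a monoid \<Rightarrow> 'b monoid \<Rightarrow> ('a \<times> 'b \<Rightarrow>\<^sub>0 int) set" where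
  "tensor_rels G H =
     {frag_of (a \<otimes>\<^bsub>G\<^esub> a', b) - (frag_of (a, b) + frag_of (a', b)) | a a' b.
        a \<in> carrier G \<and> a' \<in> carrier G \<and> b \<in> carrier H} \<union>
     {frag_of (a, b \<otimes>\<^bsub>H\<^esub> b') - (frag_of (a, b) + frag_of (a, b')) | a b b'.
        a \<in> carrier G \<and> b \<in> carrier H \<and> b' \<in> carrier H}"

definition tensor_subgroup :: "'a monoid \<Rightarrow> 'b monoid \<Rightarrow> ('a \<times> 'b \<Rightarrow>\<^sub>0 int) set" where
  "tensor_subgroup G H =
     generate (free_Abelian_group (carrier G \<times> carrier H)) (tensor_rels G H)"

definition tensor :: "'a monoid \<Rightarrow> 'b monoid \<Rightarrow> ('a \<times> 'b \<Rightarrow>\<^sub>0 int) set monoid" where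
  "tensor G H = free_Abelian_group (carrier G \<times> carrier H) Mod tensor_subgroup G H"

definition pure_tensor :: "'a monoid \<Rightarrow> 'b monoid \<Rightarrow> 'a \<Rightarrow> 'b \<Rightarrow> ('a \<times> 'b \<Rightarrow>\<^sub>0 int) set" where
  "pure_tensor G H a b =
     tensor_subgroup G H #>\<^bsub>free_Abelian_group (carrier G \<times> carrier H)\<^esub> frag_of (a, b)"

text \<open>
  The homomorphism \<open>G \<otimes> H \<rightarrow> K\<close> given by a biadditive map \<open>\<beta>\<close>, i.e. the one with
  \<open>a \<otimes> b \<mapsto> \<beta> a b\<close>.
\<close>

definition tensor_lift ::
  "'a monoid \<Rightarrow> 'b monoid \<Rightarrow> 'c monoid \<Rightarrow> ('a \<Rightarrow> 'b \<Rightarrow> 'c) \<Rightarrow> ('a \<times> 'b \<Rightarrow>\<^sub>0 int) set \<Rightarrow> 'c" where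
  "tensor_lift G H K \<beta> = (THE h. h \<in> hom (tensor G H) K \<and> h \<in> extensional (carrier (tensor G H)) \<and>
     (\<forall>a\<in>carrier G. \<forall>b\<in>carrier H. h (pure_tensor G H a b) = \<beta> a b))"

definition tensor_map ::
  "'a monoid \<Rightarrow> 'b monoid \<Rightarrow> 'c monoid \<Rightarrow> 'd monoid \<Rightarrow> ('a \<Rightarrow> 'c) \<Rightarrow> ('b \<Rightarrow> 'd)
     \<Rightarrow> ('a \<times> 'b \<Rightarrow>\<^sub>0 int) set \<Rightarrow> ('c \<times> 'd \<Rightarrow>\<^sub>0 int) set" where
  "tensor_map G H G' H' f g =
     tensor_lift G H (tensor G' H') (\<lambda>a b. pure_tensor G' H' (f a) (g b))"

definition tensor_assoc where
  "tensor_assoc G H L = tensor_lift (tensor G H) L (tensor G (tensor H L))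
     (\<lambda>t c. tensor_lift G H (tensor G (tensor H L))
        (\<lambda>a b. pure_tensor G (tensor H L) a (pure_tensor H L b c)) t)"

text \<open>The subset \<open>B\<close> is a \<open>\<int>\<close>-basis of the abelian group \<open>G\<close>.\<close>

definition is_Z_basis :: "'a monoid \<Rightarrow> 'a set \<Rightarrow> bool" where
  "is_Z_basis G B \<longleftrightarrow> B \<subseteq> carrier G \<and>
     (\<forall>x\<in>carrier G. \<exists>!c :: 'a \<Rightarrow> int. {b. c b \<noteq> 0} \<subseteq> B \<and> finite {b. c b \<noteq> 0} \<and>
        x = finprod G (\<lambda>b. b [^]\<^bsub>G\<^esub> c b) {b. c b \<noteq> 0})"

text \<open>The linear combinations of elements of \<open>B\<close> with non-negative integer coefficients.\<close>

definition nonneg_combs :: "'a monoid \<Rightarrow> 'a set \<Rightarrow> 'a set" where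
  "nonneg_combs G B =
     {finprod G (\<lambda>b. b [^]\<^bsub>G\<^esub> (c b :: nat)) B' | c B'. finite B' \<and> B' \<subseteq> B}"

record 'a psh = "'a ring" +
  comult :: "'a \<Rightarrow> ('a \<times> 'a \<Rightarrow>\<^sub>0 int) set"
  counit :: "'a \<Rightarrow> int"
  deg_part :: "nat \<Rightarrow> 'a set"
  inner_prod :: "'a \<Rightarrow> 'a \<Rightarrow> int"
  basis :: "'a set"

text \<open>Unlike \<open>add_monoid\<close>, this forgets all further components of the record.\<close>

definition additive_group :: "('a, 'b) ring_scheme \<Rightarrow> 'a monoid" where
  "additive_group A = \<lparr>carrier = carrier A, monoid.mult = add A, one = zero A\<rparr>"

definition hopf_algebra :: "'a psh \<Rightarrow> bool" where
  "hopf_algebra A \<longleftrightarrow>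
     (let G = additive_group A; T = tensor G G; \<Delta> = comult A; \<epsilon> = counit A in
      ring A \<and> \<Delta> \<in> hom G T \<and> \<epsilon> \<in> hom G integer_group \<and>
      (\<forall>x\<in>carrier A.
         tensor_assoc G G G (tensor_map G G T G \<Delta> (\<lambda>a. a) (\<Delta> x)) =
         tensor_map G G G T (\<lambda>a. a) \<Delta> (\<Delta> x)) \<and>
      (\<forall>x\<in>carrier A. tensor_lift G G G (\<lambda>a b. [\<epsilon> a] \<cdot>\<^bsub>A\<^esub> b) (\<Delta> x) = x \<and>
                     tensor_lift G G G (\<lambda>a b. [\<epsilon> b] \<cdot>\<^bsub>A\<^esub> a) (\<Delta> x) = x) \<and>
      \<Delta> \<one>\<^bsub>A\<^esub> = pure_tensor G G \<one>\<^bsub>A\<^esub> \<one>\<^bsub>A\<^esub> \<and> \<epsilon> \<one>\<^bsub>A\<^esub> = 1 \<and>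
      (\<forall>x\<in>carrier A. \<forall>y\<in>carrier A.
         \<Delta> (x \<otimes>\<^bsub>A\<^esub> y) =
           tensor_lift G G T (\<lambda>a b. tensor_lift G G T
             (\<lambda>c d. pure_tensor G G (a \<otimes>\<^bsub>A\<^esub> c) (b \<otimes>\<^bsub>A\<^esub> d)) (\<Delta> y)) (\<Delta> x) \<and>
         \<epsilon> (x \<otimes>\<^bsub>A\<^esub> y) = \<epsilon> x * \<epsilon> y) \<and>
      (\<exists>S\<in>hom G G. \<forall>x\<in>carrier A.
         tensor_lift G G G (\<lambda>a b. S a \<otimes>\<^bsub>A\<^esub> b) (\<Delta> x) = [\<epsilon> x] \<cdot>\<^bsub>A\<^esub> \<one>\<^bsub>A\<^esub> \<and>
         tensor_lift G G G (\<lambda>a b. a \<otimes>\<^bsub>A\<^esub> S b) (\<Delta> x) = [\<epsilon> x] \<cdot>\<^bsub>A\<^esub> \<one>\<^bsub>A\<^esub>))"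

definition graded_hopf :: "'a psh \<Rightarrow> bool" where
  "graded_hopf A \<longleftrightarrow>
     (let G = additive_group A in
      (\<forall>n. subgroup (deg_part A n) G) \<and>
      (\<forall>x\<in>carrier A. \<exists>!c :: nat \<Rightarrow> 'a. (\<forall>n. c n \<in> deg_part A n) \<and> finite {n. c n \<noteq> \<zero>\<^bsub>A\<^esub>} \<and>
         x = finprod G c {n. c n \<noteq> \<zero>\<^bsub>A\<^esub>}) \<and>
      \<one>\<^bsub>A\<^esub> \<in> deg_part A 0 \<and>
      (\<forall>m n. \<forall>x\<in>deg_part A m. \<forall>y\<in>deg_part A n. x \<otimes>\<^bsub>A\<^esub> y \<in> deg_part A (m + n)) \<and>
      (\<forall>n. \<forall>x\<in>deg_part A n. comult A x \<in> generate (tensor G G)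
         {pure_tensor G G a b | a b i j. i + j = n \<and> a \<in> deg_part A i \<and> b \<in> deg_part A j}) \<and>
      (\<forall>n>0. \<forall>x\<in>deg_part A n. counit A x = 0))"

definition connected_hopf :: "'a psh \<Rightarrow> bool" where
  "connected_hopf A \<longleftrightarrow>
     (let A0 = (additive_group A)\<lparr>carrier := deg_part A 0\<rparr> in
      (\<lambda>n::int. [n] \<cdot>\<^bsub>A\<^esub> \<one>\<^bsub>A\<^esub>) \<in> iso integer_group A0 \<and> counit A \<in> iso A0 integer_group)"

definition PSH_algebra :: "'a psh \<Rightarrow> bool" where
  "PSH_algebra A \<longleftrightarrow>
     (let G = additive_group A; ip = inner_prod A; B = basis A in
      hopf_algebra A \<and> graded_hopf A \<and> connected_hopf A \<and>
      \<comment> \<open>inner product\<close>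
      (\<forall>x\<in>carrier A. \<forall>y\<in>carrier A. ip x y = ip y x) \<and>
      (\<forall>x\<in>carrier A. \<forall>y\<in>carrier A. \<forall>z\<in>carrier A. ip (x \<oplus>\<^bsub>A\<^esub> y) z = ip x z + ip y z) \<and>
      (\<forall>x\<in>carrier A. x \<noteq> \<zero>\<^bsub>A\<^esub> \<longrightarrow> ip x x > 0) \<and>
      \<comment> \<open>homogeneous orthogonal basis, finite in each degree\<close>
      is_Z_basis G B \<and> B \<subseteq> (\<Union>n. deg_part A n) \<and> (\<forall>n. finite (B \<inter> deg_part A n)) \<and>
      (\<forall>u\<in>B. \<forall>v\<in>B. u \<noteq> v \<longrightarrow> ip u v = 0) \<and>
      \<comment> \<open>multiplication and comultiplication are adjoint\<close>
      (\<forall>x\<in>carrier A. \<forall>y\<in>carrier A. \<forall>z\<in>carrier A.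
         ip (x \<otimes>\<^bsub>A\<^esub> y) z = tensor_lift G G integer_group (\<lambda>a b. ip x a * ip y b) (comult A z)) \<and>
      \<comment> \<open>positivity\<close>
      (\<forall>x\<in>nonneg_combs G B. \<forall>y\<in>nonneg_combs G B. x \<otimes>\<^bsub>A\<^esub> y \<in> nonneg_combs G B) \<and>
      (\<forall>x\<in>nonneg_combs G B.
         comult A x \<in> nonneg_combs (tensor G G) {pure_tensor G G u v | u v. u \<in> B \<and> v \<in> B}))"

section \<open>The Grothendieck group and its structure\<close>

definition K_subgroup :: "('o, 'm, 'k) gcat \<Rightarrow> ((nat \<Rightarrow> 'o) \<Rightarrow>\<^sub>0 int) set" where
  "K_subgroup C = generate (free_Abelian_group (Obj (tot C)))
     {frag_of (Tgt (tot C) f) - (frag_of (Src (tot C) f) + frag_of (Tgt (tot C) g)) | f g.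
        short_exact (tot C) f g}"

definition K_group :: "('o, 'm, 'k) gcat \<Rightarrow> ((nat \<Rightarrow> 'o) \<Rightarrow>\<^sub>0 int) set monoid" where
  "K_group C = free_Abelian_group (Obj (tot C)) Mod K_subgroup C"

definition K_class :: "('o, 'm, 'k) gcat \<Rightarrow> (nat \<Rightarrow> 'o) \<Rightarrow> ((nat \<Rightarrow> 'o) \<Rightarrow>\<^sub>0 int) set" where
  "K_class C x = K_subgroup C #>\<^bsub>free_Abelian_group (Obj (tot C))\<^esub> frag_of x"

text \<open>The homomorphism \<open>\<mu>\<close> of Grothendieck groups is the one induced by the functor \<open>F\<close>.\<close>

definition K_induced ::
  "('o, 'm, 'k) gcat \<Rightarrow> ('o, 'm, 'k) gcat \<Rightarrow> ('o, 'm) gfctr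
     \<Rightarrow> (((nat \<Rightarrow> 'o) \<Rightarrow>\<^sub>0 int) set \<Rightarrow> ((nat \<Rightarrow> 'o) \<Rightarrow>\<^sub>0 int) set) \<Rightarrow> bool" where
  "K_induced C D F \<mu> \<longleftrightarrow> \<mu> \<in> hom (K_group C) (K_group D) \<and>
     (\<forall>x\<in>Obj (tot C). \<mu> (K_class C x) = K_class D (fob F x))"

text \<open>
  The object \<open>([1], [1])\<close> over \<open>[2]\<^sub>*\<close>, its two projections to \<open>[1]\<close> (which forget one entry), and
  the arrow \<open>([1], [1]) \<rightarrow> [2]\<close> over the map \<open>[2]\<^sub>* \<rightarrow> [1]\<^sub>*\<close> sending both \<open>1\<close> and \<open>2\<close> to \<open>1\<close>.  All three
  arrows are coCartesian, so their images under an SSH structure are two equivalences with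
  \<open>\<C> = H_set H {1}\<close> and the universal bifunctor \<open>\<boxtimes>\<close> to \<open>\<C> \<otimes> \<C> = H_set H {1, 2}\<close>.
\<close>

definition fs_pair :: fs_obj where
  "fs_pair = \<lparr>fs_idx = {1, 2}, fs_fam = (\<lambda>i. if i \<in> {1, 2} then {1} else {})\<rparr>"

definition fs_proj :: "nat \<Rightarrow> fs_arr" where
  "fs_proj i = \<lparr>fs_src = fs_pair, fs_tgt = fs_one {1}, fs_base = [i \<mapsto> 1],
     fs_map = (\<lambda>_\<in>{i}. \<lambda>_\<in>{1}. 1)\<rparr>"

definition fs_box :: fs_arr where
  "fs_box = \<lparr>fs_src = fs_pair, fs_tgt = fs_one {1, 2}, fs_base = [1 \<mapsto> 1, 2 \<mapsto> 1],
     fs_map = (\<lambda>i\<in>{1, 2}. \<lambda>_\<in>{1}. i)\<rparr>"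

text \<open>
  \<open>K_box H \<kappa>\<close>: the homomorphism \<open>\<kappa>\<close> is the comparison \<open>K(\<C>) \<otimes> K(\<C>) \<cong> K(\<C> \<otimes> \<C>)\<close>,
  \<open>[X] \<otimes> [Y] \<mapsto> [X \<boxtimes> Y]\<close>.
\<close>

definition K_box ::
  "('o, 'm, 'k) psfun
     \<Rightarrow> ((((nat \<Rightarrow> 'o) \<Rightarrow>\<^sub>0 int) set \<times> ((nat \<Rightarrow> 'o) \<Rightarrow>\<^sub>0 int) set \<Rightarrow>\<^sub>0 int) set
           \<Rightarrow> ((nat \<Rightarrow> 'o) \<Rightarrow>\<^sub>0 int) set) \<Rightarrow> bool" where
  "K_box H \<kappa> \<longleftrightarrow>
     (let C = H_set H {1}; KC = K_group C in
      \<kappa> \<in> iso (tensor KC KC) (K_group (H_set H {1, 2})) \<and>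
      (\<forall>x\<in>Obj (tot (tv_fam (obH H fs_pair) 1)). \<forall>y\<in>Obj (tot (tv_fam (obH H fs_pair) 2)).
         \<kappa> (pure_tensor KC KC
              (K_class C (fob (arH H (fs_proj 1) 1) (\<lambda>_\<in>{1}. x)))
              (K_class C (fob (arH H (fs_proj 2) 1) (\<lambda>_\<in>{2}. y)))) =
         K_class (H_set H {1, 2})
           (fob (arH H fs_box 1) (\<lambda>i\<in>{1, 2}. if i = 1 then x else y))))"

text \<open>
  The structure on \<open>K(\<C>)\<close> induced by \<open>H\<close>.  In a PSH algebra the unit is determined by the
  multiplication, the comultiplication by the multiplication and the inner product, and the
  counit by the comultiplication.
\<close>

definition PSH_structure_of ::
  "('o, 'm, 'k::field) psfun \<Rightarrow> ((nat \<Rightarrow> 'o) \<Rightarrow>\<^sub>0 int) set psh \<Rightarrow> bool" where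
  "PSH_structure_of H A \<longleftrightarrow>
     (let C = H_set H {1};
          m = unary (arH H (fs_one_map {1, 2} {1} (\<lambda>_. 1)))
      in
      additive_group A = K_group C \<and>
      (\<forall>n. deg_part A n = generate (K_group C) {K_class C x | x. x \<in> Obj (tot C) \<and> gsupp C x \<subseteq> {n}}) \<and>
      (\<exists>\<kappa> \<mu>. K_box H \<kappa> \<and> K_induced (H_set H {1, 2}) C m \<mu> \<and>
         (\<forall>a\<in>carrier A. \<forall>b\<in>carrier A.
            a \<otimes>\<^bsub>A\<^esub> b = \<mu> (\<kappa> (pure_tensor (K_group C) (K_group C) a b)))) \<and>
      (\<forall>x\<in>Obj (tot C). \<forall>y\<in>Obj (tot C).
         inner_prod A (K_class C x) (K_class C y) = int (hom_dim (tot C) x y)) \<and>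
      basis A = {K_class C x | x. is_simple (tot C) x})"

end

theory Submission
 imports Defs
begin

text \<open>
 A graded 2-vector space is described by matrices: its objects by the multiplicities of the simple
 objects, its arrows by families of matrices. A multi-exact functor is then determined, up to what the
 Grothendieck group sees, by the multiplicities of the simple objects in the images of tuples of simple
 objects. A Yoneda argument shows that a coCartesian functor induces a bijection from tuples of simple
 objects to simple objects, so all categories \<open>H S\<close> have as simple objects tuples of simple objects of
 \<open>\<C>\<close>, and \<open>H\<close> is encoded by the structure constants \<open>c\<^sub>x\<^sub>y\<^sup>z\<close> of the multiplication. Functoriality makes
 the multiplication associative and commutative, and the Beck--Chevalley condition, read off on
 dimensions of hom-spaces, gives the unit (from \<open>\<emptyset> = \<emptyset> = \<emptyset> \<rightarrow> [1]\<close>), the compatibility of multiplication and counit (from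
 \<open>\<emptyset> \<rightarrow> [2] \<rightarrow> [1]\<close>) and the Hopf axiom (from \<open>[4] = [2] \<times> [2]\<close>). Positivity and the Hopf axiom in degree \<open>0\<close>
 force connectedness, and connectedness provides the antipode.
\<close>

text \<open>A coCartesian functor can be tested only against objects over the same types, and only
  by 1-morphisms of non-negative degree. A test category must therefore be non-zero in every degree:
  the hypothesis of the theorem provides a category equivalent to \<open>Vect\<close>, and the
  constant sequence with this value is the test object. Faithfulness then shows that every simple
  object is reached; essential surjectivity and fullness show that a tuple of simple objects has a
  simple image. The rest is counting. Comparison isomorphisms of the pseudofunctor become equations
  between natural numbers, and an invertible mate becomes an equality of the multiplicities of its
  source and target. Natural numbers make these equations rigid: a sum of squares equal to 1 has a
  single non-zero term, and this produces a simple unit. The comultiplication is defined as the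
  transpose of the multiplication. Adjointness then holds by construction, and coassociativity is
  transposed associativity.\<close>

abbreviation "coef \<equiv> Poly_Mapping.lookup"
abbreviation "supp \<equiv> Poly_Mapping.keys"

section \<open>Matrices\<close>

text \<open>
 The induction clears one row at a time: if \<open>E\<close> is the matrix with the single entry
 \<open>1 / A\<^sub>i\<^sub>j\<close> at \<open>(j, i)\<close>, then \<open>A - A E A\<close> has zero \<open>i\<close>-th row and no new non-zero rows, and
 an inner inverse \<open>Y\<close> of it gives the inner inverse \<open>E + (1 - E A) Y (1 - A E)\<close> of \<open>A\<close>.
\<close>

lemma ex_inner_inverse:
 fixes A :: "'a::field mat"
 assumes "A \<in> carrier_mat m n"
 shows "\<exists>X\<in>carrier_mat n m. A * X * A = A" using assms
proof (induction "card {i. i < m \<and> (\<exists>j<n. A $$ (i, j) \<noteq> 0)}" arbitrary: A rule: less_induct)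
 case less
 show ?case
 proof (cases "\<exists>i<m. \<exists>j<n. A $$ (i, j) \<noteq> 0")
  case False
  then have "A = 0\<^sub>m m n" using less.prems by auto
  then show ?thesis by (intro bexI[of _ "0\<^sub>m n m"]) auto
 next
  case True
  then obtain i j where i: "i < m" and j: "j < n" and ne: "A $$ (i, j) \<noteq> 0" by blast
  define E where "E = mat n m (\<lambda>(a, b). if a = j \<and> b = i then 1 / A $$ (i, j) else 0)"
  have E: "E \<in> carrier_mat n m" by (simp add: E_def)
  note A = less.prems
  have AE: "(A * E) $$ (a, b) = (if b = i then A $$ (a, j) / A $$ (i, j) else 0)"
   if "a < m" "b < m" for a b
  proof -
   have "(A * E) $$ (a, b) = (\<Sum>k<n. A $$ (a, k) * E $$ (k, b))" using that A E by (auto simp: scalar_prod_def atLeast0LessThan)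
   also have "\<dots> = (\<Sum>k<n. if k = j then A $$ (a, k) * (if b = i then 1 / A $$ (i, j) else 0) else 0)"
    using that by (intro sum.cong) (auto simp: E_def)
   also have "\<dots> = (if b = i then A $$ (a, j) / A $$ (i, j) else 0)" using j by auto
   finally show ?thesis .
  qed
  have EAE: "E * A * E = E"
  proof (rule eq_matI)
   fix a b assume ab: "a < dim_row E" "b < dim_col E"
   have "(E * (A * E)) $$ (a, b) = (\<Sum>k<m. E $$ (a, k) * (A * E) $$ (k, b))" using ab A E by (auto simp: scalar_prod_def atLeast0LessThan)
   also have "\<dots> = (\<Sum>k<m. if k = i then E $$ (a, i) * (A * E) $$ (i, b) else 0)" using ab E by (intro sum.cong) (auto simp: E_def)
   also have "\<dots> = E $$ (a, i) * (A * E) $$ (i, b)" using i by auto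
   also have "\<dots> = E $$ (a, b)"
   proof -
    have "a < n" "b < m" using ab E by auto
    then show ?thesis using i ne AE[OF i \<open>b < m\<close>] by (simp add: E_def)
   qed
   finally show "(E * A * E) $$ (a, b) = E $$ (a, b)" using A E by (simp add: assoc_mult_mat[of _ n m _ n _ m])
  qed (use A E in auto)
  define B where "B = A - A * E * A"
  have B: "B \<in> carrier_mat m n" using A E by (auto simp: B_def)
  have Bent: "B $$ (a, b) = A $$ (a, b) - (A $$ (a, j) / A $$ (i, j)) * A $$ (i, b)"
   if "a < m" "b < n" for a b
  proof -
   have "(A * E * A) $$ (a, b) = (\<Sum>k<m. (A * E) $$ (a, k) * A $$ (k, b))"
    using that A E by (subst index_mult_mat) (auto simp: scalar_prod_def atLeast0LessThan)
   also have "\<dots> = (\<Sum>k<m. if k = i then (A $$ (a, j) / A $$ (i, j)) * A $$ (i, b) else 0)" using that by (intro sum.cong) (auto simp: AE)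
   also have "\<dots> = (A $$ (a, j) / A $$ (i, j)) * A $$ (i, b)" using i by auto
   finally show ?thesis using that A E by (simp add: B_def)
  qed
  have "{k. k < m \<and> (\<exists>j<n. B $$ (k, j) \<noteq> 0)} \<subset> {k. k < m \<and> (\<exists>j<n. A $$ (k, j) \<noteq> 0)}"
  proof (rule psubsetI)
   show "{k. k < m \<and> (\<exists>j<n. B $$ (k, j) \<noteq> 0)} \<subseteq> {k. k < m \<and> (\<exists>j<n. A $$ (k, j) \<noteq> 0)}"
   proof safe
    fix k l assume "k < m" "l < n" "B $$ (k, l) \<noteq> 0"
    then have "A $$ (k, l) \<noteq> 0 \<or> A $$ (k, j) \<noteq> 0" by (auto simp: Bent)
    then show "\<exists>j<n. A $$ (k, j) \<noteq> 0" using j \<open>l < n\<close> by blast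
   qed
   have "i \<notin> {k. k < m \<and> (\<exists>j<n. B $$ (k, j) \<noteq> 0)}" using i ne by (auto simp: Bent)
   then show "{k. k < m \<and> (\<exists>j<n. B $$ (k, j) \<noteq> 0)} \<noteq> {k. k < m \<and> (\<exists>j<n. A $$ (k, j) \<noteq> 0)}"
    using i j ne by blast
  qed
  then have "card {k. k < m \<and> (\<exists>j<n. B $$ (k, j) \<noteq> 0)} < card {k. k < m \<and> (\<exists>j<n. A $$ (k, j) \<noteq> 0)}"
   by (intro psubset_card_mono) auto
  from less.hyps[OF this B] obtain Y where Y: "Y \<in> carrier_mat n m" and BYB: "B * Y * B = B" by blast
  define P where "P = 1\<^sub>m n - E * A"
  define Q where "Q = 1\<^sub>m m - A * E"
  have P: "P \<in> carrier_mat n n" and Q: "Q \<in> carrier_mat m m" using A E by (auto simp: P_def Q_def)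
  have EA: "E * A \<in> carrier_mat n n" and AEc: "A * E \<in> carrier_mat m m" using A E by auto
  have AP: "A * P = B" unfolding P_def B_def using A E EA by (simp add: mult_minus_distrib_mat[OF A one_carrier_mat EA] assoc_mult_mat[OF A E A])
  have QA: "Q * A = B" unfolding Q_def B_def using A E AEc by (simp add: minus_mult_distrib_mat[OF one_carrier_mat AEc A])
  have PYQ: "P * Y * Q \<in> carrier_mat n m" using P Y Q by auto
  have PY: "P * Y \<in> carrier_mat n m" using P Y by auto
  have "A * (P * Y * Q) * A = A * P * Y * (Q * A)" unfolding assoc_mult_mat[OF A PY Q, symmetric] assoc_mult_mat[OF mult_carrier_mat[OF A PY] Q A]
    assoc_mult_mat[OF A P Y] ..
  then have "A * (P * Y * Q) * A = B" by (simp add: AP QA BYB)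
  then have "A * (E + P * Y * Q) * A = A * E * A + B" using A E PYQ
   by (simp add: mult_add_distrib_mat[OF A E PYQ] add_mult_distrib_mat[OF AEc mult_carrier_mat[OF A PYQ] A])
  also have "\<dots> = A" using A E by (intro eq_matI) (auto simp: B_def)
  finally show ?thesis using E PYQ by (intro bexI[of _ "E + P * Y * Q"]) auto
 qed
qed

section \<open>Traces, which turn matrix identities into equations between dimensions\<close>

definition mat_trace :: "'a::comm_ring_1 mat => 'a" where
 "mat_trace A = (\<Sum>i<dim_row A. A $$ (i, i))"

lemma mat_trace_mult_comm:
 assumes "A \<in> carrier_mat m n" "B \<in> carrier_mat n m"
 shows "mat_trace (A * B) = mat_trace (B * A)"
proof -
 have "mat_trace (A * B) = (\<Sum>i<m. \<Sum>k<n. A $$ (i, k) * B $$ (k, i))"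
  using assms by (auto simp: mat_trace_def scalar_prod_def atLeast0LessThan intro!: sum.cong)
 also have "\<dots> = (\<Sum>k<n. \<Sum>i<m. B $$ (k, i) * A $$ (i, k))" by (subst sum.swap) (simp add: mult.commute)
 also have "\<dots> = mat_trace (B * A)" using assms by (auto simp: mat_trace_def scalar_prod_def atLeast0LessThan intro!: sum.cong)
 finally show ?thesis .
qed

lemma mat_trace_add:
 "A \<in> carrier_mat n n ==> B \<in> carrier_mat n n ==> mat_trace (A + B) = mat_trace A + mat_trace B" by (auto simp: mat_trace_def sum.distrib)

lemma mat_trace_one: "mat_trace (1\<^sub>m n) = of_nat n" by (simp add: mat_trace_def)

text \<open>Both dimensions are traces of identity matrices, and the traces of \<open>A * B\<close>
  and \<open>B * A\<close> agree; in characteristic 0 the natural numbers embed into the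
  field.\<close>

lemma inverse_mat_dims:
 fixes A :: "'a::field_char_0 mat"
 assumes "A \<in> carrier_mat m n" "B \<in> carrier_mat n m" "A * B = 1\<^sub>m m" "B * A = 1\<^sub>m n"
 shows "m = n" using mat_trace_mult_comm[OF assms(1,2)] by (simp add: assms mat_trace_one)

section \<open>Kronecker products over an unordered finite index set\<close>

definition multi_idx :: "'i set => ('i => nat) => nat => 'i => nat" where
 "multi_idx I r = (SOME e. bij_betw e {..<\<Prod>i\<in>I. r i} (\<Pi>\<^sub>E i\<in>I. {..<r i}))"

lemma bij_multi_idx:
 assumes "finite I"
 shows "bij_betw (multi_idx I r) {..<\<Prod>i\<in>I. r i} (\<Pi>\<^sub>E i\<in>I. {..<r i})"
proof -
 have "card {..<\<Prod>i\<in>I. r i} = card (\<Pi>\<^sub>E i\<in>I. {..<r i})" using assms by (simp add: card_PiE)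
 then have "\<exists>e. bij_betw e {..<\<Prod>i\<in>I. r i} (\<Pi>\<^sub>E i\<in>I. {..<r i})"
  using assms by (intro finite_same_card_bij) (auto intro: finite_PiE)
 then show ?thesis unfolding multi_idx_def by (rule someI_ex)
qed

lemma multi_idx_less:
 assumes "finite I" "p < (\<Prod>i\<in>I. r i)" "i \<in> I"
 shows "multi_idx I r p i < r i" using bij_betwE[OF bij_multi_idx[OF assms(1), of r]] assms by (auto simp: PiE_iff)

lemma multi_idx_inj:
 assumes "finite I" "p < (\<Prod>i\<in>I. r i)" "q < (\<Prod>i\<in>I. r i)" "\<And>i. i \<in> I ==> multi_idx I r p i = multi_idx I r q i"
 shows "p = q"
proof -
 note b = bij_multi_idx[OF assms(1), of r]
 have "multi_idx I r p = multi_idx I r q" using bij_betwE[OF b] assms by (intro PiE_ext[of _ I "\<lambda>i. {..<r i}"]) auto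
 then show ?thesis using b assms by (auto simp: bij_betw_def inj_on_def)
qed

lemma multi_idx_cong:
 "(\<And>i. i \<in> I ==> r i = r' i) ==> multi_idx I r = multi_idx I r'" unfolding multi_idx_def by (simp cong: prod.cong PiE_cong)

text \<open>Rows and columns are numbered by an arbitrary enumeration \<open>multi_idx\<close> of
  multi-indices. The enumeration depends on the dimensions only, so the columns of one matrix and
  the rows of the next are numbered alike and matrix products are respected.\<close>

definition kron :: "'i set => ('i => 'a::comm_ring_1 mat) => 'a mat" where
 "kron I A = mat (\<Prod>i\<in>I. dim_row (A i)) (\<Prod>i\<in>I. dim_col (A i))
   (\<lambda>(p, q). \<Prod>i\<in>I. A i $$ (multi_idx I (\<lambda>i. dim_row (A i)) p i, multi_idx I (\<lambda>i. dim_col (A i)) q i))"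

lemma kron_carrier:
 assumes "\<And>i. i \<in> I ==> A i \<in> carrier_mat (r i) (c i)"
 shows "kron I A \<in> carrier_mat (\<Prod>i\<in>I. r i) (\<Prod>i\<in>I. c i)"
proof -
 have "(\<Prod>i\<in>I. dim_row (A i)) = (\<Prod>i\<in>I. r i)" "(\<Prod>i\<in>I. dim_col (A i)) = (\<Prod>i\<in>I. c i)"
  using assms by (auto intro!: prod.cong)
 then show ?thesis by (simp add: kron_def)
qed

lemma kron_index:
 assumes "\<And>i. i \<in> I ==> A i \<in> carrier_mat (r i) (c i)" "p < (\<Prod>i\<in>I. r i)" "q < (\<Prod>i\<in>I. c i)"
 shows "kron I A $$ (p, q) = (\<Prod>i\<in>I. A i $$ (multi_idx I r p i, multi_idx I c q i))"
proof -
 have 1: "(\<Prod>i\<in>I. dim_row (A i)) = (\<Prod>i\<in>I. r i)" "(\<Prod>i\<in>I. dim_col (A i)) = (\<Prod>i\<in>I. c i)"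
  using assms(1) by (auto intro!: prod.cong)
 have 2: "multi_idx I (\<lambda>i. dim_row (A i)) = multi_idx I r" "multi_idx I (\<lambda>i. dim_col (A i)) = multi_idx I c"
  using assms(1) by (auto intro!: multi_idx_cong)
 show ?thesis using assms(2,3) unfolding kron_def 1 2 by simp
qed

text \<open>The sum over the middle number is a sum over multi-indices, and distributivity turns
  this sum of products into a product of sums, one for each factor.\<close>

lemma kron_mult:
 assumes "finite I"
  and A: "\<And>i. i \<in> I ==> A i \<in> carrier_mat (r i) (m i)"
  and B: "\<And>i. i \<in> I ==> B i \<in> carrier_mat (m i) (c i)"
 shows "kron I (\<lambda>i. A i * B i) = kron I A * kron I B"
proof -
 have AB: "A i * B i \<in> carrier_mat (r i) (c i)" if "i \<in> I" for i by (rule mult_carrier_mat[OF A[OF that] B[OF that]])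
 show ?thesis
 proof (rule eq_matI)
  fix p q assume "p < dim_row (kron I A * kron I B)" "q < dim_col (kron I A * kron I B)"
  then have p: "p < (\<Prod>i\<in>I. r i)" and q: "q < (\<Prod>i\<in>I. c i)"
   using kron_carrier[of I A r m, OF A] kron_carrier[of I B m c, OF B] by auto
  have "(kron I A * kron I B) $$ (p, q) = (\<Sum>k<\<Prod>i\<in>I. m i. kron I A $$ (p, k) * kron I B $$ (k, q))"
   using kron_carrier[of I A r m, OF A] kron_carrier[of I B m c, OF B] p q by (auto simp: scalar_prod_def atLeast0LessThan)
  also have "\<dots> = (\<Sum>k<\<Prod>i\<in>I. m i. \<Prod>i\<in>I. A i $$ (multi_idx I r p i, multi_idx I m k i) * B i $$ (multi_idx I m k i, multi_idx I c q i))"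
   using p q by (intro sum.cong refl) (simp add: kron_index[OF A] kron_index[OF B] prod.distrib)
  also have "\<dots> = (\<Sum>k\<in>(\<Pi>\<^sub>E i\<in>I. {..<m i}). \<Prod>i\<in>I. A i $$ (multi_idx I r p i, k i) * B i $$ (k i, multi_idx I c q i))"
   by (rule sum.reindex_bij_betw[OF bij_multi_idx[OF assms(1)]])
  also have "\<dots> = (\<Prod>i\<in>I. \<Sum>k<m i. A i $$ (multi_idx I r p i, k) * B i $$ (k, multi_idx I c q i))"
   using assms(1) by (subst prod_sum_PiE) auto
  also have "\<dots> = (\<Prod>i\<in>I. (A i * B i) $$ (multi_idx I r p i, multi_idx I c q i))"
  proof (rule prod.cong[OF refl])
   fix i assume i: "i \<in> I"
   note multi_idx_less[OF assms(1) p i] multi_idx_less[OF assms(1) q i]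
   then show "(\<Sum>k<m i. A i $$ (multi_idx I r p i, k) * B i $$ (k, multi_idx I c q i))
     = (A i * B i) $$ (multi_idx I r p i, multi_idx I c q i)" using A[OF i] B[OF i] by (auto simp: scalar_prod_def atLeast0LessThan)
  qed
  also have "\<dots> = kron I (\<lambda>i. A i * B i) $$ (p, q)" using kron_index[OF AB p q] by simp
  finally show "kron I (\<lambda>i. A i * B i) $$ (p, q) = (kron I A * kron I B) $$ (p, q)" ..
 qed (use kron_carrier[of I A r m, OF A] kron_carrier[of I B m c, OF B] kron_carrier[of I _ r c, OF AB] in auto)
qed

lemma kron_one:
 assumes "finite I"
 shows "kron I (\<lambda>i. 1\<^sub>m (r i)) = 1\<^sub>m (\<Prod>i\<in>I. r i)"
proof (rule eq_matI)
 fix p q assume "p < dim_row (1\<^sub>m (\<Prod>i\<in>I. r i))" "q < dim_col (1\<^sub>m (\<Prod>i\<in>I. r i))"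
 then have p: "p < (\<Prod>i\<in>I. r i)" and q: "q < (\<Prod>i\<in>I. r i)" by auto
 have "kron I (\<lambda>i. 1\<^sub>m (r i)) $$ (p, q) =
   (\<Prod>i\<in>I. if multi_idx I r p i = multi_idx I r q i then 1 else 0)"
  using p q by (subst kron_index[of I _ r r]) (auto simp: multi_idx_less[OF assms] intro!: prod.cong)
 also have "\<dots> = (if p = q then 1 else 0)"
 proof (cases "p = q")
  case False
  then obtain i where "i \<in> I" "multi_idx I r p i \<noteq> multi_idx I r q i" using multi_idx_inj[OF assms p q] by blast
  then show ?thesis using False assms by (auto intro!: prod_zero)
 qed simp
 finally show "kron I (\<lambda>i. 1\<^sub>m (r i)) $$ (p, q) = 1\<^sub>m (\<Prod>i\<in>I. r i) $$ (p, q)" using p q by simp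
qed (auto simp: kron_def)

lemma kron_cong: "(\<And>i. i \<in> I ==> A i = B i) ==> kron I A = kron I B" unfolding kron_def by (simp cong: prod.cong multi_idx_cong)

text \<open>Every entry is a product with exactly one factor from slot \<open>i\<close>, hence
  additive in that slot. This makes tensor products of multiplicity spaces linear in each
  variable.\<close>

lemma kron_add_slot:
 assumes "finite I" "i \<in> I" "P \<in> carrier_mat (r i) (c i)" "Q \<in> carrier_mat (r i) (c i)"
  "\<And>j. j \<in> I ==> j \<noteq> i ==> A j \<in> carrier_mat (r j) (c j)"
 shows "kron I (A(i := P + Q)) = kron I (A(i := P)) + kron I (A(i := Q))"
proof -
 have car: "(A(i := R)) j \<in> carrier_mat (r j) (c j)" if "R \<in> carrier_mat (r i) (c i)" "j \<in> I" for R j using that assms by auto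
 have PQ: "P + Q \<in> carrier_mat (r i) (c i)" using assms by auto
 have k: "kron I (A(i := R)) \<in> carrier_mat (\<Prod>i\<in>I. r i) (\<Prod>i\<in>I. c i)"
  if "R \<in> carrier_mat (r i) (c i)" for R by (rule kron_carrier[OF car[OF that]])
 note k = k[OF assms(3)] k[OF assms(4)] k[OF PQ]
 show ?thesis
 proof (rule eq_matI)
  fix p q assume "p < dim_row (kron I (A(i := P)) + kron I (A(i := Q)))"
   "q < dim_col (kron I (A(i := P)) + kron I (A(i := Q)))"
  then have p: "p < (\<Prod>i\<in>I. r i)" and q: "q < (\<Prod>i\<in>I. c i)" using k by auto
  note pi = multi_idx_less[OF assms(1) p assms(2)] multi_idx_less[OF assms(1) q assms(2)]
  have "kron I (A(i := R)) $$ (p, q) = R $$ (multi_idx I r p i, multi_idx I c q i) *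
    (\<Prod>j\<in>I - {i}. A j $$ (multi_idx I r p j, multi_idx I c q j))"
   if "R \<in> carrier_mat (r i) (c i)" for R using assms(1,2) by (subst kron_index[OF car[OF that] p q]) (auto simp: prod.remove intro!: prod.cong)
  then show "kron I (A(i := P + Q)) $$ (p, q) = (kron I (A(i := P)) + kron I (A(i := Q))) $$ (p, q)"
   using assms(3,4) PQ p q k pi by (simp add: algebra_simps)
 qed (use k in auto)
qed

lemma kron_smult_slot:
 assumes "finite I" "i \<in> I" "P \<in> carrier_mat (r i) (c i)"
  "\<And>j. j \<in> I ==> j \<noteq> i ==> A j \<in> carrier_mat (r j) (c j)"
 shows "kron I (A(i := a \<cdot>\<^sub>m P)) = a \<cdot>\<^sub>m kron I (A(i := P))"
proof -
 have car: "(A(i := R)) j \<in> carrier_mat (r j) (c j)" if "R \<in> carrier_mat (r i) (c i)" "j \<in> I" for R j using that assms by auto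
 have PQ: "a \<cdot>\<^sub>m P \<in> carrier_mat (r i) (c i)" using assms by auto
 have k: "kron I (A(i := R)) \<in> carrier_mat (\<Prod>i\<in>I. r i) (\<Prod>i\<in>I. c i)"
  if "R \<in> carrier_mat (r i) (c i)" for R by (rule kron_carrier[OF car[OF that]])
 note k = k[OF assms(3)] k[OF PQ]
 show ?thesis
 proof (rule eq_matI)
  fix p q assume "p < dim_row (a \<cdot>\<^sub>m kron I (A(i := P)))" "q < dim_col (a \<cdot>\<^sub>m kron I (A(i := P)))"
  then have p: "p < (\<Prod>i\<in>I. r i)" and q: "q < (\<Prod>i\<in>I. c i)" using k by auto
  note pi = multi_idx_less[OF assms(1) p assms(2)] multi_idx_less[OF assms(1) q assms(2)]
  have "kron I (A(i := R)) $$ (p, q) = R $$ (multi_idx I r p i, multi_idx I c q i) *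
    (\<Prod>j\<in>I - {i}. A j $$ (multi_idx I r p j, multi_idx I c q j))"
   if "R \<in> carrier_mat (r i) (c i)" for R using assms(1,2) by (subst kron_index[OF car[OF that] p q]) (auto simp: prod.remove intro!: prod.cong)
  then show "kron I (A(i := a \<cdot>\<^sub>m P)) $$ (p, q) = (a \<cdot>\<^sub>m kron I (A(i := P))) $$ (p, q)"
   using assms(3) PQ p q k pi by (simp add: algebra_simps)
 qed (use k in auto)
qed

section \<open>Categories presented by matrices\<close>

text \<open>The family runs over the whole index type; outside the support of \<open>a\<close> or of
  \<open>b\<close> its members have no columns or no rows and carry no information.\<close>

definition mat_fam :: "('j => nat) => ('j => nat) => ('j => 'k mat) set" where
 "mat_fam a b = {A. \<forall>j. A j \<in> carrier_mat (b j) (a j)}"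

text \<open>A splitting consists of equations between arrows, so every linear functor preserves it;
  the universal properties in \<open>short_exact\<close> have no such form.\<close>

definition split_seq ::
 "('o, 'm, 'k) lcat => 'o => 'o => 'o => 'm => 'm => 'm => 'm => bool" where
 "split_seq C a b c f g r s \<longleftrightarrow> f \<in> Homs C a b \<and> g \<in> Homs C b c \<and> r \<in> Homs C b a \<and> s \<in> Homs C c b \<and>
   Cmp C r f = Ide C a \<and> Cmp C g s = Ide C c \<and> Cmp C g f = ZeroA C a c \<and>
   AddA C (Cmp C f r) (Cmp C s g) = Ide C b"

text \<open>The dimension vector of the \<open>j\<close>-th simple object.\<close>

definition kdelta :: "'j => 'j => nat" where
 "kdelta j = (\<lambda>i. if i = j then 1 else 0)"

lemma Homs_Arr: "f \<in> Arr C ==> f \<in> Homs C (Src C f) (Tgt C f)" by (simp add: Homs_def)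

text \<open>
 Such a category is equivalent to the category of finitely supported families of finite-dimensional
 vector spaces indexed by \<open>J\<close>; \<open>d\<close> gives the dimensions and \<open>rh\<close> the matrices.
\<close>

locale matcat =
 fixes C :: "('o, 'm, 'k::field_char_0) lcat" and J :: "'j set"
  and d :: "'o => 'j => nat" and rh :: "'m => 'j => 'k mat"
 assumes Arr_ends: "f \<in> Arr C ==> Src C f \<in> Obj C \<and> Tgt C f \<in> Obj C"
  and Ide_hom: "a \<in> Obj C ==> Ide C a \<in> Homs C a a"
  and Cmp_hom: "f \<in> Homs C a b ==> g \<in> Homs C b c ==> Cmp C g f \<in> Homs C a c"
  and Zero_hom: "a \<in> Obj C ==> b \<in> Obj C ==> ZeroA C a b \<in> Homs C a b"
  and Add_hom: "f \<in> Homs C a b ==> g \<in> Homs C a b ==> AddA C f g \<in> Homs C a b"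
  and Scale_hom: "f \<in> Homs C a b ==> ScaleA C r f \<in> Homs C a b"
  and rep_bij: "a \<in> Obj C ==> b \<in> Obj C ==> bij_betw rh (Homs C a b) (mat_fam (d a) (d b))"
  and rep_Ide: "a \<in> Obj C ==> rh (Ide C a) j = 1\<^sub>m (d a j)"
  and rep_Cmp: "f \<in> Homs C a b ==> g \<in> Homs C b c ==> rh (Cmp C g f) j = rh g j * rh f j"
  and rep_Zero: "a \<in> Obj C ==> b \<in> Obj C ==> rh (ZeroA C a b) j = 0\<^sub>m (d b j) (d a j)"
  and rep_Add: "f \<in> Homs C a b ==> g \<in> Homs C a b ==> rh (AddA C f g) j = rh f j + rh g j"
  and rep_Scale: "f \<in> Homs C a b ==> rh (ScaleA C r f) j = r \<cdot>\<^sub>m rh f j"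
  and dim_finite: "a \<in> Obj C ==> finite {j. d a j \<noteq> 0}"
  and dim_support: "a \<in> Obj C ==> d a j \<noteq> 0 ==> j \<in> J"
  and ex_dim: "finite {j. n j \<noteq> 0} ==> {j. n j \<noteq> 0} \<subseteq> J ==> \<exists>a\<in>Obj C. d a = n"
begin

lemma hom_ends: "f \<in> Homs C a b ==> a \<in> Obj C \<and> b \<in> Obj C" using Arr_ends by (auto simp: Homs_def)

lemma rep_carrier:
 assumes "f \<in> Homs C a b" shows "rh f j \<in> carrier_mat (d b j) (d a j)"
 using bij_betwE[OF rep_bij[of a b]] hom_ends[OF assms] assms by (auto simp: mat_fam_def)

lemma hom_eqI:
 assumes "f \<in> Homs C a b" "g \<in> Homs C a b" "\<And>j. rh f j = rh g j"
 shows "f = g"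
proof -
 have "rh f = rh g" using assms(3) by auto
 then show ?thesis using rep_bij[of a b] hom_ends[OF assms(1)] assms(1,2) by (auto simp: bij_betw_def inj_on_def)
qed

definition mk :: "'o => 'o => ('j => 'k mat) => 'm" where
 "mk a b A = inv_into (Homs C a b) rh A"

lemma
 assumes "a \<in> Obj C" "b \<in> Obj C" "\<And>j. A j \<in> carrier_mat (d b j) (d a j)"
 shows mk_hom: "mk a b A \<in> Homs C a b" and rep_mk: "rh (mk a b A) = A"
proof -
 have "A \<in> rh ` Homs C a b" using rep_bij[OF assms(1,2)] assms(3) by (auto simp: bij_betw_def mat_fam_def)
 then show "mk a b A \<in> Homs C a b" "rh (mk a b A) = A" unfolding mk_def by (rule inv_into_into, rule f_inv_into_f)
qed

lemma mk_eq: "f \<in> Homs C a b ==> mk a b (rh f) = f"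
 using hom_eqI[of "mk a b (rh f)" a b f] hom_ends[of f a b] rep_carrier[of f a b] by (simp add: mk_hom rep_mk)

lemma Cmp_assoc:
 assumes "f \<in> Homs C a b" "g \<in> Homs C b c" "h \<in> Homs C c e"
 shows "Cmp C h (Cmp C g f) = Cmp C (Cmp C h g) f"
proof (rule hom_eqI[where a = a and b = e])
 fix j
 show "rh (Cmp C h (Cmp C g f)) j = rh (Cmp C (Cmp C h g) f) j"
  using assms rep_carrier[OF assms(1), of j] rep_carrier[OF assms(2), of j] rep_carrier[OF assms(3), of j]
  by (simp add: rep_Cmp[OF Cmp_hom[OF assms(1,2)] assms(3)] rep_Cmp[OF assms(1) Cmp_hom[OF assms(2,3)]]
    rep_Cmp[OF assms(1,2)] rep_Cmp[OF assms(2,3)])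
qed (use assms in "blast intro: Cmp_hom")+

lemma Cmp_Ide_right:
 assumes f: "f \<in> Homs C a b" shows "Cmp C f (Ide C a) = f" using hom_ends[OF f] f by (intro hom_eqI[OF Cmp_hom[OF Ide_hom f] f])
  (simp_all add: rep_Cmp[OF Ide_hom f] rep_Ide right_mult_one_mat[OF rep_carrier[OF f]])

lemma Cmp_Ide_left:
 assumes f: "f \<in> Homs C a b" shows "Cmp C (Ide C b) f = f" using hom_ends[OF f] f by (intro hom_eqI[OF Cmp_hom[OF f Ide_hom] f])
  (simp_all add: rep_Cmp[OF f Ide_hom] rep_Ide left_mult_one_mat[OF rep_carrier[OF f]])

lemma Cmp_Zero:
 assumes f: "f \<in> Homs C a b" and "c \<in> Obj C"
 shows "Cmp C f (ZeroA C c a) = ZeroA C c b" "Cmp C (ZeroA C b c) f = ZeroA C a c"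
proof -
 have ab: "a \<in> Obj C" "b \<in> Obj C" using hom_ends[OF f] by auto
 show "Cmp C f (ZeroA C c a) = ZeroA C c b" using ab assms rep_carrier[OF f] by (intro hom_eqI[OF Cmp_hom[OF Zero_hom f] Zero_hom])
   (simp_all add: rep_Cmp[OF Zero_hom f] rep_Zero right_mult_zero_mat[OF rep_carrier[OF f]])
 show "Cmp C (ZeroA C b c) f = ZeroA C a c" using ab assms rep_carrier[OF f] by (intro hom_eqI[OF Cmp_hom[OF f Zero_hom] Zero_hom])
   (simp_all add: rep_Cmp[OF f Zero_hom] rep_Zero left_mult_zero_mat[OF rep_carrier[OF f]])
qed

lemma Cmp_Add_right:
 assumes f: "f \<in> Homs C a b" and f': "f' \<in> Homs C a b" and g: "g \<in> Homs C b c"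
 shows "Cmp C g (AddA C f f') = AddA C (Cmp C g f) (Cmp C g f')" using rep_carrier[OF f] rep_carrier[OF f'] rep_carrier[OF g]
 by (intro hom_eqI[OF Cmp_hom[OF Add_hom[OF f f'] g] Add_hom[OF Cmp_hom[OF f g] Cmp_hom[OF f' g]]])
  (simp add: rep_Cmp[OF Add_hom[OF f f'] g] rep_Add[OF f f'] rep_Add[OF Cmp_hom[OF f g] Cmp_hom[OF f' g]]
   rep_Cmp[OF f g] rep_Cmp[OF f' g] mult_add_distrib_mat[OF rep_carrier[OF g] rep_carrier[OF f] rep_carrier[OF f']])

lemma Cmp_Add_left:
 assumes f: "f \<in> Homs C a b" and g: "g \<in> Homs C b c" and g': "g' \<in> Homs C b c"
 shows "Cmp C (AddA C g g') f = AddA C (Cmp C g f) (Cmp C g' f)"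
 by (intro hom_eqI[OF Cmp_hom[OF f Add_hom[OF g g']] Add_hom[OF Cmp_hom[OF f g] Cmp_hom[OF f g']]])
  (simp add: rep_Cmp[OF f Add_hom[OF g g']] rep_Add[OF g g'] rep_Add[OF Cmp_hom[OF f g] Cmp_hom[OF f g']]
   rep_Cmp[OF f g] rep_Cmp[OF f g'] add_mult_distrib_mat[OF rep_carrier[OF g] rep_carrier[OF g'] rep_carrier[OF f]])

subsection \<open>Isomorphisms, zero objects, split sequences\<close>

lemma is_iso_dims:
 assumes "is_iso C f" "f \<in> Homs C a b" shows "d a = d b"
proof
 fix j
 obtain g where g: "g \<in> Homs C b a" and "Cmp C g f = Ide C a" "Cmp C f g = Ide C b" using assms by (auto simp: is_iso_def is_inverse_def Homs_def)
 then have "rh g j * rh f j = 1\<^sub>m (d a j)" "rh f j * rh g j = 1\<^sub>m (d b j)"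
  using hom_ends[OF g] by (simp_all flip: rep_Cmp[OF assms(2) g] rep_Cmp[OF g assms(2)] add: rep_Ide)
 then show "d a j = d b j" using inverse_mat_dims[OF rep_carrier[OF g] rep_carrier[OF assms(2)]] by auto
qed

lemma is_isoI:
 assumes "f \<in> Homs C a b" "g \<in> Homs C b a" "Cmp C g f = Ide C a" "Cmp C f g = Ide C b"
 shows "is_iso C f" using assms by (auto simp: is_iso_def is_inverse_def Homs_def intro!: exI[of _ g])

lemma zero_obj_iff: "is_zero_obj C a \<longleftrightarrow> a \<in> Obj C \<and> (\<forall>j. d a j = 0)"
proof
 assume z: "is_zero_obj C a"
 then have a: "a \<in> Obj C" by (simp add: is_zero_obj_def)
 then have "Ide C a = ZeroA C a a" using z Ide_hom[OF a] Zero_hom[OF a a] by (auto simp: is_zero_obj_def)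
 then have "1\<^sub>m (d a j) = (0\<^sub>m (d a j) (d a j) :: 'k mat)" for j using rep_Ide[OF a, of j] rep_Zero[OF a a, of j] by simp
 then have "d a j = 0" for j using mat_trace_one[of "d a j", where 'a = 'k] by (simp add: mat_trace_def)
 then show "a \<in> Obj C \<and> (\<forall>j. d a j = 0)" using a by simp
next
 assume a: "a \<in> Obj C \<and> (\<forall>j. d a j = 0)"
 have "(\<exists>!f. f \<in> Homs C a b) \<and> (\<exists>!f. f \<in> Homs C b a)" if b: "b \<in> Obj C" for b
 proof safe
  fix f g assume fg: "f \<in> Homs C a b" "g \<in> Homs C a b"
  have "rh f j = rh g j" for j using rep_carrier[OF fg(1), of j] rep_carrier[OF fg(2), of j] a by (intro eq_matI) auto
  then show "f = g" by (rule hom_eqI[OF fg])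
 next
  fix f g assume fg: "f \<in> Homs C b a" "g \<in> Homs C b a"
  have "rh f j = rh g j" for j using rep_carrier[OF fg(1), of j] rep_carrier[OF fg(2), of j] a by (intro eq_matI) auto
  then show "f = g" by (rule hom_eqI[OF fg])
 qed (use a b Zero_hom in blast)+
 then show "is_zero_obj C a" using a by (auto simp: is_zero_obj_def)
qed

text \<open>Take traces in \<open>f r + s g = 1\<close>: cyclicity replaces \<open>f r\<close> by
  \<open>r f = 1\<close> and \<open>s g\<close> by \<open>g s = 1\<close>. Characteristic 0 turns
  the result into an equation of natural numbers.\<close>

lemma split_seq_dims:
 assumes "split_seq C a b c f g r s" shows "d b j = d a j + d c j"
proof -
 have h: "f \<in> Homs C a b" "g \<in> Homs C b c" "r \<in> Homs C b a" "s \<in> Homs C c b"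
  and e: "Cmp C r f = Ide C a" "Cmp C g s = Ide C c" "AddA C (Cmp C f r) (Cmp C s g) = Ide C b" using assms by (auto simp: split_seq_def)
 have o: "a \<in> Obj C" "b \<in> Obj C" "c \<in> Obj C" using hom_ends h by blast+
 note c = rep_carrier[OF h(1), of j] rep_carrier[OF h(2), of j] rep_carrier[OF h(3), of j] rep_carrier[OF h(4), of j]
 have 1: "rh r j * rh f j = 1\<^sub>m (d a j)" using rep_Cmp[OF h(1,3), of j] e(1) rep_Ide[OF o(1)] by simp
 have 2: "rh g j * rh s j = 1\<^sub>m (d c j)" using rep_Cmp[OF h(4,2), of j] e(2) rep_Ide[OF o(3)] by simp
 have "rh f j * rh r j + rh s j * rh g j = 1\<^sub>m (d b j)"
  using rep_Add[OF Cmp_hom[OF h(3,1)] Cmp_hom[OF h(2,4)], of j] rep_Cmp[OF h(3,1), of j] rep_Cmp[OF h(2,4), of j]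
   e(3) rep_Ide[OF o(2)] by simp
 then have "mat_trace (rh f j * rh r j) + mat_trace (rh s j * rh g j) = (of_nat (d b j) :: 'k)"
  using mat_trace_add[of "rh f j * rh r j" "d b j" "rh s j * rh g j"] c by (simp add: mat_trace_one)
 then have "(of_nat (d a j + d c j) :: 'k) = of_nat (d b j)"
  using mat_trace_mult_comm[OF c(1,3)] mat_trace_mult_comm[OF c(4,2)] by (simp add: 1 2 mat_trace_one)
 then show ?thesis by (metis of_nat_eq_iff)
qed

text \<open>An arrow \<open>h\<close> into \<open>b\<close> with \<open>g h = 0\<close> equals
  \<open>(f r + s g) h = f (r h)\<close>, and \<open>r f = 1\<close> makes the factor unique; the
  cokernel is dual.\<close>

lemma split_seq_short_exact:
 assumes "split_seq C a b c f g r s" shows "short_exact C f g"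
proof -
 have h: "f \<in> Homs C a b" "g \<in> Homs C b c" "r \<in> Homs C b a" "s \<in> Homs C c b"
  and e: "Cmp C r f = Ide C a" "Cmp C g s = Ide C c" "AddA C (Cmp C f r) (Cmp C s g) = Ide C b"
  and z: "Cmp C g f = ZeroA C a c" using assms by (auto simp: split_seq_def)
 have o: "a \<in> Obj C" "b \<in> Obj C" "c \<in> Obj C" using hom_ends h by blast+
 have st: "Src C f = a" "Tgt C f = b" "Src C g = b" "Tgt C g = c" "f \<in> Arr C" "g \<in> Arr C" using h by (auto simp: Homs_def)
 have add_zero: "AddA C u (ZeroA C x y) = u \<and> AddA C (ZeroA C x y) u = u" if "u \<in> Homs C x y" for u x y
  using hom_ends[OF that] that rep_carrier[OF that]
  by (auto intro!: hom_eqI[OF Add_hom[OF that Zero_hom] that] hom_eqI[OF Add_hom[OF Zero_hom that] that]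
    simp: rep_Add[OF that Zero_hom] rep_Add[OF Zero_hom that] rep_Zero right_add_zero_mat[OF rep_carrier[OF that]]
    left_add_zero_mat[OF rep_carrier[OF that]])
 have ker: "\<exists>!u. u \<in> Homs C x a \<and> Cmp C f u = h'" if hx: "h' \<in> Homs C x b" "Cmp C g h' = ZeroA C x c" for x h'
 proof (rule ex1I[of _ "Cmp C r h'"])
  have x: "x \<in> Obj C" using hom_ends[OF hx(1)] by simp
  have "h' = Cmp C (AddA C (Cmp C f r) (Cmp C s g)) h'" using Cmp_Ide_left[OF hx(1)] e(3) by simp
  also have "\<dots> = AddA C (Cmp C (Cmp C f r) h') (Cmp C (Cmp C s g) h')" using Cmp_Add_left[OF hx(1) Cmp_hom[OF h(3,1)] Cmp_hom[OF h(2,4)]] .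
  also have "Cmp C (Cmp C s g) h' = ZeroA C x b" using Cmp_assoc[OF hx(1) h(2) h(4)] hx(2) Cmp_Zero(1)[OF h(4) x] by simp
  also have "AddA C (Cmp C (Cmp C f r) h') (ZeroA C x b) = Cmp C f (Cmp C r h')"
   using Cmp_assoc[OF hx(1) h(3) h(1)] add_zero[OF Cmp_hom[OF hx(1) Cmp_hom[OF h(3,1)]]] by simp
  finally show "Cmp C r h' \<in> Homs C x a \<and> Cmp C f (Cmp C r h') = h'" using Cmp_hom[OF hx(1) h(3)] by simp
  fix u assume u: "u \<in> Homs C x a \<and> Cmp C f u = h'"
  then show "u = Cmp C r h'" using Cmp_assoc[of u x a f b r a] h e(1) Cmp_Ide_left[of u x a] by auto
 qed
 have coker: "\<exists>!u. u \<in> Homs C c x \<and> Cmp C u g = h'" if hx: "h' \<in> Homs C b x" "Cmp C h' f = ZeroA C a x" for x h'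
 proof (rule ex1I[of _ "Cmp C h' s"])
  have x: "x \<in> Obj C" using hom_ends[OF hx(1)] by simp
  have "h' = Cmp C h' (AddA C (Cmp C f r) (Cmp C s g))" using Cmp_Ide_right[OF hx(1)] e(3) by simp
  also have "\<dots> = AddA C (Cmp C h' (Cmp C f r)) (Cmp C h' (Cmp C s g))" using Cmp_Add_right[OF Cmp_hom[OF h(3,1)] Cmp_hom[OF h(2,4)] hx(1)] .
  also have "Cmp C h' (Cmp C f r) = ZeroA C b x" using Cmp_assoc[OF h(3) h(1) hx(1)] hx(2) Cmp_Zero(2)[OF h(3) x] by simp
  also have "AddA C (ZeroA C b x) (Cmp C h' (Cmp C s g)) = Cmp C (Cmp C h' s) g"
   using Cmp_assoc[OF h(2) h(4) hx(1)] add_zero[OF Cmp_hom[OF Cmp_hom[OF h(2,4)] hx(1)]] by simp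
  finally show "Cmp C h' s \<in> Homs C c x \<and> Cmp C (Cmp C h' s) g = h'" using Cmp_hom[OF h(4) hx(1)] by simp
  fix u assume u: "u \<in> Homs C c x \<and> Cmp C u g = h'"
  then show "u = Cmp C h' s" using Cmp_assoc[of s c b g c u x] h e(2) Cmp_Ide_right[of u c x] by auto
 qed
 show ?thesis unfolding short_exact_def is_kernel_def is_cokernel_def st using st z ker coker by auto
qed

lemma ex_inner_inverse_arr:
 assumes "f \<in> Homs C a b"
 shows "\<exists>x\<in>Homs C b a. Cmp C (Cmp C f x) f = f"
proof -
 have "\<forall>j. \<exists>X\<in>carrier_mat (d a j) (d b j). rh f j * X * rh f j = rh f j" using ex_inner_inverse[OF rep_carrier[OF assms]] by blast
 then obtain X where X: "\<And>j. X j \<in> carrier_mat (d a j) (d b j)" "\<And>j. rh f j * X j * rh f j = rh f j" by metis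
 have o: "a \<in> Obj C" "b \<in> Obj C" using hom_ends[OF assms] by auto
 note x = mk_hom[OF o(2,1) X(1)]
 have "Cmp C (Cmp C f (mk b a X)) f = f" by (intro hom_eqI[OF Cmp_hom[OF assms Cmp_hom[OF x assms]] assms])
   (simp add: rep_Cmp[OF assms Cmp_hom[OF x assms]] rep_Cmp[OF x assms] rep_mk[OF o(2,1) X(1)] X(2))
 then show ?thesis using x by blast
qed

text \<open>As a kernel, \<open>f\<close> can be cancelled, so an inner inverse \<open>r\<close>
  satisfies \<open>r f = 1\<close>. The arrow \<open>1 - f r\<close> vanishes on \<open>f\<close>
  and factors through the cokernel \<open>g\<close>; the factor \<open>s\<close> is a section of
  \<open>g\<close>.\<close>

lemma short_exact_split:
 assumes "short_exact C f g"
 shows "\<exists>r s. split_seq C (Src C f) (Src C g) (Tgt C g) f g r s"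
proof -
 define a b c where "a = Src C f" "b = Src C g" "c = Tgt C g"
 have f: "f \<in> Homs C a b" and g: "g \<in> Homs C b c" and z: "Cmp C g f = ZeroA C a c"
  using assms by (auto simp: short_exact_def is_kernel_def Homs_def a_b_c_def)
 have ker: "\<And>x h. h \<in> Homs C x b ==> Cmp C g h = ZeroA C x c ==> \<exists>!u. u \<in> Homs C x a \<and> Cmp C f u = h"
  and coker: "\<And>x h. h \<in> Homs C b x ==> Cmp C h f = ZeroA C a x ==> \<exists>!u. u \<in> Homs C c x \<and> Cmp C u g = h"
  using assms by (auto simp: short_exact_def is_kernel_def is_cokernel_def a_b_c_def)
 have o: "a \<in> Obj C" "b \<in> Obj C" "c \<in> Obj C" using hom_ends f g by blast+
 obtain r where r: "r \<in> Homs C b a" "Cmp C (Cmp C f r) f = f" using ex_inner_inverse_arr[OF f] by blast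
 have fr: "Cmp C f r \<in> Homs C b b" using r f by (blast intro: Cmp_hom)
 have rf: "Cmp C r f = Ide C a"
 proof -
  have "Cmp C f (Cmp C r f) = f" using Cmp_assoc[OF f r(1) f] r(2) by simp
  then show ?thesis using ker[OF f z] Cmp_hom[OF f r(1)] Ide_hom[OF o(1)] Cmp_Ide_right[OF f] by blast
 qed
 define h where "h = AddA C (Ide C b) (ScaleA C (-1) (Cmp C f r))"
 have hh: "h \<in> Homs C b b" using fr o by (auto simp: h_def intro!: Add_hom Ide_hom Scale_hom)
 have hr: "rh h j = 1\<^sub>m (d b j) - rh f j * rh r j" for j using o fr rep_carrier[OF fr, of j] rep_carrier[OF f, of j] rep_carrier[OF r(1), of j]
  by (auto simp: h_def rep_Add[OF Ide_hom Scale_hom[OF fr]] rep_Ide rep_Scale[OF fr] rep_Cmp[OF r(1) f] intro!: eq_matI)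
 have "Cmp C h f = ZeroA C a b"
 proof (rule hom_eqI[OF Cmp_hom[OF f hh] Zero_hom[OF o(1,2)]])
  fix j
  have "rh f j * rh r j * rh f j = rh f j" using r(2) rep_Cmp[OF f fr, of j] rep_Cmp[OF r(1) f, of j] by simp
  moreover have "(1\<^sub>m (d b j) - rh f j * rh r j) * rh f j = rh f j - rh f j * rh r j * rh f j"
   using rep_carrier[OF f, of j] rep_carrier[OF r(1), of j] by (subst minus_mult_distrib_mat[of _ "d b j" "d b j"]) auto
  ultimately show "rh (Cmp C h f) j = rh (ZeroA C a b) j" using rep_carrier[OF f, of j] by (auto simp: rep_Cmp[OF f hh] hr rep_Zero[OF o(1,2)])
 qed
 then obtain s where s: "s \<in> Homs C c b" "Cmp C s g = h" using coker[OF hh] by blast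
 have id: "AddA C (Cmp C f r) (Cmp C s g) = Ide C b" unfolding s(2)
 proof (rule hom_eqI[OF Add_hom[OF fr hh] Ide_hom[OF o(2)]])
  fix j
  have "rh f j * rh r j + (1\<^sub>m (d b j) - rh f j * rh r j) = 1\<^sub>m (d b j)"
   using rep_carrier[OF f, of j] rep_carrier[OF r(1), of j] by (intro eq_matI) auto
  then show "rh (AddA C (Cmp C f r) h) j = rh (Ide C b) j" by (simp add: rep_Add[OF fr hh] hr rep_Cmp[OF r(1) f] rep_Ide[OF o(2)])
 qed
 \<comment> \<open>\<open>g s g = g (1 - f r) = g\<close>, and factorizations through a cokernel are
   unique.\<close>
 have gs: "Cmp C g s = Ide C c"
 proof -
  have "Cmp C (Cmp C g s) g = Cmp C g h" using Cmp_assoc[OF g s(1) g] s(2) by simp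
  also have "\<dots> = g"
  proof (rule hom_eqI[OF Cmp_hom[OF hh g] g])
   fix j
   have gf0: "rh g j * rh f j = 0\<^sub>m (d c j) (d a j)" using z rep_Cmp[OF f g, of j] rep_Zero[OF o(1,3), of j] by simp
   have "rh g j * (rh f j * rh r j) = rh g j * rh f j * rh r j"
    using assoc_mult_mat[OF rep_carrier[OF g] rep_carrier[OF f] rep_carrier[OF r(1)]] by simp
   also have "\<dots> = 0\<^sub>m (d c j) (d b j)" unfolding gf0 using rep_carrier[OF r(1), of j] by (simp add: left_mult_zero_mat)
   finally show "rh (Cmp C g h) j = rh g j" using rep_carrier[OF f, of j] rep_carrier[OF r(1), of j] rep_carrier[OF g, of j]
    by (auto simp: rep_Cmp[OF hh g] hr mult_minus_distrib_mat[of _ "d c j" "d b j" _ "d b j"])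
  qed
  finally have "Cmp C (Cmp C g s) g = g" .
  moreover have "Cmp C (Ide C c) g = g" by (rule Cmp_Ide_left[OF g])
  moreover have "Cmp C g f = ZeroA C a c" by (rule z)
  ultimately show ?thesis using coker[OF g z] Cmp_hom[OF s(1) g] Ide_hom[OF o(3)] by blast
 qed
 show ?thesis using f g r(1) s(1) rf gs z id by (fold a_b_c_def) (auto simp: split_seq_def)
qed

text \<open>In block form, \<open>F\<close> and \<open>R\<close> are inclusion and projection for
  the first \<open>d a j\<close> coordinates, \<open>S\<close> and \<open>G\<close> for the last
  \<open>d c j\<close>.\<close>

lemma ex_split_seq:
 assumes o: "a \<in> Obj C" "b \<in> Obj C" "c \<in> Obj C" and db: "\<And>j. d b j = d a j + d c j"
 shows "\<exists>f g r s. split_seq C a b c f g r s"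
proof -
 define F where "F = (\<lambda>j. mat (d b j) (d a j) (\<lambda>(p, q). if p = q then 1 else 0 :: 'k))"
 define R where "R = (\<lambda>j. mat (d a j) (d b j) (\<lambda>(p, q). if p = q then 1 else 0 :: 'k))"
 define G where "G = (\<lambda>j. mat (d c j) (d b j) (\<lambda>(p, q). if q = p + d a j then 1 else 0 :: 'k))"
 define S where "S = (\<lambda>j. mat (d b j) (d c j) (\<lambda>(p, q). if p = q + d a j then 1 else 0 :: 'k))"
 have car: "F j \<in> carrier_mat (d b j) (d a j)" "R j \<in> carrier_mat (d a j) (d b j)"
  "G j \<in> carrier_mat (d c j) (d b j)" "S j \<in> carrier_mat (d b j) (d c j)" for j by (auto simp: F_def R_def G_def S_def)
 have sum1: "(\<Sum>k<n. (if P k then 1 else 0) * (if k = q then 1 else 0 :: 'k)) = (if P q then 1 else 0)"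
  if "q < n" for P and n q :: nat
 proof -
  have "(\<Sum>k<n. (if P k then 1 else 0) * (if k = q then 1 else 0 :: 'k)) = (\<Sum>k<n. if k = q then (if P q then 1 else 0) else 0)"
   by (intro sum.cong) auto
  also have "\<dots> = (if P q then 1 else 0)" using that by (simp only: sum.delta finite_lessThan) simp
  finally show ?thesis .
 qed
 have RF: "R j * F j = 1\<^sub>m (d a j)" for j by (rule eq_matI) (auto simp: R_def F_def scalar_prod_def atLeast0LessThan db sum1)
 have GS: "G j * S j = 1\<^sub>m (d c j)" for j by (rule eq_matI) (auto simp: G_def S_def scalar_prod_def atLeast0LessThan db sum1)
 have GF: "G j * F j = 0\<^sub>m (d c j) (d a j)" for j by (rule eq_matI) (auto simp: G_def F_def scalar_prod_def atLeast0LessThan db sum1)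
 have FR: "F j * R j + S j * G j = 1\<^sub>m (d b j)" for j
 proof (rule eq_matI)
  fix p q assume "p < dim_row (1\<^sub>m (d b j) :: 'k mat)" "q < dim_col (1\<^sub>m (d b j) :: 'k mat)"
  then have pq: "p < d b j" "q < d b j" by auto
  have "(F j * R j) $$ (p, q) = (\<Sum>k<d a j. (if p = k then 1 else 0) * (if k = q then 1 else 0))"
   using pq by (auto simp: F_def R_def scalar_prod_def atLeast0LessThan)
  also have "\<dots> = (if p = q \<and> p < d a j then 1 else 0)" by (cases "q < d a j") (auto simp: sum1 intro!: sum.neutral)
  finally have 1: "(F j * R j) $$ (p, q) = (if p = q \<and> p < d a j then 1 else 0)" .
  have "(S j * G j) $$ (p, q) = (\<Sum>k<d c j. (if p = k + d a j then 1 else 0) * (if q = k + d a j then 1 else 0))"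
   using pq by (auto simp: S_def G_def scalar_prod_def atLeast0LessThan)
  also have "\<dots> = (\<Sum>k<d c j. if d a j \<le> q then (if p = k + d a j then 1 else 0) * (if k = q - d a j then 1 else 0) else 0)"
   by (intro sum.cong) auto
  also have "\<dots> = (if p = q \<and> d a j \<le> p then 1 else 0)" using pq by (cases "d a j \<le> q") (auto simp: sum1 db)
  finally have 2: "(S j * G j) $$ (p, q) = (if p = q \<and> d a j \<le> p then 1 else 0)" .
  show "(F j * R j + S j * G j) $$ (p, q) = 1\<^sub>m (d b j) $$ (p, q)" using pq car[of j] by (subst index_add_mat) (auto simp: 1 2)
 qed (auto simp: F_def R_def G_def S_def)
 note f = mk_hom[OF o(1,2) car(1)] and g = mk_hom[OF o(2,3) car(3)]
  and r = mk_hom[OF o(2,1) car(2)] and s = mk_hom[OF o(3,2) car(4)]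
 note rep' = rep_mk[OF o(1,2) car(1)] rep_mk[OF o(2,3) car(3)] rep_mk[OF o(2,1) car(2)] rep_mk[OF o(3,2) car(4)]
 have "split_seq C a b c (mk a b F) (mk b c G) (mk b a R) (mk c b S)" unfolding split_seq_def
 proof (intro conjI f g r s)
  show "Cmp C (mk b a R) (mk a b F) = Ide C a"
   by (intro hom_eqI[OF Cmp_hom[OF f r] Ide_hom[OF o(1)]]) (simp add: rep_Cmp[OF f r] rep' rep_Ide[OF o(1)] RF)
  show "Cmp C (mk b c G) (mk c b S) = Ide C c"
   by (intro hom_eqI[OF Cmp_hom[OF s g] Ide_hom[OF o(3)]]) (simp add: rep_Cmp[OF s g] rep' rep_Ide[OF o(3)] GS)
  show "Cmp C (mk b c G) (mk a b F) = ZeroA C a c"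
   by (intro hom_eqI[OF Cmp_hom[OF f g] Zero_hom[OF o(1,3)]]) (simp add: rep_Cmp[OF f g] rep' rep_Zero[OF o(1,3)] GF)
  show "AddA C (Cmp C (mk a b F) (mk b a R)) (Cmp C (mk c b S) (mk b c G)) = Ide C b"
   by (intro hom_eqI[OF Add_hom[OF Cmp_hom[OF r f] Cmp_hom[OF g s]] Ide_hom[OF o(2)]])
    (simp add: rep_Add[OF Cmp_hom[OF r f] Cmp_hom[OF g s]] rep_Cmp[OF r f] rep_Cmp[OF g s] rep' rep_Ide[OF o(2)] FR)
 qed
 then show ?thesis by blast
qed

section \<open>Objects with a given dimension vector, and simple objects\<close>

definition ob :: "('j => nat) => 'o" where
 "ob n = (SOME a. a \<in> Obj C \<and> d a = n)"

lemma
 assumes "finite {j. n j \<noteq> 0}" "{j. n j \<noteq> 0} \<subseteq> J"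
 shows ob_Obj: "ob n \<in> Obj C" and dim_ob: "d (ob n) = n"
 using someI_ex[of "\<lambda>a. a \<in> Obj C \<and> d a = n"] ex_dim[OF assms] unfolding ob_def by auto

definition simp_obj :: "'j => 'o" where
 "simp_obj j = ob (kdelta j)"

lemma
 assumes "j \<in> J"
 shows simp_Obj: "simp_obj j \<in> Obj C" and dim_simp: "d (simp_obj j) = kdelta j"
 using assms ob_Obj[of "kdelta j"] dim_ob[of "kdelta j"] unfolding simp_obj_def by (auto simp: kdelta_def)

lemma ex_zero_obj: "\<exists>a\<in>Obj C. \<forall>j. d a j = 0"
proof -
 obtain a where "a \<in> Obj C" "d a = (\<lambda>_. 0)" using ex_dim[of "\<lambda>_. 0"] by auto
 then show ?thesis by (intro bexI[of _ a]) simp_all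
qed

text \<open>If \<open>d a j\<close> is non-zero, the \<open>j\<close>-th simple object splits off
  \<open>a\<close>, and simplicity of \<open>a\<close> makes the inclusion invertible. Conversely, a
  mono \<open>f\<close> from \<open>b\<close> to an object with dimension vector
  \<open>kdelta j\<close> has a left inverse \<open>x\<close>. Then \<open>f x\<close> is an
  idempotent of size 1 at \<open>j\<close>, so its entry is 0 or 1; in the first case
  \<open>b\<close> is zero, in the second \<open>f\<close> is invertible.\<close>

lemma is_simple_iff: "is_simple C a \<longleftrightarrow> a \<in> Obj C \<and> (\<exists>j\<in>J. d a = kdelta j)"
proof
 assume s: "is_simple C a"
 then have a: "a \<in> Obj C" "\<not> is_zero_obj C a" by (auto simp: is_simple_def)
 then obtain j where j: "d a j \<noteq> 0" by (auto simp: zero_obj_iff)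
 then have jJ: "j \<in> J" using dim_support a by blast
 have fin: "finite {i. d a i - kdelta j i \<noteq> 0}" "{i. d a i - kdelta j i \<noteq> 0} \<subseteq> J"
  using dim_finite[OF a(1)] dim_support[OF a(1)] by (auto elim!: rev_finite_subset)
 note c = ob_Obj[OF fin] dim_ob[OF fin]
 have "d a i = d (simp_obj j) i + d (ob (\<lambda>i. d a i - kdelta j i)) i" for i unfolding c dim_simp[OF jJ] using j by (auto simp: kdelta_def)
 from ex_split_seq[OF simp_Obj[OF jJ] a(1) c(1) this]
 obtain f g r t where sp: "split_seq C (simp_obj j) a (ob (\<lambda>i. d a i - kdelta j i)) f g r t" by blast
 then have f: "f \<in> Homs C (simp_obj j) a" and r: "r \<in> Homs C a (simp_obj j)" and rf: "Cmp C r f = Ide C (simp_obj j)"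
  by (auto simp: split_seq_def)
 have "is_mono C f" unfolding is_mono_def
 proof (intro conjI allI ballI impI)
  fix x u v assume uv: "u \<in> Homs C x (Src C f)" "v \<in> Homs C x (Src C f)" "Cmp C f u = Cmp C f v"
  have sf: "Src C f = simp_obj j" using f by (simp add: Homs_def)
  have cancel: "Cmp C r (Cmp C f w) = w" if "w \<in> Homs C x (Src C f)" for w
   using Cmp_assoc[OF that[unfolded sf] f r] rf Cmp_Ide_left[OF that[unfolded sf]] by simp
  show "u = v" using cancel[OF uv(1), unfolded uv(3)] cancel[OF uv(2)] by (rule trans[OF sym])
 qed (use f in "auto simp: Homs_def")
 then have "is_zero_obj C (simp_obj j) \<or> is_iso C f" using s f by (auto simp: is_simple_def)
 moreover have "\<not> is_zero_obj C (simp_obj j)" using jJ by (auto simp: zero_obj_iff dim_simp kdelta_def intro!: exI[of _ j])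
 ultimately have "d (simp_obj j) = d a" using is_iso_dims[OF _ f] by blast
 then show "a \<in> Obj C \<and> (\<exists>j\<in>J. d a = kdelta j)" using a jJ dim_simp[OF jJ] by (intro conjI bexI[of _ j]) simp_all
next
 assume "a \<in> Obj C \<and> (\<exists>j\<in>J. d a = kdelta j)"
 then obtain j where a: "a \<in> Obj C" and j: "j \<in> J" and da: "d a = kdelta j" by blast
 have "is_zero_obj C b \<or> is_iso C f" if f: "f \<in> Homs C b a" and mono: "is_mono C f" for b f
 proof -
  obtain x where x: "x \<in> Homs C a b" "Cmp C (Cmp C f x) f = f" using ex_inner_inverse_arr[OF f] by blast
  have b: "b \<in> Obj C" using hom_ends[OF f] by simp
  have xf: "Cmp C x f = Ide C b"
  proof -
   have "Cmp C f (Cmp C x f) = Cmp C f (Ide C b)" using Cmp_assoc[OF f x(1) f] x(2) Cmp_Ide_right[OF f] by simp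
   moreover have "Src C f = b" using f by (simp add: Homs_def)
   ultimately show ?thesis using mono Cmp_hom[OF f x(1)] Ide_hom[OF b] unfolding is_mono_def by blast
  qed
  have XF: "rh x i * rh f i = 1\<^sub>m (d b i)" for i using xf rep_Cmp[OF f x(1), of i] rep_Ide[OF b] by simp
  have tr: "of_nat (d b i) = mat_trace (rh f i * rh x i)" for i
   using mat_trace_mult_comm[OF rep_carrier[OF f, of i] rep_carrier[OF x(1), of i]] XF[of i] by (simp add: mat_trace_one)
  have db0: "d b i = 0" if "i \<noteq> j" for i
  proof -
   have "(of_nat (d b i) :: 'k) = 0" unfolding tr using that rep_carrier[OF f, of i] da by (simp add: mat_trace_def kdelta_def)
   then show ?thesis by simp
  qed
  define e where "e = (rh f j * rh x j) $$ (0, 0)"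
  have c11: "rh f j * rh x j \<in> carrier_mat 1 1" using rep_carrier[OF f, of j] rep_carrier[OF x(1), of j] da by (auto simp: kdelta_def)
  have dbj: "of_nat (d b j) = e" unfolding tr using carrier_matD(1)[OF rep_carrier[OF f, of j]] da by (simp add: mat_trace_def e_def kdelta_def)
  have "rh f j * rh x j * (rh f j * rh x j) = rh f j * (rh x j * rh f j * rh x j)"
   unfolding assoc_mult_mat[OF rep_carrier[OF f] rep_carrier[OF x(1)] mult_carrier_mat[OF rep_carrier[OF f] rep_carrier[OF x(1)]]]
    assoc_mult_mat[OF rep_carrier[OF x(1)] rep_carrier[OF f] rep_carrier[OF x(1)]] ..
  also have "\<dots> = rh f j * rh x j" unfolding XF left_mult_one_mat[OF rep_carrier[OF x(1)]] ..
  finally have idem: "rh f j * rh x j * (rh f j * rh x j) = rh f j * rh x j" .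
  have sq: "(M * M) $$ (0, 0) = M $$ (0, 0) * M $$ (0, 0)" if "M \<in> carrier_mat 1 1" for M :: "'k mat" using that by (auto simp: scalar_prod_def)
  have "e * e = e" using sq[OF c11] unfolding idem e_def by (rule sym)
  then have "e = 0 \<or> e = 1" by simp
  then show ?thesis
  proof
   assume "e = 0"
   then have "d b i = 0" for i using db0[of i] dbj by (cases "i = j") auto
   then show ?thesis using b by (simp add: zero_obj_iff)
  next
   assume e1: "e = 1"
   have "Cmp C f x = Ide C a"
   proof (rule hom_eqI[OF Cmp_hom[OF x(1) f] Ide_hom[OF a]])
    fix i
    show "rh (Cmp C f x) i = rh (Ide C a) i"
    proof (cases "i = j")
     case True
     have "rh f j * rh x j = 1\<^sub>m 1" using c11 e1 by (intro eq_matI) (auto simp: e_def)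
     then show ?thesis using True by (simp add: rep_Cmp[OF x(1) f] rep_Ide[OF a] da kdelta_def)
    next
     case False
     then show ?thesis using rep_carrier[OF Cmp_hom[OF x(1) f], of i] rep_carrier[OF Ide_hom[OF a], of i]
      by (intro eq_matI) (auto simp: da kdelta_def)
    qed
   qed
   then show ?thesis using is_isoI[OF f x(1) xf] by blast
  qed
 qed
 moreover have "\<not> is_zero_obj C a" by (auto simp: zero_obj_iff da kdelta_def intro!: exI[of _ j])
 ultimately show "is_simple C a" using a by (auto simp: is_simple_def)
qed

end

context matcat
begin

subsection \<open>Dimensions of hom-spaces\<close>

lemma vectorspace_hom_space:
 assumes a: "a \<in> Obj C" and b: "b \<in> Obj C"
 shows "vectorspace (class_ring :: 'k ring) (hom_space C a b)"
proof -
 have eq: "f = g" if "f \<in> Homs C a b" "g \<in> Homs C a b"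
  "\<And>j x y. x < d b j ==> y < d a j ==> rh f j $$ (x, y) = rh g j $$ (x, y)" for f g
 proof (rule hom_eqI[OF that(1,2)])
  fix j show "rh f j = rh g j" using that(3)[of _ j] rep_carrier[OF that(1), of j] rep_carrier[OF that(2), of j] by (intro eq_matI) auto
 qed
 have add: "rh (AddA C f g) j $$ (x, y) = rh f j $$ (x, y) + rh g j $$ (x, y)"
  if "f \<in> Homs C a b" "g \<in> Homs C a b" "x < d b j" "y < d a j" for f g j x y
  using that rep_carrier[OF that(1), of j] rep_carrier[OF that(2), of j] by (simp add: rep_Add)
 have scale: "rh (ScaleA C r f) j $$ (x, y) = r * rh f j $$ (x, y)"
  if "f \<in> Homs C a b" "x < d b j" "y < d a j" for f r j x y using that rep_carrier[OF that(1), of j] by (simp add: rep_Scale)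
 have zero: "rh (ZeroA C a b) j $$ (x, y) = 0" if "x < d b j" "y < d a j" for j x y using that a b by (simp add: rep_Zero)
 have "module (class_ring :: 'k ring) (hom_space C a b)"
 proof (rule module_criteria)
  show "cring (class_ring :: 'k ring)" using class_field[where ?'a = 'k] by (simp add: field_def domain_def)
  show "\<forall>v\<in>carrier (hom_space C a b). \<exists>w\<in>carrier (hom_space C a b).
    v \<oplus>\<^bsub>hom_space C a b\<^esub> w = \<zero>\<^bsub>hom_space C a b\<^esub>"
  proof
   fix v assume "v \<in> carrier (hom_space C a b)"
   then have v: "v \<in> Homs C a b" by (simp add: hom_space_def)
   then have "AddA C v (ScaleA C (-1) v) = ZeroA C a b"
    using a b by (intro eq) (auto simp: add[OF _ Scale_hom] scale zero intro: Add_hom Scale_hom Zero_hom)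
   then show "\<exists>w\<in>carrier (hom_space C a b). v \<oplus>\<^bsub>hom_space C a b\<^esub> w = \<zero>\<^bsub>hom_space C a b\<^esub>"
    using v by (auto simp: hom_space_def intro!: bexI[of _ "ScaleA C (-1) v"] Scale_hom)
  qed
 qed (use a b in "auto simp: hom_space_def add scale zero Add_hom Scale_hom Zero_hom algebra_simps intro!: eq")
 then show ?thesis using class_field by (simp add: vectorspace_def)
qed

text \<open>The arrows whose matrices have a single entry, equal to 1, form a basis. It is finite
  because \<open>d a\<close> has finite support, and for the same reason the sum extends over this
  support.\<close>

lemma
 assumes a: "a \<in> Obj C" and b: "b \<in> Obj C"
 shows hom_dim_eq: "hom_dim C a b = (\<Sum>j | d a j \<noteq> 0. d a j * d b j)"
  and hom_fin_dim: "vectorspace.fin_dim (class_ring :: 'k ring) (hom_space C a b)"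
proof -
 let ?V = "hom_space C a b"
 interpret V: vectorspace "class_ring :: 'k ring" ?V by (rule vectorspace_hom_space[OF a b])
 have carr: "carrier ?V = Homs C a b" by (simp add: hom_space_def)
 \<comment> \<open>The positions of matrix entries: component, row, column.\<close>
 define T where "T = (SIGMA j:{j. d a j \<noteq> 0}. {..<d b j} \<times> {..<d a j})"
 define u :: "_ => 'j => 'k mat" where
  "u = (\<lambda>(j, p, q) i. mat (d b i) (d a i) (\<lambda>(x, y). if i = j \<and> x = p \<and> y = q then 1 else 0))"
 define e where "e = (\<lambda>t. mk a b (u t))"
 have finT: "finite T" using dim_finite[OF a] by (auto simp: T_def)
 have ucar: "u t i \<in> carrier_mat (d b i) (d a i)" for t i by (auto simp: u_def split: prod.split)
 have eh: "e t \<in> Homs C a b" and er: "rh (e t) = u t" for t unfolding e_def by (rule mk_hom[OF a b ucar], rule rep_mk[OF a b ucar])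
 have uent: "u t i $$ (x, y) = (if t = (i, x, y) then 1 else 0)" if "x < d b i" "y < d a i" for t i x y using that by (cases t) (auto simp: u_def)
 have inj: "inj_on e T"
 proof (rule inj_onI)
  fix s t assume st: "s \<in> T" "t \<in> T" "e s = e t"
  obtain i x y where s: "s = (i, x, y)" by (cases s)
  have xy: "x < d b i" "y < d a i" using st s by (auto simp: T_def)
  have "u s i $$ (x, y) = u t i $$ (x, y)" using st(3) er by metis
  then show "s = t" using uent[OF xy, of s] uent[OF xy, of t] s by (auto split: if_splits)
 qed
 have comb: "V.lincomb c B \<in> Homs C a b \<and>
   (\<forall>j x y. x < d b j \<longrightarrow> y < d a j \<longrightarrow> rh (V.lincomb c B) j $$ (x, y) = (\<Sum>v\<in>B. c v * rh v j $$ (x, y)))"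
  if "finite B" "B \<subseteq> Homs C a b" for c B using that
 proof (induction B)
  case empty
  have "V.lincomb c {} = ZeroA C a b" unfolding V.lincomb_def V.finsum_empty by (simp add: hom_space_def)
  then show ?case using Zero_hom[OF a b] rep_Zero[OF a b] by simp
 next
  case (insert v B)
  have v: "v \<in> Homs C a b" using insert.prems by simp
  have "V.lincomb c (B \<union> {v}) = (c v \<odot>\<^bsub>?V\<^esub> v) \<oplus>\<^bsub>?V\<^esub> V.lincomb c B"
   using insert by (intro V.lincomb_insert) (auto simp: carr)
  then have l: "V.lincomb c (insert v B) = AddA C (ScaleA C (c v) v) (V.lincomb c B)" by (simp add: hom_space_def)
  have h: "V.lincomb c B \<in> Homs C a b" "ScaleA C (c v) v \<in> Homs C a b" using insert v Scale_hom by auto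
  show ?case unfolding l using insert h(1) h(2) v
    rep_carrier[OF h(1)] rep_carrier[OF v] carrier_matD[OF rep_carrier[OF h(1)]] carrier_matD[OF rep_carrier[OF v]]
   by (auto intro!: Add_hom simp: rep_Add[OF h(2,1)] rep_Scale[OF v])
 qed
 have eT: "e ` T \<subseteq> Homs C a b" using eh by blast
 have combT: "rh (V.lincomb c (e ` T)) j $$ (x, y) = c (e (j, x, y))"
  if "x < d b j" "y < d a j" for c j x y
 proof -
  have "rh (V.lincomb c (e ` T)) j $$ (x, y) = (\<Sum>v\<in>e ` T. c v * rh v j $$ (x, y))" using comb[OF _ eT, of c] finT that by auto
  also have "\<dots> = (\<Sum>t\<in>T. c (e t) * u t j $$ (x, y))" using inj by (simp add: sum.reindex er)
  also have "\<dots> = (\<Sum>t\<in>T. if t = (j, x, y) then c (e (j, x, y)) else 0)" using that by (intro sum.cong) (auto simp: uent)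
  also have "\<dots> = c (e (j, x, y))" using that finT by (auto simp: T_def)
  finally show ?thesis .
 qed
 have "V.lin_indpt (e ` T)"
 proof (rule V.finite_lin_indpt2)
  show "finite (e ` T)" using finT by simp
  show "e ` T \<subseteq> carrier ?V" using eh by (auto simp: carr)
  fix c assume "V.lincomb c (e ` T) = \<zero>\<^bsub>?V\<^esub>"
  then have z: "V.lincomb c (e ` T) = ZeroA C a b" by (simp add: hom_space_def)
  show "\<forall>v\<in>e ` T. c v = \<zero>\<^bsub>class_ring\<^esub>"
  proof
   fix v assume "v \<in> e ` T"
   then obtain j x y where v: "v = e (j, x, y)" and xy: "x < d b j" "y < d a j" by (auto simp: T_def)
   show "c v = \<zero>\<^bsub>class_ring\<^esub>" using combT[OF xy, of c] z rep_Zero[OF a b, of j] xy v by simp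
  qed
 qed
 moreover have "V.span (e ` T) = carrier ?V"
 proof
  show "V.span (e ` T) \<subseteq> carrier ?V" by (rule V.span_is_subset2) (auto simp: carr eh)
  show "carrier ?V \<subseteq> V.span (e ` T)"
  proof
   fix f assume "f \<in> carrier ?V"
   then have f: "f \<in> Homs C a b" by (simp add: carr)
   define c where "c = (\<lambda>v. case inv_into T e v of (j, x, y) => rh f j $$ (x, y))"
   have ce: "c (e (j, x, y)) = rh f j $$ (x, y)" if "x < d b j" "y < d a j" for j x y
   proof -
    have "(j, x, y) \<in> T" using that by (auto simp: T_def)
    then show ?thesis using inj by (simp add: c_def)
   qed
   have h: "V.lincomb c (e ` T) \<in> Homs C a b" using comb[OF _ eT, of c] finT by auto
   have "f = V.lincomb c (e ` T)"
   proof (rule hom_eqI[OF f h])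
    fix j show "rh f j = rh (V.lincomb c (e ` T)) j" using rep_carrier[OF f, of j] rep_carrier[OF h, of j] by (intro eq_matI) (auto simp: combT ce)
   qed
   then show "f \<in> V.span (e ` T)" using finT unfolding V.span_def by fastforce
  qed
 qed
 ultimately have "V.basis (e ` T)" using eh by (auto simp: V.basis_def carr)
 then have "V.dim = card (e ` T)" using finT by (intro V.dim_basis) auto
 also have "\<dots> = card T" using inj by (rule card_image)
 also have "\<dots> = (\<Sum>j | d a j \<noteq> 0. d a j * d b j)" using dim_finite[OF a] by (simp add: T_def card_SigmaI mult.commute)
 finally show "hom_dim C a b = (\<Sum>j | d a j \<noteq> 0. d a j * d b j)" by (simp add: hom_dim_def)
 show "V.fin_dim" using \<open>V.basis (e ` T)\<close> finT by (auto simp: V.basis_def V.fin_dim_def)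
qed

text \<open>Writes the zero arrow as a multiple, so that linear functors, which are required to
  respect sums and multiples, preserve it.\<close>

lemma Scale_0:
 assumes "f \<in> Homs C a b" shows "ScaleA C 0 f = ZeroA C a b"
proof (rule hom_eqI[OF Scale_hom[OF assms]])
 have o: "a \<in> Obj C" "b \<in> Obj C" using hom_ends[OF assms] by auto
 then show "ZeroA C a b \<in> Homs C a b" by (rule Zero_hom)
 fix j show "rh (ScaleA C 0 f) j = rh (ZeroA C a b) j"
  using rep_carrier[OF assms, of j] by (intro eq_matI) (auto simp: rep_Scale[OF assms] rep_Zero[OF o])
qed

end

subsection \<open>Functors between categories presented by matrices\<close>

text \<open>All conditions are equations between composites, sums and identities; the zero arrow is
  handled by \<open>Scale_0\<close>.\<close>

lemma linear_functor_split_seq: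
 assumes "matcat C J d rh" "linear_functor C D F" "matcat D J' d' rh'" "split_seq C a b c f g r s"
 shows "split_seq D (fob F a) (fob F b) (fob F c) (far F f) (far F g) (far F r) (far F s)"
proof -
 interpret C: matcat C J d rh by fact
 interpret D: matcat D J' d' rh' by fact
 have ide: "\<And>a. a \<in> Obj C ==> far F (Ide C a) = Ide D (fob F a)"
  and hom: "\<And>a b f. f \<in> Homs C a b ==> far F f \<in> Homs D (fob F a) (fob F b)"
  and cmp: "\<And>a b c f g. f \<in> Homs C a b ==> g \<in> Homs C b c ==> far F (Cmp C g f) = Cmp D (far F g) (far F f)"
  and add: "\<And>a b f g. f \<in> Homs C a b ==> g \<in> Homs C a b ==> far F (AddA C f g) = AddA D (far F f) (far F g)"
  and scale: "\<And>a b r f. f \<in> Homs C a b ==> far F (ScaleA C r f) = ScaleA D r (far F f)"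
  using assms(2) unfolding linear_functor_def is_functor_def by blast+
 have h: "f \<in> Homs C a b" "g \<in> Homs C b c" "r \<in> Homs C b a" "s \<in> Homs C c b"
  and e: "Cmp C r f = Ide C a" "Cmp C g s = Ide C c" "Cmp C g f = ZeroA C a c"
   "AddA C (Cmp C f r) (Cmp C s g) = Ide C b" using assms(4) by (auto simp: split_seq_def)
 have o: "a \<in> Obj C" "b \<in> Obj C" "c \<in> Obj C" using C.hom_ends h by blast+
 have zero: "far F (ZeroA C a c) = ZeroA D (fob F a) (fob F c)" using scale[OF C.Zero_hom[OF o(1,3)], of 0] C.Scale_0[OF C.Zero_hom[OF o(1,3)]]
   D.Scale_0[OF hom[OF C.Zero_hom[OF o(1,3)]]] by simp
 show ?thesis unfolding split_seq_def using hom[OF h(1)] hom[OF h(2)] hom[OF h(3)] hom[OF h(4)]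
   cmp[OF h(1,3)] cmp[OF h(4,2)] cmp[OF h(1,2)] cmp[OF h(3,1)] cmp[OF h(2,4)] e ide o zero
   add[OF C.Cmp_hom[OF h(3,1)] C.Cmp_hom[OF h(2,4)]] by simp
qed

text \<open>Short exact sequences split, linear functors preserve splittings, and split sequences
  are exact.\<close>

lemma linear_functor_exact:
 assumes "matcat C J d rh" "matcat D J' d' rh'" "linear_functor C D F"
 shows "exact_functor C D F" unfolding exact_functor_def using assms matcat.short_exact_split[OF assms(1)] matcat.split_seq_short_exact[OF assms(2)]
  linear_functor_split_seq[OF assms(1,3,2)] by blast

lemma exact_functor_dims_add:
 assumes "matcat C J d rh" "matcat D J' d' rh'" "exact_functor C D F"
  and "a \<in> Obj C" "b \<in> Obj C" "c \<in> Obj C" "\<And>j. d b j = d a j + d c j"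
 shows "d' (fob F b) j = d' (fob F a) j + d' (fob F c) j"
proof -
 obtain f g r s where s: "split_seq C a b c f g r s" using matcat.ex_split_seq[OF assms(1,4-7)] by blast
 have "linear_functor C D F" using assms(3) by (simp add: exact_functor_def)
 from matcat.split_seq_dims[OF assms(2) linear_functor_split_seq[OF assms(1) this assms(2) s]]
 show ?thesis .
qed

text \<open>Induction on the total dimension: additivity on short exact sequences lets one simple
  summand be removed at a time. The set \<open>P\<close> may exceed the support, so that ranges of
  summation can be chosen independently of the object.\<close>

lemma exact_functor_dims:
 assumes "matcat C J d rh" "matcat D J' d' rh'" "exact_functor C D F"
  and "a \<in> Obj C" "finite P" "{j. d a j \<noteq> 0} \<subseteq> P" "P \<subseteq> J"
 shows "d' (fob F a) s = (\<Sum>t\<in>P. d a t * d' (fob F (matcat.simp_obj C d t)) s)" using assms(4,6)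
proof (induction "\<Sum>t\<in>P. d a t" arbitrary: a)
 interpret C: matcat C J d rh by fact
 interpret D: matcat D J' d' rh' by fact
 have fc: "is_functor C D F" using assms(3) by (simp add: exact_functor_def linear_functor_def)
 case 0
 then have z: "d a j = 0" for j using assms(5) by (cases "j \<in> P") auto
 \<comment> \<open>A zero object satisfies \<open>d a = d a + d a\<close>, so additivity says that
   the dimension of its image is its own double.\<close>
 have "d' (fob F a) s = d' (fob F a) s + d' (fob F a) s" by (rule exact_functor_dims_add[OF assms(1-3)]) (use 0 z in auto)
 then show ?case using z by simp
next
 interpret C: matcat C J d rh by fact
 interpret D: matcat D J' d' rh' by fact
 case (Suc n)
 have fc: "is_functor C D F" using assms(3) by (simp add: exact_functor_def linear_functor_def)
 obtain t where t: "t \<in> P" "d a t \<noteq> 0" using Suc(2) by (metis Suc_neq_Zero sum.neutral)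
 then have tJ: "t \<in> J" using assms(7) by auto
 define n' where "n' = (\<lambda>j. d a j - kdelta t j)"
 have fin: "finite {j. n' j \<noteq> 0}" "{j. n' j \<noteq> 0} \<subseteq> J"
  using C.dim_finite[OF Suc.prems(1)] C.dim_support[OF Suc.prems(1)] by (auto simp: n'_def elim!: rev_finite_subset)
 note b = C.ob_Obj[OF fin] C.dim_ob[OF fin]
 have split: "d a j = d (C.simp_obj t) j + d (C.ob n') j" for j unfolding b(2) C.dim_simp[OF tJ] using t by (auto simp: n'_def kdelta_def)
 have kd: "(\<Sum>j\<in>P. kdelta t j * f j) = f t" for f :: "_ => nat"
  using t assms(5) by (simp add: kdelta_def if_distrib[of "\<lambda>x. x * _"] cong: if_cong)
 have "(\<Sum>j\<in>P. d a j) = (\<Sum>j\<in>P. kdelta t j * 1) + (\<Sum>j\<in>P. d (C.ob n') j)"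
  unfolding split C.dim_simp[OF tJ] by (simp add: sum.distrib)
 then have "n = (\<Sum>j\<in>P. d (C.ob n') j)" using Suc(2) kd[of "\<lambda>_. 1"] by simp
 moreover have "{j. d (C.ob n') j \<noteq> 0} \<subseteq> P" using Suc.prems(2) split by auto
 ultimately have IH: "d' (fob F (C.ob n')) s = (\<Sum>j\<in>P. d (C.ob n') j * d' (fob F (C.simp_obj j)) s)" using Suc.hyps(1) b(1) by blast
 have "d' (fob F a) s = d' (fob F (C.simp_obj t)) s + d' (fob F (C.ob n')) s"
  by (rule exact_functor_dims_add[OF assms(1-3) C.simp_Obj[OF tJ] Suc.prems(1) b(1) split])
 also have "\<dots> = (\<Sum>j\<in>P. kdelta t j * d' (fob F (C.simp_obj j)) s) + (\<Sum>j\<in>P. d (C.ob n') j * d' (fob F (C.simp_obj j)) s)"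
  by (simp add: IH kd)
 also have "\<dots> = (\<Sum>j\<in>P. d a j * d' (fob F (C.simp_obj j)) s)" unfolding split C.dim_simp[OF tJ] by (simp add: sum.distrib algebra_simps)
 finally show ?case .
qed

section \<open>Graded 2-vector spaces\<close>

lemma Homs_prod_cat:
 "f \<in> Homs (prod_cat I C) a b \<longleftrightarrow>
   a \<in> extensional I \<and> b \<in> extensional I \<and> f \<in> extensional I \<and> (\<forall>i\<in>I. f i \<in> Homs (C i) (a i) (b i))"
 by (auto simp: Homs_def prod_cat_def PiE_iff extensional_def fun_eq_iff)

text \<open>Dimensions and matrices are the images under the equivalence. Essential surjectivity
  reaches a dimension vector only up to isomorphism, which suffices because an invertible matrix is
  square.\<close>

lemma linear_equivalent_matcat:
 fixes C :: "('o, 'm, 'k::field_char_0) lcat"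
 assumes lin: "linear_category C" and "linear_equivalent C (prod_cat {..<r} (\<lambda>_. Vect :: (nat, 'k mat, 'k) lcat))"
 shows "\<exists>J d rh. finite (J :: nat set) \<and> matcat C J d rh"
proof -
 obtain F where F: "linear_functor C (prod_cat {..<r} (\<lambda>_. Vect :: (nat, 'k mat, 'k) lcat)) F"
  and bij: "\<And>a b. a \<in> Obj C ==> b \<in> Obj C ==>
   bij_betw (far F) (Homs C a b) (Homs (prod_cat {..<r} (\<lambda>_. Vect :: (nat, 'k mat, 'k) lcat)) (fob F a) (fob F b))"
  and surj: "\<And>n. n \<in> Obj (prod_cat {..<r} (\<lambda>_. Vect :: (nat, 'k mat, 'k) lcat)) ==>
   \<exists>a\<in>Obj C. isomorphic_in (prod_cat {..<r} (\<lambda>_. Vect :: (nat, 'k mat, 'k) lcat)) (fob F a) n"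
  using assms(2) unfolding linear_equivalent_def by blast
 let ?P = "prod_cat {..<r} (\<lambda>_. Vect :: (nat, 'k mat, 'k) lcat)"
 have HV: "f \<in> Homs (Vect :: (nat, 'k mat, 'k) lcat) a b \<longleftrightarrow> f \<in> carrier_mat b a" for f a b
  by (auto simp: Homs_def Vect_def)
 have cat: "category C"
  and vs: "\<And>a b. a \<in> Obj C ==> b \<in> Obj C ==> vectorspace (class_ring :: 'k ring) (hom_space C a b)"
  using lin by (auto simp: linear_category_def)
 have ends: "a \<in> Obj C \<and> b \<in> Obj C" if "f \<in> Homs C a b" for f a b using cat that by (auto simp: category_def Homs_def)
 \<comment> \<open>The factors are numbered below \<open>r\<close>; at every other index the
   dimension is set to 0 and the matrix to the 0 by 0 matrix.\<close>
 define d where "d = (\<lambda>x k. if k < r then fob F x k else 0)"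
 define rh where "rh = (\<lambda>f k. if k < r then far F f k else 0\<^sub>m 0 0)"
 have ob: "fob F a \<in> extensional {..<r}" if "a \<in> Obj C" for a
  using F that by (auto simp: linear_functor_def is_functor_def prod_cat_def PiE_iff)
 have hom: "far F f \<in> Homs ?P (fob F a) (fob F b)" if "f \<in> Homs C a b" for f a b
  using F that unfolding linear_functor_def is_functor_def by blast
 have hom': "far F f k \<in> carrier_mat (fob F b k) (fob F a k)" if "f \<in> Homs C a b" "k < r" for f a b k
  using hom[OF that(1)] that(2) by (auto simp: Homs_prod_cat HV)
 have zeroC: "ZeroA C a b \<in> Homs C a b" and ZZ: "AddA C (ZeroA C a b) (ZeroA C a b) = ZeroA C a b"
  if "a \<in> Obj C" "b \<in> Obj C" for a b
 proof -
  interpret V: vectorspace "class_ring :: 'k ring" "hom_space C a b" by (rule vs[OF that])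
  show "ZeroA C a b \<in> Homs C a b" using V.zero_closed by (simp add: hom_space_def)
  show "AddA C (ZeroA C a b) (ZeroA C a b) = ZeroA C a b" using V.l_zero[OF V.zero_closed] by (simp add: hom_space_def)
 qed
 have addC: "AddA C f g \<in> Homs C a b" and scaleC: "ScaleA C t f \<in> Homs C a b"
  if "f \<in> Homs C a b" "g \<in> Homs C a b" for a b f g t
 proof -
  interpret V: vectorspace "class_ring :: 'k ring" "hom_space C a b" using vs ends[OF that(1)] by blast
  show "AddA C f g \<in> Homs C a b" "ScaleA C t f \<in> Homs C a b"
   using V.a_closed[of f g] V.smult_closed[of t f] that by (simp_all add: hom_space_def)
 qed
 have add: "far F (AddA C f g) = AddA ?P (far F f) (far F g)"
  and scale: "far F (ScaleA C t f) = ScaleA ?P t (far F f)"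
  if "f \<in> Homs C a b" "g \<in> Homs C a b" for a b f g t using F that unfolding linear_functor_def by blast+
 have "matcat C {..<r} d rh"
 proof
  fix f assume "f \<in> Arr C"
  then show "Src C f \<in> Obj C \<and> Tgt C f \<in> Obj C" using cat by (simp add: category_def)
 next
  fix a assume "a \<in> Obj C"
  then show "Ide C a \<in> Homs C a a" using cat by (simp add: category_def)
 next
  fix f g a b c assume "f \<in> Homs C a b" "g \<in> Homs C b c"
  then show "Cmp C g f \<in> Homs C a c" using cat unfolding category_def by blast
 next
  fix a b assume ab: "a \<in> Obj C" "b \<in> Obj C"
  show "bij_betw rh (Homs C a b) (mat_fam (d a) (d b))"
  proof -
   have "bij_betw (\<lambda>f k. if k < r then f k else 0\<^sub>m 0 0) (Homs ?P (fob F a) (fob F b)) (mat_fam (d a) (d b) :: (nat => 'k mat) set)"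
   proof (rule bij_betw_byWitness[where f' = "\<lambda>A. restrict A {..<r}"])
    have z: "M = 0\<^sub>m 0 0" if "M \<in> carrier_mat 0 0" for M :: "'k mat" using that by (intro eq_matI) auto
    show "\<forall>A\<in>mat_fam (d a) (d b) :: (nat => 'k mat) set. (\<lambda>k. if k < r then restrict A {..<r} k else 0\<^sub>m 0 0) = A"
    proof (intro ballI ext)
     fix A :: "nat => 'k mat" and k assume "A \<in> mat_fam (d a) (d b)"
     then have "A k \<in> carrier_mat (d b k) (d a k)" by (simp add: mat_fam_def)
     then show "(if k < r then restrict A {..<r} k else 0\<^sub>m 0 0) = A k" using z[of "A k"] by (auto simp: d_def)
    qed
    show "(\<lambda>A. restrict A {..<r}) ` mat_fam (d a) (d b) \<subseteq> Homs ?P (fob F a) (fob F b)"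
     using ob[OF ab(1)] ob[OF ab(2)] by (auto simp: Homs_prod_cat HV mat_fam_def d_def)
   qed (auto simp: Homs_prod_cat HV mat_fam_def d_def fun_eq_iff extensional_def)
   from bij_betw_trans[OF bij[OF ab] this] show ?thesis by (simp add: rh_def comp_def cong: bij_betw_cong)
  qed
 next
  fix a j assume "a \<in> Obj C"
  then have "far F (Ide C a) = Ide ?P (fob F a)" using F unfolding linear_functor_def is_functor_def by blast
  then show "rh (Ide C a) j = 1\<^sub>m (d a j)" by (auto simp: rh_def d_def prod_cat_def Vect_def)
 next
  fix f g a b c j assume "f \<in> Homs C a b" "g \<in> Homs C b c"
  then have "far F (Cmp C g f) = Cmp ?P (far F g) (far F f)" using F unfolding linear_functor_def is_functor_def by blast
  then show "rh (Cmp C g f) j = rh g j * rh f j" by (auto simp: rh_def prod_cat_def Vect_def)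
 next
  fix a b j assume ab: "a \<in> Obj C" "b \<in> Obj C"
  note z = zeroC[OF ab]
  \<comment> \<open>By \<open>0 + 0 = 0\<close> the image of the zero arrow is its own double, hence
    zero.\<close>
  have "far F (ZeroA C a b) j = 0\<^sub>m (d b j) (d a j)" if "j < r"
  proof -
   have c: "far F (ZeroA C a b) j \<in> carrier_mat (d b j) (d a j)" using hom'[OF z that] that by (simp add: d_def)
   have e: "far F (ZeroA C a b) j = far F (ZeroA C a b) j + far F (ZeroA C a b) j"
    using fun_cong[OF add[OF z z], of j] ZZ[OF ab] that by (simp add: prod_cat_def Vect_def)
   show ?thesis
   proof (rule eq_matI)
    fix x y assume "x < dim_row (0\<^sub>m (d b j) (d a j) :: 'k mat)" "y < dim_col (0\<^sub>m (d b j) (d a j) :: 'k mat)"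
    then have xy: "x < d b j" "y < d a j" by auto
    have "far F (ZeroA C a b) j $$ (x, y) = far F (ZeroA C a b) j $$ (x, y) + far F (ZeroA C a b) j $$ (x, y)"
     using arg_cong[OF e, of "\<lambda>A. A $$ (x, y)"] xy c by simp
    then show "far F (ZeroA C a b) j $$ (x, y) = 0\<^sub>m (d b j) (d a j) $$ (x, y)" using xy by simp
   qed (use c in auto)
  qed
  then show "rh (ZeroA C a b) j = 0\<^sub>m (d b j) (d a j)" by (auto simp: rh_def d_def)
 next
  fix f g a b j assume "f \<in> Homs C a b" "g \<in> Homs C a b"
  from add[OF this] show "rh (AddA C f g) j = rh f j + rh g j" by (auto simp: rh_def prod_cat_def Vect_def)
 next
  fix f a b t j assume "f \<in> Homs C a b"
  from scale[OF this this] show "rh (ScaleA C t f) j = t \<cdot>\<^sub>m rh f j" by (auto simp: rh_def prod_cat_def Vect_def)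
 next
  fix a show "finite {j. d a j \<noteq> 0}" by (rule finite_subset[of _ "{..<r}"]) (auto simp: d_def)
 next
  fix a j assume "d a j \<noteq> 0" then show "j \<in> {..<r}" by (auto simp: d_def split: if_splits)
 next
  fix n :: "nat => nat" assume n: "{j. n j \<noteq> 0} \<subseteq> {..<r}"
  have rn: "restrict n {..<r} \<in> Obj ?P" by (simp add: prod_cat_def Vect_def)
  then obtain a f where a: "a \<in> Obj C" and f: "f \<in> Homs ?P (fob F a) (restrict n {..<r})" "is_iso ?P f"
   using surj[OF rn] unfolding isomorphic_in_def by blast
  then obtain g where g: "g \<in> Homs ?P (restrict n {..<r}) (fob F a)"
   and gf: "Cmp ?P g f = Ide ?P (fob F a)" and fg: "Cmp ?P f g = Ide ?P (restrict n {..<r})" by (auto simp: is_iso_def is_inverse_def Homs_def)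
  have "d a j = n j" for j
  proof (cases "j < r")
   case True
   have "f j \<in> carrier_mat (n j) (fob F a j)" "g j \<in> carrier_mat (fob F a j) (n j)" using f(1) g True by (auto simp: Homs_prod_cat HV)
   moreover have "f j * g j = 1\<^sub>m (n j)" "g j * f j = 1\<^sub>m (fob F a j)"
    using fun_cong[OF fg, of j] fun_cong[OF gf, of j] True by (auto simp: prod_cat_def Vect_def)
   ultimately show ?thesis using inverse_mat_dims True by (auto simp: d_def)
  next
   case False
   then show ?thesis using n by (auto simp: d_def)
  qed
  then show "\<exists>a\<in>Obj C. d a = n" using a by (intro bexI[of _ a] ext) auto
 qed (blast intro: zeroC addC scaleC)+
 then show ?thesis by blast
qed

text \<open>An index \<open>(n, k)\<close> stands for the simple object of degree \<open>n\<close>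
  with number \<open>k\<close>. Supports can thus be read off dimension vectors, and each degree has
  finitely many simple objects.\<close>

definition gmatcat ::
 "('o, 'm, 'k::field_char_0) gcat => (nat \<times> nat) set => ((nat => 'o) => nat \<times> nat => nat)
   => ((nat => 'm) => nat \<times> nat => 'k mat) => bool" where
 "gmatcat C J d rh \<longleftrightarrow> matcat (tot C) J d rh \<and>
   (\<forall>x\<in>Obj (tot C). gsupp C x = fst ` {j. d x j \<noteq> 0}) \<and> (\<forall>n. finite {j\<in>J. fst j = n})"

lemma Obj_tot: "x \<in> Obj (tot C) \<longleftrightarrow> (\<forall>n. x n \<in> Obj (C n)) \<and> finite (gsupp C x)"
 by (auto simp: tot_def full_subcat_def prod_cat_def PiE_iff)

lemma tot_simps:
 "Src (tot C) f = (\<lambda>n. Src (C n) (f n))" "Tgt (tot C) f = (\<lambda>n. Tgt (C n) (f n))"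
 "Ide (tot C) x = (\<lambda>n. Ide (C n) (x n))" "Cmp (tot C) g f = (\<lambda>n. Cmp (C n) (g n) (f n))"
 "ZeroA (tot C) x y = (\<lambda>n. ZeroA (C n) (x n) (y n))" "AddA (tot C) f g = (\<lambda>n. AddA (C n) (f n) (g n))"
 "ScaleA (tot C) r f = (\<lambda>n. ScaleA (C n) r (f n))" by (simp_all add: tot_def full_subcat_def prod_cat_def restrict_def)

lemma Homs_tot:
 assumes "\<And>n. category (C n)"
 shows "f \<in> Homs (tot C) x y \<longleftrightarrow> x \<in> Obj (tot C) \<and> y \<in> Obj (tot C) \<and> (\<forall>n. f n \<in> Homs (C n) (x n) (y n))"
proof
 assume f: "f \<in> Homs (tot C) x y"
 then have xy: "x = (\<lambda>n. Src (C n) (f n))" "y = (\<lambda>n. Tgt (C n) (f n))" and fA: "\<And>n. f n \<in> Arr (C n)"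
  and fin: "finite (gsupp C x)" "finite (gsupp C y)"
  by (auto simp: Homs_def tot_simps) (auto simp: tot_def full_subcat_def prod_cat_def PiE_iff restrict_def)
 show "x \<in> Obj (tot C) \<and> y \<in> Obj (tot C) \<and> (\<forall>n. f n \<in> Homs (C n) (x n) (y n))"
  using fin fA assms unfolding Obj_tot by (auto simp: category_def xy Homs_def)
next
 assume r: "x \<in> Obj (tot C) \<and> y \<in> Obj (tot C) \<and> (\<forall>n. f n \<in> Homs (C n) (x n) (y n))"
 then have "(\<lambda>n. Src (C n) (f n)) = x" "(\<lambda>n. Tgt (C n) (f n)) = y" by (auto simp: Homs_def)
 then show "f \<in> Homs (tot C) x y" using r unfolding Obj_tot by (auto simp: Homs_def tot_def full_subcat_def prod_cat_def PiE_iff restrict_def)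
qed

text \<open>The presentations of the single degrees are put side by side. Objects of
  \<open>tot C\<close> are zero in almost all degrees, which keeps their dimension vectors finitely
  supported.\<close>

lemma graded_2vect_gmatcat:
 fixes C :: "('o, 'm, 'k::field_char_0) gcat"
 assumes "graded_2vect C"
 shows "\<exists>J d rh. gmatcat C J d rh"
proof -
 have "\<forall>n. \<exists>J d rh. finite (J :: nat set) \<and> matcat (C n) J d rh"
 proof
  fix n
  obtain r where "linear_category (C n)"
   "linear_equivalent (C n) (prod_cat {..<r} (\<lambda>_. Vect :: (nat, 'k mat, 'k) lcat))"
   using assms unfolding graded_2vect_def two_vector_space_def by blast
  from linear_equivalent_matcat[OF this]
  show "\<exists>J d rh. finite (J :: nat set) \<and> matcat (C n) J d rh" .
 qed
 then obtain J d rh where fJ: "\<And>n. finite (J n :: nat set)" and mc: "\<And>n. matcat (C n) (J n) (d n) (rh n)" by metis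
 have cat: "category (C n)" for n using assms by (simp add: graded_2vect_def two_vector_space_def linear_category_def)
 note H = Homs_tot[OF cat]
 define d' where "d' = (\<lambda>x (n, k). d n (x n) k)"
 define rh' where "rh' = (\<lambda>f (n, k). rh n (f n) k)"
 have supp: "gsupp C x = fst ` {j. d' x j \<noteq> 0}" if "\<And>n. x n \<in> Obj (C n)" for x
 proof -
  have "gsupp C x = {n. \<exists>k. d n (x n) k \<noteq> 0}" using that by (simp add: gsupp_def matcat.zero_obj_iff[OF mc])
  also have "\<dots> = fst ` {j. d' x j \<noteq> 0}" by (force simp: d'_def image_iff)
  finally show ?thesis .
 qed
 have "matcat (tot C) (SIGMA n:UNIV. J n) d' rh'"
 proof
  fix f assume "f \<in> Arr (tot C)"
  then have "f \<in> Homs (tot C) (Src (tot C) f) (Tgt (tot C) f)" by (rule Homs_Arr)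
  then show "Src (tot C) f \<in> Obj (tot C) \<and> Tgt (tot C) f \<in> Obj (tot C)" unfolding H by simp
 next
  fix a b assume ab: "a \<in> Obj (tot C)" "b \<in> Obj (tot C)"
  then have o: "\<And>n. a n \<in> Obj (C n)" "\<And>n. b n \<in> Obj (C n)" by (auto simp: Obj_tot)
  show "bij_betw rh' (Homs (tot C) a b) (mat_fam (d' a) (d' b))"
  proof (rule bij_betw_byWitness[where f' = "\<lambda>A n. matcat.mk (C n) (rh n) (a n) (b n) (\<lambda>k. A (n, k))"])
   show "\<forall>f\<in>Homs (tot C) a b. (\<lambda>n. matcat.mk (C n) (rh n) (a n) (b n) (\<lambda>k. rh' f (n, k))) = f"
    using matcat.mk_eq[OF mc] by (auto simp: H rh'_def)
   show "\<forall>A\<in>mat_fam (d' a) (d' b). rh' (\<lambda>n. matcat.mk (C n) (rh n) (a n) (b n) (\<lambda>k. A (n, k))) = A"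
    using matcat.rep_mk[OF mc o] by (auto simp: mat_fam_def d'_def rh'_def fun_eq_iff)
   show "rh' ` Homs (tot C) a b \<subseteq> mat_fam (d' a) (d' b)" using matcat.rep_carrier[OF mc] by (auto simp: H mat_fam_def d'_def rh'_def)
   show "(\<lambda>A n. matcat.mk (C n) (rh n) (a n) (b n) (\<lambda>k. A (n, k))) ` mat_fam (d' a) (d' b) \<subseteq> Homs (tot C) a b"
    using matcat.mk_hom[OF mc o] ab by (auto simp: H mat_fam_def d'_def)
  qed
 next
  fix a assume a: "a \<in> Obj (tot C)"
  then have fin: "finite (fst ` {j. d' a j \<noteq> 0})" and o: "\<And>n. a n \<in> Obj (C n)" using supp[of a] by (auto simp: Obj_tot)
  have "{j. d' a j \<noteq> 0} \<subseteq> (SIGMA n:fst ` {j. d' a j \<noteq> 0}. J n)"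
  proof
   fix j assume "j \<in> {j. d' a j \<noteq> 0}"
   moreover obtain m k where j: "j = (m, k)" by (cases j)
   ultimately have nz: "d' a (m, k) \<noteq> 0" by simp
   then have "k \<in> J m" using matcat.dim_support[OF mc o] by (simp add: d'_def)
   then show "j \<in> (SIGMA n:fst ` {j. d' a j \<noteq> 0}. J n)" using nz j by force
  qed
  then show "finite {j. d' a j \<noteq> 0}" using fin fJ by (rule finite_subset[OF _ finite_SigmaI])
  fix j assume "d' a j \<noteq> 0"
  then show "j \<in> (SIGMA n:UNIV. J n)" using matcat.dim_support[OF mc o] by (cases j) (auto simp: d'_def)
 next
  fix n :: "nat \<times> nat => nat" assume n: "finite {j. n j \<noteq> 0}" "{j. n j \<noteq> 0} \<subseteq> (SIGMA n:UNIV. J n)"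
  define a where "a = (\<lambda>m. matcat.ob (C m) (d m) (\<lambda>k. n (m, k)))"
  have f: "finite {k. n (m, k) \<noteq> 0}" "{k. n (m, k) \<noteq> 0} \<subseteq> J m" for m using n by (auto intro!: finite_subset[OF _ fJ[of m]])
  note aa = matcat.ob_Obj[OF mc f] matcat.dim_ob[OF mc f]
  have d: "d' a = n" by (auto simp: d'_def a_def aa fun_eq_iff)
  have "a m \<in> Obj (C m)" for m using aa by (simp add: a_def)
  then have "a \<in> Obj (tot C)" using supp[of a] n(1) by (simp add: Obj_tot d)
  then show "\<exists>a\<in>Obj (tot C). d' a = n" using d by blast
 next
  fix f g a b c j assume "f \<in> Homs (tot C) a b" "g \<in> Homs (tot C) b c"
  then have "f n \<in> Homs (C n) (a n) (b n)" "g n \<in> Homs (C n) (b n) (c n)" for n by (auto simp: H)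
  from matcat.rep_Cmp[OF mc this] show "rh' (Cmp (tot C) g f) j = rh' g j * rh' f j" by (cases j) (simp add: rh'_def tot_simps)
 next
  fix f g a b j assume "f \<in> Homs (tot C) a b" "g \<in> Homs (tot C) a b"
  then have "f n \<in> Homs (C n) (a n) (b n)" "g n \<in> Homs (C n) (a n) (b n)" for n by (auto simp: H)
  from matcat.rep_Add[OF mc this] show "rh' (AddA (tot C) f g) j = rh' f j + rh' g j" by (cases j) (simp add: rh'_def tot_simps)
 next
  fix f a b r j assume "f \<in> Homs (tot C) a b"
  then have "f n \<in> Homs (C n) (a n) (b n)" for n by (auto simp: H)
  from matcat.rep_Scale[OF mc this] show "rh' (ScaleA (tot C) r f) j = r \<cdot>\<^sub>m rh' f j" by (cases j) (simp add: rh'_def tot_simps)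
 qed (auto simp: H Obj_tot tot_simps d'_def rh'_def matcat.rep_Ide[OF mc] matcat.rep_Zero[OF mc] split: prod.splits
   intro: matcat.Ide_hom[OF mc] matcat.Cmp_hom[OF mc] matcat.Zero_hom[OF mc] matcat.Add_hom[OF mc] matcat.Scale_hom[OF mc])
 moreover have "finite {j\<in>(SIGMA n:UNIV. J n). fst j = m}" for m
 proof -
  have "{j\<in>(SIGMA n:UNIV. J n). fst j = m} = (SIGMA n:{m}. J n)" by auto
  then show ?thesis using fJ by simp
 qed
 ultimately have "gmatcat C (SIGMA n:UNIV. J n) d' rh'" using supp by (auto simp: gmatcat_def Obj_tot)
 then show ?thesis by blast
qed

section \<open>Sums of arrows, bases of hom-spaces and semisimplicity\<close>

context matcat
begin

lemma
 assumes "a \<in> Obj C" "b \<in> Obj C" "finite A" "\<And>k. k \<in> A ==> f k \<in> Homs C a b"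
 shows finsum_hom: "finsum (hom_space C a b) f A \<in> Homs C a b"
  and rep_finsum: "x < d b j ==> y < d a j ==>
   rh (finsum (hom_space C a b) f A) j $$ (x, y) = (\<Sum>k\<in>A. rh (f k) j $$ (x, y))"
proof -
 interpret V: vectorspace "class_ring :: 'k ring" "hom_space C a b" by (rule vectorspace_hom_space[OF assms(1,2)])
 have carr: "carrier (hom_space C a b) = Homs C a b" by (simp add: hom_space_def)
 have "finsum (hom_space C a b) f A \<in> Homs C a b \<and>
   (\<forall>x<d b j. \<forall>y<d a j. rh (finsum (hom_space C a b) f A) j $$ (x, y) = (\<Sum>k\<in>A. rh (f k) j $$ (x, y)))" for j using assms(3,4)
 proof (induction A)
  case empty
  then show ?case unfolding V.finsum_empty using Zero_hom[OF assms(1,2)] rep_Zero[OF assms(1,2)] by (simp add: hom_space_def)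
 next
  case (insert k A)
  have k: "f k \<in> Homs C a b" using insert.prems by simp
  have IH: "finsum (hom_space C a b) f A \<in> Homs C a b"
   "\<And>x y. x < d b j ==> y < d a j ==> rh (finsum (hom_space C a b) f A) j $$ (x, y) = (\<Sum>k\<in>A. rh (f k) j $$ (x, y))" using insert by auto
  have "finsum (hom_space C a b) f (insert k A) = f k \<oplus>\<^bsub>hom_space C a b\<^esub> finsum (hom_space C a b) f A"
   using insert by (intro V.finsum_insert) (auto simp: carr)
  then have "finsum (hom_space C a b) f (insert k A) = AddA C (f k) (finsum (hom_space C a b) f A)" by (simp add: hom_space_def)
  then show ?case using insert.hyps IH(2) Add_hom[OF k IH(1)] rep_carrier[OF k, of j] rep_carrier[OF IH(1), of j] by (simp add: rep_Add[OF k IH(1)])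
 qed
 then show "finsum (hom_space C a b) f A \<in> Homs C a b"
  and "x < d b j ==> y < d a j ==> rh (finsum (hom_space C a b) f A) j $$ (x, y) = (\<Sum>k\<in>A. rh (f k) j $$ (x, y))" by auto
qed

definition inc :: "'j => 'o => nat => 'm" where
 "inc j x p = mk (simp_obj j) x (\<lambda>i. mat (d x i) (kdelta j i) (\<lambda>(r, c). if i = j \<and> r = p then 1 else 0))"

lemma
 assumes "j \<in> J" "x \<in> Obj C"
 shows inc_hom: "inc j x p \<in> Homs C (simp_obj j) x"
  and rep_inc: "rh (inc j x p) i = mat (d x i) (kdelta j i) (\<lambda>(r, c). if i = j \<and> r = p then 1 else 0)"
proof -
 have c: "mat (d x i) (kdelta j i) (\<lambda>(r, c). if i = j \<and> r = p then 1 else 0) \<in> carrier_mat (d x i) (d (simp_obj j) i)"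
  for i by (simp add: dim_simp[OF assms(1)])
 show "inc j x p \<in> Homs C (simp_obj j) x" unfolding inc_def by (rule mk_hom[OF simp_Obj[OF assms(1)] assms(2) c])
 show "rh (inc j x p) i = mat (d x i) (kdelta j i) (\<lambda>(r, c). if i = j \<and> r = p then 1 else 0)"
  unfolding inc_def rep_mk[OF simp_Obj[OF assms(1)] assms(2) c] ..
qed

text \<open>The arrows \<open>inc j x p\<close>, \<open>p < d x j\<close>, form a basis of the arrows from the \<open>j\<close>-th simple object to \<open>x\<close>.\<close>

lemma linear_functional_inc:
 fixes L :: "'m => 'k"
 assumes j: "j \<in> J" and x: "x \<in> Obj C"
  and add: "\<And>f g. f \<in> Homs C (simp_obj j) x ==> g \<in> Homs C (simp_obj j) x ==> L (AddA C f g) = L f + L g"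
  and scale: "\<And>f r. f \<in> Homs C (simp_obj j) x ==> L (ScaleA C r f) = r * L f"
  and g: "g \<in> Homs C (simp_obj j) x"
 shows "L g = (\<Sum>p<d x j. rh g j $$ (p, 0) * L (inc j x p))"
proof -
 \<comment> \<open>\<open>cut n\<close> keeps the first \<open>n\<close> rows of the matrices of
   \<open>g\<close>, so that binary additivity suffices: each further row adds one multiple of an
   arrow \<open>inc j x p\<close>.\<close>
 define cut where "cut = (\<lambda>n. mk (simp_obj j) x
   (\<lambda>i. mat (d x i) (kdelta j i) (\<lambda>(r, c). if r < n then rh g i $$ (r, c) else 0)))"
 have c: "mat (d x i) (kdelta j i) (\<lambda>(r, c). if r < n then rh g i $$ (r, c) else 0) \<in> carrier_mat (d x i) (d (simp_obj j) i)"
  for i n by (simp add: dim_simp[OF j])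
 have cut: "cut n \<in> Homs C (simp_obj j) x"
  "rh (cut n) i = mat (d x i) (kdelta j i) (\<lambda>(r, c). if r < n then rh g i $$ (r, c) else 0)" for n i
  unfolding cut_def by (rule mk_hom[OF simp_Obj[OF j] x c], unfold rep_mk[OF simp_Obj[OF j] x c], rule refl)
 have gc: "rh g i \<in> carrier_mat (d x i) (kdelta j i)" for i using rep_carrier[OF g, of i] dim_simp[OF j] by simp
 have sum: "L (cut n) = (\<Sum>p<n. rh g j $$ (p, 0) * L (inc j x p))" if "n \<le> d x j" for n using that
 proof (induction n)
  case 0
  have "cut 0 = ScaleA C 0 g" unfolding Scale_0[OF g] using dim_simp[OF j] by (intro hom_eqI[OF cut(1) Zero_hom[OF simp_Obj[OF j] x]] eq_matI)
    (auto simp: cut(2) rep_Zero[OF simp_Obj[OF j] x])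
  then show ?case using scale[OF g] by simp
 next
  case (Suc n)
  note h = cut(1) Scale_hom[OF inc_hom[OF j x]]
  have "cut (Suc n) = AddA C (cut n) (ScaleA C (rh g j $$ (n, 0)) (inc j x n))"
  proof (rule hom_eqI[OF cut(1) Add_hom[OF h]])
   fix i
   show "rh (cut (Suc n)) i = rh (AddA C (cut n) (ScaleA C (rh g j $$ (n, 0)) (inc j x n))) i"
    using gc[of i] unfolding rep_Add[OF h] rep_Scale[OF inc_hom[OF j x]] cut(2) rep_inc[OF j x]
    by (intro eq_matI) (auto simp: kdelta_def less_Suc_eq split: if_splits)
  qed
  then show ?case using Suc add[OF h] scale[OF inc_hom[OF j x]] by simp
 qed
 have "cut (d x j) = g"
 proof (rule hom_eqI[OF cut(1) g])
  fix i
  show "rh (cut (d x j)) i = rh g i" using gc[of i] unfolding cut(2) by (intro eq_matI) (auto simp: kdelta_def split: if_splits)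
 qed
 then show ?thesis using sum[of "d x j"] by simp
qed

text \<open>Each pair of a component \<open>j\<close> and a position \<open>p < d x j\<close>
  contributes one simple summand, with unit vectors as inclusion and projection. Semisimplicity is
  part of the definition of \<open>two_vector_space\<close>, which the test category has to
  satisfy.\<close>

lemma semisimple: "semisimple C" unfolding semisimple_def
proof
 fix x assume x: "x \<in> Obj C"
 define T where "T = (SIGMA j:{j. d x j \<noteq> 0}. {..<d x j})"
 have "finite T" using dim_finite[OF x] by (auto simp: T_def)
 then obtain e where e: "bij_betw e {..<card T} T" using ex_bij_betw_nat_finite by (metis atLeast0LessThan)
 define j p where "j = (\<lambda>k. fst (e k))" "p = (\<lambda>k. snd (e k))"
 have jp: "j k \<in> J" "p k < d x (j k)" if "k < card T" for k
 proof -
  have "e k \<in> T" using bij_betwE[OF e] that by auto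
  then show "j k \<in> J" "p k < d x (j k)" using dim_support[OF x] by (auto simp: T_def j_p_def)
 qed
 define pr where "pr = (\<lambda>k. mk x (simp_obj (j k))
   (\<lambda>i. mat (kdelta (j k) i) (d x i) (\<lambda>(r, c). if i = j k \<and> c = p k then 1 else 0)))"
 have c: "mat (kdelta (j k) i) (d x i) (\<lambda>(r, c). if i = j k \<and> c = p k then 1 else 0) \<in> carrier_mat (d (simp_obj (j k)) i) (d x i)"
  if "k < card T" for k i using dim_simp jp[OF that] by simp
 have pr: "pr k \<in> Homs C x (simp_obj (j k))"
  "rh (pr k) i = mat (kdelta (j k) i) (d x i) (\<lambda>(r, c). if i = j k \<and> c = p k then 1 else 0)" if "k < card T" for k i
  unfolding pr_def using mk_hom[OF x simp_Obj c] rep_mk[OF x simp_Obj c] jp[OF that] that by auto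
 have inc: "inc (j k) x (p k) \<in> Homs C (simp_obj (j k)) x"
  "rh (inc (j k) x (p k)) i = mat (d x i) (kdelta (j k) i) (\<lambda>(r, c). if i = j k \<and> r = p k then 1 else 0)"
  if "k < card T" for k i using inc_hom rep_inc jp[OF that] x by auto
 have ortho: "Cmp C (pr k) (inc (j l) x (p l)) = (if k = l then Ide C (simp_obj (j k)) else ZeroA C (simp_obj (j l)) (simp_obj (j k)))"
  if kl: "k < card T" "l < card T" for k l
 proof -
  have rp: "rh (Cmp C (pr k) (inc (j l) x (p l))) i =
    mat (kdelta (j k) i) (kdelta (j l) i) (\<lambda>_. if k = l then 1 else 0)" for i
  proof -
   have eq: "j k = j l \<and> p k = p l \<longleftrightarrow> k = l" using e kl by (auto simp: j_p_def bij_betw_def inj_on_def prod_eq_iff)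
   show ?thesis unfolding rep_Cmp[OF inc(1)[OF kl(2)] pr(1)[OF kl(1)]] inc(2)[OF kl(2)] pr(2)[OF kl(1)]
   proof (rule eq_matI)
    fix r c
    assume "r < dim_row (mat (kdelta (j k) i) (kdelta (j l) i) (\<lambda>_. if k = l then 1 else 0 :: 'k))"
     "c < dim_col (mat (kdelta (j k) i) (kdelta (j l) i) (\<lambda>_. if k = l then 1 else 0 :: 'k))"
    then have rc: "r = 0" "c = 0" "i = j k" "i = j l" by (auto simp: kdelta_def split: if_splits)
    have "(\<Sum>a<d x i. (if a = p k then 1 else 0) * (if a = p l then 1 else 0 :: 'k)) =
      (\<Sum>a<d x i. if a = p k then (if p k = p l then 1 else 0) else 0)" by (intro sum.cong) auto
    also have "\<dots> = (if k = l then 1 else 0)" using jp[OF kl(1)] rc eq by auto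
    finally have s: "(\<Sum>a<d x i. (if a = p k then 1 else 0) * (if a = p l then 1 else 0 :: 'k)) = (if k = l then 1 else 0)" .
    show "(mat (kdelta (j k) i) (d x i) (\<lambda>(r, c). if i = j k \<and> c = p k then 1 else 0) *
      mat (d x i) (kdelta (j l) i) (\<lambda>(r, c). if i = j l \<and> r = p l then 1 else 0)) $$ (r, c)
      = mat (kdelta (j k) i) (kdelta (j l) i) (\<lambda>_. if k = l then 1 else 0 :: 'k) $$ (r, c)" unfolding s[symmetric] using rc
     by (subst index_mult_mat) (auto simp: scalar_prod_def atLeast0LessThan kdelta_def s)
   qed (auto simp: kdelta_def)
  qed
  show ?thesis
  proof (cases "k = l")
   case True
   have "Cmp C (pr k) (inc (j l) x (p l)) = Ide C (simp_obj (j k))"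
   proof (rule hom_eqI)
    fix i show "rh (Cmp C (pr k) (inc (j l) x (p l))) i = rh (Ide C (simp_obj (j k))) i"
     unfolding rp rep_Ide[OF simp_Obj[OF jp(1)[OF kl(1)]]] dim_simp[OF jp(1)[OF kl(1)]]
     using True by (intro eq_matI) (auto simp: kdelta_def split: if_splits)
   qed (use True Cmp_hom[OF inc(1)[OF kl(2)] pr(1)[OF kl(1)]] Ide_hom simp_Obj jp kl in auto)
   then show ?thesis using True by simp
  next
   case False
   have "Cmp C (pr k) (inc (j l) x (p l)) = ZeroA C (simp_obj (j l)) (simp_obj (j k))"
   proof (rule hom_eqI[OF Cmp_hom[OF inc(1)[OF kl(2)] pr(1)[OF kl(1)]]])
    note so = simp_Obj[OF jp(1)[OF kl(2)]] simp_Obj[OF jp(1)[OF kl(1)]]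
    show "ZeroA C (simp_obj (j l)) (simp_obj (j k)) \<in> Homs C (simp_obj (j l)) (simp_obj (j k))" by (rule Zero_hom[OF so])
    fix i show "rh (Cmp C (pr k) (inc (j l) x (p l))) i = rh (ZeroA C (simp_obj (j l)) (simp_obj (j k))) i"
     unfolding rp rep_Zero[OF so] dim_simp[OF jp(1)[OF kl(1)]] dim_simp[OF jp(1)[OF kl(2)]] using False by (intro eq_matI) auto
   qed
   then show ?thesis using False by simp
  qed
 qed
 have pi: "Cmp C (inc (j k) x (p k)) (pr k) \<in> Homs C x x"
  "r < d x i ==> c < d x i ==> rh (Cmp C (inc (j k) x (p k)) (pr k)) i $$ (r, c) = (if e k = (i, r) \<and> r = c then 1 else 0)"
  if k: "k < card T" for k i r c
 proof -
  show "Cmp C (inc (j k) x (p k)) (pr k) \<in> Homs C x x" using pr(1)[OF k] inc(1)[OF k] by (rule Cmp_hom)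
  assume rc: "r < d x i" "c < d x i"
  have "e k = (j k, p k)" by (simp add: j_p_def)
  then show "rh (Cmp C (inc (j k) x (p k)) (pr k)) i $$ (r, c) = (if e k = (i, r) \<and> r = c then 1 else 0)"
   unfolding rep_Cmp[OF pr(1)[OF k] inc(1)[OF k]] inc(2)[OF k] pr(2)[OF k] using rc by (subst index_mult_mat) (auto simp: scalar_prod_def kdelta_def)
 qed
 have "finsum (hom_space C x x) (\<lambda>k. Cmp C (inc (j k) x (p k)) (pr k)) {..<card T} = Ide C x"
 proof (rule hom_eqI)
  show h: "finsum (hom_space C x x) (\<lambda>k. Cmp C (inc (j k) x (p k)) (pr k)) {..<card T} \<in> Homs C x x"
   using pi(1) by (intro finsum_hom[OF x x]) auto
  show "Ide C x \<in> Homs C x x" by (rule Ide_hom[OF x])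
  fix i
  show "rh (finsum (hom_space C x x) (\<lambda>k. Cmp C (inc (j k) x (p k)) (pr k)) {..<card T}) i = rh (Ide C x) i"
  proof (rule eq_matI)
   fix r c assume "r < dim_row (rh (Ide C x) i)" "c < dim_col (rh (Ide C x) i)"
   then have rc: "r < d x i" "c < d x i" using x by (simp_all add: rep_Ide)
   have "rh (finsum (hom_space C x x) (\<lambda>k. Cmp C (inc (j k) x (p k)) (pr k)) {..<card T}) i $$ (r, c)
     = (\<Sum>k<card T. if e k = (i, r) \<and> r = c then 1 else 0)" using pi by (subst rep_finsum[OF x x _ _ rc]) (auto intro!: sum.cong simp: rc)
   also have "\<dots> = (\<Sum>t\<in>T. if t = (i, r) \<and> r = c then 1 else 0)" by (rule sum.reindex_bij_betw[OF e])
   also have "\<dots> = (\<Sum>t\<in>T. if t = (i, r) then (if r = c then 1 else 0) else 0)" by (intro sum.cong) auto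
   also have "\<dots> = (if r = c then 1 else 0)" using \<open>finite T\<close> rc by (auto simp: T_def)
   finally show "rh (finsum (hom_space C x x) (\<lambda>k. Cmp C (inc (j k) x (p k)) (pr k)) {..<card T}) i $$ (r, c) = rh (Ide C x) i $$ (r, c)"
    using rc x by (simp add: rep_Ide)
  qed (use rep_carrier[OF h, of i] rep_carrier[OF Ide_hom[OF x], of i] in auto)
 qed
 then have "is_direct_sum C x (card T) (\<lambda>k. simp_obj (j k))" unfolding is_direct_sum_def using x simp_Obj jp inc(1) pr(1) ortho
  by (intro conjI exI[of _ "\<lambda>k. inc (j k) x (p k)"] exI[of _ pr]) auto
 moreover have "is_simple C (simp_obj (j k))" if "k < card T" for k using jp[OF that] simp_Obj dim_simp by (auto simp: is_simple_iff)
 ultimately show "\<exists>n s. (\<forall>k<n. is_simple C (s k)) \<and> is_direct_sum C x n s"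
  by (intro exI[of _ "card T"] exI[of _ "\<lambda>k. simp_obj (j k)"]) auto
qed

end

text \<open>\<open>Vect\<close> is the product of one copy of itself, which is the form required by
  \<open>two_vector_space\<close>; an object of dimension 1 is non-zero because its identity is not
  0 times itself.\<close>

lemma ex_nonzero_two_vector_space:
 fixes V :: "('o, 'm, 'k::field_char_0) lcat"
 assumes "linear_category V" "linear_equivalent V (Vect :: (nat, 'k mat, 'k) lcat)"
 shows "two_vector_space V \<and> (\<exists>a\<in>Obj V. \<not> is_zero_obj V a)"
proof -
 let ?P = "prod_cat {..<1} (\<lambda>_. Vect :: (nat, 'k mat, 'k) lcat)"
 obtain F where F: "linear_functor V (Vect :: (nat, 'k mat, 'k) lcat) F"
  and bij: "\<And>a b. a \<in> Obj V ==> b \<in> Obj V ==>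
   bij_betw (far F) (Homs V a b) (Homs (Vect :: (nat, 'k mat, 'k) lcat) (fob F a) (fob F b))"
  and surj: "\<And>n. \<exists>a\<in>Obj V. isomorphic_in (Vect :: (nat, 'k mat, 'k) lcat) (fob F a) n"
  using assms(2) unfolding linear_equivalent_def by (auto simp: Vect_def)
 have HV: "f \<in> Homs (Vect :: (nat, 'k mat, 'k) lcat) a b \<longleftrightarrow> f \<in> carrier_mat b a" for f a b
  by (auto simp: Homs_def Vect_def)
 define F' where "F' = \<lparr>fob = (\<lambda>x. \<lambda>i\<in>{..<1::nat}. fob F x), far = (\<lambda>f. \<lambda>i\<in>{..<1::nat}. far F f)\<rparr>"
 have iso: "isomorphic_in (Vect :: (nat, 'k mat, 'k) lcat) a b ==> a = b" for a b
 proof -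
  assume "isomorphic_in (Vect :: (nat, 'k mat, 'k) lcat) a b"
  then obtain f g :: "'k mat" where "f \<in> carrier_mat b a" "g \<in> carrier_mat a b" "f * g = 1\<^sub>m b" "g * f = 1\<^sub>m a"
   by (auto simp: isomorphic_in_def is_iso_def is_inverse_def Homs_def Vect_def)
  then show "a = b" using inverse_mat_dims by blast
 qed
 have Hom: "f \<in> Homs ?P (\<lambda>i\<in>{..<1}. a) (\<lambda>i\<in>{..<1}. b) \<longleftrightarrow> f \<in> extensional {..<1} \<and> f 0 \<in> carrier_mat b a" for f a b
  by (auto simp: Homs_prod_cat HV)
 have "linear_functor V ?P F'" unfolding linear_functor_def is_functor_def
 proof (intro conjI ballI allI)
  have F1: "far F f \<in> carrier_mat (fob F b) (fob F a)" if "f \<in> Homs V a b" for f a b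
   using F that unfolding linear_functor_def is_functor_def HV by blast
  fix a b f assume "f \<in> Homs V a b"
  then show "far F' f \<in> Homs ?P (fob F' a) (fob F' b)" unfolding F'_def fctr.simps Hom using F1 by simp
 next
  fix a b c f g assume "f \<in> Homs V a b" "g \<in> Homs V b c"
  then have "far F (Cmp V g f) = far F g * far F f" using F unfolding linear_functor_def is_functor_def by (simp add: Vect_def)
  then show "far F' (Cmp V g f) = Cmp ?P (far F' g) (far F' f)" by (auto simp: F'_def prod_cat_def Vect_def)
 next
  fix a b f g and r :: 'k assume fg: "f \<in> Homs V a b" "g \<in> Homs V a b"
  then have "far F (AddA V f g) = far F f + far F g" "far F (ScaleA V r f) = r \<cdot>\<^sub>m far F f"
   using F unfolding linear_functor_def by (simp_all add: Vect_def)
  then show "far F' (AddA V f g) = AddA ?P (far F' f) (far F' g)" "far F' (ScaleA V r f) = ScaleA ?P r (far F' f)"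
   by (auto simp: F'_def prod_cat_def Vect_def)
 next
  fix a assume "a \<in> Obj V"
  then have "far F (Ide V a) = 1\<^sub>m (fob F a)" using F unfolding linear_functor_def is_functor_def by (simp add: Vect_def)
  then show "far F' (Ide V a) = Ide ?P (fob F' a)" by (auto simp: F'_def prod_cat_def Vect_def)
 qed (auto simp: F'_def prod_cat_def Vect_def)
 moreover have "bij_betw (far F') (Homs V a b) (Homs ?P (fob F' a) (fob F' b))" if "a \<in> Obj V" "b \<in> Obj V" for a b
 proof -
  have "bij_betw (\<lambda>f. \<lambda>i\<in>{..<1::nat}. f) (Homs (Vect :: (nat, 'k mat, 'k) lcat) (fob F a) (fob F b)) (Homs ?P (fob F' a) (fob F' b))"
  proof -
   have "Homs ?P (fob F' a) (fob F' b) = {f. f \<in> extensional {..<1} \<and> f 0 \<in> carrier_mat (fob F b) (fob F a)}"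
    unfolding F'_def fctr.simps using Hom by blast
   moreover have "Homs (Vect :: (nat, 'k mat, 'k) lcat) (fob F a) (fob F b) = carrier_mat (fob F b) (fob F a)" using HV by blast
   ultimately show ?thesis by (intro bij_betw_byWitness[where f' = "\<lambda>f. f 0"]) (auto simp: extensional_def fun_eq_iff)
  qed
  from bij_betw_trans[OF bij[OF that] this] show ?thesis by (simp add: F'_def comp_def)
 qed
 moreover have "\<exists>a\<in>Obj V. isomorphic_in ?P (fob F' a) n" if n: "n \<in> Obj ?P" for n
 proof -
  obtain a where a: "a \<in> Obj V" "fob F a = n 0" using surj[of "n 0"] iso by blast
  then have e: "fob F' a = n" using n by (auto simp: F'_def prod_cat_def PiE_iff extensional_def fun_eq_iff)
  have "isomorphic_in ?P n n" using n by (auto simp: isomorphic_in_def is_iso_def is_inverse_def Homs_def prod_cat_def Vect_def PiE_iff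
     extensional_def fun_eq_iff intro!: exI[of _ "\<lambda>i\<in>{..<1}. 1\<^sub>m (n 0)"])
  then show ?thesis using a e by blast
 qed
 ultimately have eq: "linear_equivalent V ?P" unfolding linear_equivalent_def by blast
 obtain J d rh where "matcat V (J :: nat set) d rh" using linear_equivalent_matcat[OF assms(1) eq] by blast
 then interpret matcat V J d rh .
 have "two_vector_space V" using assms(1) semisimple eq unfolding two_vector_space_def by blast
 moreover obtain a where a: "a \<in> Obj V" "fob F a = 1" using surj[of 1] iso by blast
 have "\<not> is_zero_obj V a"
 proof
  assume "is_zero_obj V a"
  then have "Ide V a = ZeroA V a a" using Ide_hom[OF a(1)] Zero_hom[OF a(1,1)] by (auto simp: is_zero_obj_def)
  also have "\<dots> = ScaleA V 0 (Ide V a)" using Scale_0[OF Ide_hom[OF a(1)]] by simp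
  finally have "far F (Ide V a) = far F (ScaleA V 0 (Ide V a))" by simp
  moreover have "far F (ScaleA V 0 (Ide V a)) = ScaleA Vect 0 (far F (Ide V a))" using F Ide_hom[OF a(1)] unfolding linear_functor_def by blast
  moreover have "far F (Ide V a) = 1\<^sub>m 1" using F a unfolding linear_functor_def is_functor_def by (auto simp: Vect_def)
  ultimately have "1\<^sub>m 1 = 0 \<cdot>\<^sub>m (1\<^sub>m 1 :: 'k mat)" by (simp add: Vect_def)
  from arg_cong[OF this, of "\<lambda>A. A $$ (0, 0)"] show False by simp
 qed
 ultimately show ?thesis using a by blast
qed

section \<open>Multi-exact functors\<close>

text \<open>The slots are expanded one after the other; in \<open>g K t\<close> those in
  \<open>K\<close> are already replaced by basis elements. Values lie in a commutative semiring
  because the lemma serves for multiplicities in the natural numbers and for matrix entries in the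
  field.\<close>

lemma multilinear_expand:
 fixes Ps :: "('i => 'v) => 'r::comm_semiring_1"
 assumes "finite I" and P: "\<And>i. i \<in> I ==> finite (P i)"
  and f: "f \<in> (PiE I X)" and e: "\<And>i p. i \<in> I ==> p \<in> P i ==> e i p \<in> X i"
  and slot: "\<And>h i. h \<in> (PiE I X) ==> i \<in> I ==>
   Ps (h(i := f i)) = (\<Sum>p\<in>P i. a i p * Ps (h(i := e i p)))"
 shows "Ps f = (\<Sum>t\<in>(PiE I P). (\<Prod>i\<in>I. a i (t i)) * Ps (\<lambda>i\<in>I. e i (t i)))"
proof -
 define g where "g = (\<lambda>K t. \<lambda>i\<in>I. if i \<in> K then e i (t i) else f i)"
 have "Ps f = (\<Sum>t\<in>(PiE K P). (\<Prod>i\<in>K. a i (t i)) * Ps (g K t))" if "finite K" "K \<subseteq> I" for K using that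
 proof (induction K)
  case empty
  have "g {} t = f" for t using f by (auto simp: g_def PiE_iff extensional_def fun_eq_iff)
  then show ?case by simp
 next
  case (insert k K)
  have k: "k \<in> I" "k \<notin> K" using insert by auto
  have step: "Ps (g K t) = (\<Sum>p\<in>P k. a k p * Ps (g (insert k K) (t(k := p))))" if t: "t \<in> (PiE K P)" for t
  proof -
   have gX: "g K t \<in> (PiE I X)" using f e t insert.prems by (auto simp: g_def PiE_iff)
   have "g K t = (g K t)(k := f k)" using k by (auto simp: g_def)
   then have "Ps (g K t) = Ps ((g K t)(k := f k))" by simp
   also have "\<dots> = (\<Sum>p\<in>P k. a k p * Ps ((g K t)(k := e k p)))" by (rule slot[OF gX k(1)])
   finally have *: "Ps (g K t) = (\<Sum>p\<in>P k. a k p * Ps ((g K t)(k := e k p)))" .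
   have "(g K t)(k := e k p) = g (insert k K) (t(k := p))" for p using k by (auto simp: g_def fun_eq_iff)
   then show ?thesis using * by simp
  qed
  have "Ps f = (\<Sum>t\<in>(PiE K P). \<Sum>p\<in>P k. (\<Prod>i\<in>K. a i (t i)) * (a k p * Ps (g (insert k K) (t(k := p)))))"
   using insert by (simp add: step sum_distrib_left)
  also have "\<dots> = (\<Sum>(p, t)\<in>P k \<times> (PiE K P). (\<Prod>i\<in>insert k K. a i ((t(k := p)) i)) * Ps (g (insert k K) (t(k := p))))"
  proof -
   have "(\<Prod>i\<in>insert k K. a i ((t(k := p)) i)) = a k p * (\<Prod>i\<in>K. a i (t i))" for t p
   proof -
    have "(\<Prod>i\<in>K. a i ((t(k := p)) i)) = (\<Prod>i\<in>K. a i (t i))" using k by (intro prod.cong) auto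
    then show ?thesis using insert.hyps by simp
   qed
   then show ?thesis by (subst sum.swap, simp add: sum.cartesian_product mult.assoc mult.left_commute)
  qed
  also have "\<dots> = (\<Sum>t\<in>(\<Pi>\<^sub>E i\<in>insert k K. P i). (\<Prod>i\<in>insert k K. a i (t i)) * Ps (g (insert k K) t))"
   unfolding PiE_insert_eq using insert.hyps by (subst sum.reindex[OF inj_combinator]) (auto simp: case_prod_unfold comp_def)
  finally show ?case .
 qed
 from this[OF assms(1) subset_refl] show ?thesis by (simp add: g_def cong: restrict_cong)
qed

text \<open>By \<open>exact_functor_dims\<close> the dimension is additive in each variable, so it
  expands like a multilinear form.\<close>

lemma multi_exact_dims:
 assumes "finite I" and B: "\<And>i. i \<in> I ==> matcat (B i) (J i) (d i) (rh i)" and D: "matcat D JD dD rhD"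
  and Fn: "multi_exact I B D Fn" and x: "x \<in> Obj (prod_cat I B)"
  and P: "\<And>i. i \<in> I ==> finite (P i) \<and> {j. d i (x i) j \<noteq> 0} \<subseteq> P i \<and> P i \<subseteq> J i"
 shows "dD (fob Fn x) s =
  (\<Sum>t\<in>(PiE I P). (\<Prod>i\<in>I. d i (x i) (t i)) * dD (fob Fn (\<lambda>i\<in>I. matcat.simp_obj (B i) (d i) (t i))) s)"
proof (rule multilinear_expand[where X = "\<lambda>i. Obj (B i)"])
 show "x \<in> (\<Pi>\<^sub>E i\<in>I. Obj (B i))" using x by (simp add: prod_cat_def)
 fix h i assume h: "h \<in> (\<Pi>\<^sub>E i\<in>I. Obj (B i))" and i: "i \<in> I"
 have "exact_functor (B i) D (fctr_comp Fn (slot I B h i))" using Fn h i by (simp add: multi_exact_def prod_cat_def)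
 moreover have "x i \<in> Obj (B i)" using x i by (auto simp: prod_cat_def PiE_iff)
 ultimately show "dD (fob Fn (h(i := x i))) s =
   (\<Sum>p\<in>P i. d i (x i) p * dD (fob Fn (h(i := matcat.simp_obj (B i) (d i) p))) s)"
  using exact_functor_dims[OF B[OF i] D, of "fctr_comp Fn (slot I B h i)" "x i" "P i" s] P[OF i] by (simp add: fctr_comp_def slot_def)
next
 fix i p assume "i \<in> I" "p \<in> P i"
 then show "matcat.simp_obj (B i) (d i) p \<in> Obj (B i)" using matcat.simp_Obj[OF B] P by blast
qed (use assms P in auto)

section \<open>Multiples of one simple object\<close>

context matcat
begin

text \<open>The sum of \<open>n\<close> copies of the simple object \<open>z\<close>. Together with
  \<open>arr1\<close> it copies coordinate spaces and matrices into the category, so test functors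
  can be prescribed by matrices.\<close>

definition ob1 :: "'j => nat => 'o" where
 "ob1 z n = ob (\<lambda>j. if j = z then n else 0)"

definition arr1 :: "'j => nat => nat => 'k mat => 'm" where
 "arr1 z n m A = mk (ob1 z n) (ob1 z m) (\<lambda>j. if j = z then A else 0\<^sub>m 0 0)"

context
 fixes z assumes z: "z \<in> J"
begin

lemma ob1_Obj: "ob1 z n \<in> Obj C" and dim_ob1: "d (ob1 z n) = (\<lambda>j. if j = z then n else 0)"
 unfolding ob1_def using z by (auto intro!: ob_Obj dim_ob split: if_splits)

lemma
 assumes "A \<in> carrier_mat m n"
 shows arr1_hom: "arr1 z n m A \<in> Homs C (ob1 z n) (ob1 z m)"
  and rep_arr1: "rh (arr1 z n m A) = (\<lambda>j. if j = z then A else 0\<^sub>m 0 0)"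
proof -
 have c: "(if j = z then A else 0\<^sub>m 0 0) \<in> carrier_mat (d (ob1 z m) j) (d (ob1 z n) j)" for j using assms by (simp add: dim_ob1)
 show "arr1 z n m A \<in> Homs C (ob1 z n) (ob1 z m)" "rh (arr1 z n m A) = (\<lambda>j. if j = z then A else 0\<^sub>m 0 0)"
  unfolding arr1_def by (rule mk_hom[OF ob1_Obj ob1_Obj c], rule rep_mk[OF ob1_Obj ob1_Obj c])
qed

lemma hom_eqI1:
 assumes "f \<in> Homs C (ob1 z n) b" "g \<in> Homs C (ob1 z n) b" "rh f z = rh g z"
 shows "f = g"
proof (rule hom_eqI[OF assms(1,2)])
 fix j show "rh f j = rh g j"
 proof (cases "j = z")
  case False
  then show ?thesis using rep_carrier[OF assms(1), of j] rep_carrier[OF assms(2), of j] by (intro eq_matI) (auto simp: dim_ob1)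
 qed (use assms(3) in simp)
qed

lemma arr1_Ide: "arr1 z n n (1\<^sub>m n) = Ide C (ob1 z n)"
 by (rule hom_eqI1[OF arr1_hom Ide_hom[OF ob1_Obj]]) (simp_all add: rep_arr1 rep_Ide[OF ob1_Obj] dim_ob1)

lemma arr1_Cmp:
 assumes A: "A \<in> carrier_mat m n" and B: "B \<in> carrier_mat l m"
 shows "arr1 z n l (B * A) = Cmp C (arr1 z m l B) (arr1 z n m A)"
proof (rule hom_eqI1[OF arr1_hom Cmp_hom[OF arr1_hom[OF A] arr1_hom[OF B]]])
 show BA: "B * A \<in> carrier_mat l n" using A B by simp
 show "rh (arr1 z n l (B * A)) z = rh (Cmp C (arr1 z m l B) (arr1 z n m A)) z"
  by (simp add: rep_Cmp[OF arr1_hom[OF A] arr1_hom[OF B]] rep_arr1[OF BA] rep_arr1[OF A] rep_arr1[OF B])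
qed

lemma arr1_Add:
 assumes A: "A \<in> carrier_mat m n" and B: "B \<in> carrier_mat m n"
 shows "arr1 z n m (A + B) = AddA C (arr1 z n m A) (arr1 z n m B)"
proof (rule hom_eqI1[OF arr1_hom Add_hom[OF arr1_hom[OF A] arr1_hom[OF B]]])
 show BA: "A + B \<in> carrier_mat m n" using A B by simp
 show "rh (arr1 z n m (A + B)) z = rh (AddA C (arr1 z n m A) (arr1 z n m B)) z"
  by (simp add: rep_Add[OF arr1_hom[OF A] arr1_hom[OF B]] rep_arr1[OF BA] rep_arr1[OF A] rep_arr1[OF B])
qed

lemma arr1_Scale:
 assumes A: "A \<in> carrier_mat m n"
 shows "arr1 z n m (r \<cdot>\<^sub>m A) = ScaleA C r (arr1 z n m A)"
proof (rule hom_eqI1[OF arr1_hom Scale_hom[OF arr1_hom[OF A]]])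
 show BA: "r \<cdot>\<^sub>m A \<in> carrier_mat m n" using A by simp
 show "rh (arr1 z n m (r \<cdot>\<^sub>m A)) z = rh (ScaleA C r (arr1 z n m A)) z"
  by (simp add: rep_Scale[OF arr1_hom[OF A]] rep_arr1[OF BA] rep_arr1[OF A])
qed

end

end

text \<open>
 Functors out of a product whose values are concentrated at the simple object \<open>z\<close> of the target;
 on objects and arrows they are given by the dimensions \<open>dt\<close> and the matrices \<open>M\<close>.
\<close>

definition slot_fctr where
 "slot_fctr D dD rhD z B I dt M = \<lparr>fob = (\<lambda>x. matcat.ob1 D dD z (dt x)),
   far = (\<lambda>f. matcat.arr1 D dD rhD z (dt (\<lambda>i\<in>I. Src (B i) (f i))) (dt (\<lambda>i\<in>I. Tgt (B i) (f i))) (M f))\<rparr>"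

lemma prod_cat_simps:
 "Obj (prod_cat I B) = (\<Pi>\<^sub>E i\<in>I. Obj (B i))"
 "Ide (prod_cat I B) a = (\<lambda>i\<in>I. Ide (B i) (a i))"
 "Cmp (prod_cat I B) g f = (\<lambda>i\<in>I. Cmp (B i) (g i) (f i))" by (simp_all add: prod_cat_def)

lemma Homs_prod_ends:
 assumes "f \<in> Homs (prod_cat I B) a b"
 shows "(\<lambda>i\<in>I. Src (B i) (f i)) = a" "(\<lambda>i\<in>I. Tgt (B i) (f i)) = b" using assms by (auto simp: Homs_def prod_cat_def)

lemma slot_hom:
 assumes B: "\<And>i. i \<in> I ==> matcat (B i) (J i) (d i) (rh i)"
  and a: "a \<in> Obj (prod_cat I B)" and i: "i \<in> I" and f: "f \<in> Homs (B i) x y"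
 shows "(\<lambda>j\<in>I. Ide (B j) (a j))(i := f) \<in> Homs (prod_cat I B) (a(i := x)) (a(i := y))"
 using assms matcat.Ide_hom[OF B] by (auto simp: Homs_prod_cat prod_cat_simps PiE_iff extensional_def)

text \<open>Composition, sums and multiples are checked on the matrices \<open>M\<close>; exactness
  in each variable then follows from linearity by \<open>linear_functor_exact\<close>.\<close>

lemma (in matcat) slot_fctr_multi_exact:
 assumes B: "\<And>i. i \<in> I ==> matcat (B i) (J' i) (d' i) (rh' i)" and z: "z \<in> J"
  and car: "\<And>f a b. f \<in> Homs (prod_cat I B) a b ==> M f \<in> carrier_mat (dt b) (dt a)"
  and ide: "\<And>a. a \<in> Obj (prod_cat I B) ==> M (Ide (prod_cat I B) a) = 1\<^sub>m (dt a)"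
  and cmp: "\<And>f g a b c. f \<in> Homs (prod_cat I B) a b ==> g \<in> Homs (prod_cat I B) b c ==>
   M (Cmp (prod_cat I B) g f) = M g * M f"
  and add: "\<And>a i f g x y. a \<in> Obj (prod_cat I B) ==> i \<in> I ==> f \<in> Homs (B i) x y ==> g \<in> Homs (B i) x y ==>
   M ((\<lambda>j\<in>I. Ide (B j) (a j))(i := AddA (B i) f g)) =
   M ((\<lambda>j\<in>I. Ide (B j) (a j))(i := f)) + M ((\<lambda>j\<in>I. Ide (B j) (a j))(i := g))"
  and scale: "\<And>a i f r x y. a \<in> Obj (prod_cat I B) ==> i \<in> I ==> f \<in> Homs (B i) x y ==>
   M ((\<lambda>j\<in>I. Ide (B j) (a j))(i := ScaleA (B i) r f)) = r \<cdot>\<^sub>m M ((\<lambda>j\<in>I. Ide (B j) (a j))(i := f))"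
 shows "multi_exact I B C (slot_fctr C d rh z B I dt M)"
proof -
 let ?P = "prod_cat I B" and ?F = "slot_fctr C d rh z B I dt M"
 have far: "far ?F f = arr1 z (dt a) (dt b) (M f)" if "f \<in> Homs ?P a b" for f a b using Homs_prod_ends[OF that] by (simp add: slot_fctr_def)
 have cmpP: "Cmp ?P g f \<in> Homs ?P a c" if "f \<in> Homs ?P a b" "g \<in> Homs ?P b c" for f g a b c
 proof -
  have "Cmp (B i) (g i) (f i) \<in> Homs (B i) (a i) (c i)" if "i \<in> I" for i
   using matcat.Cmp_hom[OF B[OF that]] \<open>f \<in> _\<close> \<open>g \<in> _\<close> that by (auto simp: Homs_prod_cat)
  then show ?thesis using that by (auto simp: Homs_prod_cat) (auto simp: prod_cat_simps)
 qed
 have ideP: "Ide ?P a \<in> Homs ?P a a" if "a \<in> Obj ?P" for a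
  using that matcat.Ide_hom[OF B] by (auto simp: Homs_prod_cat) (auto simp: prod_cat_simps PiE_iff)
 have fctr: "is_functor ?P C ?F" unfolding is_functor_def
 proof (intro conjI ballI allI)
  fix a assume a: "a \<in> Obj ?P"
  show "fob ?F a \<in> Obj C" using ob1_Obj[OF z] by (simp add: slot_fctr_def)
  show "far ?F (Ide ?P a) = Ide C (fob ?F a)" unfolding far[OF ideP[OF a]] ide[OF a] arr1_Ide[OF z] by (simp add: slot_fctr_def)
 next
  fix a b f assume f: "f \<in> Homs ?P a b"
  show "far ?F f \<in> Homs C (fob ?F a) (fob ?F b)" unfolding far[OF f] using arr1_hom[OF z car[OF f]] by (simp add: slot_fctr_def)
 next
  fix a b c f g assume fg: "f \<in> Homs ?P a b" "g \<in> Homs ?P b c"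
  show "far ?F (Cmp ?P g f) = Cmp C (far ?F g) (far ?F f)" unfolding far[OF cmpP[OF fg]] far[OF fg(1)] far[OF fg(2)] cmp[OF fg]
   by (rule arr1_Cmp[OF z car[OF fg(1)] car[OF fg(2)]])
 qed
 have lin: "linear_functor (B i) C (fctr_comp ?F (slot I B a i))" if a: "a \<in> Obj ?P" and i: "i \<in> I" for a i
 proof -
  interpret Bi: matcat "B i" "J' i" "d' i" "rh' i" by (rule B[OF i])
  let ?s = "\<lambda>f. (\<lambda>j\<in>I. Ide (B j) (a j))(i := f)"
  have sh: "?s f \<in> Homs ?P (a(i := x)) (a(i := y))" if "f \<in> Homs (B i) x y" for f x y by (rule slot_hom[OF _ a i that]) (rule B)
  have ax: "a(i := x) \<in> Obj ?P" if "x \<in> Obj (B i)" for x using a i that by (auto simp: prod_cat_simps PiE_iff extensional_def)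
  have id: "?s (Ide (B i) x) = Ide ?P (a(i := x))" for x using i by (auto simp: prod_cat_simps fun_eq_iff)
  have sc: "?s (Cmp (B i) g f) = Cmp ?P (?s g) (?s f)" if "f \<in> Homs (B i) x y" for f g x y
  proof -
   have "Cmp (B j) (Ide (B j) (a j)) (Ide (B j) (a j)) = Ide (B j) (a j)" if "j \<in> I" for j
    using matcat.Cmp_Ide_right[OF B[OF that] matcat.Ide_hom[OF B[OF that]]] a that by (auto simp: prod_cat_simps PiE_iff)
   then show ?thesis using i by (auto simp: prod_cat_simps fun_eq_iff)
  qed
  have F: "fob (fctr_comp ?F (slot I B a i)) x = fob ?F (a(i := x))"
   "far (fctr_comp ?F (slot I B a i)) f = far ?F (?s f)" for x f by (simp_all add: fctr_comp_def slot_def)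
  show ?thesis unfolding linear_functor_def is_functor_def F
  proof (intro conjI ballI allI)
   fix x assume x: "x \<in> Obj (B i)"
   show "fob ?F (a(i := x)) \<in> Obj C" "far ?F (?s (Ide (B i) x)) = Ide C (fob ?F (a(i := x)))"
    using fctr ax[OF x] unfolding is_functor_def id by auto
  next
   fix x y f assume f: "f \<in> Homs (B i) x y"
   show "far ?F (?s f) \<in> Homs C (fob ?F (a(i := x))) (fob ?F (a(i := y)))" using fctr sh[OF f] unfolding is_functor_def by blast
  next
   fix x y w f g assume f: "f \<in> Homs (B i) x y" and g: "g \<in> Homs (B i) y w"
   show "far ?F (?s (Cmp (B i) g f)) = Cmp C (far ?F (?s g)) (far ?F (?s f))"
    unfolding sc[OF f] using fctr sh[OF f] sh[OF g] unfolding is_functor_def by blast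
  next
   fix x y f g and r :: 'k assume f: "f \<in> Homs (B i) x y" and g: "g \<in> Homs (B i) x y"
   show "far ?F (?s (AddA (B i) f g)) = AddA C (far ?F (?s f)) (far ?F (?s g))"
    unfolding far[OF sh[OF f]] far[OF sh[OF g]] far[OF sh[OF Bi.Add_hom[OF f g]]] add[OF a i f g]
    by (rule arr1_Add[OF z car[OF sh[OF f]] car[OF sh[OF g]]])
   show "far ?F (?s (ScaleA (B i) r f)) = ScaleA C r (far ?F (?s f))"
    unfolding far[OF sh[OF f]] far[OF sh[OF Bi.Scale_hom[OF f]]] scale[OF a i f] by (rule arr1_Scale[OF z car[OF sh[OF f]]])
  qed
 qed
 have "exact_functor (B i) C (fctr_comp ?F (slot I B a i))" if "a \<in> Obj ?P" "i \<in> I" for a i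
  using linear_functor_exact[OF B[OF that(2)] matcat_axioms lin[OF that]] .
 then show ?thesis using fctr by (simp add: multi_exact_def)
qed

text \<open>The functor takes a tuple to the tensor product of the multiplicity spaces of the simple
  objects \<open>t i\<close> in its entries. On arrows this is a Kronecker product, which is
  functorial and linear in each slot.\<close>

lemma (in matcat) kron_fctr_multi_exact:
 assumes "finite I" and B: "\<And>i. i \<in> I ==> matcat (B i) (J' i) (d' i) (rh' i)" and z: "z \<in> J"
 shows "multi_exact I B C (slot_fctr C d rh z B I (\<lambda>x. \<Prod>i\<in>I. d' i (x i) (t i)) (\<lambda>f. kron I (\<lambda>i. rh' i (f i) (t i))))"
proof (rule slot_fctr_multi_exact[OF B z])
 have H: "f i \<in> Homs (B i) (a i) (b i)" if "f \<in> Homs (prod_cat I B) a b" "i \<in> I" for f a b i using that by (auto simp: Homs_prod_cat)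
 fix f a b assume f: "f \<in> Homs (prod_cat I B) a b"
 show "kron I (\<lambda>i. rh' i (f i) (t i)) \<in> carrier_mat (\<Prod>i\<in>I. d' i (b i) (t i)) (\<Prod>i\<in>I. d' i (a i) (t i))"
  by (rule kron_carrier) (rule matcat.rep_carrier[OF B H[OF f]])
next
 fix a assume a: "a \<in> Obj (prod_cat I B)"
 have "kron I (\<lambda>i. rh' i (Ide (prod_cat I B) a i) (t i)) = kron I (\<lambda>i. 1\<^sub>m (d' i (a i) (t i)))"
  using a matcat.rep_Ide[OF B] by (intro kron_cong) (auto simp: prod_cat_simps PiE_iff)
 then show "kron I (\<lambda>i. rh' i (Ide (prod_cat I B) a i) (t i)) = 1\<^sub>m (\<Prod>i\<in>I. d' i (a i) (t i))"
  by (simp add: kron_one[OF assms(1)])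
next
 have H: "f i \<in> Homs (B i) (a i) (b i)" if "f \<in> Homs (prod_cat I B) a b" "i \<in> I" for f a b i using that by (auto simp: Homs_prod_cat)
 fix f g a b c assume f: "f \<in> Homs (prod_cat I B) a b" and g: "g \<in> Homs (prod_cat I B) b c"
 have "kron I (\<lambda>i. rh' i (Cmp (prod_cat I B) g f i) (t i)) = kron I (\<lambda>i. rh' i (g i) (t i) * rh' i (f i) (t i))"
  using matcat.rep_Cmp[OF B H[OF f] H[OF g]] by (intro kron_cong) (auto simp: prod_cat_simps)
 also have "\<dots> = kron I (\<lambda>i. rh' i (g i) (t i)) * kron I (\<lambda>i. rh' i (f i) (t i))"
  by (rule kron_mult[OF assms(1) matcat.rep_carrier[OF B H[OF g]] matcat.rep_carrier[OF B H[OF f]]])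
 finally show "kron I (\<lambda>i. rh' i (Cmp (prod_cat I B) g f i) (t i)) =
  kron I (\<lambda>i. rh' i (g i) (t i)) * kron I (\<lambda>i. rh' i (f i) (t i))" .
next
 fix a i f g x y assume a: "a \<in> Obj (prod_cat I B)" and i: "i \<in> I"
  and f: "f \<in> Homs (B i) x y" and g: "g \<in> Homs (B i) x y"
 interpret Bi: matcat "B i" "J' i" "d' i" "rh' i" by (rule B[OF i])
 define A where "A = (\<lambda>j. rh' j (Ide (B j) (a j)) (t j))"
 define r where "r = (\<lambda>j. if j = i then d' i y (t i) else d' j (a j) (t j))"
 define c where "c = (\<lambda>j. if j = i then d' i x (t i) else d' j (a j) (t j))"
 have k: "kron I (\<lambda>j. rh' j (((\<lambda>j\<in>I. Ide (B j) (a j))(i := h)) j) (t j)) = kron I (A(i := rh' i h (t i)))" for h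
  by (intro kron_cong) (auto simp: A_def)
 have A: "A j \<in> carrier_mat (r j) (c j)" if "j \<in> I" "j \<noteq> i" for j
  using matcat.rep_carrier[OF B[OF that(1)] matcat.Ide_hom[OF B[OF that(1)]]] a that by (auto simp: A_def r_def c_def prod_cat_simps PiE_iff)
 show "kron I (\<lambda>j. rh' j (((\<lambda>j\<in>I. Ide (B j) (a j))(i := AddA (B i) f g)) j) (t j)) =
   kron I (\<lambda>j. rh' j (((\<lambda>j\<in>I. Ide (B j) (a j))(i := f)) j) (t j)) +
   kron I (\<lambda>j. rh' j (((\<lambda>j\<in>I. Ide (B j) (a j))(i := g)) j) (t j))" unfolding k Bi.rep_Add[OF f g]
  using Bi.rep_carrier[OF f] Bi.rep_carrier[OF g] by (intro kron_add_slot[OF assms(1) i _ _ A]) (auto simp: r_def c_def)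
next
 fix a i f s x y assume a: "a \<in> Obj (prod_cat I B)" and i: "i \<in> I" and f: "f \<in> Homs (B i) x y"
 interpret Bi: matcat "B i" "J' i" "d' i" "rh' i" by (rule B[OF i])
 define A where "A = (\<lambda>j. rh' j (Ide (B j) (a j)) (t j))"
 define r where "r = (\<lambda>j. if j = i then d' i y (t i) else d' j (a j) (t j))"
 define c where "c = (\<lambda>j. if j = i then d' i x (t i) else d' j (a j) (t j))"
 have k: "kron I (\<lambda>j. rh' j (((\<lambda>j\<in>I. Ide (B j) (a j))(i := h)) j) (t j)) = kron I (A(i := rh' i h (t i)))" for h
  by (intro kron_cong) (auto simp: A_def)
 have A: "A j \<in> carrier_mat (r j) (c j)" if "j \<in> I" "j \<noteq> i" for j
  using matcat.rep_carrier[OF B[OF that(1)] matcat.Ide_hom[OF B[OF that(1)]]] a that by (auto simp: A_def r_def c_def prod_cat_simps PiE_iff)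
 show "kron I (\<lambda>j. rh' j (((\<lambda>j\<in>I. Ide (B j) (a j))(i := ScaleA (B i) s f)) j) (t j)) =
   s \<cdot>\<^sub>m kron I (\<lambda>j. rh' j (((\<lambda>j\<in>I. Ide (B j) (a j))(i := f)) j) (t j))"
  unfolding k Bi.rep_Scale[OF f] using Bi.rep_carrier[OF f] by (intro kron_smult_slot[OF assms(1) i _ A]) (auto simp: r_def c_def)
qed

text \<open>The case of one variable, stated with the matrix itself in place of a Kronecker product
  and its renumbered rows and columns.\<close>

lemma (in matcat) mult_fctr_multi_exact:
 assumes B: "matcat (B i) J' d' rh'" and z: "z \<in> J"
 shows "multi_exact {i} B C (slot_fctr C d rh z B {i} (\<lambda>x. d' (x i) s) (\<lambda>f. rh' (f i) s))"
proof -
 interpret B: matcat "B i" J' d' rh' by (rule B)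
 have BB: "matcat (B j) J' d' rh'" if "j \<in> {i}" for j using that B by simp
 show ?thesis by (rule slot_fctr_multi_exact[OF BB z])
   (auto simp: Homs_prod_cat B.rep_carrier B.rep_Ide B.rep_Cmp B.rep_Add B.rep_Scale prod_cat_simps PiE_iff)
qed

text \<open>Multi-exactness freezes the other variables at objects, that is, at identity arrows. For
  arbitrary arrows in the other slots, factor \<open>h(i := f)\<close> as the arrow that changes
  slot \<open>i\<close> only, followed by \<open>h\<close> with an identity in slot
  \<open>i\<close>; composition is bilinear.\<close>

lemma multi_exact_slot_linear:
 assumes B: "\<And>i. i \<in> I ==> matcat (B i) (J i) (d i) (rh i)" and D: "matcat D JD dD rhD"
  and Fn: "multi_exact I B D Fn" and h: "h \<in> Homs (prod_cat I B) x y"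
  and i: "i \<in> I" and f: "f \<in> Homs (B i) (x i) (y i)" and g: "g \<in> Homs (B i) (x i) (y i)"
 shows "far Fn (h(i := AddA (B i) f g)) = AddA D (far Fn (h(i := f))) (far Fn (h(i := g)))" (is ?add)
  and "far Fn (h(i := ScaleA (B i) r f)) = ScaleA D r (far Fn (h(i := f)))" (is ?scale)
proof -
 interpret D: matcat D JD dD rhD by fact
 interpret Bi: matcat "B i" "J i" "d i" "rh i" by (rule B[OF i])
 let ?P = "prod_cat I B"
 let ?s = "\<lambda>f. (\<lambda>j\<in>I. Ide (B j) (x j))(i := f)"
 have hh: "h j \<in> Homs (B j) (x j) (y j)" if "j \<in> I" for j using h that by (simp add: Homs_prod_cat)
 have ext: "x \<in> extensional I" "y \<in> extensional I" "h \<in> extensional I" using h by (auto simp: Homs_prod_cat)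
 have x: "x \<in> Obj ?P" using ext matcat.hom_ends[OF B hh] by (auto simp: prod_cat_simps PiE_iff)
 have xi: "x(i := x i) = x" by simp
 have xy: "x i \<in> Obj (B i)" "y i \<in> Obj (B i)" using Bi.hom_ends[OF f] by auto
 have s: "?s f \<in> Homs ?P x (x(i := y i))" if "f \<in> Homs (B i) (x i) (y i)" for f
 proof -
  have "?s f \<in> Homs ?P (x(i := x i)) (x(i := y i))" by (rule slot_hom[OF _ x i that]) (rule B)
  then show ?thesis by (simp only: xi)
 qed
 have k: "h(i := Ide (B i) (y i)) \<in> Homs ?P (x(i := y i)) y" using ext hh i Bi.Ide_hom[OF xy(2)] by (auto simp: Homs_prod_cat extensional_def)
 have dec: "h(i := f) = Cmp ?P (h(i := Ide (B i) (y i))) (?s f)" if f: "f \<in> Homs (B i) (x i) (y i)" for f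
 proof
  fix j show "(h(i := f)) j = Cmp ?P (h(i := Ide (B i) (y i))) (?s f) j"
   using i ext matcat.Cmp_Ide_right[OF B hh] Bi.Cmp_Ide_left[OF f] by (auto simp: prod_cat_simps extensional_def)
 qed
 have fc: "is_functor ?P D Fn" using Fn by (simp add: multi_exact_def)
 define G where "G = fctr_comp Fn (slot I B x i)"
 have G: "linear_functor (B i) D G" using Fn x i by (auto simp: multi_exact_def exact_functor_def G_def)
 have farG: "far G f = far Fn (?s f)" for f by (simp add: G_def fctr_comp_def slot_def)
 have fh: "far Fn (h(i := f)) = Cmp D (far Fn (h(i := Ide (B i) (y i)))) (far G f)" if f: "f \<in> Homs (B i) (x i) (y i)" for f
  unfolding dec[OF f] farG using fc s[OF f] k unfolding is_functor_def by blast
 have kD: "far Fn (h(i := Ide (B i) (y i))) \<in> Homs D (fob Fn (x(i := y i))) (fob Fn y)" using fc k unfolding is_functor_def by blast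
 have GD: "far G f \<in> Homs D (fob Fn x) (fob Fn (x(i := y i)))" if "f \<in> Homs (B i) (x i) (y i)" for f
  unfolding farG using fc s[OF that] unfolding is_functor_def by blast
 have "far G (AddA (B i) f g) = AddA D (far G f) (far G g)" "far G (ScaleA (B i) r f) = ScaleA D r (far G f)"
  using G f g unfolding linear_functor_def by blast+
 then show ?add ?scale unfolding fh[OF f] fh[OF g] fh[OF Bi.Add_hom[OF f g]] fh[OF Bi.Scale_hom[OF f]] using D.Cmp_Add_right[OF GD[OF f] GD[OF g] kD]
  by (simp_all add: D.hom_eqI[OF D.Cmp_hom[OF D.Scale_hom[OF GD[OF f]] kD] D.Scale_hom[OF D.Cmp_hom[OF GD[OF f] kD]]]
    D.rep_Cmp[OF D.Scale_hom[OF GD[OF f]] kD] D.rep_Scale[OF GD[OF f]] D.rep_Scale[OF D.Cmp_hom[OF GD[OF f] kD]]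
    D.rep_Cmp[OF GD[OF f] kD] mult_smult_distrib[OF D.rep_carrier[OF kD] D.rep_carrier[OF GD[OF f]]])
qed

lemma slot_fctr_far:
 "f \<in> Homs (prod_cat I B) a b ==>
  far (slot_fctr D dD rhD z B I dt M) f = matcat.arr1 D dD rhD z (dt a) (dt b) (M f)" using Homs_prod_ends[of f I B a b] by (simp add: slot_fctr_def)

lemma slot_fctr_fob: "fob (slot_fctr D dD rhD z B I dt M) x = matcat.ob1 D dD z (dt x)" by (simp add: slot_fctr_def)

lemma slot_fctr_degree:
 assumes "gmatcat Z JZ dZ rhZ" "z \<in> JZ"
  and "\<And>x n. x \<in> Obj (prod_cat I (\<lambda>i. tot (C i))) ==> (\<And>i. i \<in> I ==> gsupp (C i) (x i) \<subseteq> {n i}) ==>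
   dt x \<noteq> 0 ==> fst z = (\<Sum>i\<in>I. n i)"
 shows "degree_between I C Z (slot_fctr (tot Z) dZ rhZ z B I dt M) 0 0" unfolding degree_between_def slot_fctr_fob
proof (intro ballI allI impI)
 have Z: "matcat (tot Z) JZ dZ rhZ" using assms(1) by (simp add: gmatcat_def)
 fix x n m
 assume x: "x \<in> Obj (prod_cat I (\<lambda>i. tot (C i)))" and n: "\<forall>i\<in>I. gsupp (C i) (x i) \<subseteq> {n i}"
  and m: "m \<in> gsupp Z (matcat.ob1 (tot Z) dZ z (dt x))"
 have "gsupp Z (matcat.ob1 (tot Z) dZ z (dt x)) = fst ` {j. (if j = z then dt x else 0) \<noteq> 0}"
  using assms(1) matcat.ob1_Obj[OF Z assms(2)] matcat.dim_ob1[OF Z assms(2)] by (simp add: gmatcat_def)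
 then have "m = fst z \<and> dt x \<noteq> 0" using m by (auto split: if_splits)
 then show "int m - (\<Sum>i\<in>I. int (n i)) \<in> {0..0}" using assms(3)[OF x, of n] n by auto
qed

lemma degree_between_zeroD:
 assumes "degree_between I C D F 0 0" "x \<in> Obj (prod_cat I (\<lambda>i. tot (C i)))"
  "\<And>i. i \<in> I ==> gsupp (C i) (x i) \<subseteq> {n i}" "m \<in> gsupp D (fob F x)"
 shows "m = (\<Sum>i\<in>I. n i)"
proof -
 have "int m - (\<Sum>i\<in>I. int (n i)) \<in> {0..0}" using assms unfolding degree_between_def by auto
 then show ?thesis by (simp flip: of_nat_sum)
qed

section \<open>CoCartesian arrows and simple objects\<close>

text \<open>One component \<open>j\<close> of a coCartesian functor is tested against the object
  over \<open>{j}\<close> given by \<open>Z\<close>; the map \<open>ps\<close> sends all other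
  indices to the base point. By \<open>Zne\<close> the test functors can be placed at a simple
  object of the degree that makes them of degree 0.\<close>

locale cocart =
 fixes X Y :: "('o, 'm, 'k::field_char_0) tv_obj" and ph F j J d rh JY dY rhY
  and Z :: "('o, 'm, 'k) gcat" and JZ dZ rhZ
 assumes cc: "tv_cocartesian X Y ph F" and j: "j \<in> tv_idx Y" and finI: "finite (fib ph j)"
  and gX: "\<And>i. i \<in> fib ph j ==> gmatcat (tv_fam X i) (J i) (d i) (rh i)"
  and gY: "gmatcat (tv_fam Y j) JY dY rhY"
  and deg0: "degree_between (fib ph j) (tv_fam X) (tv_fam Y j) (F j) 0 0"
  and Z2: "graded_2vect Z" and gZ: "gmatcat Z JZ dZ rhZ" and Zne: "\<exists>k. (n, k) \<in> JZ"
begin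

abbreviation "I \<equiv> fib ph j"
abbreviation "B \<equiv> \<lambda>i. tot (tv_fam X i)"
abbreviation "B' \<equiv> \<lambda>i. tot (tv_fam Y i)"
abbreviation "P \<equiv> prod_cat I B"
abbreviation "Q \<equiv> prod_cat {j} B'"
abbreviation "Fn \<equiv> F j"
abbreviation "Zo \<equiv> \<lparr>tv_idx = {j}, tv_fam = \<lambda>_. Z\<rparr>"
abbreviation "ps \<equiv> [j \<mapsto> j]"
abbreviation "pt y \<equiv> (\<lambda>_\<in>{j}. y)"
abbreviation "S t \<equiv> (\<lambda>i\<in>I. matcat.simp_obj (B i) (d i) (t i))"

lemma BX: "i \<in> I ==> matcat (B i) (J i) (d i) (rh i)" using gX by (simp add: gmatcat_def)

sublocale D: matcat "tot (tv_fam Y j)" JY dY rhY using gY by (simp add: gmatcat_def)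
sublocale Zc: matcat "tot Z" JZ dZ rhZ using gZ by (simp add: gmatcat_def)

lemma fib_psi: "fib ps j = {j}" by (auto simp: fib_def)
lemma fib_comp: "fib (ps \<circ>\<^sub>m ph) j = I" by (auto simp: fib_def map_comp_def split: option.splits)

lemma tvF: "tv_mor X Y ph F" and pm: "pointed_map (tv_idx X) (tv_idx Y) ph" and me: "multi_exact I B (tot (tv_fam Y j)) Fn"
 using cc j by (auto simp: tv_cocartesian_def tv_mor_def)

lemma fcF: "is_functor P (tot (tv_fam Y j)) Fn" using me by (simp add: multi_exact_def)

lemma F_ob: "x \<in> Obj P ==> fob Fn x \<in> Obj (tot (tv_fam Y j))"
 and F_hom: "f \<in> Homs P a b ==> far Fn f \<in> Homs (tot (tv_fam Y j)) (fob Fn a) (fob Fn b)"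
 and F_cmp: "f \<in> Homs P a b ==> g \<in> Homs P b c ==> far Fn (Cmp P g f) = Cmp (tot (tv_fam Y j)) (far Fn g) (far Fn f)"
 and F_ide: "x \<in> Obj P ==> far Fn (Ide P x) = Ide (tot (tv_fam Y j)) (fob Fn x)" using fcF unfolding is_functor_def by blast+

lemma pt_Obj: "y \<in> Obj (tot (tv_fam Y j)) ==> pt y \<in> Obj Q" by (auto simp: prod_cat_simps)

lemma pt_Hom: "f \<in> Homs (tot (tv_fam Y j)) a b ==> pt f \<in> Homs Q (pt a) (pt b)" by (auto simp: Homs_prod_cat)

lemma Hom_P_ends: "f \<in> Homs P a b ==> a \<in> Obj P \<and> b \<in> Obj P"
 using matcat.hom_ends[OF BX] by (auto simp: Homs_prod_cat prod_cat_simps PiE_iff)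

lemma S_Obj: "t \<in> (PiE I J) ==> S t \<in> Obj P" using matcat.simp_Obj[OF BX] by (auto simp: prod_cat_simps PiE_iff)

lemma S_dim: "t \<in> (PiE I J) ==> i \<in> I ==> d i (S t i) = kdelta (t i)" using matcat.dim_simp[OF BX] by (auto simp: PiE_iff)

lemma comp_ext: "x \<in> extensional I ==> (\<lambda>j'\<in>fib ps j. h j' (restrict x (fib ph j'))) = pt (h j x)"
 unfolding fib_psi by (auto simp: extensional_restrict)

lemma comp_fob: "x \<in> Obj P ==> fob (tv_comp ps ph G F j) x = fob (G j) (pt (fob Fn x))"
 using comp_ext[of x "\<lambda>j'. fob (F j')"] by (simp add: tv_comp_def prod_cat_simps PiE_iff)

lemma comp_far: "f \<in> Homs P a b ==> far (tv_comp ps ph G F j) f = far (G j) (pt (far Fn f))"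
 using comp_ext[of f "\<lambda>j'. far (F j')"] by (simp add: tv_comp_def Homs_prod_cat)

lemma tv_mor_Y:
 assumes "multi_exact {j} B' (tot Z) G" "degree_between {j} (tv_fam Y) Z G 0 N"
 shows "tv_mor Y Zo ps (\<lambda>_. G)" using assms j by (auto simp: tv_mor_def fib_psi pointed_map_def)

lemma tv_mor_X:
 assumes "multi_exact I B (tot Z) G" "degree_between I (tv_fam X) Z G 0 N"
 shows "tv_mor X Zo (ps \<circ>\<^sub>m ph) (\<lambda>_. G)"
proof -
 have "pointed_map (tv_idx X) {j} (ps \<circ>\<^sub>m ph)"
  using pm by (auto simp: pointed_map_def map_comp_def ran_def split: option.splits if_splits)
 then show ?thesis using assms by (auto simp: tv_mor_def fib_comp)
qed

lemma tv_trans_Y: "tv_trans Y Zo ps G G' = (\<Pi>\<^sub>E j'\<in>{j}. nat_trans Q (tot Z) (G j') (G' j'))"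
 by (auto simp: tv_trans_def fib_prod_def fib_psi PiE_iff)

lemma tv_trans_X: "tv_trans X Zo (ps \<circ>\<^sub>m ph) G G' = (\<Pi>\<^sub>E j'\<in>{j}. nat_trans P (tot Z) (G j') (G' j'))"
 by (auto simp: tv_trans_def fib_prod_def fib_comp PiE_iff)

lemma rwhisker: "tv_rwhisker X Zo ps ph be F = (\<lambda>j'\<in>{j}. \<lambda>x\<in>Obj P. be j (pt (fob Fn x)))"
proof -
 have "tv_rwhisker X Zo ps ph be F j = (\<lambda>x\<in>Obj P. be j (pt (fob Fn x)))"
 proof
  fix x
  have "(\<lambda>j'\<in>fib ps j. fob (F j') (restrict x (fib ph j'))) = pt (fob Fn x)" if "x \<in> Obj P"
   using that comp_ext[of x "\<lambda>j'. fob (F j')"] by (simp add: prod_cat_simps PiE_iff)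
  then show "tv_rwhisker X Zo ps ph be F j x = (\<lambda>x\<in>Obj P. be j (pt (fob Fn x))) x"
   by (cases "x \<in> Obj P") (simp_all add: tv_rwhisker_def fib_prod_def fib_comp)
 qed
 moreover have "tv_rwhisker X Zo ps ph be F \<in> extensional {j}" unfolding tv_rwhisker_def by simp
 ultimately show ?thesis by (auto simp: fun_eq_iff extensional_def)
qed

lemma Zo: "is_tv_obj Zo" "pointed_map (tv_idx Y) (tv_idx Zo) ps" using Z2 j by (auto simp: is_tv_obj_def pointed_map_def)

lemma bij_whisker:
 assumes "tv_mor Y Zo ps G" "tv_mor Y Zo ps G'"
 shows "bij_betw (\<lambda>be. tv_rwhisker X Zo ps ph be F) (tv_trans Y Zo ps G G')
   (tv_trans X Zo (ps \<circ>\<^sub>m ph) (tv_comp ps ph G F) (tv_comp ps ph G' F))" using cc assms Zo unfolding tv_cocartesian_def by blast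

lemma ess_surj:
 assumes "tv_mor X Zo (ps \<circ>\<^sub>m ph) K"
 shows "\<exists>G. tv_mor Y Zo ps G \<and> tv_iso X Zo (ps \<circ>\<^sub>m ph) (tv_comp ps ph G F) K \<noteq> {}"
 using cc assms Zo unfolding tv_cocartesian_def by blast

text \<open>\<open>Gf s z\<close> is \<open>y \<mapsto> Hom (s, y)\<close>, and \<open>Kf t z\<close> is \<open>x \<mapsto> \<Otimes>\<^sub>i Hom (t\<^sub>i, x\<^sub>i)\<close>, placed at \<open>z\<close>.\<close>

abbreviation "Gf s z \<equiv> slot_fctr (tot Z) dZ rhZ z B' {j} (\<lambda>x. dY (x j) s) (\<lambda>f. rhY (f j) s)"
abbreviation "Kf t z \<equiv> slot_fctr (tot Z) dZ rhZ z B I (\<lambda>x. \<Prod>i\<in>I. d i (x i) (t i)) (\<lambda>f. kron I (\<lambda>i. rh i (f i) (t i)))"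

lemma Gf_mor:
 assumes "z \<in> JZ" "fst z = fst s"
 shows "tv_mor Y Zo ps (\<lambda>_. Gf s z)"
proof (rule tv_mor_Y)
 show "multi_exact {j} B' (tot Z) (Gf s z)" by (rule Zc.mult_fctr_multi_exact[where i = j and B = B', OF D.matcat_axioms assms(1)])
 show "degree_between {j} (tv_fam Y) Z (Gf s z) 0 0"
 proof (rule slot_fctr_degree[OF gZ assms(1)])
  fix x n assume x: "x \<in> Obj Q" and n: "\<And>i. i \<in> {j} ==> gsupp (tv_fam Y i) (x i) \<subseteq> {n i}" and nz: "dY (x j) s \<noteq> 0"
  have "gsupp (tv_fam Y j) (x j) = fst ` {i. dY (x j) i \<noteq> 0}" using gY x by (auto simp: gmatcat_def prod_cat_simps PiE_iff)
  then have "fst s \<in> {n j}" using nz n[of j] by blast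
  then show "fst z = (\<Sum>i\<in>{j}. n i)" using assms(2) by simp
 qed
qed

lemma Kf_mor:
 assumes "z \<in> JZ" "fst z = (\<Sum>i\<in>I. fst (t i))"
 shows "tv_mor X Zo (ps \<circ>\<^sub>m ph) (\<lambda>_. Kf t z)"
proof (rule tv_mor_X)
 show "multi_exact I B (tot Z) (Kf t z)" by (rule Zc.kron_fctr_multi_exact[OF finI BX assms(1)])
 show "degree_between I (tv_fam X) Z (Kf t z) 0 0"
 proof (rule slot_fctr_degree[OF gZ assms(1)])
  fix x n assume x: "x \<in> Obj P" and n: "\<And>i. i \<in> I ==> gsupp (tv_fam X i) (x i) \<subseteq> {n i}"
   and nz: "(\<Prod>i\<in>I. d i (x i) (t i)) \<noteq> 0"
  have "fst (t i) = n i" if i: "i \<in> I" for i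
  proof -
   have "gsupp (tv_fam X i) (x i) = fst ` {k. d i (x i) k \<noteq> 0}" using gX[OF i] x i by (auto simp: gmatcat_def prod_cat_simps PiE_iff)
   moreover have "d i (x i) (t i) \<noteq> 0" using nz i finI by (metis prod_zero)
   ultimately have "fst (t i) \<in> {n i}" using n[OF i] by blast
   then show ?thesis by simp
  qed
  then show "fst z = (\<Sum>i\<in>I. n i)" using assms(2) by simp
 qed
qed

lemma F_dims_zero:
 assumes "\<And>t. t \<in> (PiE I J) ==> dY (fob Fn (S t)) s = 0" and x: "x \<in> Obj P"
 shows "dY (fob Fn x) s = 0"
proof -
 have xi: "i \<in> I ==> x i \<in> Obj (B i)" for i using x by (auto simp: prod_cat_simps PiE_iff)
 have "dY (fob Fn x) s = (\<Sum>t\<in>(\<Pi>\<^sub>E i\<in>I. {k. d i (x i) k \<noteq> 0}). (\<Prod>i\<in>I. d i (x i) (t i)) * dY (fob Fn (S t)) s)"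
  using matcat.dim_finite[OF BX xi] matcat.dim_support[OF BX xi] by (intro multi_exact_dims[OF finI BX D.matcat_axioms me x]) auto
 also have "\<dots> = 0" using matcat.dim_support[OF BX xi] assms(1) by (intro sum.neutral) (auto simp: PiE_iff)
 finally show ?thesis .
qed

text \<open>If \<open>s\<close> never occurred, the functor \<open>Gf s z\<close> would vanish on
  all values of \<open>Fn\<close>. Its identity and its zero endomorphism would then agree after
  whiskering with \<open>F\<close>, against faithfulness.\<close>

lemma hits_every_simple:
 assumes s: "s \<in> JY"
 shows "\<exists>t\<in>(PiE I J). dY (fob Fn (S t)) s \<noteq> 0"
proof (rule ccontr)
 assume "\<not> ?thesis"
 then have z0: "dY (fob Fn x) s = 0" if "x \<in> Obj P" for x using F_dims_zero that by blast
 obtain k where z: "(fst s, k) \<in> JZ" using Zne by blast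
 define z where "z = (fst s, k)"
 note zJ = z[folded z_def]
 let ?G = "Gf s z"
 have mor: "tv_mor Y Zo ps (\<lambda>_. ?G)" by (rule Gf_mor[OF zJ]) (simp add: z_def)
 have fc: "is_functor Q (tot Z) ?G" using Zc.mult_fctr_multi_exact[where i = j and B = B', OF D.matcat_axioms zJ] by (simp add: multi_exact_def)
 define be where "be = (\<lambda>c::bool. \<lambda>j'\<in>{j}. \<lambda>x\<in>Obj Q. if c then Ide (tot Z) (fob ?G x) else ZeroA (tot Z) (fob ?G x) (fob ?G x))"
 have ob: "fob ?G x \<in> Obj (tot Z)" for x unfolding slot_fctr_fob by (rule Zc.ob1_Obj[OF zJ])
 have be: "be c \<in> tv_trans Y Zo ps (\<lambda>_. ?G) (\<lambda>_. ?G)" for c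
 proof -
  have "(\<lambda>x\<in>Obj Q. if c then Ide (tot Z) (fob ?G x) else ZeroA (tot Z) (fob ?G x) (fob ?G x)) \<in> nat_trans Q (tot Z) ?G ?G"
   unfolding nat_trans_def
  proof (intro CollectI conjI ballI allI)
   fix a b f assume f: "f \<in> Homs Q a b"
   then have ab: "a \<in> Obj Q" "b \<in> Obj Q" using D.hom_ends by (auto simp: Homs_prod_cat prod_cat_simps PiE_iff)
   have h: "far ?G f \<in> Homs (tot Z) (fob ?G a) (fob ?G b)" using fc f unfolding is_functor_def by blast
   show "Cmp (tot Z) (far ?G f) ((\<lambda>x\<in>Obj Q. if c then Ide (tot Z) (fob ?G x) else ZeroA (tot Z) (fob ?G x) (fob ?G x)) a)
    = Cmp (tot Z) ((\<lambda>x\<in>Obj Q. if c then Ide (tot Z) (fob ?G x) else ZeroA (tot Z) (fob ?G x) (fob ?G x)) b) (far ?G f)"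
    using ab ob by (simp add: Zc.Cmp_Ide_left[OF h] Zc.Cmp_Ide_right[OF h] Zc.Cmp_Zero[OF h])
  qed (use ob Zc.Ide_hom Zc.Zero_hom in auto)
  then show ?thesis unfolding tv_trans_Y be_def by auto
 qed
 have "tv_rwhisker X Zo ps ph (be True) F = tv_rwhisker X Zo ps ph (be False) F"
 proof -
  have "be True j (pt (fob Fn x)) = be False j (pt (fob Fn x))" if x: "x \<in> Obj P" for x
  proof -
   have e: "fob ?G (pt (fob Fn x)) = Zc.ob1 z 0" by (simp add: slot_fctr_fob z0[OF x])
   have "Ide (tot Z) (Zc.ob1 z 0) = ZeroA (tot Z) (Zc.ob1 z 0) (Zc.ob1 z 0)" by (rule Zc.hom_eqI1[OF zJ Zc.Ide_hom Zc.Zero_hom])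
     (auto simp: Zc.ob1_Obj[OF zJ] Zc.rep_Ide Zc.rep_Zero Zc.dim_ob1[OF zJ])
   then show ?thesis using pt_Obj[OF F_ob[OF x]] by (simp add: be_def e)
  qed
  then show ?thesis unfolding rwhisker by (auto simp: fun_eq_iff)
 qed
 then have "be True = be False" using bij_whisker[OF mor mor] be by (auto simp: bij_betw_def inj_on_def)
 then have "be True j (pt (D.simp_obj s)) = be False j (pt (D.simp_obj s))" by simp
 then have "Ide (tot Z) (Zc.ob1 z 1) = ZeroA (tot Z) (Zc.ob1 z 1) (Zc.ob1 z 1)"
  using pt_Obj[OF D.simp_Obj[OF s]] by (simp add: be_def slot_fctr_fob D.dim_simp[OF s] kdelta_def)
 then have "rhZ (Ide (tot Z) (Zc.ob1 z 1)) z $$ (0, 0) = rhZ (ZeroA (tot Z) (Zc.ob1 z 1) (Zc.ob1 z 1)) z $$ (0, 0)" by simp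
 then show False by (simp add: Zc.rep_Ide Zc.rep_Zero Zc.ob1_Obj[OF zJ] Zc.dim_ob1[OF zJ])
qed

text \<open>
 A Yoneda argument: a vector of \<open>Hom (s, Fn (S t))\<close> determines a transformation from \<open>Kf t z\<close>
 to \<open>Hom (s, Fn -)\<close>.
\<close>

lemma yoneda_trans:
 assumes t: "t \<in> (PiE I J)" and nz: "dY (fob Fn (S t)) s \<noteq> 0" and z: "z \<in> JZ"
 shows "\<exists>al\<in>nat_trans P (tot Z) (Kf t z) (tv_comp ps ph (\<lambda>_. Gf s z) F j). rhZ (al (S t)) z $$ (0, 0) = 1"
proof -
 define dd where "dd = (\<lambda>x i. d i (x i) (t i))"
 define \<iota> where "\<iota> = (\<lambda>x q. \<lambda>i\<in>I. matcat.inc (B i) (d i) (rh i) (t i) (x i) (q i))"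
 \<comment> \<open>Column \<open>c\<close> is the image of the first basis vector of
   \<open>Hom (s, Fn (S t))\<close> under \<open>Fn\<close> applied to the \<open>c\<close>-th tuple
   of inclusions of simple objects into \<open>x\<close>.\<close>
 define A where "A = (\<lambda>x. mat (dY (fob Fn x) s) (\<Prod>i\<in>I. dd x i)
   (\<lambda>(r, c). rhY (far Fn (\<iota> x (multi_idx I (dd x) c))) s $$ (r, 0)))"
 have tJ: "i \<in> I ==> t i \<in> J i" for i using t by (auto simp: PiE_iff)
 have xi: "x \<in> Obj P ==> i \<in> I ==> x i \<in> Obj (B i)" for x i by (auto simp: prod_cat_simps PiE_iff)
 have \<iota>h: "\<iota> x q \<in> Homs P (S t) x" if "x \<in> Obj P" for x q using matcat.inc_hom[OF BX tJ xi] that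
  by (auto simp: \<iota>_def Homs_prod_cat prod_cat_simps PiE_iff)
 have Acar: "A x \<in> carrier_mat (dY (fob Fn x) s) (\<Prod>i\<in>I. d i (x i) (t i))" for x by (simp add: A_def dd_def)
 define al where "al = (\<lambda>x\<in>Obj P. Zc.arr1 z (\<Prod>i\<in>I. d i (x i) (t i)) (dY (fob Fn x) s) (A x))"
 let ?GF = "tv_comp ps ph (\<lambda>_. Gf s z) F j"
 have fobGF: "fob ?GF x = Zc.ob1 z (dY (fob Fn x) s)" if "x \<in> Obj P" for x using that by (simp add: comp_fob slot_fctr_fob)
 have farGF: "far ?GF f = Zc.arr1 z (dY (fob Fn x) s) (dY (fob Fn y) s) (rhY (far Fn f) s)" if "f \<in> Homs P x y" for f x y
  using comp_far[OF that, of "\<lambda>_. Gf s z"]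
   slot_fctr_far[OF pt_Hom[OF F_hom[OF that]], of "tot Z" dZ rhZ z "\<lambda>x. dY (x j) s" "\<lambda>f. rhY (f j) s"] by simp
 \<comment> \<open>In each slot, \<open>f\<close> after an inclusion into \<open>x\<close> is a
   combination of inclusions into \<open>y\<close> whose coefficients form a column of the matrix of
   \<open>f\<close>. Multilinearity of \<open>Fn\<close> collects these columns into the Kronecker
   product.\<close>
 have nat: "rhY (far Fn f) s * A x = A y * kron I (\<lambda>i. rh i (f i) (t i))" if f: "f \<in> Homs P x y" for f x y
 proof -
  have x: "x \<in> Obj P" and y: "y \<in> Obj P" using Hom_P_ends[OF f] by auto
  have fi: "f i \<in> Homs (B i) (x i) (y i)" if "i \<in> I" for i using f that by (simp add: Homs_prod_cat)
  have fcar: "rh i (f i) (t i) \<in> carrier_mat (dd y i) (dd x i)" if "i \<in> I" for i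
   unfolding dd_def by (rule matcat.rep_carrier[OF BX[OF that] fi[OF that]])
  note kc = kron_carrier[of I "\<lambda>i. rh i (f i) (t i)", OF fcar]
  note Fc = D.rep_carrier[OF F_hom[OF f], of s]
  have Ac: "A w \<in> carrier_mat (dY (fob Fn w) s) (\<Prod>i\<in>I. dd w i)" for w by (simp add: A_def)
  show ?thesis
  proof (rule eq_matI)
   fix r c assume "r < dim_row (A y * kron I (\<lambda>i. rh i (f i) (t i)))" "c < dim_col (A y * kron I (\<lambda>i. rh i (f i) (t i)))"
   then have r: "r < dY (fob Fn y) s" and c: "c < (\<Prod>i\<in>I. dd x i)" using kc Ac[of y] by auto
   define q where "q = multi_idx I (dd x) c"
   have ql: "q i < dd x i" if "i \<in> I" for i using multi_idx_less[OF finI c that] by (simp add: q_def)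
   have h\<iota>: "\<iota> x q \<in> Homs P (S t) x" by (rule \<iota>h[OF x])
   note Fi = D.rep_carrier[OF F_hom[OF h\<iota>], of s]
   define g where "g = Cmp P f (\<iota> x q)"
   have gi: "g i = Cmp (B i) (f i) (matcat.inc (B i) (d i) (rh i) (t i) (x i) (q i))" if "i \<in> I" for i
    using that by (simp add: g_def \<iota>_def prod_cat_simps)
   have gh: "g i \<in> Homs (B i) (S t i) (y i)" if "i \<in> I" for i
    using matcat.Cmp_hom[OF BX matcat.inc_hom[OF BX tJ xi[OF x]] fi] that by (simp add: gi)
   have gE: "g \<in> (\<Pi>\<^sub>E i\<in>I. Homs (B i) (S t i) (y i))" using gh by (auto simp: PiE_iff g_def prod_cat_simps)
   have dS: "dY (fob Fn (S t)) s > 0" using nz by simp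
   have "(rhY (far Fn f) s * A x) $$ (r, c) = (\<Sum>k<dY (fob Fn x) s. rhY (far Fn f) s $$ (r, k) * rhY (far Fn (\<iota> x q)) s $$ (k, 0))"
    using r c Fc by (auto simp: A_def q_def scalar_prod_def atLeast0LessThan)
   also have "\<dots> = (rhY (far Fn f) s * rhY (far Fn (\<iota> x q)) s) $$ (r, 0)" using r Fc Fi dS by (auto simp: scalar_prod_def atLeast0LessThan)
   also have "rhY (far Fn f) s * rhY (far Fn (\<iota> x q)) s = rhY (far Fn g) s"
    unfolding g_def F_cmp[OF h\<iota> f] D.rep_Cmp[OF F_hom[OF h\<iota>] F_hom[OF f]] ..
   also have "rhY (far Fn g) s $$ (r, 0) = (\<Sum>p\<in>(\<Pi>\<^sub>E i\<in>I. {..<dd y i}). (\<Prod>i\<in>I. rh i (f i) (t i) $$ (p i, q i)) *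
     rhY (far Fn (\<lambda>i\<in>I. matcat.inc (B i) (d i) (rh i) (t i) (y i) (p i))) s $$ (r, 0))"
   proof (rule multilinear_expand[where Ps = "\<lambda>h. rhY (far Fn h) s $$ (r, 0)", OF finI _ gE])
    fix i p assume "i \<in> I" "p \<in> {..<dd y i}"
    then show "matcat.inc (B i) (d i) (rh i) (t i) (y i) p \<in> Homs (B i) (S t i) (y i)" using matcat.inc_hom[OF BX tJ xi[OF y]] by simp
   next
    fix h i assume h: "h \<in> (\<Pi>\<^sub>E i\<in>I. Homs (B i) (S t i) (y i))" and i: "i \<in> I"
    interpret Bi: matcat "B i" "J i" "d i" "rh i" by (rule BX[OF i])
    have hP: "h \<in> Homs P (S t) y" using h y by (auto simp: Homs_prod_cat PiE_iff prod_cat_simps)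
    have St: "S t i = Bi.simp_obj (t i)" using i by simp
    have upd: "h(i := u) \<in> Homs P (S t) y" if "u \<in> Homs (B i) (S t i) (y i)" for u
     using hP that i by (auto simp: Homs_prod_cat extensional_def)
    have L: "rhY (far Fn (h(i := g i))) s $$ (r, 0) = (\<Sum>p<d i (y i) (t i). rh i (g i) (t i) $$ (p, 0) *
      rhY (far Fn (h(i := Bi.inc (t i) (y i) p))) s $$ (r, 0))"
    proof (rule Bi.linear_functional_inc[OF tJ[OF i] xi[OF y i], where L = "\<lambda>u. rhY (far Fn (h(i := u))) s $$ (r, 0)"])
     show "g i \<in> Homs (B i) (Bi.simp_obj (t i)) (y i)" using gh[OF i] i by simp
     fix u v e assume uv: "u \<in> Homs (B i) (Bi.simp_obj (t i)) (y i)"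
     then have u: "u \<in> Homs (B i) (S t i) (y i)" using i by simp
     note Fu = F_hom[OF upd[OF u]]
     show "rhY (far Fn (h(i := ScaleA (B i) e u))) s $$ (r, 0) = e * rhY (far Fn (h(i := u))) s $$ (r, 0)" using r dS D.rep_carrier[OF Fu, of s]
       multi_exact_slot_linear(2)[OF _ D.matcat_axioms me hP i u u, of J d rh e] BX D.rep_Scale[OF Fu] by simp
     assume "v \<in> Homs (B i) (Bi.simp_obj (t i)) (y i)"
     then have v: "v \<in> Homs (B i) (S t i) (y i)" using i by simp
     note Fv = F_hom[OF upd[OF v]]
     show "rhY (far Fn (h(i := AddA (B i) u v))) s $$ (r, 0) =
       rhY (far Fn (h(i := u))) s $$ (r, 0) + rhY (far Fn (h(i := v))) s $$ (r, 0)" using r dS D.rep_carrier[OF Fu, of s] D.rep_carrier[OF Fv, of s]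
       multi_exact_slot_linear(1)[OF _ D.matcat_axioms me hP i u v, of J d rh] BX D.rep_Add[OF Fu Fv] by simp
    qed
    have ent: "rh i (g i) (t i) $$ (p, 0) = rh i (f i) (t i) $$ (p, q i)" if p: "p < dd y i" for p
    proof -
     have "rh i (g i) (t i) = rh i (f i) (t i) * mat (d i (x i) (t i)) (kdelta (t i) (t i)) (\<lambda>(r, c). if t i = t i \<and> r = q i then 1 else 0)"
      unfolding gi[OF i] Bi.rep_Cmp[OF Bi.inc_hom[OF tJ[OF i] xi[OF x i]] fi[OF i]] Bi.rep_inc[OF tJ[OF i] xi[OF x i]] ..
     then have "rh i (g i) (t i) $$ (p, 0) = (\<Sum>k<dd x i. rh i (f i) (t i) $$ (p, k) * (if k = q i then 1 else 0))"
      using p fcar[OF i] by (auto simp: scalar_prod_def atLeast0LessThan kdelta_def dd_def)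
     also have "\<dots> = (\<Sum>k<dd x i. if k = q i then rh i (f i) (t i) $$ (p, k) else 0)" by (intro sum.cong) auto
     also have "\<dots> = rh i (f i) (t i) $$ (p, q i)" using ql[OF i] by simp
     finally show ?thesis .
    qed
    show "rhY (far Fn (h(i := g i))) s $$ (r, 0) = (\<Sum>p\<in>{..<dd y i}. rh i (f i) (t i) $$ (p, q i) *
      rhY (far Fn (h(i := matcat.inc (B i) (d i) (rh i) (t i) (y i) p))) s $$ (r, 0))"
    proof -
     have "dd y i = d i (y i) (t i)" by (simp add: dd_def)
     then show ?thesis unfolding L by (intro sum.cong) (auto simp: ent)
    qed
   qed simp
   also have "\<dots> = (\<Sum>c'<\<Prod>i\<in>I. dd y i. (\<Prod>i\<in>I. rh i (f i) (t i) $$ (multi_idx I (dd y) c' i, q i)) *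
     rhY (far Fn (\<iota> y (multi_idx I (dd y) c'))) s $$ (r, 0))"
    unfolding \<iota>_def by (rule sum.reindex_bij_betw[OF bij_multi_idx[OF finI], symmetric])
   also have "\<dots> = (\<Sum>c'<\<Prod>i\<in>I. dd y i. A y $$ (r, c') * kron I (\<lambda>i. rh i (f i) (t i)) $$ (c', c))"
    using r c by (intro sum.cong refl) (simp add: kron_index[of I "\<lambda>i. rh i (f i) (t i)", OF fcar] A_def q_def mult.commute)
   also have "\<dots> = (A y * kron I (\<lambda>i. rh i (f i) (t i))) $$ (r, c)"
    using r c kc Ac[of y] by (auto simp: scalar_prod_def atLeast0LessThan)
   finally show "(rhY (far Fn f) s * A x) $$ (r, c) = (A y * kron I (\<lambda>i. rh i (f i) (t i))) $$ (r, c)" .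
  qed (use Fc Ac[of x] Ac[of y] kc in auto)
 qed
 have "al \<in> nat_trans P (tot Z) (Kf t z) ?GF" unfolding nat_trans_def
 proof (intro CollectI conjI allI ballI)
  show "al \<in> (\<Pi>\<^sub>E a\<in>Obj P. Homs (tot Z) (fob (Kf t z) a) (fob ?GF a))"
   using Zc.arr1_hom[OF z Acar] by (auto simp: al_def fobGF slot_fctr_fob)
  fix x y f assume f: "f \<in> Homs P x y"
  have xy: "x \<in> Obj P" "y \<in> Obj P" using Hom_P_ends[OF f] by auto
  have "f i \<in> Homs (B i) (x i) (y i)" if "i \<in> I" for i using f that by (simp add: Homs_prod_cat)
  from matcat.rep_carrier[OF BX this]
  have kc: "kron I (\<lambda>i. rh i (f i) (t i)) \<in> carrier_mat (\<Prod>i\<in>I. d i (y i) (t i)) (\<Prod>i\<in>I. d i (x i) (t i))"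
   by (intro kron_carrier) auto
  show "Cmp (tot Z) (far ?GF f) (al x) = Cmp (tot Z) (al y) (far (Kf t z) f)" unfolding farGF[OF f] slot_fctr_far[OF f] using xy
   by (simp add: al_def nat[OF f] flip: Zc.arr1_Cmp[OF z Acar D.rep_carrier[OF F_hom[OF f]]] Zc.arr1_Cmp[OF z kc Acar])
 qed
 moreover have "rhZ (al (S t)) z $$ (0, 0) = 1"
 proof -
  note So = S_Obj[OF t]
  have one: "(\<Prod>i\<in>I. dd (S t) i) = 1" using S_dim[OF t] by (intro prod.neutral) (auto simp: dd_def kdelta_def)
  define q where "q = multi_idx I (dd (S t)) 0"
  have q0: "q i = 0" if "i \<in> I" for i
   using multi_idx_less[OF finI, of 0 "dd (S t)" i] one that S_dim[OF t that] by (simp add: q_def dd_def kdelta_def)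
  \<comment> \<open>Each entry of \<open>S t\<close> has multiplicity 1, so there is a single tuple
    of inclusions, and it consists of identities.\<close>
  have "\<iota> (S t) q = Ide P (S t)"
  proof
   fix i show "\<iota> (S t) q i = Ide P (S t) i"
   proof (cases "i \<in> I")
    case True
    interpret Bi: matcat "B i" "J i" "d i" "rh i" by (rule BX[OF True])
    have so: "Bi.simp_obj (t i) \<in> Obj (B i)" by (rule Bi.simp_Obj[OF tJ[OF True]])
    have "Bi.inc (t i) (Bi.simp_obj (t i)) 0 = Ide (B i) (Bi.simp_obj (t i))"
     by (rule Bi.hom_eqI[OF Bi.inc_hom[OF tJ[OF True] so] Bi.Ide_hom[OF so]], rule eq_matI)
      (auto simp: Bi.rep_inc[OF tJ[OF True] so] Bi.rep_Ide[OF so] Bi.dim_simp[OF tJ[OF True]] kdelta_def split: if_splits)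
    then show ?thesis using True q0 by (simp add: \<iota>_def prod_cat_simps)
   qed (simp add: \<iota>_def prod_cat_simps)
  qed
  then have "rhY (far Fn (\<iota> (S t) q)) s = 1\<^sub>m (dY (fob Fn (S t)) s)" using F_ide[OF So] D.rep_Ide[OF F_ob[OF So]] by simp
  then have "A (S t) $$ (0, 0) = 1" using nz one by (simp add: A_def q_def)
  moreover have "al (S t) = Zc.arr1 z (\<Prod>i\<in>I. d i (S t i) (t i)) (dY (fob Fn (S t)) s) (A (S t))"
   unfolding al_def by (rule restrict_apply'[OF So])
  ultimately show ?thesis by (simp only: Zc.rep_arr1[OF z Acar]) simp
 qed
 ultimately show ?thesis by blast
qed

text \<open>Essential surjectivity provides \<open>G\<close> whose composite with \<open>F\<close>
  is isomorphic to \<open>Kf t z\<close>, a functor that vanishes on every tuple of simple objects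
  except \<open>S t\<close>, where it has dimension 1. Hence exactly one constituent
  \<open>s\<close> of \<open>Fn (S t)\<close> is seen by \<open>G\<close>; it has multiplicity 1 and
  occurs in no other image. Fullness excludes further constituents \<open>s'\<close>, on which
  \<open>G\<close> would vanish.\<close>

lemma simple_image:
 assumes t: "t \<in> (PiE I J)"
 shows "\<exists>s\<in>JY. dY (fob Fn (S t)) = kdelta s \<and> fst s = (\<Sum>i\<in>I. fst (t i)) \<and>
  (\<forall>t'\<in>(PiE I J). t' \<noteq> t \<longrightarrow> dY (fob Fn (S t')) s = 0)"
proof -
 note St = S_Obj[OF t]
 obtain k where "(\<Sum>i\<in>I. fst (t i), k) \<in> JZ" using Zne by blast
 then obtain z where z: "z \<in> JZ" and fz: "fst z = (\<Sum>i\<in>I. fst (t i))" by fastforce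
 obtain G \<theta> where G: "tv_mor Y Zo ps G"
  and "\<theta> \<in> tv_iso X Zo (ps \<circ>\<^sub>m ph) (tv_comp ps ph G F) (\<lambda>_. Kf t z)" using ess_surj[OF Kf_mor[OF z fz]] by blast
 then have \<theta>: "\<theta> j \<in> nat_trans P (tot Z) (tv_comp ps ph G F j) (Kf t z)"
  and iso: "\<And>x. x \<in> Obj P ==> is_iso (tot Z) (\<theta> j x)" unfolding tv_iso_def tv_trans_X by (auto simp: PiE_iff fib_prod_def fib_comp)
 have \<theta>h: "\<theta> j x \<in> Homs (tot Z) (fob (G j) (pt (fob Fn x))) (fob (Kf t z) x)" if "x \<in> Obj P" for x
  using \<theta> that by (auto simp: nat_trans_def PiE_iff comp_fob[OF that])
 have meG: "multi_exact {j} B' (tot Z) (G j)" using G by (simp add: tv_mor_def fib_psi)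
 define y0 where "y0 = fob Fn (S t)"
 have y0: "y0 \<in> Obj (tot (tv_fam Y j))" unfolding y0_def by (rule F_ob[OF St])
 define G1 where "G1 = fctr_comp (G j) (slot {j} B' (pt y0) j)"
 have exG: "exact_functor (tot (tv_fam Y j)) (tot Z) G1" using meG pt_Obj[OF y0] by (simp add: multi_exact_def G1_def)
 have G1: "fob G1 y = fob (G j) (pt y)" for y
 proof -
  have "(pt y0)(j := y) = pt y" by (auto simp: fun_eq_iff)
  then show ?thesis by (simp add: G1_def fctr_comp_def slot_def)
 qed
 \<comment> \<open>The multiplicity of \<open>z\<close> in the value of \<open>G\<close> at the
   simple object \<open>s\<close>; by additivity these numbers determine the multiplicity at every
   object.\<close>
 define g where "g = (\<lambda>s. dZ (fob G1 (D.simp_obj s)) z)"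
 have dims: "dZ (fob G1 y) z = (\<Sum>s | dY y s \<noteq> 0. dY y s * g s)" if y: "y \<in> Obj (tot (tv_fam Y j))" for y
  unfolding g_def using D.dim_finite[OF y] D.dim_support[OF y] by (intro exact_functor_dims[OF D.matcat_axioms Zc.matcat_axioms exG y]) auto
 have dK: "dZ (fob G1 (fob Fn x)) z = (\<Prod>i\<in>I. d i (x i) (t i))" if "x \<in> Obj P" for x
  using Zc.is_iso_dims[OF iso[OF that] \<theta>h[OF that]] by (simp add: G1 slot_fctr_fob Zc.dim_ob1[OF z])
 have prod_delta: "(\<Prod>i\<in>I. d i (S t' i) (t i)) = (if t' = t then 1 else 0)" if t': "t' \<in> (PiE I J)" for t'
 proof (cases "t' = t")
  case True
  then show ?thesis using S_dim[OF t'] by (auto simp: kdelta_def intro!: prod.neutral)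
 next
  case False
  then obtain i where "i \<in> I" "t' i \<noteq> t i" using t t' PiE_ext by blast
  then have "\<exists>i\<in>I. d i (S t' i) (t i) = 0" using S_dim[OF t'] by (intro bexI[of _ i]) (auto simp: kdelta_def)
  then show ?thesis using False finI prod_zero by auto
 qed
 have total: "(\<Sum>s | dY (fob Fn (S t')) s \<noteq> 0. dY (fob Fn (S t')) s * g s) = (if t' = t then 1 else 0)"
  if t': "t' \<in> (PiE I J)" for t' using dims[OF F_ob[OF S_Obj[OF t']]] dK[OF S_Obj[OF t']] prod_delta[OF t'] by simp
 have finS: "finite {s. dY (fob Fn (S t')) s \<noteq> 0}" if "t' \<in> (PiE I J)" for t' by (rule D.dim_finite[OF F_ob[OF S_Obj[OF that]]])
 \<comment> \<open>A sum of natural numbers equal to 1 has one summand 1 and all others 0.\<close>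
 have "\<exists>s\<in>{s. dY (fob Fn (S t)) s \<noteq> 0}. dY (fob Fn (S t)) s * g s = 1 \<and>
   (\<forall>s'\<in>{s. dY (fob Fn (S t)) s \<noteq> 0}. s \<noteq> s' \<longrightarrow> dY (fob Fn (S t)) s' * g s' = 0)"
  using total[OF t] sum_eq_1_iff[OF finS[OF t], of "\<lambda>s. dY (fob Fn (S t)) s * g s"] by simp
 then obtain s where s: "dY (fob Fn (S t)) s \<noteq> 0" "dY (fob Fn (S t)) s * g s = 1"
  and other: "\<And>s'. dY (fob Fn (S t)) s' \<noteq> 0 ==> s' \<noteq> s ==> g s' = 0" by auto
 have s1: "dY (fob Fn (S t)) s = 1" "g s = 1" using s(2) by auto
 have sJ: "s \<in> JY" by (rule D.dim_support[OF F_ob[OF St] s(1)])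
 have zero_elsewhere: "dY (fob Fn (S t')) s = 0" if t': "t' \<in> (PiE I J)" "t' \<noteq> t" for t'
 proof (rule ccontr)
  assume "dY (fob Fn (S t')) s \<noteq> 0"
  moreover have "\<forall>s\<in>{s. dY (fob Fn (S t')) s \<noteq> 0}. dY (fob Fn (S t')) s * g s = 0"
   using total[OF t'(1)] t'(2) finS[OF t'(1)] by (simp add: sum_eq_0_iff)
  ultimately have "dY (fob Fn (S t')) s \<noteq> 0 \<and> dY (fob Fn (S t')) s * g s = 0" by blast
  then show False using s1(2) by auto
 qed
 have deg: "fst s' = (\<Sum>i\<in>I. fst (t i))" if "dY (fob Fn (S t)) s' \<noteq> 0" for s'
 proof -
  have "gsupp (tv_fam X i) (S t i) \<subseteq> {fst (t i)}" if i: "i \<in> I" for i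
  proof -
   have "S t i \<in> Obj (B i)" using St i by (auto simp: prod_cat_simps PiE_iff)
   then have "gsupp (tv_fam X i) (S t i) = fst ` {k. d i (S t i) k \<noteq> 0}" using gX[OF i] by (simp add: gmatcat_def)
   then show ?thesis unfolding S_dim[OF t i] by (auto simp: kdelta_def)
  qed
  moreover have "fst s' \<in> gsupp (tv_fam Y j) (fob Fn (S t))" using gY F_ob[OF St] that by (auto simp: gmatcat_def)
  ultimately show ?thesis by (rule degree_between_zeroD[OF deg0 St])
 qed
 have "dY (fob Fn (S t)) s' = 0" if ne: "s' \<noteq> s" for s'
 proof (rule ccontr)
  assume nz: "dY (fob Fn (S t)) s' \<noteq> 0"
  have gz: "g s' = 0" using other[OF nz ne] .
  have s'J: "s' \<in> JY" by (rule D.dim_support[OF F_ob[OF St] nz])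
  have mor': "tv_mor Y Zo ps (\<lambda>_. Gf s' z)" using Gf_mor[OF z] deg[OF nz] fz by simp
  obtain al where al: "al \<in> nat_trans P (tot Z) (Kf t z) (tv_comp ps ph (\<lambda>_. Gf s' z) F j)"
   and al1: "rhZ (al (S t)) z $$ (0, 0) = 1" using yoneda_trans[OF t nz z] by blast
  have alh: "al x \<in> Homs (tot Z) (fob (Kf t z) x) (fob (tv_comp ps ph (\<lambda>_. Gf s' z) F j) x)" if "x \<in> Obj P" for x
   using al that by (auto simp: nat_trans_def PiE_iff)
  \<comment> \<open>Following \<theta> by the Yoneda transformation \<open>al\<close> gives a
    transformation from \<open>G\<close> after \<open>F\<close> to \<open>Gf s' z\<close> after
    \<open>F\<close>; by fullness it is the whiskering of some \<open>be\<close>.\<close>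
  define ga where "ga = (\<lambda>x\<in>Obj P. Cmp (tot Z) (al x) (\<theta> j x))"
  have ga: "(\<lambda>_\<in>{j}. ga) \<in> tv_trans X Zo (ps \<circ>\<^sub>m ph) (tv_comp ps ph G F) (tv_comp ps ph (\<lambda>_. Gf s' z) F)"
  proof -
   have "ga \<in> nat_trans P (tot Z) (tv_comp ps ph G F j) (tv_comp ps ph (\<lambda>_. Gf s' z) F j)" unfolding nat_trans_def
   proof (intro CollectI conjI allI ballI)
    show "ga \<in> (\<Pi>\<^sub>E a\<in>Obj P. Homs (tot Z) (fob (tv_comp ps ph G F j) a) (fob (tv_comp ps ph (\<lambda>_. Gf s' z) F j) a))"
     using Zc.Cmp_hom[OF \<theta>h alh] by (auto simp: ga_def comp_fob)
    fix x y f assume f: "f \<in> Homs P x y"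
    have xy: "x \<in> Obj P" "y \<in> Obj P" using Hom_P_ends[OF f] by auto
    let ?g1 = "far (tv_comp ps ph G F j) f" and ?g2 = "far (Kf t z) f" and ?g3 = "far (tv_comp ps ph (\<lambda>_. Gf s' z) F j) f"
    have n1: "Cmp (tot Z) ?g2 (\<theta> j x) = Cmp (tot Z) (\<theta> j y) ?g1" using \<theta> f by (auto simp: nat_trans_def)
    have n2: "Cmp (tot Z) ?g3 (al x) = Cmp (tot Z) (al y) ?g2" using al f by (auto simp: nat_trans_def)
    have h1: "?g1 \<in> Homs (tot Z) (fob (G j) (pt (fob Fn x))) (fob (G j) (pt (fob Fn y)))"
     using meG pt_Hom[OF F_hom[OF f]] unfolding multi_exact_def is_functor_def comp_far[OF f] by blast
    have h2: "?g2 \<in> Homs (tot Z) (fob (Kf t z) x) (fob (Kf t z) y)"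
     using Zc.kron_fctr_multi_exact[where I = I and B = B and J' = J and d' = d and rh' = rh and t = t, OF finI BX z] f
     unfolding multi_exact_def is_functor_def by blast
    have h3: "?g3 \<in> Homs (tot Z) (fob (tv_comp ps ph (\<lambda>_. Gf s' z) F j) x) (fob (tv_comp ps ph (\<lambda>_. Gf s' z) F j) y)"
     using Zc.mult_fctr_multi_exact[where i = j and B = B', OF D.matcat_axioms z] pt_Hom[OF F_hom[OF f]]
     unfolding multi_exact_def is_functor_def comp_far[OF f] comp_fob[OF xy(1)] comp_fob[OF xy(2)] by blast
    have "Cmp (tot Z) ?g3 (Cmp (tot Z) (al x) (\<theta> j x)) = Cmp (tot Z) (Cmp (tot Z) (al y) ?g2) (\<theta> j x)"
     unfolding Zc.Cmp_assoc[OF \<theta>h[OF xy(1)] alh[OF xy(1)] h3] n2 ..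
    also have "\<dots> = Cmp (tot Z) (al y) (Cmp (tot Z) (\<theta> j y) ?g1)"
     unfolding Zc.Cmp_assoc[OF \<theta>h[OF xy(1)] h2 alh[OF xy(2)], symmetric] n1 ..
    also have "\<dots> = Cmp (tot Z) (Cmp (tot Z) (al y) (\<theta> j y)) ?g1" by (rule Zc.Cmp_assoc[OF h1 \<theta>h[OF xy(2)] alh[OF xy(2)]])
    finally show "Cmp (tot Z) ?g3 (ga x) = Cmp (tot Z) (ga y) ?g1" using xy by (simp add: ga_def)
   qed
   then show ?thesis unfolding tv_trans_X by auto
  qed
  obtain be where w: "(\<lambda>_\<in>{j}. ga) = tv_rwhisker X Zo ps ph be F"
   and be: "be \<in> tv_trans Y Zo ps G (\<lambda>_. Gf s' z)" by (rule imageE[OF ga[folded bij_betw_imp_surj_on[OF bij_whisker[OF G mor']]]])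
  have ben: "be j \<in> nat_trans Q (tot Z) (G j) (Gf s' z)" using be unfolding tv_trans_Y by auto
  have "tv_rwhisker X Zo ps ph be F j (S t) = ga (S t)" unfolding w[symmetric] by simp
  then have beS: "be j (pt y0) = Cmp (tot Z) (al (S t)) (\<theta> j (S t))" using St by (simp add: rwhisker ga_def y0_def)
  have bh: "be j (pt y) \<in> Homs (tot Z) (fob (G j) (pt y)) (Zc.ob1 z (dY y s'))" if "y \<in> Obj (tot (tv_fam Y j))" for y
   using ben pt_Obj[OF that] by (auto simp: nat_trans_def PiE_iff slot_fctr_fob)
  \<comment> \<open>Project \<open>y0\<close> to its \<open>s'\<close>-isotypic part, on which \<open>G\<close> vanishes.\<close>
  define n where "n = dY y0 s'"
  define w where "w = D.ob1 s' n"
  have wO: "w \<in> Obj (tot (tv_fam Y j))" and wd: "dY w = (\<lambda>i. if i = s' then n else 0)"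
   unfolding w_def by (rule D.ob1_Obj[OF s'J], rule D.dim_ob1[OF s'J])
  define \<pi> where "\<pi> = D.mk y0 w (\<lambda>i. if i = s' then 1\<^sub>m n else 0\<^sub>m 0 (dY y0 i))"
  have c: "(if i = s' then 1\<^sub>m n else 0\<^sub>m 0 (dY y0 i)) \<in> carrier_mat (dY w i) (dY y0 i)" for i by (simp add: wd n_def)
  have \<pi>: "\<pi> \<in> Homs (tot (tv_fam Y j)) y0 w" "rhY \<pi> s' = 1\<^sub>m n"
   unfolding \<pi>_def by (rule D.mk_hom[OF y0 wO c], unfold D.rep_mk[OF y0 wO c], simp)
  have farp: "far (Gf s' z) (pt \<pi>) = Zc.arr1 z n n (1\<^sub>m n)"
   using slot_fctr_far[OF pt_Hom[OF \<pi>(1)], of "tot Z" dZ rhZ z "\<lambda>x. dY (x j) s'" "\<lambda>f. rhY (f j) s'"]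
   by (simp add: wd \<pi>(2) n_def)
  have wn: "dY w s' = n" by (simp add: wd)
  have "Cmp (tot Z) (far (Gf s' z) (pt \<pi>)) (be j (pt y0)) = Cmp (tot Z) (be j (pt w)) (far (G j) (pt \<pi>))"
   using ben pt_Hom[OF \<pi>(1)] by (auto simp: nat_trans_def)
  moreover have "Cmp (tot Z) (far (Gf s' z) (pt \<pi>)) (be j (pt y0)) = be j (pt y0)"
   unfolding farp Zc.arr1_Ide[OF z] using Zc.Cmp_Ide_left[OF bh[OF y0]] by (simp add: n_def)
  ultimately have be0: "be j (pt y0) = Cmp (tot Z) (be j (pt w)) (far (G j) (pt \<pi>))" by simp
  have Gp: "far (G j) (pt \<pi>) \<in> Homs (tot Z) (fob (G j) (pt y0)) (fob (G j) (pt w))"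
   using meG pt_Hom[OF \<pi>(1)] unfolding multi_exact_def is_functor_def by blast
  have Gw: "dZ (fob (G j) (pt w)) z = 0"
  proof -
   have "dZ (fob (G j) (pt w)) z = (\<Sum>s | dY w s \<noteq> 0. dY w s * g s)" using dims[OF wO] by (simp add: G1)
   also have "\<dots> = 0" using gz by (intro sum.neutral) (auto simp: wd)
   finally show ?thesis .
  qed
  have "rhZ (be j (pt y0)) z = rhZ (be j (pt w)) z * rhZ (far (G j) (pt \<pi>)) z" unfolding be0 by (rule Zc.rep_Cmp[OF Gp bh[OF wO]])
  moreover have "rhZ (be j (pt w)) z \<in> carrier_mat n 0" "rhZ (far (G j) (pt \<pi>)) z \<in> carrier_mat 0 (dZ (fob (G j) (pt y0)) z)"
   using Zc.rep_carrier[OF bh[OF wO], of z] Zc.rep_carrier[OF Gp, of z] by (simp_all add: Gw wn Zc.dim_ob1[OF z])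
  moreover have "dZ (fob (G j) (pt y0)) z = 1" using dK[OF St] prod_delta[OF t] by (simp add: G1 y0_def)
  ultimately have bz: "rhZ (be j (pt y0)) z = 0\<^sub>m n 1" by (intro eq_matI) (auto simp: scalar_prod_def)
  \<comment> \<open>An inverse of \<theta> at \<open>S t\<close>; it recovers
    \<open>al (S t)\<close> from \<open>be\<close>, whose \<open>z\<close>-component has just been
    shown to be zero.\<close>
  obtain et where et: "et \<in> Homs (tot Z) (fob (Kf t z) (S t)) (fob (G j) (pt (fob Fn (S t))))"
   "Cmp (tot Z) (\<theta> j (S t)) et = Ide (tot Z) (fob (Kf t z) (S t))"
   using iso[OF St] \<theta>h[OF St] by (auto simp: is_iso_def is_inverse_def Homs_def)
  have "al (S t) = Cmp (tot Z) (be j (pt y0)) et"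
   unfolding beS Zc.Cmp_assoc[OF et(1) \<theta>h[OF St] alh[OF St], symmetric] et(2) Zc.Cmp_Ide_right[OF alh[OF St]] ..
  then have "rhZ (al (S t)) z = rhZ (be j (pt y0)) z * rhZ et z" using Zc.rep_Cmp[OF et(1) bh[OF y0, unfolded y0_def]] by (simp add: y0_def)
  moreover have "rhZ et z \<in> carrier_mat 1 1" using Zc.rep_carrier[OF et(1), of z] \<open>dZ (fob (G j) (pt y0)) z = 1\<close> prod_delta[OF t]
   by (simp add: y0_def slot_fctr_fob Zc.dim_ob1[OF z])
  ultimately have "rhZ (al (S t)) z = 0\<^sub>m n 1" unfolding bz by (simp add: left_mult_zero_mat)
  moreover have "n > 0" using nz by (simp add: n_def y0_def)
  ultimately show False using al1 by simp
 qed
 then have "dY (fob Fn (S t)) = kdelta s" using s1 by (auto simp: kdelta_def fun_eq_iff)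
 then show ?thesis using sJ deg[OF s(1)] zero_elsewhere by blast
qed

text \<open>Images of distinct tuples have no common constituent, which gives injectivity;
  surjectivity is \<open>hits_every_simple\<close>.\<close>

lemma ex_simple_bij:
 "\<exists>ta. bij_betw ta (PiE I J) JY \<and>
   (\<forall>t\<in>(PiE I J). dY (fob Fn (S t)) = kdelta (ta t) \<and> fst (ta t) = (\<Sum>i\<in>I. fst (t i)))"
proof -
 define R where "R t s \<longleftrightarrow> s \<in> JY \<and> dY (fob Fn (S t)) = kdelta s \<and> fst s = (\<Sum>i\<in>I. fst (t i)) \<and>
   (\<forall>t'\<in>(PiE I J). t' \<noteq> t \<longrightarrow> dY (fob Fn (S t')) s = 0)" for t s
 have "\<forall>t\<in>(PiE I J). \<exists>s. R t s"
 proof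
  fix t assume "t \<in> (PiE I J)"
  from simple_image[OF this] show "\<exists>s. R t s" unfolding R_def by (elim bexE) (rule exI, elim conjE, intro conjI)
 qed
 from bchoice[OF this] obtain ta where "\<forall>t\<in>(PiE I J). R t (ta t)" by (elim exE)
 then have R: "R t (ta t)" if "t \<in> (PiE I J)" for t using that by (rule bspec)
 have ta: "ta t \<in> JY" "dY (fob Fn (S t)) = kdelta (ta t)" "fst (ta t) = (\<Sum>i\<in>I. fst (t i))"
  if "t \<in> (PiE I J)" for t using R[OF that] by (simp_all only: R_def)
 have zero: "dY (fob Fn (S t')) (ta t) = 0"
  if "t \<in> (PiE I J)" "t' \<in> (PiE I J)" "t' \<noteq> t" for t t'
  using bspec[OF R[OF that(1), unfolded R_def, THEN conjunct2, THEN conjunct2, THEN conjunct2] that(2)] that(3) by (rule mp)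
 have "inj_on ta (PiE I J)"
 proof (rule inj_onI, rule ccontr)
  fix t t' assume t: "t \<in> (PiE I J)" "t' \<in> (PiE I J)" "ta t = ta t'" "t \<noteq> t'"
  then have "t' \<noteq> t" by simp
  from zero[OF t(1,2) this] have "kdelta (ta t') (ta t) = 0" unfolding ta(2)[OF t(2)] .
  then show False using t(3) by (simp add: kdelta_def)
 qed
 moreover have "JY \<subseteq> ta ` (PiE I J)"
 proof
  fix s assume "s \<in> JY"
  then obtain t where t: "t \<in> (PiE I J)" "dY (fob Fn (S t)) s \<noteq> 0" using hits_every_simple by blast
  have "kdelta (ta t) s \<noteq> 0" using t(2) unfolding ta(2)[OF t(1)] .
  then have "s = ta t" by (simp add: kdelta_def split: if_splits)
  then show "s \<in> ta ` (PiE I J)" using t by blast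
 qed
 ultimately have "bij_betw ta (PiE I J) JY" using ta(1) unfolding bij_betw_def by blast
 then show ?thesis by (intro exI[of _ ta] conjI ballI ta(2,3))
qed

end

section \<open>Arrows between collections of finite sets\<close>

declare One_nat_def [simp del]

text \<open>One point over every index in \<open>U\<close>. An SSH structure turns it into a family
  of copies, up to equivalence, of the category of one point.\<close>

definition fs_disc :: "nat set => fs_obj" where
 "fs_disc U = \<lparr>fs_idx = U, fs_fam = (\<lambda>i. if i \<in> U then {1} else {})\<rparr>"

definition pbase :: "nat set => (nat => nat) => nat \<rightharpoonup> nat" where
 "pbase V f = (\<lambda>i. if i \<in> V then Some (f i) else None)"

text \<open>The arrow over the partial map that is \<open>f\<close> on \<open>V\<close> and sends
  the rest of \<open>U\<close> to the base point; between one-point sets it is the only one.\<close>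

definition disc_map :: "nat set => nat set => nat set => (nat => nat) => fs_arr" where
 "disc_map U V W f = \<lparr>fs_src = fs_disc U, fs_tgt = fs_disc W, fs_base = pbase V f,
   fs_map = (\<lambda>i\<in>V. \<lambda>_\<in>{1}. 1)\<rparr>"

text \<open>The universal arrow from a family of points to their union; its image under an SSH
  structure is the external tensor product.\<close>

definition box :: "nat set => fs_arr" where
 "box U = \<lparr>fs_src = fs_disc U, fs_tgt = fs_one U, fs_base = pbase U (\<lambda>_. 1),
   fs_map = (\<lambda>i\<in>U. \<lambda>_\<in>{1}. i)\<rparr>"

abbreviation proj :: "nat set => nat => fs_arr" where
 "proj U u \<equiv> disc_map U {u} {1} (\<lambda>_. 1)"

abbreviation fold_arr :: "nat set => fs_arr" where
 "fold_arr U \<equiv> disc_map U U {1} (\<lambda>_. 1)"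

lemma fs_sel [simp]:
 "fs_idx (fs_disc U) = U" "fs_idx (fs_one U) = {1}"
 "fs_src (disc_map U V W f) = fs_disc U" "fs_tgt (disc_map U V W f) = fs_disc W" "fs_base (disc_map U V W f) = pbase V f"
 "fs_src (box U) = fs_disc U" "fs_tgt (box U) = fs_one U" "fs_base (box U) = pbase U (\<lambda>_. 1)"
 "fs_src (fs_one_map U W f) = fs_one U" "fs_tgt (fs_one_map U W f) = fs_one W"
 "fs_base (fs_one_map U W f) = pointed_id {1}" by (simp_all add: fs_disc_def fs_one_def disc_map_def box_def fs_one_map_def)

lemma fs_disc_1: "fs_disc {1} = fs_one {1}" by (auto simp: fs_disc_def fs_one_def)

lemma is_fs_obj_disc: "finite U ==> is_fs_obj (fs_disc U)" by (simp add: is_fs_obj_def fs_disc_def)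

lemma is_fs_obj_one: "finite U ==> is_fs_obj (fs_one U)" by (simp add: is_fs_obj_def fs_one_def)

lemma pbase_simps: "dom (pbase V f) = V" "ran (pbase V f) = f ` V" "pointed_id V = pbase V (\<lambda>i. i)"
 by (auto simp: pbase_def pointed_id_def dom_def ran_def)

lemma fib_pbase: "fib (pbase V f) w = {v\<in>V. f v = w}" by (auto simp: fib_def pbase_def)

lemma pbase_comp: "pbase V' g \<circ>\<^sub>m pbase V f = pbase {v\<in>V. f v \<in> V'} (\<lambda>v. g (f v))"
 by (auto simp: pbase_def map_comp_def fun_eq_iff)

lemma pbase_cong: "V = V' ==> (\<And>v. v \<in> V' ==> f v = f' v) ==> pbase V f = pbase V' f'" by (auto simp: pbase_def)

lemma disc_map_hom:
 assumes "finite U" "finite W" "V \<subseteq> U" "f \<in> V \<rightarrow> W"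
 shows "disc_map U V W f \<in> fs_hom (fs_disc U) (fs_disc W) (pbase V f)" unfolding fs_hom_def mem_Collect_eq pointed_map_def pbase_simps
 using assms is_fs_obj_disc[of U] is_fs_obj_disc[of W] by (auto simp: disc_map_def fs_disc_def pbase_def split: if_splits)

lemma box_hom:
 assumes "finite U"
 shows "box U \<in> fs_hom (fs_disc U) (fs_one U) (pbase U (\<lambda>_. 1))" unfolding fs_hom_def mem_Collect_eq pointed_map_def pbase_simps
 using assms is_fs_obj_disc[OF assms] is_fs_obj_one[OF assms] by (auto simp: box_def fs_disc_def fs_one_def pbase_def)

lemma one_map_hom:
 assumes "finite U" "finite W" "f \<in> U \<rightarrow> W"
 shows "fs_one_map U W f \<in> fs_hom (fs_one U) (fs_one W) (pointed_id {1})" unfolding fs_hom_def mem_Collect_eq pointed_map_def pbase_simps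
 using assms is_fs_obj_one by (auto simp: fs_one_map_def fs_one_def pbase_def pointed_id_def split: if_splits)

lemma disc_map_comp:
 assumes "f \<in> V \<rightarrow> W" "V \<subseteq> U"
 shows "fs_comp (disc_map W V' X g) (disc_map U V W f) = disc_map U {v\<in>V. f v \<in> V'} X (\<lambda>v. g (f v))"
 unfolding fs_comp_def fs_sel pbase_comp pbase_simps using assms by (auto simp: disc_map_def pbase_def fs_disc_def fun_eq_iff)

lemma disc_map_cong:
 "V = V' ==> (\<And>v. v \<in> V' ==> f v = f' v) ==> disc_map U V W f = disc_map U V' W f'"
 unfolding disc_map_def using pbase_cong[of V V' f f'] by simp

text \<open>Naturality of \<open>box\<close>: a map of finite sets can be evaluated on families of
  points, fibre by fibre.\<close>

lemma one_map_box:
 assumes "f \<in> U \<rightarrow> W"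
 shows "fs_comp (fs_one_map U W f) (box U) = fs_comp (box W) (disc_map U U W f)" unfolding fs_comp_def fs_sel pbase_comp pbase_simps
 using assms by (auto simp: disc_map_def box_def fs_one_map_def pbase_def fs_disc_def fun_eq_iff)

lemma fold_box: "fs_comp (fs_one_map U {1} (\<lambda>_. 1)) (box U) = fold_arr U" unfolding fs_comp_def fs_sel pbase_comp pbase_simps
 by (auto simp: disc_map_def box_def fs_one_map_def pbase_def fs_disc_def fs_one_def fun_eq_iff)

lemma fold_one_map_comp:
 "f \<in> U \<rightarrow> W ==> fs_comp (fold_arr W) (disc_map U U W f) = fold_arr U" by (subst disc_map_comp) (auto intro: disc_map_cong)

section \<open>CoCartesian arrows between collections of finite sets\<close>

lemma fs_hom_base: "h \<in> fs_hom S T ch ==> fs_src h = S \<and> fs_tgt h = T \<and> fs_base h = ch" by (simp add: fs_hom_def)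

lemma fs_arr_eqI:
 assumes "h \<in> fs_hom S T ch" "h' \<in> fs_hom S T ch"
  and "\<And>i x. i \<in> dom ch ==> x \<in> fs_fam S i ==> fs_map h i x = fs_map h' i x"
 shows "h = h'"
proof -
 have m: "fs_map h \<in> (\<Pi>\<^sub>E i\<in>dom ch. fs_fam S i \<rightarrow>\<^sub>E fs_fam T (the (ch i)))"
  "fs_map h' \<in> (\<Pi>\<^sub>E i\<in>dom ch. fs_fam S i \<rightarrow>\<^sub>E fs_fam T (the (ch i)))"
  using assms(1,2) by (simp_all add: fs_hom_def)
 have "fs_map h = fs_map h'"
 proof (rule PiE_ext[OF m])
  fix i assume i: "i \<in> dom ch"
  show "fs_map h i = fs_map h' i" using m i assms(3)[OF i] by (intro PiE_ext[of _ "fs_fam S i" "\<lambda>_. fs_fam T (the (ch i))"]) auto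
 qed
 then show ?thesis using assms(1,2) by (simp add: fs_hom_def)
qed

lemma fs_hom_map: "h \<in> fs_hom S T ch ==> ch i = Some k ==> x \<in> fs_fam S i ==> fs_map h i x \<in> fs_fam T k"
 unfolding fs_hom_def by (force simp: PiE_iff)

text \<open>An arrow out of the set \<open>U\<close> and an arrow out of the family of points of
  \<open>U\<close> consist of the same values; the inverse \<open>w\<close> moves a point from the
  index to the argument.\<close>

lemma box_cocartesian:
 assumes "finite U" shows "fs_cocartesian (box U)" unfolding fs_cocartesian_def fs_sel
proof (intro conjI allI impI)
 show "is_fs_arr (box U)" using box_hom[OF assms] by (simp add: is_fs_arr_def)
 fix Z ps assume Z: "is_fs_obj Z" and ps: "pointed_map {1} (fs_idx Z) ps"
 let ?ch = "ps \<circ>\<^sub>m pbase U (\<lambda>_. 1)"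
 have ch: "?ch i = (if i \<in> U then ps 1 else None)" for i by (simp add: pbase_def map_comp_def)
 have pch: "pointed_map U (fs_idx Z) ?ch" using ps by (auto simp: pointed_map_def ran_def dom_def ch split: if_splits)
 define w where "w = (\<lambda>h :: fs_arr. \<lparr>fs_src = fs_one U, fs_tgt = Z, fs_base = ps, fs_map = (\<lambda>i\<in>dom ps. \<lambda>x\<in>U. fs_map h x 1)\<rparr>)"
 have cm: "fs_comp g (box U) \<in> fs_hom (fs_disc U) Z ?ch" if g: "g \<in> fs_hom (fs_one U) Z ps" for g
 proof -
  have "fs_map g 1 i \<in> fs_fam Z k" if "i \<in> U" "ps 1 = Some k" for i k using fs_hom_map[OF g that(2)] that(1) by (simp add: fs_one_def)
  then show ?thesis using fs_hom_base[OF g] Z pch is_fs_obj_disc[OF assms]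
   by (auto simp: fs_hom_def fs_comp_def ch fs_disc_def box_def pbase_def dom_def)
 qed
 have wm: "w h \<in> fs_hom (fs_one U) Z ps" if h: "h \<in> fs_hom (fs_disc U) Z ?ch" for h
 proof -
  have "fs_map h x 1 \<in> fs_fam Z k" if "x \<in> U" "ps 1 = Some k" for x k using fs_hom_map[OF h, of x k 1] that by (simp add: ch fs_disc_def)
  moreover have "dom ps \<subseteq> {1}" using ps by (simp add: pointed_map_def)
  ultimately show ?thesis using Z ps is_fs_obj_one[OF assms] by (auto simp: fs_hom_def w_def fs_one_def)
 qed
 show "bij_betw (\<lambda>g. fs_comp g (box U)) (fs_hom (fs_one U) Z ps) (fs_hom (fs_disc U) Z ?ch)"
 proof (rule bij_betw_byWitness[where f' = w])
  show "\<forall>g\<in>fs_hom (fs_one U) Z ps. w (fs_comp g (box U)) = g"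
  proof
   fix g assume g: "g \<in> fs_hom (fs_one U) Z ps"
   show "w (fs_comp g (box U)) = g"
   proof (rule fs_arr_eqI[OF wm[OF cm[OF g]] g])
    fix i x assume i: "i \<in> dom ps" and x: "x \<in> fs_fam (fs_one U) i"
    have "i = 1" using ps i by (auto simp: pointed_map_def)
    then show "fs_map (w (fs_comp g (box U))) i x = fs_map g i x"
     using i x fs_hom_base[OF g] by (auto simp: w_def fs_comp_def ch fs_one_def fs_disc_def box_def pbase_def dom_def)
   qed
  qed
  show "\<forall>h\<in>fs_hom (fs_disc U) Z ?ch. fs_comp (w h) (box U) = h"
  proof
   fix h assume h: "h \<in> fs_hom (fs_disc U) Z ?ch"
   show "fs_comp (w h) (box U) = h"
   proof (rule fs_arr_eqI[OF cm[OF wm[OF h]] h])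
    fix i x assume i: "i \<in> dom ?ch" and x: "x \<in> fs_fam (fs_disc U) i"
    then have "i \<in> U" "x = 1" "ps 1 \<noteq> None" by (auto simp: ch fs_disc_def split: if_splits)
    then show "fs_map (fs_comp (w h) (box U)) i x = fs_map h i x" by (auto simp: w_def fs_comp_def ch fs_disc_def box_def pbase_def)
   qed
  qed
 qed (use cm wm in auto)
qed

text \<open>The omitted indices go to the base point, so an arrow out of the family over the
  composite base map is determined by its value at \<open>u\<close>.\<close>

lemma proj_cocartesian:
 assumes "finite U" "u \<in> U" shows "fs_cocartesian (proj U u)" unfolding fs_cocartesian_def fs_sel
proof (intro conjI allI impI)
 show "is_fs_arr (proj U u)" using disc_map_hom[of U "{1}" "{u}" "\<lambda>_. 1"] assms by (simp add: is_fs_arr_def)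
 fix Z ps assume Z: "is_fs_obj Z" and ps: "pointed_map {1} (fs_idx Z) ps"
 let ?ch = "ps \<circ>\<^sub>m pbase {u} (\<lambda>_. 1)"
 have ch: "?ch i = (if i = u then ps 1 else None)" for i by (simp add: pbase_def map_comp_def)
 have pch: "pointed_map U (fs_idx Z) ?ch" using ps assms(2) by (auto simp: pointed_map_def ran_def dom_def ch split: if_splits)
 define w where "w = (\<lambda>h :: fs_arr. \<lparr>fs_src = fs_disc {1}, fs_tgt = Z, fs_base = ps, fs_map = (\<lambda>i\<in>dom ps. \<lambda>x\<in>{1}. fs_map h u x)\<rparr>)"
 have cm: "fs_comp g (proj U u) \<in> fs_hom (fs_disc U) Z ?ch" if g: "g \<in> fs_hom (fs_disc {1}) Z ps" for g
 proof -
  have "fs_map g 1 1 \<in> fs_fam Z k" if "ps 1 = Some k" for k using fs_hom_map[OF g that] by (simp add: fs_disc_def)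
  then show ?thesis using fs_hom_base[OF g] Z pch is_fs_obj_disc[OF assms(1)] assms(2)
   by (auto simp: fs_hom_def fs_comp_def ch fs_disc_def disc_map_def pbase_def dom_def)
 qed
 have wm: "w h \<in> fs_hom (fs_disc {1}) Z ps" if h: "h \<in> fs_hom (fs_disc U) Z ?ch" for h
 proof -
  have "fs_map h u 1 \<in> fs_fam Z k" if "ps 1 = Some k" for k using fs_hom_map[OF h, of u k 1] that assms(2) by (simp add: ch fs_disc_def)
  moreover have "dom ps \<subseteq> {1}" using ps by (simp add: pointed_map_def)
  ultimately show ?thesis using Z ps is_fs_obj_disc[of "{1}"] by (auto simp: fs_hom_def w_def fs_disc_def)
 qed
 show "bij_betw (\<lambda>g. fs_comp g (proj U u)) (fs_hom (fs_disc {1}) Z ps) (fs_hom (fs_disc U) Z ?ch)"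
 proof (rule bij_betw_byWitness[where f' = w])
  show "\<forall>g\<in>fs_hom (fs_disc {1}) Z ps. w (fs_comp g (proj U u)) = g"
  proof
   fix g assume g: "g \<in> fs_hom (fs_disc {1}) Z ps"
   show "w (fs_comp g (proj U u)) = g"
   proof (rule fs_arr_eqI[OF wm[OF cm[OF g]] g])
    fix i x assume i: "i \<in> dom ps" and x: "x \<in> fs_fam (fs_disc {1}) i"
    have "i = 1" using ps i by (auto simp: pointed_map_def)
    then show "fs_map (w (fs_comp g (proj U u))) i x = fs_map g i x" using i x fs_hom_base[OF g] assms(2)
     by (auto simp: w_def fs_comp_def ch fs_disc_def disc_map_def pbase_def dom_def)
   qed
  qed
  show "\<forall>h\<in>fs_hom (fs_disc U) Z ?ch. fs_comp (w h) (proj U u) = h"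
  proof
   fix h assume h: "h \<in> fs_hom (fs_disc U) Z ?ch"
   show "fs_comp (w h) (proj U u) = h"
   proof (rule fs_arr_eqI[OF cm[OF wm[OF h]] h])
    fix i x assume i: "i \<in> dom ?ch" and x: "x \<in> fs_fam (fs_disc U) i"
    then have "i = u" "x = 1" "ps 1 \<noteq> None" using assms(2) by (auto simp: ch fs_disc_def split: if_splits)
    then show "fs_map (fs_comp (w h) (proj U u)) i x = fs_map h i x"
     using assms(2) by (auto simp: w_def fs_comp_def ch fs_disc_def disc_map_def pbase_def)
   qed
  qed
 qed (use cm wm in auto)
qed

declare One_nat_def [simp]

section \<open>Multiplicities of the functors of an SSH category\<close>

definition gpres ::
 "('o, 'm, 'k::field_char_0) gcat => (nat \<times> nat) set \<times> ((nat => 'o) => nat \<times> nat => nat)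
   \<times> ((nat => 'm) => nat \<times> nat => 'k mat)" where
 "gpres C = (SOME p. gmatcat C (fst p) (fst (snd p)) (snd (snd p)))"

definition "gJ C = fst (gpres C)"
definition "gd C = fst (snd (gpres C))"
definition "gr C = snd (snd (gpres C))"
definition "gs C = matcat.simp_obj (tot C) (gd C)"

lemma gmatcat_gpres:
 assumes "graded_2vect C" shows "gmatcat C (gJ C) (gd C) (gr C)"
proof -
 obtain J d rh where "gmatcat C J d rh" using graded_2vect_gmatcat[OF assms] by blast
 then have "\<exists>p. gmatcat C (fst p) (fst (snd p)) (snd (snd p))" by (intro exI[of _ "(J, d, rh)"]) simp
 then show ?thesis unfolding gJ_def gd_def gr_def gpres_def by (rule someI_ex)
qed

lemma graded_2vect_facts:
 assumes "graded_2vect C"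
 shows matcat_gpres: "matcat (tot C) (gJ C) (gd C) (gr C)"
  and gsupp_gd: "x \<in> Obj (tot C) ==> gsupp C x = fst ` {j. gd C x j \<noteq> 0}"
  and finite_gJ: "finite {j\<in>gJ C. fst j = n}"
  and gs_Obj: "t \<in> gJ C ==> gs C t \<in> Obj (tot C)"
  and gd_gs: "t \<in> gJ C ==> gd C (gs C t) = kdelta t"
proof -
 note g = gmatcat_gpres[OF assms]
 show m: "matcat (tot C) (gJ C) (gd C) (gr C)" using g by (simp add: gmatcat_def)
 show "x \<in> Obj (tot C) ==> gsupp C x = fst ` {j. gd C x j \<noteq> 0}" "finite {j\<in>gJ C. fst j = n}" using g by (simp_all add: gmatcat_def)
 show "t \<in> gJ C ==> gs C t \<in> Obj (tot C)" "t \<in> gJ C ==> gd C (gs C t) = kdelta t"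
  unfolding gs_def by (rule matcat.simp_Obj[OF m], assumption, rule matcat.dim_simp[OF m])
qed

lemma sum_PiE_delta:
 fixes h :: "('i => 'a) => nat"
 assumes "finite K" "\<And>k. k \<in> K ==> finite (P k)" "y \<in> (PiE K P) \<or> h y = 0"
 shows "(\<Sum>u\<in>(PiE K P). h u * (if u = y then 1 else 0)) = h y"
proof -
 have "(\<Sum>u\<in>(PiE K P). h u * (if u = y then 1 else 0)) = (\<Sum>u\<in>(PiE K P). if u = y then h y else 0)" by (intro sum.cong) auto
 also have "\<dots> = (if y \<in> (PiE K P) then h y else 0)" using assms by (intro sum.delta) (auto intro: finite_PiE)
 finally show ?thesis using assms(3) by auto
qed

text \<open>\<open>Z\<close> is the test category for coCartesian arrows; it enters through
  \<open>N_cocartesian\<close>.\<close>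

locale ssh =
 fixes H :: "('o, 'm, 'k::field_char_0) psfun" and Z :: "('o, 'm, 'k) gcat"
 assumes ssh: "SSH_category H" and Z2: "graded_2vect Z" and Zne: "\<exists>k. (n, k) \<in> gJ Z"
begin

abbreviation "fam S \<equiv> tv_fam (obH H S)"

text \<open>The multiplicity of the simple object \<open>s\<close> in the \<open>j\<close>-th
  component of \<open>H f\<close> at the tuple \<open>t\<close> of simple objects.\<close>

definition N :: "fs_arr => nat => nat \<times> nat => (nat => nat \<times> nat) => nat" where
 "N f j s t = gd (fam (fs_tgt f) j) (fob (arH H f j) (\<lambda>i\<in>fib (fs_base f) j. gs (fam (fs_src f) i) (t i))) s"

lemma pf: "pseudofunctor_over H" using ssh by (simp add: SSH_category_def)

lemma idx_obH: "is_fs_obj S ==> tv_idx (obH H S) = fs_idx S"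
 and g2: "is_fs_obj S ==> i \<in> fs_idx S ==> graded_2vect (fam S i)" using pf by (auto simp: pseudofunctor_over_def is_tv_obj_def)

context
 fixes f S T ph assumes f: "f \<in> fs_hom S T ph"
begin

lemma hom_facts:
 shows hom_src: "is_fs_obj S" and hom_tgt: "is_fs_obj T" and hom_sel: "fs_src f = S" "fs_tgt f = T" "fs_base f = ph"
  and fib_sub: "fib ph j \<subseteq> fs_idx S" and fib_finite: "finite (fib ph j)"
proof -
 show "is_fs_obj S" "is_fs_obj T" "fs_src f = S" "fs_tgt f = T" "fs_base f = ph" using f by (auto simp: fs_hom_def)
 show "fib ph j \<subseteq> fs_idx S" using f by (auto simp: fs_hom_def pointed_map_def fib_def)
 then show "finite (fib ph j)" using f by (auto simp: fs_hom_def is_fs_obj_def elim: finite_subset)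
qed

lemma fib_g2: "i \<in> fib ph j ==> graded_2vect (fam S i)" using g2[OF hom_src] fib_sub by blast

lemma arr_me: "j \<in> fs_idx T ==> multi_exact (fib ph j) (\<lambda>i. tot (fam S i)) (tot (fam T j)) (arH H f j)"
 and arr_deg: "j \<in> fs_idx T ==> degree_between (fib ph j) (fam S) (fam T j) (arH H f j) 0 0"
proof -
 have "tv_mor (obH H S) (obH H T) ph (arH H f)" using pf[unfolded pseudofunctor_over_def, THEN conjunct2, THEN conjunct1] f by blast
 moreover have "tv_degree_zero (obH H S) (obH H T) ph (arH H f)" using ssh[unfolded SSH_category_def, THEN conjunct2, THEN conjunct1] f by blast
 ultimately show "j \<in> fs_idx T ==> multi_exact (fib ph j) (\<lambda>i. tot (fam S i)) (tot (fam T j)) (arH H f j)"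
  "j \<in> fs_idx T ==> degree_between (fib ph j) (fam S) (fam T j) (arH H f j) 0 0"
  by (simp_all add: tv_mor_def tv_degree_zero_def idx_obH[OF hom_tgt])
qed

lemma arr_ob:
 assumes "j \<in> fs_idx T" "x \<in> Obj (prod_cat (fib ph j) (\<lambda>i. tot (fam S i)))"
 shows "fob (arH H f j) x \<in> Obj (tot (fam T j))" using arr_me[OF assms(1)] assms(2) by (auto simp: multi_exact_def is_functor_def)

lemma gs_tuple:
 assumes "t \<in> (\<Pi>\<^sub>E i\<in>fib ph j. gJ (fam S i))"
 shows "(\<lambda>i\<in>fib ph j. gs (fam S i) (t i)) \<in> Obj (prod_cat (fib ph j) (\<lambda>i. tot (fam S i)))"
 using assms gs_Obj[OF fib_g2] by (auto simp: prod_cat_simps PiE_iff)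

lemma N_eq: "N f j s t = gd (fam T j) (fob (arH H f j) (\<lambda>i\<in>fib ph j. gs (fam S i) (t i))) s" unfolding N_def hom_sel ..

lemma N_expand:
 assumes j: "j \<in> fs_idx T" and x: "x \<in> Obj (prod_cat (fib ph j) (\<lambda>i. tot (fam S i)))"
  and P: "\<And>i. i \<in> fib ph j ==> finite (P i) \<and> {k. gd (fam S i) (x i) k \<noteq> 0} \<subseteq> P i \<and> P i \<subseteq> gJ (fam S i)"
 shows "gd (fam T j) (fob (arH H f j) x) s =
  (\<Sum>t\<in>(\<Pi>\<^sub>E i\<in>fib ph j. P i). (\<Prod>i\<in>fib ph j. gd (fam S i) (x i) (t i)) * N f j s t)"
 unfolding N_eq gs_def by (rule multi_exact_dims[where B = "\<lambda>i. tot (fam S i)" and d = "\<lambda>i. gd (fam S i)",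
    OF fib_finite matcat_gpres[OF fib_g2] matcat_gpres[OF g2[OF hom_tgt j]] arr_me[OF j] x P])

lemma N_degree:
 assumes j: "j \<in> fs_idx T" and t: "t \<in> (\<Pi>\<^sub>E i\<in>fib ph j. gJ (fam S i))" and nz: "N f j s t \<noteq> 0"
 shows "s \<in> gJ (fam T j)" and "fst s = (\<Sum>i\<in>fib ph j. fst (t i))"
proof -
 note o = arr_ob[OF j gs_tuple[OF t]]
 show "s \<in> gJ (fam T j)" using matcat.dim_support[OF matcat_gpres[OF g2[OF hom_tgt j]] o] nz by (simp add: N_eq)
 have "gsupp (fam S i) (gs (fam S i) (t i)) \<subseteq> {fst (t i)}" if i: "i \<in> fib ph j" for i
 proof -
  have ti: "t i \<in> gJ (fam S i)" using t i by (auto simp: PiE_iff)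
  show ?thesis unfolding gsupp_gd[OF fib_g2[OF i] gs_Obj[OF fib_g2[OF i] ti]] gd_gs[OF fib_g2[OF i] ti] by (auto simp: kdelta_def)
 qed
 moreover have "fst s \<in> gsupp (fam T j) (fob (arH H f j) (\<lambda>i\<in>fib ph j. gs (fam S i) (t i)))"
  using nz gsupp_gd[OF g2[OF hom_tgt j] o] by (auto simp: N_eq)
 ultimately show "fst s = (\<Sum>i\<in>fib ph j. fst (t i))"
  using degree_between_zeroD[OF arr_deg[OF j] gs_tuple[OF t], of "\<lambda>i. fst (t i)"] by simp
qed

lemma N_finite:
 assumes j: "j \<in> fs_idx T" and t: "t \<in> (\<Pi>\<^sub>E i\<in>fib ph j. gJ (fam S i))"
 shows "finite {s. N f j s t \<noteq> 0}"
 using matcat.dim_finite[OF matcat_gpres[OF g2[OF hom_tgt j]] arr_ob[OF j gs_tuple[OF t]]] by (simp add: N_eq)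

lemma N_cocartesian:
 assumes "fs_cocartesian f" and j: "j \<in> fs_idx T"
 shows "\<exists>ta. bij_betw ta (\<Pi>\<^sub>E i\<in>fib ph j. gJ (fam S i)) (gJ (fam T j)) \<and>
  (\<forall>t\<in>(\<Pi>\<^sub>E i\<in>fib ph j. gJ (fam S i)). (\<forall>s. N f j s t = kdelta (ta t) s) \<and> fst (ta t) = (\<Sum>i\<in>fib ph j. fst (t i)))"
proof -
 interpret cocart "obH H S" "obH H T" ph "arH H f" j "\<lambda>i. gJ (fam S i)" "\<lambda>i. gd (fam S i)" "\<lambda>i. gr (fam S i)"
  "gJ (fam T j)" "gd (fam T j)" "gr (fam T j)" Z "gJ Z" "gd Z" "gr Z"
 proof
  show "tv_cocartesian (obH H S) (obH H T) ph (arH H f)" using ssh assms(1) unfolding SSH_category_def by (metis hom_sel)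
  show "j \<in> tv_idx (obH H T)" using j idx_obH[OF hom_tgt] by simp
  show "graded_2vect Z" by (rule Z2)
 qed (use gmatcat_gpres[OF fib_g2] gmatcat_gpres[OF g2[OF hom_tgt j]] gmatcat_gpres[OF Z2] arr_deg[OF j] fib_finite Zne in auto)
 obtain ta where "bij_betw ta (\<Pi>\<^sub>E i\<in>fib ph j. gJ (fam S i)) (gJ (fam T j))"
  and "\<And>t. t \<in> (\<Pi>\<^sub>E i\<in>fib ph j. gJ (fam S i)) ==>
   gd (fam T j) (fob (arH H f j) (\<lambda>i\<in>fib ph j. matcat.simp_obj (tot (fam S i)) (gd (fam S i)) (t i))) = kdelta (ta t) \<and>
   fst (ta t) = (\<Sum>i\<in>fib ph j. fst (t i))" using ex_simple_bij by (elim exE conjE) blast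
 then show ?thesis by (intro exI[of _ ta]) (simp add: N_eq gs_def)
qed

end

text \<open>The comparison isomorphism of the pseudofunctor identifies the multiplicities of
  \<open>H (g f)\<close> with those of the composite functor. Expanding the values of
  \<open>H f\<close> into simple objects gives a matrix product; the sets \<open>P j\<close> are
  finite and contain all constituents that occur.\<close>

lemma N_comp:
 assumes f: "f \<in> fs_hom S T ph" and g: "g \<in> fs_hom T U ps" and k: "k \<in> fs_idx U"
  and t: "t \<in> (\<Pi>\<^sub>E i\<in>fib (ps \<circ>\<^sub>m ph) k. gJ (fam S i))"
  and P: "\<And>j. j \<in> fib ps k ==> finite (P j) \<and> {s. N f j s (restrict t (fib ph j)) \<noteq> 0} \<subseteq> P j \<and> P j \<subseteq> gJ (fam T j)"
 shows "N (fs_comp g f) k s t =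
  (\<Sum>u\<in>(\<Pi>\<^sub>E j\<in>fib ps k. P j). (\<Prod>j\<in>fib ps k. N f j (u j) (restrict t (fib ph j))) * N g k s u)"
proof -
 let ?F = "tv_comp ps ph (arH H g) (arH H f) k" and ?G = "arH H (fs_comp g f) k"
 have sel: "fs_src (fs_comp g f) = S" "fs_tgt (fs_comp g f) = U" "fs_base (fs_comp g f) = ps \<circ>\<^sub>m ph"
  using hom_sel[OF f] hom_sel[OF g] by (simp_all add: fs_comp_def)
 have fib: "fib (ps \<circ>\<^sub>m ph) k \<subseteq> fs_idx S" using fib_sub[OF f] by (auto simp: fib_def map_comp_def split: option.splits)
 have sub: "fib ph j \<subseteq> fib (ps \<circ>\<^sub>m ph) k" if "j \<in> fib ps k" for j using that by (auto simp: fib_def map_comp_def)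
 define X where "X = (\<lambda>i\<in>fib (ps \<circ>\<^sub>m ph) k. gs (fam S i) (t i))"
 have XO: "X \<in> Obj (fib_prod (obH H S) (ps \<circ>\<^sub>m ph) k)"
 proof -
  have "gs (fam S i) (t i) \<in> Obj (tot (fam S i))" if "i \<in> fib (ps \<circ>\<^sub>m ph) k" for i
   using t fib that by (intro gs_Obj[OF g2[OF hom_src[OF f]]]) (auto simp: PiE_iff)
  then show ?thesis by (simp add: X_def fib_prod_def prod_cat_simps)
 qed
 have kH: "k \<in> tv_idx (obH H U)" using k idx_obH[OF hom_tgt[OF g]] by simp
 have tr: "cmpH H g f \<in> tv_iso (obH H S) (obH H U) (ps \<circ>\<^sub>m ph) (tv_comp ps ph (arH H g) (arH H f)) (arH H (fs_comp g f))"
  using pf[unfolded pseudofunctor_over_def, THEN conjunct2, THEN conjunct2, THEN conjunct2, THEN conjunct1] f g by blast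
 then have "cmpH H g f k X \<in> Homs (tot (fam U k)) (fob ?F X) (fob ?G X)" "is_iso (tot (fam U k)) (cmpH H g f k X)"
  using kH XO unfolding tv_iso_def tv_trans_def nat_trans_def by (auto simp: PiE_iff)
 then have dims: "gd (fam U k) (fob ?F X) = gd (fam U k) (fob ?G X)" using matcat.is_iso_dims[OF matcat_gpres[OF g2[OF hom_tgt[OF g] k]]] by blast
 define Y where "Y = (\<lambda>j\<in>fib ps k. fob (arH H f j) (\<lambda>i\<in>fib ph j. gs (fam S i) (t i)))"
 have fobF: "fob ?F X = fob (arH H g k) Y"
 proof -
  have "restrict X (fib ph j) = (\<lambda>i\<in>fib ph j. gs (fam S i) (t i))" if "j \<in> fib ps k" for j
   unfolding X_def restrict_restrict using sub[OF that] by (simp add: Int_absorb1)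
  then have "(\<lambda>j\<in>fib ps k. fob (arH H f j) (restrict X (fib ph j))) = Y" unfolding Y_def by (intro restrict_ext) simp
  then show ?thesis by (simp add: tv_comp_def)
 qed
 have jT: "j \<in> fib ps k ==> j \<in> fs_idx T" for j using fib_sub[OF g] by blast
 have tr: "restrict t (fib ph j) \<in> (\<Pi>\<^sub>E i\<in>fib ph j. gJ (fam S i))" if "j \<in> fib ps k" for j
  using t sub[OF that] by (auto simp: PiE_iff)
 have NY: "gd (fam T j) (Y j) s = N f j s (restrict t (fib ph j))" if "j \<in> fib ps k" for j s
  using that by (simp add: Y_def N_eq[OF f] cong: restrict_cong)
 have YO: "Y \<in> Obj (prod_cat (fib ps k) (\<lambda>j. tot (fam T j)))"
  using arr_ob[OF f jT gs_tuple[OF f tr]] by (auto simp: Y_def prod_cat_simps PiE_iff cong: restrict_cong)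
 have "N (fs_comp g f) k s t = gd (fam U k) (fob ?F X) s" unfolding dims by (simp add: N_def sel X_def)
 also have "\<dots> = (\<Sum>u\<in>(\<Pi>\<^sub>E j\<in>fib ps k. P j). (\<Prod>j\<in>fib ps k. gd (fam T j) (Y j) (u j)) * N g k s u)"
  unfolding fobF using P NY by (intro N_expand[OF g k YO]) auto
 also have "\<dots> = (\<Sum>u\<in>(\<Pi>\<^sub>E j\<in>fib ps k. P j). (\<Prod>j\<in>fib ps k. N f j (u j) (restrict t (fib ph j))) * N g k s u)"
  by (simp add: NY)
 finally show ?thesis .
qed

text \<open>The first functor sends the tuple to simple objects \<open>a j\<close>, so a single term
  of \<open>N_comp\<close> remains.\<close>

lemma N_comp_delta:
 assumes f: "f \<in> fs_hom S T ph" and g: "g \<in> fs_hom T U ps" and k: "k \<in> fs_idx U"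
  and t: "t \<in> (\<Pi>\<^sub>E i\<in>fib (ps \<circ>\<^sub>m ph) k. gJ (fam S i))"
  and a: "\<And>j s. j \<in> fib ps k ==> N f j s (restrict t (fib ph j)) = kdelta (a j) s"
  and aJ: "\<And>j. j \<in> fib ps k ==> a j \<in> gJ (fam T j)"
 shows "N (fs_comp g f) k s t = N g k s (restrict a (fib ps k))"
proof -
 have "N (fs_comp g f) k s t = (\<Sum>u\<in>(\<Pi>\<^sub>E j\<in>fib ps k. {restrict a (fib ps k) j}).
   (\<Prod>j\<in>fib ps k. N f j (u j) (restrict t (fib ph j))) * N g k s u)" using a aJ by (intro N_comp[OF f g k t]) (auto simp: kdelta_def)
 also have "(\<Pi>\<^sub>E j\<in>fib ps k. {restrict a (fib ps k) j}) = {restrict a (fib ps k)}" by (rule PiE_singleton[OF restrict_extensional])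
 also have "(\<Sum>u\<in>{restrict a (fib ps k)}. (\<Prod>j\<in>fib ps k. N f j (u j) (restrict t (fib ph j))) * N g k s u) =
   (\<Prod>j\<in>fib ps k. N f j (a j) (restrict t (fib ph j))) * N g k s (restrict a (fib ps k))" by simp
 also have "(\<Prod>j\<in>fib ps k. N f j (a j) (restrict t (fib ph j))) = 1" using a by (intro prod.neutral) (simp add: kdelta_def)
 finally show ?thesis by (simp only: mult_1)
qed

text \<open>Here the second functor sends distinct simple tuples to distinct simple objects.\<close>

lemma N_comp_delta':
 assumes f: "f \<in> fs_hom S T ph" and g: "g \<in> fs_hom T U ps" and k: "k \<in> fs_idx U"
  and t: "t \<in> (\<Pi>\<^sub>E i\<in>fib (ps \<circ>\<^sub>m ph) k. gJ (fam S i))"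
  and y: "y \<in> (\<Pi>\<^sub>E j\<in>fib ps k. gJ (fam T j))"
  and s: "\<And>u. u \<in> (\<Pi>\<^sub>E j\<in>fib ps k. gJ (fam T j)) ==> N g k s u = (if u = y then 1 else 0)"
 shows "N (fs_comp g f) k s t = (\<Prod>j\<in>fib ps k. N f j (y j) (restrict t (fib ph j)))"
proof -
 let ?P = "\<lambda>j. {s. N f j s (restrict t (fib ph j)) \<noteq> 0}"
 have jT: "j \<in> fib ps k ==> j \<in> fs_idx T" for j using fib_sub[OF g] by blast
 have sub: "fib ph j \<subseteq> fib (ps \<circ>\<^sub>m ph) k" if "j \<in> fib ps k" for j using that by (auto simp: fib_def map_comp_def)
 have tr: "restrict t (fib ph j) \<in> (\<Pi>\<^sub>E i\<in>fib ph j. gJ (fam S i))" if "j \<in> fib ps k" for j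
  using t sub[OF that] by (auto simp: PiE_iff)
 have P: "finite (?P j)" "?P j \<subseteq> gJ (fam T j)" if "j \<in> fib ps k" for j using N_finite[OF f jT tr] N_degree(1)[OF f jT tr] that by auto
 have "N (fs_comp g f) k s t = (\<Sum>u\<in>(\<Pi>\<^sub>E j\<in>fib ps k. ?P j).
   (\<Prod>j\<in>fib ps k. N f j (u j) (restrict t (fib ph j))) * N g k s u)" using P by (intro N_comp[OF f g k t]) auto
 also have "\<dots> = (\<Sum>u\<in>(\<Pi>\<^sub>E j\<in>fib ps k. ?P j).
   (\<Prod>j\<in>fib ps k. N f j (u j) (restrict t (fib ph j))) * (if u = y then 1 else 0))"
 proof (intro sum.cong refl)
  fix u assume "u \<in> (\<Pi>\<^sub>E j\<in>fib ps k. ?P j)"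
  then have "u \<in> (\<Pi>\<^sub>E j\<in>fib ps k. gJ (fam T j))" using P(2) by (auto simp: PiE_iff)
  from s[OF this] show "(\<Prod>j\<in>fib ps k. N f j (u j) (restrict t (fib ph j))) * N g k s u =
    (\<Prod>j\<in>fib ps k. N f j (u j) (restrict t (fib ph j))) * (if u = y then 1 else 0)" by simp
 qed
 also have "\<dots> = (\<Prod>j\<in>fib ps k. N f j (y j) (restrict t (fib ph j)))"
 proof (rule sum_PiE_delta)
  show "y \<in> (\<Pi>\<^sub>E j\<in>fib ps k. ?P j) \<or> (\<Prod>j\<in>fib ps k. N f j (y j) (restrict t (fib ph j))) = 0"
   using y fib_finite[OF g] by (auto simp: PiE_iff)
 qed (use fib_finite[OF g] P in auto)
 finally show ?thesis .
qed

end

lemma bij_betw_PiE_map: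
 assumes "\<And>w. w \<in> W ==> inj_on (h w) (A w)"
 shows "bij_betw (\<lambda>y. \<lambda>w\<in>W. h w (y w)) (PiE W A) (\<Pi>\<^sub>E w\<in>W. h w ` A w)"
proof (rule bij_betw_byWitness[where f' = "\<lambda>y. \<lambda>w\<in>W. inv_into (A w) (h w) (y w)"])
 show "\<forall>y\<in>(PiE W A). (\<lambda>w\<in>W. inv_into (A w) (h w) ((\<lambda>w\<in>W. h w (y w)) w)) = y"
 proof
  fix y assume y: "y \<in> (PiE W A)"
  show "(\<lambda>w\<in>W. inv_into (A w) (h w) ((\<lambda>w\<in>W. h w (y w)) w)) = y"
  proof
   fix w show "(\<lambda>w\<in>W. inv_into (A w) (h w) ((\<lambda>w\<in>W. h w (y w)) w)) w = y w"
    using y assms inv_into_f_f by (cases "w \<in> W") (auto simp: PiE_iff extensional_def)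
  qed
 qed
 show "\<forall>y\<in>(\<Pi>\<^sub>E w\<in>W. h w ` A w). (\<lambda>w\<in>W. h w ((\<lambda>w\<in>W. inv_into (A w) (h w) (y w)) w)) = y"
 proof
  fix y assume y: "y \<in> (\<Pi>\<^sub>E w\<in>W. h w ` A w)"
  show "(\<lambda>w\<in>W. h w ((\<lambda>w\<in>W. inv_into (A w) (h w) (y w)) w)) = y"
  proof
   fix w show "(\<lambda>w\<in>W. h w ((\<lambda>w\<in>W. inv_into (A w) (h w) (y w)) w)) w = y w"
    using y f_inv_into_f[of "y w" "h w" "A w"] by (cases "w \<in> W") (auto simp: PiE_iff extensional_def)
  qed
 qed
 show "(\<lambda>y. \<lambda>w\<in>W. h w (y w)) ` (PiE W A) \<subseteq> (\<Pi>\<^sub>E w\<in>W. h w ` A w)" by auto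
 show "(\<lambda>y. \<lambda>w\<in>W. inv_into (A w) (h w) (y w)) ` (\<Pi>\<^sub>E w\<in>W. h w ` A w) \<subseteq> (PiE W A)"
  by (auto simp: PiE_iff inv_into_into)
qed

lemma prod_kdelta:
 assumes "finite W" "y \<in> extensional W"
 shows "(\<Prod>w\<in>W. kdelta (a w) (y w)) = (if y = restrict a W then 1 else 0)"
proof (cases "y = restrict a W")
 case True
 then show ?thesis by (auto simp: kdelta_def intro!: prod.neutral)
next
 case False
 then obtain w where "y w \<noteq> restrict a W w" by blast
 then have w: "w \<in> W" "kdelta (a w) (y w) = 0" using assms(2) by (cases "w \<in> W"; simp add: kdelta_def extensional_def)+
 have "(\<Prod>w\<in>W. kdelta (a w) (y w)) = 0" by (rule prod_zero[OF assms(1)]) (use w in blast)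
 then show ?thesis using False by simp
qed

lemma sum_PiE_insert:
 assumes "k \<notin> K"
 shows "(\<Sum>y\<in>(\<Pi>\<^sub>E i\<in>insert k K. P i). F y) = (\<Sum>a\<in>P k. \<Sum>y\<in>(PiE K P). F (y(k := a)))"
 unfolding PiE_insert_eq using assms by (subst sum.reindex[OF inj_combinator]) (auto simp: sum.cartesian_product case_prod_unfold comp_def)

lemma N_sum_mono:
 fixes F :: "'a => nat"
 assumes "finite B" "A \<subseteq> B" "\<And>x. x \<in> B ==> F x \<noteq> 0 ==> x \<in> A"
 shows "(\<Sum>x\<in>A. F x) = (\<Sum>x\<in>B. F x)" using assms by (intro sum.mono_neutral_left) auto

text \<open>The bijection that sends \<open>f\<close> to \<open>R f\<close> after the unit is linear
  because \<open>R\<close> is; its inverse sends \<open>g\<close> to the counit after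
  \<open>L g\<close>. In this way the multiplicities of an adjoint are obtained from those of the
  functor.\<close>

lemma adjunction_dims:
 fixes C D :: "('o, 'm, 'k::field_char_0) gcat"
 assumes C: "matcat (tot C) J d rh" and D: "matcat (tot D) J' d' rh'"
  and adj: "gr_adjunction C D L R et ep" and x: "x \<in> Obj (tot C)" and y: "y \<in> Obj (tot D)"
 shows "hom_dim (tot D) (fob L x) y = hom_dim (tot C) x (fob R y)"
proof -
 interpret C: matcat "tot C" J d rh by fact
 interpret D: matcat "tot D" J' d' rh' by fact
 have L: "linear_functor (tot C) (tot D) L" and R: "linear_functor (tot D) (tot C) R"
  using adj by (auto simp: gr_adjunction_def gr_mor_def exact_functor_def)
 have Lo: "fob L a \<in> Obj (tot D)" if "a \<in> Obj (tot C)" for a using L that unfolding linear_functor_def is_functor_def by blast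
 have Ro: "fob R a \<in> Obj (tot C)" if "a \<in> Obj (tot D)" for a using R that unfolding linear_functor_def is_functor_def by blast
 have Lh: "far L f \<in> Homs (tot D) (fob L a) (fob L b)" if "f \<in> Homs (tot C) a b" for f a b
  using L that unfolding linear_functor_def is_functor_def by blast
 have Rh: "far R f \<in> Homs (tot C) (fob R a) (fob R b)" if "f \<in> Homs (tot D) a b" for f a b
  using R that unfolding linear_functor_def is_functor_def by blast
 have Lc: "far L (Cmp (tot C) g f) = Cmp (tot D) (far L g) (far L f)"
  if "f \<in> Homs (tot C) a b" "g \<in> Homs (tot C) b c" for f g a b c using L that unfolding linear_functor_def is_functor_def by blast
 have Rc: "far R (Cmp (tot D) g f) = Cmp (tot C) (far R g) (far R f)"
  if "f \<in> Homs (tot D) a b" "g \<in> Homs (tot D) b c" for f g a b c using R that unfolding linear_functor_def is_functor_def by blast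
 have Ra: "far R (AddA (tot D) f g) = AddA (tot C) (far R f) (far R g)" "far R (ScaleA (tot D) r f) = ScaleA (tot C) r (far R f)"
  if "f \<in> Homs (tot D) a b" "g \<in> Homs (tot D) a b" for f g a b r using R that unfolding linear_functor_def by blast+
 have eth: "et a \<in> Homs (tot C) a (fob R (fob L a))" if "a \<in> Obj (tot C)" for a
  using adj that by (auto simp: gr_adjunction_def nat_trans_def PiE_iff fctr_comp_def fctr_id_def)
 have eph: "ep a \<in> Homs (tot D) (fob L (fob R a)) a" if "a \<in> Obj (tot D)" for a
  using adj that by (auto simp: gr_adjunction_def nat_trans_def PiE_iff fctr_comp_def fctr_id_def)
 have etn: "Cmp (tot C) (far R (far L f)) (et a) = Cmp (tot C) (et b) f" if "f \<in> Homs (tot C) a b" for f a b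
  using adj that by (auto simp: gr_adjunction_def nat_trans_def fctr_comp_def fctr_id_def)
 have epn: "Cmp (tot D) f (ep a) = Cmp (tot D) (ep b) (far L (far R f))" if "f \<in> Homs (tot D) a b" for f a b
  using adj that by (auto simp: gr_adjunction_def nat_trans_def fctr_comp_def fctr_id_def)
 have t1: "Cmp (tot D) (ep (fob L x)) (far L (et x)) = Ide (tot D) (fob L x)"
  and t2: "Cmp (tot C) (far R (ep y)) (et (fob R y)) = Ide (tot C) (fob R y)" using adj x y by (auto simp: gr_adjunction_def)
 let ?V = "hom_space (tot D) (fob L x) y" and ?W = "hom_space (tot C) x (fob R y)"
 define T where "T = (\<lambda>f. Cmp (tot C) (far R f) (et x))"
 have Th: "T f \<in> Homs (tot C) x (fob R y)" if "f \<in> Homs (tot D) (fob L x) y" for f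
  unfolding T_def by (rule C.Cmp_hom[OF eth[OF x] Rh[OF that]])
 interpret V: vectorspace "class_ring :: 'k ring" ?V by (rule D.vectorspace_hom_space[OF Lo[OF x] y])
 interpret W: vectorspace "class_ring :: 'k ring" ?W by (rule C.vectorspace_hom_space[OF x Ro[OF y]])
 interpret T: linear_map "class_ring :: 'k ring" ?V ?W T
 proof
  show "T \<in> LinearCombinations.module_hom class_ring ?V ?W" unfolding LinearCombinations.module_hom_def hom_space_def
  proof (simp, intro conjI allI impI)
   show "T \<in> Homs (tot D) (fob L x) y \<rightarrow> Homs (tot C) x (fob R y)" using Th by auto
  next
   fix f g assume fg: "f \<in> Homs (tot D) (fob L x) y \<and> g \<in> Homs (tot D) (fob L x) y"
   then show "T (AddA (tot D) f g) = AddA (tot C) (T f) (T g)"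
    unfolding T_def using C.Cmp_Add_left[OF eth[OF x] Rh Rh, of f y g] Ra(1)[of f "fob L x" y g] by simp
  next
   fix r f assume f: "f \<in> Homs (tot D) (fob L x) y"
   note h = Rh[OF f] eth[OF x]
   have "Cmp (tot C) (ScaleA (tot C) r (far R f)) (et x) = ScaleA (tot C) r (Cmp (tot C) (far R f) (et x))"
    by (rule C.hom_eqI[OF C.Cmp_hom[OF h(2) C.Scale_hom[OF h(1)]] C.Scale_hom[OF C.Cmp_hom[OF h(2,1)]]])
     (simp add: C.rep_Cmp[OF h(2) C.Scale_hom[OF h(1)]] C.rep_Scale[OF h(1)] C.rep_Scale[OF C.Cmp_hom[OF h(2,1)]]
      C.rep_Cmp[OF h(2,1)] mult_smult_assoc_mat[OF C.rep_carrier[OF h(1)] C.rep_carrier[OF h(2)]])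
   then show "T (ScaleA (tot D) r f) = ScaleA (tot C) r (T f)" unfolding T_def using Ra(2)[OF f f] by simp
  qed
 qed
 have inv: "Cmp (tot D) (ep y) (far L (T f)) = f" if f: "f \<in> Homs (tot D) (fob L x) y" for f
 proof -
  have "Cmp (tot D) (ep y) (far L (T f)) = Cmp (tot D) (ep y) (Cmp (tot D) (far L (far R f)) (far L (et x)))"
   unfolding T_def Lc[OF eth[OF x] Rh[OF f]] ..
  also have "\<dots> = Cmp (tot D) (Cmp (tot D) f (ep (fob L x))) (far L (et x))"
   unfolding epn[OF f] by (rule D.Cmp_assoc[OF Lh[OF eth[OF x]] Lh[OF Rh[OF f]] eph[OF y]])
  also have "\<dots> = Cmp (tot D) f (Cmp (tot D) (ep (fob L x)) (far L (et x)))"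
   by (rule D.Cmp_assoc[OF Lh[OF eth[OF x]] eph[OF Lo[OF x]] f, symmetric])
  also have "\<dots> = f" unfolding t1 by (rule D.Cmp_Ide_right[OF f])
  finally show ?thesis .
 qed
 have "inj_on T (carrier ?V)" by (rule inj_on_inverseI[where g = "\<lambda>g. Cmp (tot D) (ep y) (far L g)"]) (simp add: inv hom_space_def)
 moreover have "T ` carrier ?V = carrier ?W"
 proof
  show "T ` carrier ?V \<subseteq> carrier ?W" using Th by (auto simp: hom_space_def)
  show "carrier ?W \<subseteq> T ` carrier ?V"
  proof
   fix g assume "g \<in> carrier ?W"
   then have g: "g \<in> Homs (tot C) x (fob R y)" by (simp add: hom_space_def)
   have h: "Cmp (tot D) (ep y) (far L g) \<in> Homs (tot D) (fob L x) y" by (rule D.Cmp_hom[OF Lh[OF g] eph[OF y]])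
   have "T (Cmp (tot D) (ep y) (far L g)) = Cmp (tot C) (Cmp (tot C) (far R (ep y)) (far R (far L g))) (et x)"
    unfolding T_def Rc[OF Lh[OF g] eph[OF y]] ..
   also have "\<dots> = Cmp (tot C) (far R (ep y)) (Cmp (tot C) (et (fob R y)) g)"
    unfolding etn[OF g, symmetric] by (rule C.Cmp_assoc[OF eth[OF x] Rh[OF Lh[OF g]] Rh[OF eph[OF y]], symmetric])
   also have "\<dots> = Cmp (tot C) (Cmp (tot C) (far R (ep y)) (et (fob R y))) g" by (rule C.Cmp_assoc[OF g eth[OF Ro[OF y]] Rh[OF eph[OF y]]])
   also have "\<dots> = g" unfolding t2 by (rule C.Cmp_Ide_left[OF g])
   finally show "g \<in> T ` carrier ?V" using h by (force simp: hom_space_def)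
  qed
 qed
 ultimately have "V.dim = W.dim" using T.dim_eq D.hom_fin_dim[OF Lo[OF x] y] by blast
 then show ?thesis by (simp add: hom_dim_def)
qed

text \<open>Inverses are unique, so the definite description in \<open>inv_arr\<close> denotes
  one.\<close>

lemma is_inverse_inv_arr:
 assumes "matcat C J d rh" "is_iso C f" "f \<in> Homs C a b"
 shows "inv_arr C f \<in> Homs C b a"
proof -
 interpret matcat C J d rh by fact
 obtain g where g: "is_inverse C f g" using assms(2) by (auto simp: is_iso_def)
 have "g' = g" if g': "is_inverse C f g'" for g'
 proof -
  have h: "g \<in> Homs C b a" "g' \<in> Homs C b a" "Cmp C g f = Ide C a" "Cmp C f g' = Ide C b"
   using g g' assms(3) by (auto simp: is_inverse_def Homs_def)
  have "g' = Cmp C (Cmp C g f) g'" using Cmp_Ide_left[OF h(2)] h(3) by simp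
  also have "\<dots> = Cmp C g (Cmp C f g')" by (rule Cmp_assoc[OF h(2) assms(3) h(1), symmetric])
  also have "\<dots> = g" unfolding h(4) by (rule Cmp_Ide_right[OF h(1)])
  finally show ?thesis .
 qed
 then have "inv_arr C f = g" unfolding inv_arr_def using g by (intro the_equality)
 then show ?thesis using g assms(3) by (auto simp: is_inverse_def Homs_def)
qed

section \<open>Structure constants of families of points\<close>

context ssh
begin

abbreviation "J1 \<equiv> gJ (fam (fs_disc {1}) 1)"

lemma disc_g2: "finite U ==> u \<in> U ==> graded_2vect (fam (fs_disc U) u)" by (rule g2[OF is_fs_obj_disc]) auto

lemma one_g2: "finite U ==> graded_2vect (fam (fs_one U) 1)" by (rule g2[OF is_fs_obj_one]) auto

lemma N_cong: "(\<And>i. i \<in> fib (fs_base f) j ==> t i = t' i) ==> N f j s t = N f j s t'" unfolding N_def by (simp cong: restrict_cong)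

text \<open>\<open>sg U u\<close> identifies the simple objects of \<open>\<C>\<close> with those of the \<open>u\<close>-th factor of \<open>([1])\<^sub>u\<^sub>\<in>\<^sub>U\<close>.\<close>

lemma ex_sg:
 assumes "finite U" "u \<in> U"
 shows "\<exists>si. bij_betw si J1 (gJ (fam (fs_disc U) u)) \<and>
  (\<forall>x\<in>J1. N (proj U u) 1 = (\<lambda>s t. if t u = si x then kdelta x s else N (proj U u) 1 s t) \<and> fst (si x) = fst x)"
proof -
 have fib: "fib (pbase {u} (\<lambda>_. 1)) 1 = {u}" by (auto simp: fib_pbase)
 have hom: "proj U u \<in> fs_hom (fs_disc U) (fs_disc {1}) (pbase {u} (\<lambda>_. 1))" using assms by (intro disc_map_hom) auto
 obtain ta where ta: "bij_betw ta (\<Pi>\<^sub>E i\<in>{u}. gJ (fam (fs_disc U) i)) J1"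
  and N: "\<And>t s. t \<in> (\<Pi>\<^sub>E i\<in>{u}. gJ (fam (fs_disc U) i)) ==> N (proj U u) 1 s t = kdelta (ta t) s"
  and d: "\<And>t. t \<in> (\<Pi>\<^sub>E i\<in>{u}. gJ (fam (fs_disc U) i)) ==> fst (ta t) = (\<Sum>i\<in>{u}. fst (t i))"
  using N_cocartesian[OF hom proj_cocartesian[OF assms], of 1] unfolding fib by auto
 let ?G = "gJ (fam (fs_disc U) u)"
 have pt: "bij_betw (\<lambda>y. \<lambda>_\<in>{u}. y) ?G (\<Pi>\<^sub>E i\<in>{u}. gJ (fam (fs_disc U) i))"
  by (rule bij_betw_byWitness[where f' = "\<lambda>t. t u"]) (auto simp: PiE_iff extensional_def fun_eq_iff split: if_splits)
 define \<pi> where "\<pi> = (\<lambda>y. ta (\<lambda>_\<in>{u}. y))"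
 have \<pi>: "bij_betw \<pi> ?G J1" using bij_betw_trans[OF pt ta] by (simp add: \<pi>_def comp_def)
 have N\<pi>: "N (proj U u) 1 s t = kdelta (\<pi> (t u)) s" if "t u \<in> ?G" for s t
 proof -
  have "N (proj U u) 1 s t = N (proj U u) 1 s (\<lambda>_\<in>{u}. t u)" by (rule N_cong) (simp add: fib_pbase)
  also have "\<dots> = kdelta (\<pi> (t u)) s" unfolding \<pi>_def by (rule N) (use that in auto)
  finally show ?thesis .
 qed
 show ?thesis
 proof (intro exI[of _ "inv_into ?G \<pi>"] conjI ballI)
  show "bij_betw (inv_into ?G \<pi>) J1 ?G" by (rule bij_betw_inv_into[OF \<pi>])
  fix x assume x: "x \<in> J1"
  have i: "inv_into ?G \<pi> x \<in> ?G" "\<pi> (inv_into ?G \<pi> x) = x" using \<pi> x by (auto simp: bij_betw_def inv_into_into f_inv_into_f)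
  show "N (proj U u) 1 = (\<lambda>s t. if t u = inv_into ?G \<pi> x then kdelta x s else N (proj U u) 1 s t)"
   using N\<pi> i by (auto simp: fun_eq_iff)
  show "fst (inv_into ?G \<pi> x) = fst x" using d[of "\<lambda>_\<in>{u}. inv_into ?G \<pi> x"] i by (simp add: \<pi>_def)
 qed
qed

text \<open>The equation of \<open>N\<close> with its own conditional variant says that
  \<open>N (proj U u) 1 s t = kdelta x s\<close> whenever \<open>t u = si x\<close>, whatever
  \<open>t\<close> is at the other indices.\<close>

definition sg :: "nat set => nat => nat \<times> nat => nat \<times> nat" where
 "sg U u = (SOME si. bij_betw si J1 (gJ (fam (fs_disc U) u)) \<and>
  (\<forall>x\<in>J1. N (proj U u) 1 = (\<lambda>s t. if t u = si x then kdelta x s else N (proj U u) 1 s t) \<and> fst (si x) = fst x))"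

lemma
 assumes "finite U" "u \<in> U"
 shows sg_bij: "bij_betw (sg U u) J1 (gJ (fam (fs_disc U) u))"
  and sg_N: "x \<in> J1 ==> t u = sg U u x ==> N (proj U u) 1 s t = kdelta x s"
  and sg_deg: "x \<in> J1 ==> fst (sg U u x) = fst x"
proof -
 note S = someI_ex[OF ex_sg[OF assms], folded sg_def]
 show "bij_betw (sg U u) J1 (gJ (fam (fs_disc U) u))" "x \<in> J1 ==> fst (sg U u x) = fst x" using S by auto
 assume x: "x \<in> J1" "t u = sg U u x"
 then have "N (proj U u) 1 = (\<lambda>s t. if t u = sg U u x then kdelta x s else N (proj U u) 1 s t)" using S by blast
 from fun_cong[OF fun_cong[OF this, of s], of t] show "N (proj U u) 1 s t = kdelta x s" using x(2) by simp
qed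

lemma sg_in: "finite U ==> u \<in> U ==> x \<in> J1 ==> sg U u x \<in> gJ (fam (fs_disc U) u)" using bij_betwE[OF sg_bij] by blast

lemma sg_inj: "finite U ==> u \<in> U ==> x \<in> J1 ==> y \<in> J1 ==> sg U u x = sg U u y ==> x = y"
 using sg_bij[of U u] by (auto simp: bij_betw_def inj_on_def)

abbreviation tup :: "nat set => nat set => (nat => nat \<times> nat) => nat => nat \<times> nat" where
 "tup U V x \<equiv> (\<lambda>u\<in>V. sg U u (x u))"

lemma tup_in: "finite U ==> V \<subseteq> U ==> x \<in> V \<rightarrow> J1 ==> tup U V x \<in> (\<Pi>\<^sub>E u\<in>V. gJ (fam (fs_disc U) u))"
 by (auto intro!: sg_in)

text \<open>Distinct simple objects have distinct simple images under a projection. This is the form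
  in which \<open>N_comp_delta'\<close> asks for it.\<close>

lemma proj_separates:
 assumes "finite U" "u \<in> U" "y \<in> J1" "t \<in> (\<Pi>\<^sub>E i\<in>{u}. gJ (fam (fs_disc U) i))"
 shows "N (proj U u) 1 y t = (if t = tup U {u} (\<lambda>_. y) then 1 else 0)"
proof -
 have "t u \<in> sg U u ` J1" using bij_betw_imp_surj_on[OF sg_bij[OF assms(1,2)]] assms(4) by (simp add: PiE_iff)
 then obtain x where x: "t u = sg U u x" "x \<in> J1" by (rule imageE)
 have "t = tup U {u} (\<lambda>_. y) \<longleftrightarrow> x = y"
  using assms(4) x sg_inj[OF assms(1,2) x(2) assms(3)] by (auto simp: PiE_iff extensional_def fun_eq_iff)
 then show ?thesis using sg_N[where t = t and u = u and x = x, OF assms(1,2) x(2,1)] by (auto simp: kdelta_def)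
qed

text \<open>The multiplicity of \<open>z\<close> in the product of the simple objects \<open>x\<^sub>u\<close>, \<open>u \<in> U\<close>.\<close>

definition c :: "nat set => (nat => nat \<times> nat) => nat \<times> nat => nat" where
 "c U x z = N (fold_arr U) 1 z (tup U U x)"

lemma c_cong: "(\<And>u. u \<in> U ==> x u = x' u) ==> c U x z = c U x' z" unfolding c_def by (simp cong: restrict_cong)

lemma fold_hom: "finite U ==> fold_arr U \<in> fs_hom (fs_disc U) (fs_disc {1}) (pbase U (\<lambda>_. 1))" by (intro disc_map_hom) auto

lemma c_degree:
 assumes U: "finite U" and x: "x \<in> U \<rightarrow> J1" and nz: "c U x z \<noteq> 0"
 shows "z \<in> J1" "fst z = (\<Sum>u\<in>U. fst (x u))"
proof -
 have fib: "fib (pbase U (\<lambda>_. 1)) 1 = U" by (auto simp: fib_pbase)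
 note D = N_degree[OF fold_hom[OF U], of 1 "tup U U x" z, unfolded fib]
 show "z \<in> J1" using D(1) tup_in[OF U order_refl x] nz by (simp add: c_def)
 have "fst z = (\<Sum>u\<in>U. fst (tup U U x u))" using D(2) tup_in[OF U order_refl x] nz by (simp add: c_def)
 also have "\<dots> = (\<Sum>u\<in>U. fst (x u))" using x by (intro sum.cong) (auto intro!: sg_deg[OF U])
 finally show "fst z = (\<Sum>u\<in>U. fst (x u))" .
qed

lemma c_single: "x u \<in> J1 ==> c {u} x z = kdelta (x u) z" unfolding c_def by (rule sg_N) auto

text \<open>The projection of \<open>U\<close> to \<open>v\<close> is this restriction followed by
  the projection of \<open>V\<close> to \<open>v\<close>. The latter separates simple objects, so
  the multiplicities of the restriction are forced.\<close>

lemma N_restriction: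
 assumes U: "finite U" and V: "V \<subseteq> U" "v \<in> V" and x: "x \<in> J1" and t: "t v = sg U v x"
 shows "N (disc_map U V V (\<lambda>i. i)) v y t = kdelta (sg V v x) y"
proof -
 have fV: "finite V" using V(1) U by (rule finite_subset)
 have r: "disc_map U V V (\<lambda>i. i) \<in> fs_hom (fs_disc U) (fs_disc V) (pbase V (\<lambda>i. i))" using U V fV by (intro disc_map_hom) auto
 have p: "proj V v \<in> fs_hom (fs_disc V) (fs_disc {1}) (pbase {v} (\<lambda>_. 1))" using fV V by (intro disc_map_hom) auto
 have comp: "fs_comp (proj V v) (disc_map U V V (\<lambda>i. i)) = proj U v" using V by (subst disc_map_comp) (auto intro: disc_map_cong)
 have fib1: "fib (pbase V (\<lambda>i. i)) v = {v}" using V by (auto simp: fib_pbase)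
 have fib2: "fib (pbase {v} (\<lambda>_. 1)) 1 = {v}" by (auto simp: fib_pbase)
 have fib3: "fib (pbase {v} (\<lambda>_. 1) \<circ>\<^sub>m pbase V (\<lambda>i. i)) 1 = {v}" using V by (auto simp: fib_pbase pbase_comp)
 define t' where "t' = (\<lambda>_\<in>{v}. sg U v x)"
 have t': "t' \<in> (\<Pi>\<^sub>E i\<in>{v}. gJ (fam (fs_disc U) i))" using sg_in[OF U _ x] V by (auto simp: t'_def)
 have tt: "N (disc_map U V V (\<lambda>i. i)) v y t = N (disc_map U V V (\<lambda>i. i)) v y t'" for y
  by (rule N_cong) (use V t in "auto simp: t'_def fib_pbase")
 have key: "N (disc_map U V V (\<lambda>i. i)) v (sg V v x') t' = kdelta x x'" if x': "x' \<in> J1" for x'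
 proof -
  have "N (proj U v) 1 x' t' = (\<Prod>j\<in>{v}. N (disc_map U V V (\<lambda>i. i)) j (tup V {v} (\<lambda>_. x') j) (restrict t' (fib (pbase V (\<lambda>i. i)) j)))"
   unfolding comp[symmetric] by (rule N_comp_delta'[OF r p, where k = 1, unfolded fib2 fib3])
    (use t' tup_in[OF fV, of "{v}"] V x' proj_separates[OF fV V(2) x'] in auto)
  then have "N (proj U v) 1 x' t' = N (disc_map U V V (\<lambda>i. i)) v (sg V v x') t'" by (simp add: fib1 t'_def)
  moreover have "N (proj U v) 1 x' t' = kdelta x x'" by (rule sg_N[OF U _ x]) (use V in "auto simp: t'_def")
  ultimately show ?thesis by simp
 qed
 show ?thesis
 proof (cases "y \<in> gJ (fam (fs_disc V) v)")
  case True
  then have "y \<in> sg V v ` J1" using bij_betw_imp_surj_on[OF sg_bij[OF fV V(2)]] by simp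
  then obtain x' where x': "y = sg V v x'" "x' \<in> J1" by (rule imageE)
  have "x = x' \<longleftrightarrow> sg V v x = sg V v x'" using sg_inj[OF fV V(2) x x'(2)] by blast
  then show ?thesis using tt key[OF x'(2)] x'(1) by (simp add: kdelta_def eq_commute)
 next
  case False
  then have "N (disc_map U V V (\<lambda>i. i)) v y t' = 0" using N_degree(1)[OF r, of v t' y, unfolded fib1] t' V by auto
  moreover have "y \<noteq> sg V v x" using False sg_in[OF fV V(2) x] by blast
  ultimately show ?thesis using tt by (simp add: kdelta_def)
 qed
qed

text \<open>The arrow to one point that is defined on the fibre \<open>V\<close> of \<open>w\<close>
  factors in two ways: through \<open>W\<close> and the projection to \<open>w\<close>, and through
  the restriction to \<open>V\<close> and the folding of \<open>V\<close>. Comparing multiplicities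
  identifies the component at \<open>w\<close> with a product over the fibre.\<close>

lemma N_disc_map:
 assumes U: "finite U" and W: "finite W" and f: "f \<in> U \<rightarrow> W" and w: "w \<in> W" and x: "x \<in> U \<rightarrow> J1" and y: "y \<in> J1"
 shows "N (disc_map U U W f) w (sg W w y) (tup U {u\<in>U. f u = w} x) = c {u\<in>U. f u = w} x y"
proof -
 define V where "V = {u\<in>U. f u = w}"
 have V: "V \<subseteq> U" "finite V" using U by (auto simp: V_def)
 have hf: "disc_map U U W f \<in> fs_hom (fs_disc U) (fs_disc W) (pbase U f)" using U W f by (intro disc_map_hom) auto
 have hp: "proj W w \<in> fs_hom (fs_disc W) (fs_disc {1}) (pbase {w} (\<lambda>_. 1))" using W w by (intro disc_map_hom) auto
 have hr: "disc_map U V V (\<lambda>i. i) \<in> fs_hom (fs_disc U) (fs_disc V) (pbase V (\<lambda>i. i))" using U V by (intro disc_map_hom) auto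
 have e1: "fs_comp (proj W w) (disc_map U U W f) = disc_map U V {1} (\<lambda>_. 1)" using f by (subst disc_map_comp) (auto simp: V_def)
 have e2: "fs_comp (fold_arr V) (disc_map U V V (\<lambda>i. i)) = disc_map U V {1} (\<lambda>_. 1)"
  using V by (subst disc_map_comp) (auto intro: disc_map_cong)
 have fib: "fib (pbase {w} (\<lambda>_. 1)) 1 = {w}" "fib (pbase {w} (\<lambda>_. 1) \<circ>\<^sub>m pbase U f) 1 = V" "fib (pbase U f) w = V"
  "fib (pbase V (\<lambda>_. 1)) 1 = V" "fib (pbase V (\<lambda>_. 1) \<circ>\<^sub>m pbase V (\<lambda>i. i)) 1 = V"
  by (auto simp: fib_pbase pbase_comp V_def)
 have xV: "x \<in> V \<rightarrow> J1" using x V by auto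
 note t = tup_in[OF U V(1) xV]
 have "N (disc_map U V {1} (\<lambda>_. 1)) 1 y (tup U V x) =
   (\<Prod>j\<in>{w}. N (disc_map U U W f) j (tup W {w} (\<lambda>_. y) j) (restrict (tup U V x) (fib (pbase U f) j)))"
  unfolding e1[symmetric] by (rule N_comp_delta'[OF hf hp, where k = 1, unfolded fib])
   (use t tup_in[OF W, of "{w}"] w y proj_separates[OF W w y] in "auto split: if_splits")
 then have "N (disc_map U V {1} (\<lambda>_. 1)) 1 y (tup U V x) = N (disc_map U U W f) w (sg W w y) (tup U V x)" by (simp add: fib)
 moreover have "N (disc_map U V {1} (\<lambda>_. 1)) 1 y (tup U V x) = N (fold_arr V) 1 y (restrict (\<lambda>v. sg V v (x v)) V)"
  unfolding e2[symmetric]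
 proof (rule N_comp_delta[OF hr fold_hom[OF V(2)], where k = 1, unfolded fib])
  fix j s assume j: "j \<in> V"
  show "sg V j (x j) \<in> gJ (fam (fs_disc V) j)" using xV j by (auto intro!: sg_in[OF V(2)])
  have "N (disc_map U V V (\<lambda>i. i)) j s (tup U V x) = kdelta (sg V j (x j)) s" using j xV by (intro N_restriction[OF U V(1) j]) auto
  moreover have "N (disc_map U V V (\<lambda>i. i)) j s (restrict (tup U V x) (fib (pbase V (\<lambda>i. i)) j)) = N (disc_map U V V (\<lambda>i. i)) j s (tup U V x)"
   by (rule N_cong) simp
  ultimately show "N (disc_map U V V (\<lambda>i. i)) j s (restrict (tup U V x) (fib (pbase V (\<lambda>i. i)) j)) = kdelta (sg V j (x j)) s" by simp
 qed (use t in auto)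
 ultimately show ?thesis by (simp add: c_def V_def)
qed

text \<open>Folding \<open>U\<close> is the map to \<open>W\<close> followed by folding
  \<open>W\<close>. This formula alone yields the unit law, associativity and commutativity, for
  suitable \<open>f\<close>; the degree confines each \<open>y w\<close> to a finite set.\<close>

lemma c_chain:
 assumes U: "finite U" and W: "finite W" and f: "f \<in> U \<rightarrow> W" and x: "x \<in> U \<rightarrow> J1"
 shows "c U x z = (\<Sum>y\<in>(\<Pi>\<^sub>E w\<in>W. {j\<in>J1. fst j = (\<Sum>u\<in>{u\<in>U. f u = w}. fst (x u))}).
  (\<Prod>w\<in>W. c {u\<in>U. f u = w} x (y w)) * c W y z)"
proof -
 define A where "A = (\<lambda>w. {j\<in>J1. fst j = (\<Sum>u\<in>{u\<in>U. f u = w}. fst (x u))})"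
 have hf: "disc_map U U W f \<in> fs_hom (fs_disc U) (fs_disc W) (pbase U f)" using U W f by (intro disc_map_hom) auto
 have fib: "fib (pbase W (\<lambda>_. 1)) 1 = W" "fib (pbase W (\<lambda>_. 1) \<circ>\<^sub>m pbase U f) 1 = U" "fib (pbase U f) w = {u\<in>U. f u = w}" for w
  using f by (auto simp: fib_pbase pbase_comp)
 have finA: "finite (A w)" for w unfolding A_def by (rule finite_gJ[OF disc_g2]) auto
 have tr: "restrict (tup U U x) {u\<in>U. f u = w} = tup U {u\<in>U. f u = w} x" for w by (auto simp: fun_eq_iff)
 have xV: "x \<in> {u\<in>U. f u = w} \<rightarrow> J1" for w using x by auto
 note N' = N_disc_map[OF U W f _ x]
 have "c U x z = N (fs_comp (fold_arr W) (disc_map U U W f)) 1 z (tup U U x)" unfolding fold_one_map_comp[OF f] c_def ..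
 also have "\<dots> = (\<Sum>u\<in>(\<Pi>\<^sub>E w\<in>W. sg W w ` A w). (\<Prod>w\<in>W. N (disc_map U U W f) w (u w) (tup U {u\<in>U. f u = w} x)) * N (fold_arr W) 1 z u)"
 proof (rule N_comp[OF hf fold_hom[OF W], of 1 "tup U U x" "\<lambda>w. sg W w ` A w", unfolded fib tr])
  show "tup U U x \<in> (\<Pi>\<^sub>E i\<in>U. gJ (fam (fs_disc U) i))" by (rule tup_in[OF U order_refl x])
  fix w assume w: "w \<in> W"
  have "{s. N (disc_map U U W f) w s (tup U {u\<in>U. f u = w} x) \<noteq> 0} \<subseteq> sg W w ` A w"
  proof
   fix s assume s: "s \<in> {s. N (disc_map U U W f) w s (tup U {u\<in>U. f u = w} x) \<noteq> 0}"
   have "tup U {u\<in>U. f u = w} x \<in> (\<Pi>\<^sub>E i\<in>fib (pbase U f) w. gJ (fam (fs_disc U) i))"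
    unfolding fib by (rule tup_in[OF U _ xV]) auto
   then have "s \<in> gJ (fam (fs_disc W) w)" using N_degree(1)[OF hf, of w] s w by auto
   then have "s \<in> sg W w ` J1" using bij_betw_imp_surj_on[OF sg_bij[OF W w]] by simp
   then obtain y where y: "s = sg W w y" "y \<in> J1" by (rule imageE)
   have "c {u\<in>U. f u = w} x y \<noteq> 0" using N'[OF w y(2)] s y(1) by simp
   then have "fst y = (\<Sum>u\<in>{u\<in>U. f u = w}. fst (x u))" using U by (intro c_degree(2)[OF _ xV]) auto
   then have "y \<in> A w" using y(2) by (simp add: A_def)
   then show "s \<in> sg W w ` A w" using y(1) by blast
  qed
  moreover have "sg W w ` A w \<subseteq> gJ (fam (fs_disc W) w)" by (auto simp: A_def intro!: sg_in[OF W w])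
  ultimately show "finite (sg W w ` A w) \<and> {s. N (disc_map U U W f) w s (tup U {u\<in>U. f u = w} x) \<noteq> 0} \<subseteq> sg W w ` A w \<and>
    sg W w ` A w \<subseteq> gJ (fam (fs_disc W) w)" using finA by simp
 qed simp
 also have "\<dots> = (\<Sum>y\<in>(PiE W A). (\<Prod>w\<in>W. N (disc_map U U W f) w (tup W W y w) (tup U {u\<in>U. f u = w} x)) * N (fold_arr W) 1 z (tup W W y))"
 proof (rule sum.reindex_bij_betw[symmetric])
  show "bij_betw (\<lambda>y. tup W W y) (PiE W A) (\<Pi>\<^sub>E w\<in>W. sg W w ` A w)"
   using sg_bij[OF W] by (intro bij_betw_PiE_map) (auto simp: bij_betw_def A_def intro: inj_on_subset)
 qed
 also have "\<dots> = (\<Sum>y\<in>(PiE W A). (\<Prod>w\<in>W. c {u\<in>U. f u = w} x (y w)) * c W y z)"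
 proof (intro sum.cong refl arg_cong2[where f = "(*)"] prod.cong)
  fix y w assume "y \<in> (PiE W A)" "w \<in> W"
  then show "N (disc_map U U W f) w (tup W W y w) (tup U {u\<in>U. f u = w} x) = c {u\<in>U. f u = w} x (y w)"
   using N'[of w "y w"] by (auto simp: A_def PiE_iff)
 qed (simp add: c_def)
 finally show ?thesis by (simp add: A_def)
qed

end

lemma one_map_comp:
 "f \<in> U \<rightarrow> W ==> fs_comp (fs_one_map W X g) (fs_one_map U W f) = fs_one_map U X (\<lambda>u. g (f u))"
 by (auto simp: fs_comp_def fs_one_map_def fs_one_def pointed_id_def map_comp_def fun_eq_iff dom_def split: if_splits)

lemma one_map_cong: "(\<And>u. u \<in> U ==> f u = f' u) ==> fs_one_map U X f = fs_one_map U X f'" by (simp add: fs_one_map_def cong: restrict_cong)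

section \<open>Simple objects of tensor powers and the matrices of maps of finite sets\<close>

context ssh
begin

abbreviation "JS U \<equiv> gJ (fam (fs_one U) 1)"

abbreviation "tuples U \<equiv> (\<Pi>\<^sub>E u\<in>U. J1)"

text \<open>\<open>bx U\<close> identifies the tuples of simple objects of \<open>\<C>\<close> with the simple objects of \<open>\<C>\<close>'s \<open>U\<close>-th tensor power.\<close>

lemma tup_bij:
 assumes "finite U" shows "bij_betw (tup U U) (tuples U) (\<Pi>\<^sub>E u\<in>U. gJ (fam (fs_disc U) u))"
proof -
 have "bij_betw (tup U U) (tuples U) (\<Pi>\<^sub>E u\<in>U. sg U u ` J1)" by (rule bij_betw_PiE_map) (rule bij_betw_imp_inj_on[OF sg_bij[OF assms]])
 moreover have "(\<Pi>\<^sub>E u\<in>U. sg U u ` J1) = (\<Pi>\<^sub>E u\<in>U. gJ (fam (fs_disc U) u))"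
  by (rule PiE_cong) (rule bij_betw_imp_surj_on[OF sg_bij[OF assms]])
 ultimately show ?thesis by simp
qed

lemma ex_bx:
 assumes "finite U"
 shows "\<exists>b. bij_betw b (tuples U) (JS U) \<and>
  (\<forall>x\<in>tuples U. (\<lambda>s. N (box U) 1 s (tup U U x)) = kdelta (b x) \<and> fst (b x) = (\<Sum>u\<in>U. fst (x u)))"
proof -
 have fib: "fib (pbase U (\<lambda>_. 1)) 1 = U" by (auto simp: fib_pbase)
 have "\<exists>ta. bij_betw ta (\<Pi>\<^sub>E u\<in>U. gJ (fam (fs_disc U) u)) (JS U) \<and>
  (\<forall>t\<in>(\<Pi>\<^sub>E u\<in>U. gJ (fam (fs_disc U) u)). (\<forall>s. N (box U) 1 s t = kdelta (ta t) s) \<and> fst (ta t) = (\<Sum>u\<in>U. fst (t u)))"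
  using N_cocartesian[OF box_hom[OF assms] box_cocartesian[OF assms], of 1, unfolded fib] by simp
 then obtain ta where ta: "bij_betw ta (\<Pi>\<^sub>E u\<in>U. gJ (fam (fs_disc U) u)) (JS U)"
  and N: "\<And>t s. t \<in> (\<Pi>\<^sub>E u\<in>U. gJ (fam (fs_disc U) u)) ==> N (box U) 1 s t = kdelta (ta t) s"
  and d: "\<And>t. t \<in> (\<Pi>\<^sub>E u\<in>U. gJ (fam (fs_disc U) u)) ==> fst (ta t) = (\<Sum>u\<in>U. fst (t u))" by blast
 show ?thesis
 proof (intro exI[of _ "\<lambda>x. ta (tup U U x)"] conjI ballI)
  show "bij_betw (\<lambda>x. ta (tup U U x)) (tuples U) (JS U)" using bij_betw_trans[OF tup_bij[OF assms] ta] by (simp add: comp_def)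
  fix x assume x: "x \<in> tuples U"
  have t: "tup U U x \<in> (\<Pi>\<^sub>E u\<in>U. gJ (fam (fs_disc U) u))" using x by (intro tup_in[OF assms]) auto
  show "(\<lambda>s. N (box U) 1 s (tup U U x)) = kdelta (ta (tup U U x))" by (rule ext) (rule N[OF t])
  have "(\<Sum>u\<in>U. fst (tup U U x u)) = (\<Sum>u\<in>U. fst (x u))" using x by (intro sum.cong) (auto intro!: sg_deg[OF assms])
  then show "fst (ta (tup U U x)) = (\<Sum>u\<in>U. fst (x u))" using d[OF t] by simp
 qed
qed

definition bx :: "nat set => (nat => nat \<times> nat) => nat \<times> nat" where
 "bx U = (SOME b. bij_betw b (tuples U) (JS U) \<and>
  (\<forall>x\<in>tuples U. (\<lambda>s. N (box U) 1 s (tup U U x)) = kdelta (b x) \<and> fst (b x) = (\<Sum>u\<in>U. fst (x u))))"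

lemma
 assumes "finite U"
 shows bx_bij: "bij_betw (bx U) (tuples U) (JS U)"
  and bx_N: "x \<in> tuples U ==> N (box U) 1 s (tup U U x) = kdelta (bx U x) s"
  and bx_deg: "x \<in> tuples U ==> fst (bx U x) = (\<Sum>u\<in>U. fst (x u))"
proof -
 note S = someI_ex[OF ex_bx[OF assms], folded bx_def]
 show "bij_betw (bx U) (tuples U) (JS U)" "x \<in> tuples U ==> fst (bx U x) = (\<Sum>u\<in>U. fst (x u))" using S by auto
 assume "x \<in> tuples U"
 then have "(\<lambda>s. N (box U) 1 s (tup U U x)) = kdelta (bx U x)" using S by blast
 then show "N (box U) 1 s (tup U U x) = kdelta (bx U x) s" by (rule fun_cong)
qed

lemma bx_in: "finite U ==> x \<in> tuples U ==> bx U x \<in> JS U" using bij_betwE[OF bx_bij] by blast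

lemma JS_bx: "finite U ==> s \<in> JS U ==> \<exists>x\<in>tuples U. s = bx U x" using bij_betw_imp_surj_on[OF bx_bij] by blast

lemma box_separates:
 assumes U: "finite U" and y: "y \<in> tuples U" and u: "u \<in> (\<Pi>\<^sub>E i\<in>U. gJ (fam (fs_disc U) i))"
 shows "N (box U) 1 (bx U y) u = (if u = tup U U y then 1 else 0)"
proof -
 have "u \<in> tup U U ` tuples U" using u bij_betw_imp_surj_on[OF tup_bij[OF U]] by simp
 then obtain x where x: "u = tup U U x" "x \<in> tuples U" by (rule imageE)
 have "bx U y = bx U x \<longleftrightarrow> tup U U x = tup U U y" using bx_bij[OF U] tup_bij[OF U] x(2) y unfolding bij_betw_def inj_on_def by blast
 then show ?thesis unfolding x(1) using bx_N[OF U x(2), of "bx U y"] by (simp add: kdelta_def)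
qed

text \<open>The matrix of multiplicities of \<open>H f\<close> for a map \<open>f\<close> of finite
  sets. The only index is 1, so a constant function serves as the tuple.\<close>

abbreviation "M U W f s t \<equiv> N (fs_one_map U W f) 1 s (\<lambda>_. t)"

lemma fib_one: "fib (pointed_id {1}) 1 = {1}" by (auto simp: fib_def pointed_id_def)

lemma M_box:
 assumes U: "finite U" and W: "finite W" and f: "f \<in> U \<rightarrow> W" and x: "x \<in> tuples U"
 shows "M U W f s (bx U x) = N (fs_comp (fs_one_map U W f) (box U)) 1 s (tup U U x)"
proof -
 have fib: "fib (pbase U (\<lambda>_. 1)) 1 = U" "fib (pointed_id {1} \<circ>\<^sub>m pbase U (\<lambda>_. 1)) 1 = U"
  unfolding pbase_simps(3) by (auto simp: fib_pbase pbase_comp)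
 have t: "tup U U x \<in> (\<Pi>\<^sub>E u\<in>U. gJ (fam (fs_disc U) u))" using x by (intro tup_in[OF U]) auto
 have "N (fs_comp (fs_one_map U W f) (box U)) 1 s (tup U U x) = N (fs_one_map U W f) 1 s (restrict (\<lambda>_. bx U x) {1})"
 proof (rule N_comp_delta[OF box_hom[OF U] one_map_hom[OF U W f], where k = 1 and a = "\<lambda>_. bx U x", unfolded fib fib_one])
  show "tup U U x \<in> (\<Pi>\<^sub>E u\<in>U. gJ (fam (fs_disc U) u))" by (rule t)
  fix j :: nat and s assume "j \<in> {1}"
  then have j: "j = 1" by simp
  show "bx U x \<in> gJ (fam (fs_one U) j)" unfolding j by (rule bx_in[OF U x])
  have "restrict (tup U U x) (fib (pbase U (\<lambda>_. 1)) j) = tup U U x" unfolding j fib by (auto simp: fun_eq_iff)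
  then show "N (box U) j s (restrict (tup U U x) (fib (pbase U (\<lambda>_. 1)) j)) = kdelta (bx U x) s" using bx_N[OF U x] j by simp
 qed simp
 also have "\<dots> = M U W f s (bx U x)" by (rule N_cong) (simp add: fib_one[unfolded One_nat_def])
 finally show ?thesis ..
qed

lemma M_fold:
 assumes "finite U" "x \<in> tuples U"
 shows "M U {1} (\<lambda>_. 1) z (bx U x) = c U x z" using M_box[OF assms(1) _ _ assms(2), of "{1}" "\<lambda>_. 1"] unfolding fold_box c_def by simp

text \<open>By naturality of \<open>box\<close>, the functor acts on a tuple of simple objects by
  multiplying its entries over each fibre, and \<open>box\<close> separates the results.\<close>

lemma M_bx:
 assumes U: "finite U" and W: "finite W" and f: "f \<in> U \<rightarrow> W" and x: "x \<in> tuples U" and y: "y \<in> tuples W"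
 shows "M U W f (bx W y) (bx U x) = (\<Prod>w\<in>W. c {u\<in>U. f u = w} x (y w))"
proof -
 have hf: "disc_map U U W f \<in> fs_hom (fs_disc U) (fs_disc W) (pbase U f)" using U W f by (intro disc_map_hom) auto
 have fib: "fib (pbase W (\<lambda>_. 1)) 1 = W" "fib (pbase W (\<lambda>_. 1) \<circ>\<^sub>m pbase U f) 1 = U" "fib (pbase U f) w = {u\<in>U. f u = w}" for w
  using f by (auto simp: fib_pbase pbase_comp)
 have tr: "restrict (tup U U x) {u\<in>U. f u = w} = tup U {u\<in>U. f u = w} x" for w by (auto simp: fun_eq_iff)
 have "M U W f (bx W y) (bx U x) = N (fs_comp (box W) (disc_map U U W f)) 1 (bx W y) (tup U U x)" unfolding M_box[OF U W f x] one_map_box[OF f] ..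
 also have "\<dots> = (\<Prod>w\<in>W. N (disc_map U U W f) w (tup W W y w) (tup U {u\<in>U. f u = w} x))"
 proof (rule N_comp_delta'[OF hf box_hom[OF W], where k = 1 and t = "tup U U x" and y = "tup W W y", unfolded fib tr])
  show "tup U U x \<in> (\<Pi>\<^sub>E u\<in>U. gJ (fam (fs_disc U) u))" using x by (intro tup_in[OF U]) auto
  show "tup W W y \<in> (\<Pi>\<^sub>E u\<in>W. gJ (fam (fs_disc W) u))" using y by (intro tup_in[OF W]) auto
 qed (use box_separates[OF W y] in auto)
 also have "\<dots> = (\<Prod>w\<in>W. c {u\<in>U. f u = w} x (y w))"
 proof (rule prod.cong[OF refl])
  fix w assume w: "w \<in> W"
  have "N (disc_map U U W f) w (sg W w (y w)) (tup U {u\<in>U. f u = w} x) = c {u\<in>U. f u = w} x (y w)"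
   by (rule N_disc_map[OF U W f w]) (use x y w in auto)
  then show "N (disc_map U U W f) w (tup W W y w) (tup U {u\<in>U. f u = w} x) = c {u\<in>U. f u = w} x (y w)" using w by simp
 qed
 finally show ?thesis .
qed

lemma M_degree:
 assumes "finite U" "finite W" "f \<in> U \<rightarrow> W" "t \<in> JS U" "M U W f s t \<noteq> 0"
 shows "s \<in> JS W" "fst s = fst t"
proof -
 have e: "M U W f s t = N (fs_one_map U W f) 1 s (\<lambda>_\<in>{1}. t)" by (rule N_cong) (simp add: fib_one[unfolded One_nat_def])
 note D = N_degree[OF one_map_hom[OF assms(1-3)], of 1 "\<lambda>_\<in>{1}. t" s, unfolded fib_one]
 show "s \<in> JS W" using D(1) assms(4,5) e by simp
 show "fst s = fst t" using D(2) assms(4,5) e by simp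
qed

subsection \<open>The Beck--Chevalley condition on multiplicities\<close>

text \<open>Translates the comparison isomorphism from families over one index to functors of one
  variable, the form in which the Beck--Chevalley condition is stated.\<close>

lemma cmpH_one_map:
 assumes U: "finite U" and W: "finite W" and X: "finite X" and f: "f \<in> U \<rightarrow> W" and g: "g \<in> W \<rightarrow> X"
  and x: "x \<in> Obj (tot (H_set H U))"
 defines "F \<equiv> fs_one_map U W f" and "G \<equiv> fs_one_map W X g"
 shows "cmpH H G F 1 (\<lambda>_\<in>{1}. x) \<in> Homs (tot (H_set H X)) (fob (unary (arH H G)) (fob (unary (arH H F)) x))
   (fob (arH H (fs_comp G F) 1) (\<lambda>_\<in>{1}. x))"
  and "is_iso (tot (H_set H X)) (cmpH H G F 1 (\<lambda>_\<in>{1}. x))"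
proof -
 let ?X = "\<lambda>_\<in>{1::nat}. x"
 have hF: "F \<in> fs_hom (fs_one U) (fs_one W) (pointed_id {1})" unfolding F_def by (rule one_map_hom[OF U W f])
 have hG: "G \<in> fs_hom (fs_one W) (fs_one X) (pointed_id {1})" unfolding G_def by (rule one_map_hom[OF W X g])
 have fib: "fib (pointed_id {1} \<circ>\<^sub>m pointed_id {1}) 1 = {1}" unfolding pbase_simps(3) by (auto simp: fib_pbase pbase_comp)
 have tr: "cmpH H G F \<in> tv_iso (obH H (fs_one U)) (obH H (fs_one X)) (pointed_id {1} \<circ>\<^sub>m pointed_id {1})
   (tv_comp (pointed_id {1}) (pointed_id {1}) (arH H G) (arH H F)) (arH H (fs_comp G F))"
  using pf[unfolded pseudofunctor_over_def, THEN conjunct2, THEN conjunct2, THEN conjunct2, THEN conjunct1] hF hG by blast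
 have one: "1 \<in> tv_idx (obH H (fs_one X))" using idx_obH[OF is_fs_obj_one[OF X]] by simp
 have XO: "?X \<in> Obj (fib_prod (obH H (fs_one U)) (pointed_id {1} \<circ>\<^sub>m pointed_id {1}) 1)"
  using x unfolding fib_prod_def fib by (auto simp: prod_cat_simps H_set_def)
 have rX: "restrict ?X {1} = ?X" by (auto simp: fun_eq_iff)
 have fobc: "fob (tv_comp (pointed_id {1}) (pointed_id {1}) (arH H G) (arH H F) 1) ?X = fob (unary (arH H G)) (fob (unary (arH H F)) x)"
 proof -
  have "(\<lambda>j\<in>fib (pointed_id {1}) 1. fob (arH H F j) (restrict ?X (fib (pointed_id {1}) j))) = (\<lambda>_\<in>{1}. fob (arH H F 1) ?X)"
  proof (unfold fib_one, rule restrict_ext)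
   fix j :: nat assume "j \<in> {1}"
   then have j: "j = 1" by simp
   show "fob (arH H F j) (restrict ?X (fib (pointed_id {1}) j)) = fob (arH H F 1) ?X" unfolding j fib_one rX ..
  qed
  then show ?thesis by (simp add: tv_comp_def unary_def)
 qed
 have m: "cmpH H G F 1 \<in> nat_trans (fib_prod (obH H (fs_one U)) (pointed_id {1} \<circ>\<^sub>m pointed_id {1}) 1) (tot (fam (fs_one X) 1))
   (tv_comp (pointed_id {1}) (pointed_id {1}) (arH H G) (arH H F) 1) (arH H (fs_comp G F) 1)"
  and iso: "\<forall>x\<in>Obj (fib_prod (obH H (fs_one U)) (pointed_id {1} \<circ>\<^sub>m pointed_id {1}) 1). is_iso (tot (fam (fs_one X) 1)) (cmpH H G F 1 x)"
  using tr one unfolding tv_iso_def tv_trans_def by (auto simp: PiE_iff)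
 show "is_iso (tot (H_set H X)) (cmpH H G F 1 ?X)" using iso XO by (simp add: H_set_def)
 have "cmpH H G F 1 ?X \<in> Homs (tot (fam (fs_one X) 1))
   (fob (tv_comp (pointed_id {1}) (pointed_id {1}) (arH H G) (arH H F) 1) ?X) (fob (arH H (fs_comp G F) 1) ?X)"
  using m XO unfolding nat_trans_def by (auto simp: PiE_iff)
 then show "cmpH H G F 1 ?X \<in> Homs (tot (H_set H X)) (fob (unary (arH H G)) (fob (unary (arH H F)) x))
   (fob (arH H (fs_comp G F) 1) ?X)" unfolding fobc by (simp add: H_set_def)
qed

lemma unary_M:
 "gd (H_set H W) (fob (unary (arH H (fs_one_map U W f))) (gs (H_set H U) t)) s = M U W f s t"
proof -
 have "(\<lambda>_\<in>{1::nat}. gs (fam (fs_one U) 1) t) = (\<lambda>i\<in>{1}. gs (fam (fs_one U) i) t)" by (rule restrict_ext) simp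
 then show ?thesis unfolding N_def by (simp add: unary_def H_set_def fib_one[unfolded One_nat_def])
qed

lemma hom_dim_simple:
 assumes "graded_2vect C" "s \<in> gJ C" "x \<in> Obj (tot C)"
 shows "hom_dim (tot C) (gs C s) x = gd C x s" "hom_dim (tot C) x (gs C s) = gd C x s"
proof -
 interpret matcat "tot C" "gJ C" "gd C" "gr C" by (rule matcat_gpres[OF assms(1)])
 note g = gs_Obj[OF assms(1,2)] gd_gs[OF assms(1,2)]
 have "{j. kdelta s j \<noteq> 0} = {s}" by (auto simp: kdelta_def)
 then show "hom_dim (tot C) (gs C s) x = gd C x s" unfolding hom_dim_eq[OF g(1) assms(3)] g(2) by (simp add: kdelta_def)
 have "hom_dim (tot C) x (gs C s) = (\<Sum>j | gd C x j \<noteq> 0. if j = s then gd C x s else 0)"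
  unfolding hom_dim_eq[OF assms(3) g(1)] g(2) by (intro sum.cong) (auto simp: kdelta_def)
 also have "\<dots> = gd C x s" using dim_finite[OF assms(3)] by (simp add: sum.delta)
 finally show "hom_dim (tot C) x (gs C s) = gd C x s" .
qed

text \<open>Evaluate the right mate at the simple object \<open>ga\<close> and compare the
  multiplicities of \<open>be\<close> in its source and target. Adjunctions eliminate the adjoints:
  \<open>fR\<close> of \<open>ga\<close> contains \<open>al\<close> as often as the image of
  \<open>al\<close> under \<open>f\<close> contains \<open>ga\<close>, and maps from
  \<open>be\<close> into \<open>hR\<close> of an object are maps from the image of \<open>be\<close>
  under \<open>h\<close> into that object.\<close>

lemma BC_M:
 assumes sq: "cartesian_square A B C D g f h i" and be: "be \<in> JS B" and ga: "ga \<in> JS C"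
 shows "(\<Sum>z\<in>{z\<in>JS D. fst z = fst be}. M B D h z be * M C D i z ga) =
  (\<Sum>al\<in>{al\<in>JS A. fst al = fst be}. M A B g be al * M A C f ga al)"
proof -
 have fin: "finite A" "finite B" "finite C" "finite D"
  and maps: "g \<in> A \<rightarrow> B" "f \<in> A \<rightarrow> C" "h \<in> B \<rightarrow> D" "i \<in> C \<rightarrow> D"
  and comm: "\<And>a. a \<in> A ==> h (g a) = i (f a)" using sq unfolding cartesian_square_def by auto
 let ?g = "fs_one_map A B g" and ?f = "fs_one_map A C f" and ?h = "fs_one_map B D h" and ?i = "fs_one_map C D i"
 let ?A = "H_set H A" and ?B = "H_set H B" and ?C = "H_set H C" and ?D = "H_set H D"
 let ?G = "unary (arH H ?g)" and ?F = "unary (arH H ?f)" and ?H = "unary (arH H ?h)" and ?I = "unary (arH H ?i)"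
 let ?al = "square_trans H D ?g ?f ?h ?i"
 have gr: "graded_2vect ?A" "graded_2vect ?B" "graded_2vect ?C" "graded_2vect ?D" using one_g2 fin by (simp_all add: H_set_def)
 interpret mA: matcat "tot ?A" "gJ ?A" "gd ?A" "gr ?A" by (rule matcat_gpres[OF gr(1)])
 interpret mB: matcat "tot ?B" "gJ ?B" "gd ?B" "gr ?B" by (rule matcat_gpres[OF gr(2)])
 interpret mC: matcat "tot ?C" "gJ ?C" "gd ?C" "gr ?C" by (rule matcat_gpres[OF gr(3)])
 interpret mD: matcat "tot ?D" "gJ ?D" "gd ?D" "gr ?D" by (rule matcat_gpres[OF gr(4)])
 have JSe: "JS A = gJ ?A" "JS B = gJ ?B" "JS C = gJ ?C" "JS D = gJ ?D" by (simp_all add: H_set_def)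
 have "BC_condition ?A ?B ?C ?D ?G ?F ?H ?I ?al" using ssh sq unfolding SSH_category_def Let_def by blast
 then obtain gL etg epg iL eti epi fR etf epf hR eth eph where
  adg: "gr_adjunction ?B ?A gL ?G etg epg" and adi: "gr_adjunction ?D ?C iL ?I eti epi"
  and adf: "gr_adjunction ?A ?C ?F fR etf epf" and adh: "gr_adjunction ?B ?D ?H hR eth eph"
  and mate: "\<And>z. z \<in> Obj (tot ?C) ==> is_iso (tot ?B) (right_mate ?B ?G ?I ?al fR epf hR eth z)" unfolding BC_condition_def by blast
 have exG: "exact_functor (tot ?A) (tot ?B) ?G" and exI': "exact_functor (tot ?C) (tot ?D) ?I"
  and exF: "exact_functor (tot ?A) (tot ?C) ?F" and exH: "exact_functor (tot ?B) (tot ?D) ?H"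
  and exfR: "exact_functor (tot ?C) (tot ?A) fR" and exhR: "exact_functor (tot ?D) (tot ?B) hR"
  using adg adi adf adh unfolding gr_adjunction_def gr_mor_def by blast+
 have ob: "fob E a \<in> Obj Y" if "exact_functor X Y E" "a \<in> Obj X"
  for X Y :: "(nat => 'o, nat => 'm, 'k) lcat" and E a using that unfolding exact_functor_def linear_functor_def is_functor_def by blast
 have hm: "far E u \<in> Homs Y (fob E a) (fob E b)" if "exact_functor X Y E" "u \<in> Homs X a b"
  for X Y :: "(nat => 'o, nat => 'm, 'k) lcat" and E a b u using that unfolding exact_functor_def linear_functor_def is_functor_def by blast
 define z where "z = gs ?C ga"
 define x where "x = gs ?B be"
 have zO: "z \<in> Obj (tot ?C)" unfolding z_def using gs_Obj[OF gr(3)] ga JSe by simp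
 have xO: "x \<in> Obj (tot ?B)" unfolding x_def using gs_Obj[OF gr(2)] be JSe by simp
 define w where "w = fob fR z"
 have wO: "w \<in> Obj (tot ?A)" unfolding w_def by (rule ob[OF exfR zO])
 have alh: "?al w \<in> Homs (tot ?D) (fob ?H (fob ?G w)) (fob ?I (fob ?F w))"
 proof -
  have "fs_comp ?h ?g = fs_comp ?i ?f" unfolding one_map_comp[OF maps(1)] one_map_comp[OF maps(2)] by (rule one_map_cong) (rule comm)
  note eq = this
  note k = cmpH_one_map[OF fin(1,2,4) maps(1,3) wO] cmpH_one_map[OF fin(1,3,4) maps(2,4) wO]
  show ?thesis unfolding square_trans_def by (rule mD.Cmp_hom[OF k(1)[unfolded eq] is_inverse_inv_arr[OF mD.matcat_axioms k(4,3)]])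
 qed
 have eps: "epf z \<in> Homs (tot ?C) (fob ?F w) z"
  using adf zO by (auto simp: gr_adjunction_def nat_trans_def PiE_iff fctr_comp_def fctr_id_def w_def)
 have eta: "eth (fob ?G w) \<in> Homs (tot ?B) (fob ?G w) (fob hR (fob ?H (fob ?G w)))"
  using adh ob[OF exG wO] by (auto simp: gr_adjunction_def nat_trans_def PiE_iff fctr_comp_def fctr_id_def)
 have "right_mate ?B ?G ?I ?al fR epf hR eth z \<in> Homs (tot ?B) (fob ?G w) (fob hR (fob ?I z))"
  unfolding right_mate_def w_def[symmetric] by (rule mB.Cmp_hom[OF mB.Cmp_hom[OF eta hm[OF exhR alh]] hm[OF exhR hm[OF exI' eps]]])
 from mB.is_iso_dims[OF mate[OF zO] this]
 have dims: "gd ?B (fob ?G w) = gd ?B (fob hR (fob ?I z))" .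
 have gdw: "gd ?A w al = M A C f ga al" if "al \<in> gJ ?A" for al
 proof -
  have "gd ?A w al = hom_dim (tot ?A) (gs ?A al) w" using hom_dim_simple(1)[OF gr(1) that wO] by simp
  also have "\<dots> = hom_dim (tot ?C) (fob ?F (gs ?A al)) z"
   unfolding w_def using adjunction_dims[OF mA.matcat_axioms mC.matcat_axioms adf gs_Obj[OF gr(1) that] zO] by simp
  also have "\<dots> = gd ?C (fob ?F (gs ?A al)) ga"
   unfolding z_def using hom_dim_simple(2)[OF gr(3) _ ob[OF exF gs_Obj[OF gr(1) that]]] ga JSe by simp
  finally show ?thesis by (simp add: unary_M)
 qed
 \<comment> \<open>The functor of \<open>g\<close> has degree 0, so only simple objects of the
   degree of \<open>be\<close> contribute; this gives the finite range of the final sum.\<close>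
 have dg: "fst al = fst be" if "al \<in> gJ ?A" "M A B g be al \<noteq> 0" for al using M_degree(2)[OF fin(1,2) maps(1), of al be] that JSe by simp
 have supp: "{j. gd ?A w j \<noteq> 0} = {j \<in> gJ ?A. M A C f ga j \<noteq> 0}"
 proof (rule equalityI; rule subsetI)
  fix j assume "j \<in> {j. gd ?A w j \<noteq> 0}"
  then have nz: "gd ?A w j \<noteq> 0" by simp
  then have "j \<in> gJ ?A" by (rule mA.dim_support[OF wO])
  then show "j \<in> {j \<in> gJ ?A. M A C f ga j \<noteq> 0}" using nz gdw by simp
 next
  fix j assume "j \<in> {j \<in> gJ ?A. M A C f ga j \<noteq> 0}"
  then have "j \<in> gJ ?A" "M A C f ga j \<noteq> 0" by simp_all
  then show "j \<in> {j. gd ?A w j \<noteq> 0}" using gdw by simp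
 qed
 have finw: "finite {j \<in> gJ ?A. M A C f ga j \<noteq> 0}" using mA.dim_finite[OF wO] supp by simp
 have "(\<Sum>z\<in>{z\<in>JS D. fst z = fst be}. M B D h z be * M C D i z ga) =
   (\<Sum>j | gd ?D (fob ?H x) j \<noteq> 0. gd ?D (fob ?H x) j * gd ?D (fob ?I z) j)" unfolding x_def z_def unary_M
  using M_degree[OF fin(2,4) maps(3) be] finite_gJ[OF gr(4)] JSe by (intro N_sum_mono[symmetric]) auto
 also have "\<dots> = hom_dim (tot ?D) (fob ?H x) (fob ?I z)" by (rule mD.hom_dim_eq[OF ob[OF exH xO] ob[OF exI' zO], symmetric])
 also have "\<dots> = hom_dim (tot ?B) x (fob hR (fob ?I z))" by (rule adjunction_dims[OF mB.matcat_axioms mD.matcat_axioms adh xO ob[OF exI' zO]])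
 also have "\<dots> = gd ?B (fob hR (fob ?I z)) be" unfolding x_def using hom_dim_simple(1)[OF gr(2) _ ob[OF exhR ob[OF exI' zO]]] be JSe by simp
 also have "\<dots> = gd ?B (fob ?G w) be" by (simp add: dims)
 also have "\<dots> = (\<Sum>t | gd ?A w t \<noteq> 0. gd ?A w t * gd ?B (fob ?G (gs ?A t)) be)" unfolding gs_def
  by (rule exact_functor_dims[where d = "gd ?A" and a = w, OF mA.matcat_axioms mB.matcat_axioms exG wO mA.dim_finite[OF wO] subset_refl])
   (use mA.dim_support[OF wO] in blast)
 also have "\<dots> = (\<Sum>al\<in>{j \<in> gJ ?A. M A C f ga j \<noteq> 0}. M A B g be al * M A C f ga al)"
  unfolding supp by (intro sum.cong refl) (auto simp: gdw unary_M)
 also have "\<dots> = (\<Sum>al\<in>{j \<in> gJ ?A. M A C f ga j \<noteq> 0 \<and> fst j = fst be}. M A B g be al * M A C f ga al)"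
  using finw dg by (intro N_sum_mono[symmetric]) auto
 also have "\<dots> = (\<Sum>al\<in>{al\<in>JS A. fst al = fst be}. M A B g be al * M A C f ga al)"
  using finite_gJ[OF gr(1)] unfolding JSe by (intro N_sum_mono) auto
 finally show ?thesis .
qed

end

declare One_nat_def [simp del]

text \<open>A set with a map to the empty set is empty, so the universal property concerns the empty
  test set only.\<close>

lemma empty_square:
 assumes "finite B" "finite D" "h \<in> B \<rightarrow>\<^sub>E D"
 shows "cartesian_square {} B {} D (\<lambda>_. undefined) (\<lambda>_. undefined) h (\<lambda>_. undefined)" unfolding cartesian_square_def
proof (intro conjI allI impI ballI)
 fix T :: "nat set" and u v :: "nat => nat"
 assume "v \<in> T \<rightarrow>\<^sub>E {}"
 then have "T = {}" by (cases "T = {}") auto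
 then show "\<exists>!w. w \<in> T \<rightarrow>\<^sub>E {} \<and> (\<forall>t\<in>T. undefined = u t \<and> undefined = v t)" by auto
qed (use assms in auto)

section \<open>Unit, associativity, counit and Hopf axiom for the structure constants\<close>

context ssh
begin

lemma finite_J1_deg: "finite {j \<in> J1. P j \<and> fst j = (n :: nat)}" "finite {j \<in> J1. fst j = n}" "finite {j \<in> J1. fst j \<le> n}"
proof -
 have fin: "finite {j \<in> J1. fst j = m}" for m by (rule finite_gJ[OF disc_g2]) auto
 show "finite {j \<in> J1. fst j = n}" by (rule fin)
 show "finite {j \<in> J1. P j \<and> fst j = n}" by (rule finite_subset[OF _ fin[of n]]) auto
 have "{j \<in> J1. fst j \<le> n} = (\<Union>m\<in>{..n}. {j \<in> J1. fst j = m})" by auto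
 then show "finite {j \<in> J1. fst j \<le> n}" using fin by simp
qed

text \<open>In \<open>c_chain\<close> for a bijection all fibres are singletons; their constants are
  Kronecker deltas, and one summand survives.\<close>

lemma c_bij:
 assumes U: "finite U" and f: "bij_betw f U W" and x: "x \<in> U \<rightarrow> J1" and x': "\<And>u. u \<in> U ==> x' (f u) = x u"
 shows "c U x z = c W x' z"
proof -
 have W: "finite W" using bij_betw_finite[OF f] U by simp
 have fW: "f \<in> U \<rightarrow> W" using f by (auto simp: bij_betw_def)
 define A where "A = (\<lambda>w. {j\<in>J1. fst j = (\<Sum>u\<in>{u\<in>U. f u = w}. fst (x u))})"
 have finA: "finite (PiE W A)" unfolding A_def by (intro finite_PiE W finite_J1_deg)
 have fibre: "\<exists>u\<in>U. {u\<in>U. f u = w} = {u} \<and> x' w = x u \<and> x u \<in> J1" if "w \<in> W" for w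
 proof -
  have "w \<in> f ` U" using f that by (simp add: bij_betw_def)
  then obtain u where u: "w = f u" "u \<in> U" by (rule imageE)
  have "{v\<in>U. f v = w} = {u}" using f u by (auto simp: bij_betw_def inj_on_def)
  then show ?thesis using u x' x by (intro bexI[of _ u]) auto
 qed
 have prod: "(\<Prod>w\<in>W. c {u\<in>U. f u = w} x (y w)) = (if y = restrict x' W then 1 else 0)" if "y \<in> extensional W" for y
 proof -
  have "(\<Prod>w\<in>W. c {u\<in>U. f u = w} x (y w)) = (\<Prod>w\<in>W. kdelta (x' w) (y w))"
  proof (rule prod.cong[OF refl])
   fix w assume "w \<in> W"
   from fibre[OF this] obtain u where u: "{u\<in>U. f u = w} = {u}" "x' w = x u" "x u \<in> J1" by blast
   show "c {u\<in>U. f u = w} x (y w) = kdelta (x' w) (y w)" unfolding u(1,2) by (rule c_single[of x u, OF u(3)])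
  qed
  then show ?thesis using prod_kdelta[OF W that] by simp
 qed
 have mem: "restrict x' W \<in> (PiE W A)"
 proof (rule restrict_PiE_iff[THEN iffD2], rule ballI)
  fix w assume "w \<in> W"
  from fibre[OF this] obtain u where "{u\<in>U. f u = w} = {u}" "x' w = x u" "x u \<in> J1" by blast
  then show "x' w \<in> A w" by (simp add: A_def)
 qed
 have "c U x z = (\<Sum>y\<in>(PiE W A). (\<Prod>w\<in>W. c {u\<in>U. f u = w} x (y w)) * c W y z)" unfolding A_def by (rule c_chain[OF U W fW x])
 also have "\<dots> = (\<Sum>y\<in>(PiE W A). if y = restrict x' W then c W y z else 0)" by (rule sum.cong[OF refl]) (auto simp: prod PiE_def)
 also have "\<dots> = c W (restrict x' W) z" using finA mem by (simp add: sum.delta)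
 also have "\<dots> = c W x' z" by (rule c_cong) simp
 finally show ?thesis .
qed

text \<open>The structure constants of the product in the basis of simple objects, with the two
  factors in named positions.\<close>

definition c2 :: "nat \<times> nat => nat \<times> nat => nat \<times> nat => nat" where
 "c2 x y z = c {1, 2} (\<lambda>i. if i = 1 then x else y) z"

lemma c_pair:
 assumes "u \<noteq> v" "x u \<in> J1" "x v \<in> J1"
 shows "c {u, v} x z = c2 (x u) (x v) z" unfolding c2_def
proof (rule c_bij[where f = "\<lambda>i. if i = u then 1 else 2"])
 show "bij_betw (\<lambda>i. if i = u then 1 else 2) {u, v} {1, 2::nat}" using assms(1) by (auto simp: bij_betw_def)
qed (use assms in auto)

lemma c2_degree:
 assumes "x \<in> J1" "y \<in> J1" "c2 x y z \<noteq> 0"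
 shows "z \<in> J1" "fst z = fst x + fst y" using c_degree[of "{1,2}" "\<lambda>i. if i = 1 then x else y" z] assms by (auto simp: c2_def)

lemma c2_comm:
 assumes "x \<in> J1" "y \<in> J1"
 shows "c2 x y z = c2 y x z"
proof -
 have "c2 x y z = c {2, 1} (\<lambda>i. if i = 1 then x else y) z" by (simp add: c2_def insert_commute)
 also have "\<dots> = c2 y x z" by (subst c_pair) (use assms in auto)
 finally show ?thesis .
qed

lemma c_chain2:
 fixes f :: "nat => nat"
 assumes U: "finite U" and f: "f \<in> U \<rightarrow> {1, 2}" and x: "x \<in> U \<rightarrow> J1"
 shows "c U x z = (\<Sum>a\<in>{j\<in>J1. fst j = (\<Sum>u\<in>{u\<in>U. f u = 1}. fst (x u))}.
  \<Sum>b\<in>{j\<in>J1. fst j = (\<Sum>u\<in>{u\<in>U. f u = 2}. fst (x u))}.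
   c {u\<in>U. f u = 1} x a * c {u\<in>U. f u = 2} x b * c2 a b z)"
proof -
 let ?A = "\<lambda>w. {j\<in>J1. fst j = (\<Sum>u\<in>{u\<in>U. f u = w}. fst (x u))}"
 have "c U x z = (\<Sum>y\<in>(\<Pi>\<^sub>E w\<in>{1,2}. ?A w). (\<Prod>w\<in>{1,2}. c {u\<in>U. f u = w} x (y w)) * c {1,2} y z)"
  by (rule c_chain[OF U _ f x]) simp
 also have "\<dots> = (\<Sum>a\<in>?A 1. \<Sum>y\<in>(\<Pi>\<^sub>E w\<in>{2}. ?A w). (\<Prod>w\<in>{1,2}. c {u\<in>U. f u = w} x ((y(1 := a)) w)) * c {1,2} (y(1 := a)) z)"
  by (rule sum_PiE_insert) simp
 also have "\<dots> = (\<Sum>a\<in>?A 1. \<Sum>b\<in>?A 2. \<Sum>y\<in>(\<Pi>\<^sub>E w\<in>{}. ?A w).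
   (\<Prod>w\<in>{1,2}. c {u\<in>U. f u = w} x ((y(2 := b, 1 := a)) w)) * c {1,2} (y(2 := b, 1 := a)) z)" by (intro sum.cong refl sum_PiE_insert) simp
 also have "\<dots> = (\<Sum>a\<in>?A 1. \<Sum>b\<in>?A 2. c {u\<in>U. f u = 1} x a * c {u\<in>U. f u = 2} x b * c2 a b z)"
 proof (intro sum.cong refl)
  fix a b assume "a \<in> ?A 1" "b \<in> ?A 2"
  then have ab: "a \<in> J1" "b \<in> J1" by simp_all
  have "c {1, 2} (y(2 := b, 1 := a)) z = c2 a b z" for y :: "nat => nat \<times> nat" using c_pair[of 1 2 "y(2 := b, 1 := a)" z] ab by simp
  then show "(\<Sum>y\<in>(\<Pi>\<^sub>E w\<in>{}. ?A w). (\<Prod>w\<in>{1,2}. c {u\<in>U. f u = w} x ((y(2 := b, 1 := a)) w)) * c {1,2} (y(2 := b, 1 := a)) z) =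
    c {u\<in>U. f u = 1} x a * c {u\<in>U. f u = 2} x b * c2 a b z" by simp
 qed
 finally show ?thesis .
qed

text \<open>The Beck--Chevalley condition makes the sum of the squares of the multiplicities in the
  unit object equal to 1. Exactly one multiplicity is 1, so the unit object is simple.\<close>

lemma ex_unit: "\<exists>e\<in>J1. fst e = 0 \<and> (\<forall>x z. c {} x z = kdelta e z)"
proof -
 let ?x = "\<lambda>_::nat. undefined :: nat \<times> nat"
 have x: "?x \<in> tuples {}" by simp
 define be where "be = bx {} ?x"
 have be: "be \<in> JS {}" unfolding be_def by (rule bx_in[OF _ x]) simp
 have deg: "fst be = 0" unfolding be_def using bx_deg[OF _ x] by simp
 have JS0: "JS {} = {be}" using bij_betw_imp_surj_on[OF bx_bij[of "{}"]] by (simp add: be_def)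
 have MD: "M {} {1} (\<lambda>_. undefined) z be = c {} ?x z" for z
 proof -
  have "fs_one_map {} {1} (\<lambda>_. undefined) = fs_one_map {} {1} (\<lambda>_. 1)" by (rule one_map_cong) simp
  then show ?thesis using M_fold[OF _ x, of z] by (simp add: be_def)
 qed
 have MA: "M {} {} (\<lambda>_. undefined) be be = 1" unfolding be_def by (subst M_bx[OF _ _ _ x x]) auto
 have "cartesian_square {} {} {} {1} (\<lambda>_. undefined) (\<lambda>_. undefined) (\<lambda>_. undefined) (\<lambda>_. undefined)"
  by (rule empty_square) auto
 from BC_M[OF this be be]
 have "(\<Sum>z\<in>{z\<in>J1. fst z = 0}. c {} ?x z * c {} ?x z) = 1" unfolding MD JS0 fs_disc_1[symmetric] using MA deg
  by (simp add: Collect_conv_if cong: conj_cong)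
 moreover have fin: "finite {z\<in>J1. fst z = 0}" by (rule finite_J1_deg)
 ultimately have "\<exists>e\<in>{z\<in>J1. fst z = 0}. c {} ?x e * c {} ?x e = 1 \<and>
   (\<forall>z\<in>{z\<in>J1. fst z = 0}. e \<noteq> z \<longrightarrow> c {} ?x z * c {} ?x z = 0)" unfolding sum_eq_1_iff[OF fin] by simp
 then obtain e where e: "e \<in> {z\<in>J1. fst z = 0}" and e': "c {} ?x e * c {} ?x e = 1 \<and>
   (\<forall>z\<in>{z\<in>J1. fst z = 0}. e \<noteq> z \<longrightarrow> c {} ?x z * c {} ?x z = 0)" by (rule bexE)
 have ne: "c {} ?x z * c {} ?x z = 0" if "z \<in> {z\<in>J1. fst z = 0}" "z \<noteq> e" for z
  by (rule bspec[OF conjunct2[OF e'] that(1), THEN mp]) (use that(2) in simp)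
 have "c {} x z = kdelta e z" for x z
 proof -
  have cx: "c {} x z = c {} ?x z" by (rule c_cong) simp
  show ?thesis
  proof (cases "z = e")
   case True then show ?thesis using cx e' by (simp add: kdelta_def)
  next
   case False
   have "c {} ?x z = 0"
   proof (rule ccontr)
    assume nz: "c {} ?x z \<noteq> 0"
    have "z \<in> J1" "fst z = 0" using c_degree[of "{}" ?x z] nz by auto
    then show False using ne[of z] False nz by simp
   qed
   then show ?thesis using cx False by (simp add: kdelta_def)
  qed
 qed
 then show ?thesis using e by (intro bexI[of _ e]) auto
qed

definition e :: "nat \<times> nat" where
 "e = (SOME e. e \<in> J1 \<and> fst e = 0 \<and> (\<forall>x z. c {} x z = kdelta e z))"

lemma e_in: "e \<in> J1" and e_deg: "fst e = 0" and c_empty: "c {} x z = kdelta e z"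
proof -
 have "\<exists>e. e \<in> J1 \<and> fst e = 0 \<and> (\<forall>x z. c {} x z = kdelta e z)" using ex_unit unfolding Bex_def .
 note S = someI_ex[OF this, folded e_def]
 show "e \<in> J1" by (rule conjunct1[OF S])
 show "fst e = 0" by (rule conjunct1[OF conjunct2[OF S]])
 show "c {} x z = kdelta e z" by (rule spec[OF spec[OF conjunct2[OF conjunct2[OF S]]]])
qed

text \<open>Apply the chain formula to the inclusion of \<open>{2}\<close> into
  \<open>{1, 2}\<close>: the empty fibre over 1 contributes \<open>e\<close>.\<close>

lemma c2_unit:
 assumes x: "x \<in> J1"
 shows "c2 e x z = kdelta x z"
proof -
 have s: "{u\<in>{2::nat}. u = 1} = {}" "{u\<in>{2::nat}. u = 2} = {2}" by auto
 have k: "c {2} (\<lambda>_. x) = kdelta x" by (rule ext) (rule c_single[OF x])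
 have "kdelta x z = (\<Sum>a\<in>{j\<in>J1. fst j = 0}. \<Sum>b\<in>{j\<in>J1. fst j = fst x}. kdelta e a * kdelta x b * c2 a b z)"
  using c_chain2[of "{2}" "\<lambda>i. i" "\<lambda>_. x" z, unfolded s c_empty k] x by simp
 also have "\<dots> = (\<Sum>a\<in>{j\<in>J1. fst j = 0}. if a = e then \<Sum>b\<in>{j\<in>J1. fst j = fst x}. if b = x then c2 a b z else 0 else 0)"
  by (auto simp: kdelta_def intro!: sum.cong)
 also have "\<dots> = c2 e x z" using x e_in e_deg by (simp add: sum.delta' sum.delta finite_J1_deg)
 finally show ?thesis ..
qed

text \<open>Both sides are the threefold product: \<open>{1, 2, 3}\<close> is mapped to
  \<open>{1, 2}\<close> with fibres \<open>{1, 2}\<close> and \<open>{3}\<close>, or with fibres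
  \<open>{1}\<close> and \<open>{2, 3}\<close>.\<close>

lemma c2_assoc:
 assumes x: "x \<in> J1" and y: "y \<in> J1" and z: "z \<in> J1"
 shows "(\<Sum>w\<in>{j\<in>J1. fst j = fst x + fst y}. c2 x y w * c2 w z v) = (\<Sum>w\<in>{j\<in>J1. fst j = fst y + fst z}. c2 y z w * c2 x w v)"
proof -
 let ?t = "\<lambda>i::nat. if i = 1 then x else if i = 2 then y else z"
 have t: "?t i \<in> J1" for i using assms by simp
 have s: "{u\<in>{1,2,3::nat}. (if u = 3 then 2 else 1) = (1::nat)} = {1,2}" "{u\<in>{1,2,3::nat}. (if u = 3 then 2 else 1) = (2::nat)} = {3}"
  "{u\<in>{1,2,3::nat}. (if u = 1 then 1 else 2) = (1::nat)} = {1}" "{u\<in>{1,2,3::nat}. (if u = 1 then 1 else 2) = (2::nat)} = {2,3}" by auto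
 have k: "c {3} ?t = kdelta z" "c {1} ?t = kdelta x" using c_single[of ?t 3] c_single[of ?t 1] assms by auto
 have p: "c {1,2} ?t = c2 x y" "c {2,3} ?t = c2 y z" using c_pair[of 1 2 ?t] c_pair[of 2 3 ?t] assms by auto
 have "(\<Sum>w\<in>{j\<in>J1. fst j = fst x + fst y}. c2 x y w * c2 w z v) =
   (\<Sum>a\<in>{j\<in>J1. fst j = fst x + fst y}. \<Sum>b\<in>{j\<in>J1. fst j = fst z}. if b = z then c2 x y a * c2 a b v else 0)"
  using z by (simp add: sum.delta finite_J1_deg)
 also have "\<dots> = (\<Sum>a\<in>{j\<in>J1. fst j = fst x + fst y}. \<Sum>b\<in>{j\<in>J1. fst j = fst z}. c2 x y a * kdelta z b * c2 a b v)"
  by (auto simp: kdelta_def intro!: sum.cong)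
 also have "\<dots> = c {1,2,3} ?t v" using c_chain2[of "{1,2,3}" "\<lambda>u. if u = 3 then 2 else 1" ?t v, unfolded s k p] t assms by simp
 also have "\<dots> = (\<Sum>a\<in>{j\<in>J1. fst j = fst x}. \<Sum>b\<in>{j\<in>J1. fst j = fst y + fst z}. kdelta x a * c2 y z b * c2 a b v)"
  using c_chain2[of "{1,2,3}" "\<lambda>u. if u = 1 then 1 else 2" ?t v, unfolded s k p] t assms by simp
 also have "\<dots> = (\<Sum>a\<in>{j\<in>J1. fst j = fst x}. if a = x then \<Sum>b\<in>{j\<in>J1. fst j = fst y + fst z}. c2 y z b * c2 a b v else 0)"
  by (auto simp: kdelta_def intro!: sum.cong)
 also have "\<dots> = (\<Sum>w\<in>{j\<in>J1. fst j = fst y + fst z}. c2 y z w * c2 x w v)" using x by (simp add: sum.delta finite_J1_deg)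
 finally show ?thesis .
qed

lemma M_fold2:
 assumes "x \<in> tuples {1,2}"
 shows "M {1,2} {1} (\<lambda>i\<in>{1,2}. 1) z (bx {1,2} x) = c2 (x 1) (x 2) z"
proof -
 have "fs_one_map {1,2} {1} (\<lambda>i\<in>{1,2}. 1) = fs_one_map {1,2} {1} (\<lambda>_. 1)" by (rule one_map_cong) simp
 then have "M {1,2} {1} (\<lambda>i\<in>{1,2}. 1) z (bx {1,2} x) = c {1,2} x z" using M_fold[OF _ assms, of z] by simp
 also have "\<dots> = c2 (x 1) (x 2) z" by (rule c_pair) (use assms in "auto simp: PiE_iff")
 finally show ?thesis .
qed

definition pr :: "nat \<times> nat => nat \<times> nat => nat => nat \<times> nat" where
 "pr x y = (\<lambda>i\<in>{1,2}. if i = 1 then x else y)"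

lemma pr_in: "x \<in> J1 ==> y \<in> J1 ==> pr x y \<in> tuples {1,2}"
 and pr_simps: "pr x y 1 = x" "pr x y 2 = y" by (auto simp: pr_def)

lemma bx_pr:
 assumes "x \<in> J1" "y \<in> J1"
 shows "bx {1,2} (pr x y) \<in> JS {1,2}" "fst (bx {1,2} (pr x y)) = fst x + fst y"
 using bx_in[OF _ pr_in[OF assms]] bx_deg[OF _ pr_in[OF assms]] pr_simps[of x y] by simp_all

lemma c2_counit:
 assumes x: "x \<in> J1" and y: "y \<in> J1"
 shows "c2 x y e = kdelta e x * kdelta e y"
proof -
 let ?t = "\<lambda>_::nat. undefined :: nat \<times> nat"
 have t: "?t \<in> tuples {}" by simp
 define ga where "ga = bx {} ?t"
 have ga: "ga \<in> JS {}" unfolding ga_def by (rule bx_in[OF _ t]) simp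
 have deg: "fst ga = 0" unfolding ga_def using bx_deg[OF _ t] by simp
 have JS0: "JS {} = {ga}" using bij_betw_imp_surj_on[OF bx_bij[of "{}"]] by (simp add: ga_def)
 define be where "be = bx {1,2} (pr x y)"
 have be: "be \<in> JS {1,2}" "fst be = fst x + fst y" unfolding be_def by (rule bx_pr[OF x y])+
 have MC: "M {} {1} (\<lambda>_. undefined) z ga = kdelta e z" for z
 proof -
  have "fs_one_map {} {1} (\<lambda>_. undefined) = fs_one_map {} {1} (\<lambda>_. 1)" by (rule one_map_cong) simp
  then show ?thesis using M_fold[OF _ t, of z] by (simp add: ga_def c_empty)
 qed
 have MB: "M {1,2} {1} (\<lambda>i\<in>{1,2}. 1) z be = c2 x y z" for z unfolding be_def M_fold2[OF pr_in[OF x y]] pr_simps ..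
 have MA: "M {} {} (\<lambda>_. undefined) ga ga = 1" unfolding ga_def by (subst M_bx[OF _ _ _ t t]) auto
 have MG: "M {} {1,2} (\<lambda>_. undefined) be ga = kdelta e x * kdelta e y"
  unfolding be_def ga_def by (subst M_bx[OF _ _ _ t pr_in[OF x y]]) (auto simp: c_empty pr_def)
 have "cartesian_square {} {1,2} {} {1} (\<lambda>_. undefined) (\<lambda>_. undefined) (\<lambda>i\<in>{1,2}. 1) (\<lambda>_. undefined)"
  by (rule empty_square) auto
 \<comment> \<open>The only simple object of the empty tensor power has degree 0, so the right-hand
   sum is empty unless \<open>be\<close> has degree 0.\<close>
 from BC_M[OF this be(1) ga]
 have BC: "(\<Sum>z\<in>{z\<in>J1. fst z = fst x + fst y}. c2 x y z * kdelta e z) = (if fst x + fst y = 0 then kdelta e x * kdelta e y else 0)"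
  unfolding MB MC JS0 fs_disc_1[symmetric] be(2) using MA MG deg by (auto simp: Collect_conv_if cong: conj_cong)
 have "(\<Sum>z\<in>{z\<in>J1. fst z = fst x + fst y}. c2 x y z * kdelta e z) =
   (\<Sum>z\<in>{z\<in>J1. fst z = fst x + fst y}. if z = e then c2 x y z else 0)" by (intro sum.cong) (auto simp: kdelta_def)
 also have "\<dots> = c2 x y e" using c2_degree[OF x y, of e] by (auto simp: sum.delta finite_J1_deg)
 finally show ?thesis using BC e_deg by (auto simp: kdelta_def split: if_splits)
qed

text \<open>The elements 1, 2, 3, 4 form a table with rows \<open>1 2\<close> and
  \<open>3 4\<close>; one map gives the row of an element and the other its column.\<close>

lemma hopf_square:
 "cartesian_square {1,2,3,4} {1,2} {1,2} {1} (\<lambda>a\<in>{1,2,3,4}. if a \<le> 2 then 1 else 2)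
  (\<lambda>a\<in>{1,2,3,4}. if odd a then 1 else 2) (\<lambda>i\<in>{1,2}. 1) (\<lambda>i\<in>{1,2}. 1)" (is "cartesian_square ?A ?B ?B _ ?g ?f _ _")
 unfolding cartesian_square_def
proof (intro conjI allI impI ballI)
 fix T :: "nat set" and u v :: "nat => nat" assume u: "u \<in> T \<rightarrow>\<^sub>E {1,2}" and v: "v \<in> T \<rightarrow>\<^sub>E {1,2}"
 have uv: "\<exists>!a. a \<in> ?A \<and> ?g a = u t \<and> ?f a = v t" if "t \<in> T" for t
 proof -
  have "u t = 1 \<or> u t = 2" "v t = 1 \<or> v t = 2" using u v that by auto
  then show ?thesis by (intro ex1I[of _ "if u t = 1 then if v t = 1 then 1 else 2 else if v t = 1 then 3 else 4"]) (auto split: if_splits)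
 qed
 show "\<exists>!w. w \<in> T \<rightarrow>\<^sub>E ?A \<and> (\<forall>t\<in>T. ?g (w t) = u t \<and> ?f (w t) = v t)"
 proof (rule ex1I[of _ "\<lambda>t\<in>T. THE a. a \<in> ?A \<and> ?g a = u t \<and> ?f a = v t"])
  show "(\<lambda>t\<in>T. THE a. a \<in> ?A \<and> ?g a = u t \<and> ?f a = v t) \<in> T \<rightarrow>\<^sub>E ?A \<and>
    (\<forall>t\<in>T. ?g ((\<lambda>t\<in>T. THE a. a \<in> ?A \<and> ?g a = u t \<and> ?f a = v t) t) = u t \<and>
     ?f ((\<lambda>t\<in>T. THE a. a \<in> ?A \<and> ?g a = u t \<and> ?f a = v t) t) = v t)"
  proof (intro conjI ballI PiE_I)
   fix t assume t: "t \<in> T"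
   note * = theI'[OF uv[OF t]]
   show "(\<lambda>t\<in>T. THE a. a \<in> ?A \<and> ?g a = u t \<and> ?f a = v t) t \<in> ?A" using * t unfolding restrict_apply'[OF t] by blast
   show "?g ((\<lambda>t\<in>T. THE a. a \<in> ?A \<and> ?g a = u t \<and> ?f a = v t) t) = u t" using * t unfolding restrict_apply'[OF t] by blast
   show "?f ((\<lambda>t\<in>T. THE a. a \<in> ?A \<and> ?g a = u t \<and> ?f a = v t) t) = v t" using * t unfolding restrict_apply'[OF t] by blast
  qed simp
  fix w assume w: "w \<in> T \<rightarrow>\<^sub>E ?A \<and> (\<forall>t\<in>T. ?g (w t) = u t \<and> ?f (w t) = v t)"
  show "w = (\<lambda>t\<in>T. THE a. a \<in> ?A \<and> ?g a = u t \<and> ?f a = v t)"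
  proof
   fix t show "w t = (\<lambda>t\<in>T. THE a. a \<in> ?A \<and> ?g a = u t \<and> ?f a = v t) t"
   proof (cases "t \<in> T")
    case True
    have "(THE a. a \<in> ?A \<and> ?g a = u t \<and> ?f a = v t) = w t" by (rule the1_equality[OF uv[OF True]]) (use w True in blast)
    then show ?thesis using True by simp
   next
    case False
    then show ?thesis using w by (auto simp: PiE_iff extensional_def)
   qed
  qed
 qed
qed (auto split: if_splits)

text \<open>A tuple on the four elements is a table with rows \<open>a b\<close> and
  \<open>a' b'\<close>. The left edge of the Beck--Chevalley identity pairs its columns with
  \<open>p\<close> and \<open>q\<close>, the top edge its rows with \<open>x\<close> and
  \<open>y\<close>. The bound \<open>L\<close> gives all four variables the same finite
  range.\<close>

lemma c2_hopf:
 assumes x: "x \<in> J1" and y: "y \<in> J1" and p: "p \<in> J1" and q: "q \<in> J1"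
 defines "L \<equiv> {j\<in>J1. fst j \<le> fst x + fst y}"
 shows "(\<Sum>z\<in>{z\<in>J1. fst z = fst x + fst y}. c2 x y z * c2 p q z) =
  (\<Sum>a\<in>L. \<Sum>b\<in>L. \<Sum>a'\<in>L. \<Sum>b'\<in>L. c2 a b x * c2 a' b' y * c2 a a' p * c2 b b' q)"
proof -
 let ?A = "{1,2,3,4::nat}" let ?g = "\<lambda>a\<in>?A. if a \<le> 2 then 1 else (2::nat)" let ?f = "\<lambda>a\<in>?A. if odd a then 1 else (2::nat)"
 define be where "be = bx {1,2} (pr x y)"
 define ga where "ga = bx {1,2} (pr p q)"
 have be: "be \<in> JS {1,2}" "fst be = fst x + fst y" unfolding be_def by (rule bx_pr[OF x y])+
 have ga: "ga \<in> JS {1,2}" unfolding ga_def by (rule bx_pr[OF p q])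
 have M1: "M {1,2} {1} (\<lambda>i\<in>{1,2}. 1) z be = c2 x y z" "M {1,2} {1} (\<lambda>i\<in>{1,2}. 1) z ga = c2 p q z" for z
  unfolding be_def ga_def M_fold2[OF pr_in[OF x y]] M_fold2[OF pr_in[OF p q]] pr_simps by (rule refl)+
 have gf: "?g \<in> ?A \<rightarrow> {1,2}" "?f \<in> ?A \<rightarrow> {1,2}" by auto
 have fb: "{u\<in>?A. ?g u = 1} = {1,2}" "{u\<in>?A. ?g u = 2} = {3,4}" "{u\<in>?A. ?f u = 1} = {1,3}" "{u\<in>?A. ?f u = 2} = {2,4}" by auto
 define T where "T = (\<lambda>t::nat => nat \<times> nat. c2 (t 1) (t 2) x * c2 (t 3) (t 4) y * (c2 (t 1) (t 3) p * c2 (t 2) (t 4) q))"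
 have MT: "M ?A {1,2} ?g be (bx ?A t) * M ?A {1,2} ?f ga (bx ?A t) = T t" if t: "t \<in> tuples ?A" for t
 proof -
  have tJ: "t 1 \<in> J1" "t 2 \<in> J1" "t 3 \<in> J1" "t 4 \<in> J1" using t by (auto simp: PiE_iff)
  have "M ?A {1,2} ?g be (bx ?A t) = (\<Prod>w\<in>{1,2}. c {u\<in>?A. ?g u = w} t (pr x y w))"
   unfolding be_def by (rule M_bx[OF _ _ gf(1) t pr_in[OF x y]]) simp_all
  also have "\<dots> = c {u\<in>?A. ?g u = 1} t (pr x y 1) * c {u\<in>?A. ?g u = 2} t (pr x y 2)" by (subst prod.insert) simp_all
  also have "\<dots> = c2 (t 1) (t 2) x * c2 (t 3) (t 4) y" unfolding fb pr_simps using c_pair[of 1 2 t] c_pair[of 3 4 t] tJ by simp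
  finally have 1: "M ?A {1,2} ?g be (bx ?A t) = c2 (t 1) (t 2) x * c2 (t 3) (t 4) y" .
  have "M ?A {1,2} ?f ga (bx ?A t) = (\<Prod>w\<in>{1,2}. c {u\<in>?A. ?f u = w} t (pr p q w))"
   unfolding ga_def by (rule M_bx[OF _ _ gf(2) t pr_in[OF p q]]) simp_all
  also have "\<dots> = c {u\<in>?A. ?f u = 1} t (pr p q 1) * c {u\<in>?A. ?f u = 2} t (pr p q 2)" by (subst prod.insert) simp_all
  also have "\<dots> = c2 (t 1) (t 3) p * c2 (t 2) (t 4) q" unfolding fb pr_simps using c_pair[of 1 3 t] c_pair[of 2 4 t] tJ by simp
  finally show ?thesis using 1 by (simp add: T_def)
 qed
 let ?S = "{t \<in> tuples ?A. (\<Sum>u\<in>?A. fst (t u)) = fst be}"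
 have bij: "bij_betw (bx ?A) ?S {al\<in>JS ?A. fst al = fst be}"
 proof (rule bij_betw_subset[OF bx_bij])
  show "bx ?A ` ?S = {al\<in>JS ?A. fst al = fst be}"
  proof (intro equalityI subsetI)
   fix al assume "al \<in> bx ?A ` ?S"
   then obtain t where t: "al = bx ?A t" "t \<in> ?S" by (rule imageE)
   then have tt: "t \<in> tuples ?A" "(\<Sum>u\<in>?A. fst (t u)) = fst be" by blast+
   show "al \<in> {al\<in>JS ?A. fst al = fst be}" unfolding t(1) using bx_in[OF _ tt(1)] bx_deg[OF _ tt(1)] tt(2) by simp
  next
   fix al assume "al \<in> {al\<in>JS ?A. fst al = fst be}"
   then have a: "al \<in> JS ?A" "fst al = fst be" by simp_all
   obtain t where t: "t \<in> tuples ?A" "al = bx ?A t" using JS_bx[OF _ a(1)] by auto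
   have "t \<in> ?S" using t bx_deg[OF _ t(1)] a(2) by simp
   then show "al \<in> bx ?A ` ?S" using t(2) by blast
  qed
 qed (simp, blast)
 have finL: "finite L" unfolding L_def by (rule finite_J1_deg)
 have "(\<Sum>z\<in>{z\<in>J1. fst z = fst x + fst y}. c2 x y z * c2 p q z) =
   (\<Sum>al\<in>{al\<in>JS ?A. fst al = fst be}. M ?A {1,2} ?g be al * M ?A {1,2} ?f ga al)"
  using BC_M[OF hopf_square be(1) ga] unfolding M1 fs_disc_1 be(2) .
 also have "\<dots> = (\<Sum>t\<in>?S. M ?A {1,2} ?g be (bx ?A t) * M ?A {1,2} ?f ga (bx ?A t))" by (rule sum.reindex_bij_betw[OF bij, symmetric])
 also have "\<dots> = (\<Sum>t\<in>?S. T t)" by (rule sum.cong[OF refl]) (use MT in blast)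
 \<comment> \<open>Tuples of the wrong total degree are added to the range; their rows cannot
   produce \<open>x\<close> and \<open>y\<close>, so their terms vanish.\<close>
 also have "\<dots> = (\<Sum>t\<in>(\<Pi>\<^sub>E i\<in>?A. L). T t)"
 proof (rule N_sum_mono)
  show "finite (\<Pi>\<^sub>E i\<in>?A. L)" using finL by (intro finite_PiE) auto
  show "?S \<subseteq> (\<Pi>\<^sub>E i\<in>?A. L)"
  proof
   fix t assume "t \<in> ?S"
   then have t: "t \<in> tuples ?A" "(\<Sum>u\<in>?A. fst (t u)) = fst be" by blast+
   have "t i \<in> L" if i: "i \<in> ?A" for i
   proof -
    have "fst (t i) \<le> (\<Sum>u\<in>?A. fst (t u))" by (rule member_le_sum[OF i]) auto
    then show ?thesis using t be(2) i by (auto simp: L_def PiE_iff)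
   qed
   then show "t \<in> (\<Pi>\<^sub>E i\<in>?A. L)" using t(1) unfolding PiE_iff by blast
  qed
  fix t assume t: "t \<in> (\<Pi>\<^sub>E i\<in>?A. L)" and nz: "T t \<noteq> 0"
  have tJ: "t 1 \<in> J1" "t 2 \<in> J1" "t 3 \<in> J1" "t 4 \<in> J1" using t by (auto simp: PiE_iff L_def)
  have "fst x = fst (t 1) + fst (t 2)" "fst y = fst (t 3) + fst (t 4)"
   using nz c2_degree(2)[OF tJ(1,2), of x] c2_degree(2)[OF tJ(3,4), of y] by (auto simp: T_def)
  then show "t \<in> ?S" using t be(2) by (auto simp: PiE_iff L_def)
 qed
 also have "\<dots> = (\<Sum>a\<in>L. \<Sum>t\<in>(\<Pi>\<^sub>E i\<in>{2,3,4}. L). T (t(1 := a)))" by (rule sum_PiE_insert) simp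
 also have "\<dots> = (\<Sum>a\<in>L. \<Sum>b\<in>L. \<Sum>t\<in>(\<Pi>\<^sub>E i\<in>{3,4}. L). T (t(2 := b, 1 := a)))"
  by (intro sum.cong refl sum_PiE_insert) simp
 also have "\<dots> = (\<Sum>a\<in>L. \<Sum>b\<in>L. \<Sum>a'\<in>L. \<Sum>t\<in>(\<Pi>\<^sub>E i\<in>{4}. L). T (t(3 := a', 2 := b, 1 := a)))"
  by (intro sum.cong refl sum_PiE_insert) simp
 also have "\<dots> = (\<Sum>a\<in>L. \<Sum>b\<in>L. \<Sum>a'\<in>L. \<Sum>b'\<in>L. \<Sum>t\<in>(\<Pi>\<^sub>E i\<in>{}. L). T (t(4 := b', 3 := a', 2 := b, 1 := a)))"
  by (intro sum.cong refl sum_PiE_insert) simp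
 also have "\<dots> = (\<Sum>a\<in>L. \<Sum>b\<in>L. \<Sum>a'\<in>L. \<Sum>b'\<in>L. c2 a b x * c2 a' b' y * c2 a a' p * c2 b b' q)"
  by (simp add: T_def mult.assoc)
 finally show ?thesis .
qed

end

declare One_nat_def [simp]

section \<open>Free abelian groups in coordinates\<close>

text \<open>The coordinates of a pure tensor in terms of those of its factors.\<close>

definition tens :: "('i \<Rightarrow>\<^sub>0 int) => ('j \<Rightarrow>\<^sub>0 int) => ('i \<times> 'j \<Rightarrow>\<^sub>0 int)" where
 "tens x y = frag_extend (\<lambda>i. frag_extend (\<lambda>j. frag_of (i, j)) y) x"

lemma frag_eq_on_basis:
 assumes "supp x \<subseteq> S" "f 0 = g 0" "\<And>u v. f (u - v) = f u - f v" "\<And>u v. g (u - v) = g u - g v"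
  and "\<And>s. s \<in> S ==> f (frag_of s) = (g (frag_of s) :: 'b \<Rightarrow>\<^sub>0 int)"
 shows "f x = g x" using assms(1) by (induction rule: frag_induction) (simp_all add: assms)

lemma frag_closed_induct [consumes 1, case_names zero diff one]:
 assumes "supp x \<subseteq> S" "P 0"
  and "\<And>x y. supp x \<subseteq> S ==> supp y \<subseteq> S ==> P x ==> P y ==> P (x - y)"
  and "\<And>s. s \<in> S ==> P (frag_of s)"
 shows "P x" using assms(1) by (rule free_Abelian_group_induct) (use assms(2-) in auto)

lemma frag_extend_fun_diff: "frag_extend (\<lambda>i. f i - g i) x = frag_extend f x - frag_extend g x"
 by (rule frag_eq_on_basis[of x UNIV]) (auto simp: frag_extend_diff)

lemma frag_extend_compose': "frag_extend f (frag_extend g x) = frag_extend (\<lambda>i. frag_extend f (g i)) x"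
 by (rule frag_eq_on_basis[of x UNIV]) (auto simp: frag_extend_diff)

lemma frag_extend_tens: "frag_extend F (tens x y) = frag_extend (\<lambda>i. frag_extend (\<lambda>j. F (i, j)) y) x"
 by (simp add: tens_def frag_extend_compose')

lemma tens_simps [simp]: "tens (frag_of i) (frag_of j) = frag_of (i, j)" "tens 0 y = 0" "tens x 0 = 0" by (simp_all add: tens_def frag_extend_eq_0)

lemma tens_diff: "tens (x - x') y = tens x y - tens x' y" "tens x (y - y') = tens x y - tens x y'"
 by (simp_all add: tens_def frag_extend_diff frag_extend_fun_diff)

lemma tens_minus: "tens (- x) y = - tens x y" "tens x (- y) = - tens x y" using tens_diff(1)[of 0 x y] tens_diff(2)[of x 0 y] by simp_all

lemma tens_add: "tens (x + x') y = tens x y + tens x' y" "tens x (y + y') = tens x y + tens x y'"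
 using tens_diff(1)[of x "- x'" y] tens_diff(2)[of x y "- y'"] by (simp_all add: tens_minus)

lemma keys_tens: "supp (tens x y) \<subseteq> supp x \<times> supp y"
proof -
 have "supp (frag_extend (\<lambda>j. frag_of (i, j)) y) \<subseteq> {i} \<times> supp y" for i
  using keys_frag_extend[of "\<lambda>j. frag_of (i, j)" y] by (auto simp: keys_frag_of)
 note 1 = this
 have "supp (tens x y) \<subseteq> (\<Union>i\<in>supp x. supp (frag_extend (\<lambda>j. frag_of (i, j)) y))"
  unfolding tens_def by (rule keys_frag_extend)
 also have "\<dots> \<subseteq> supp x \<times> supp y" by (rule UN_least, rule order_trans[OF 1]) auto
 finally show ?thesis .
qed

lemma lookup_frag_extend:
 assumes "finite I" "supp x \<subseteq> I"
 shows "coef (frag_extend f x) j = (\<Sum>i\<in>I. coef x i * coef (f i) j)"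
proof -
 have "coef (frag_extend f x) j = (\<Sum>i\<in>supp x. coef x i * coef (f i) j)" by (simp add: frag_extend_def lookup_sum)
 also have "\<dots> = (\<Sum>i\<in>I. coef x i * coef (f i) j)" using assms by (intro sum.mono_neutral_left) (auto simp: in_keys_iff)
 finally show ?thesis .
qed

lemma lookup_tens: "coef (tens x y) (i, j) = coef x i * coef y j"
proof -
 have 1: "coef (frag_extend (\<lambda>j. frag_of (i', j)) y) (i, j) = (if i' = i then coef y j else 0)" for i'
  unfolding lookup_frag_extend[OF finite_keys order_refl] by (auto simp: if_distrib[of "\<lambda>x. _ * x"] sum.delta in_keys_iff cong: if_cong)
 have "coef (tens x y) (i, j) =
   (\<Sum>i'\<in>supp x. coef x i' * coef (frag_extend (\<lambda>j. frag_of (i', j)) y) (i, j))" unfolding tens_def by (rule lookup_frag_extend) auto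
 also have "\<dots> = (\<Sum>i'\<in>supp x. if i' = i then coef x i * coef y j else 0)" unfolding 1 by (rule sum.cong) auto
 also have "\<dots> = coef x i * coef y j" by (simp add: in_keys_iff)
 finally show ?thesis .
qed

lemma lookup_sum_frag_of:
 "finite I ==> coef (\<Sum>i\<in>I. frag_cmul (a i) (frag_of i)) j = (if j \<in> I then a j else 0)"
proof -
 assume "finite I"
 have "coef (\<Sum>i\<in>I. frag_cmul (a i) (frag_of i)) j = (\<Sum>i\<in>I. if i = j then a i else 0)" unfolding lookup_sum by (rule sum.cong) auto
 then show ?thesis using \<open>finite I\<close> by simp
qed

lemma frag_extend_sum_frag_of:
 "finite I ==> frag_extend f (\<Sum>i\<in>I. frag_cmul (a i) (frag_of i)) = (\<Sum>i\<in>I. frag_cmul (a i) (f i))"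
 by (simp add: frag_extend_sum frag_extend_cmul)

text \<open>An abelian group with a basis indexed by \<open>J\<close>, recorded by its coordinate
  isomorphism. Cosets and chosen representatives stay hidden behind \<open>ph\<close>, and
  identities are checked between finitely supported integer functions.\<close>

locale free_coords =
 fixes G :: "('a, 'b) monoid_scheme" and J :: "'j set" and ph :: "'a => 'j \<Rightarrow>\<^sub>0 int"
 assumes comm: "comm_group G" and iso: "ph \<in> iso G (free_Abelian_group J)"
begin

definition "ps = inv_into (carrier G) ph"

lemma group: "group G" using comm by (simp add: comm_group_def)

lemma ph_hom: "ph \<in> hom G (free_Abelian_group J)" and ph_bij: "bij_betw ph (carrier G) {x. supp x \<subseteq> J}"
 using iso by (auto simp: iso_def free_Abelian_group_def)

lemma ph_keys: "a \<in> carrier G ==> supp (ph a) \<subseteq> J" using ph_bij by (auto simp: bij_betw_def)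

lemma ph_mult: "a \<in> carrier G ==> b \<in> carrier G ==> ph (a \<otimes>\<^bsub>G\<^esub> b) = ph a + ph b" using hom_mult[OF ph_hom] by simp

lemma ph_one: "ph \<one>\<^bsub>G\<^esub> = 0" using hom_one[OF ph_hom group] by simp

lemma ph_inj: "a \<in> carrier G ==> b \<in> carrier G ==> ph a = ph b ==> a = b" using ph_bij by (auto simp: bij_betw_def inj_on_def)

lemma ps_in: "supp x \<subseteq> J ==> ps x \<in> carrier G"
 and ph_ps: "supp x \<subseteq> J ==> ph (ps x) = x" using ph_bij unfolding ps_def bij_betw_def by (auto simp: inv_into_into f_inv_into_f)

lemma ps_ph: "a \<in> carrier G ==> ps (ph a) = a" using ph_bij unfolding ps_def bij_betw_def by (auto simp: inv_into_f_f)

lemma ph_inv: "a \<in> carrier G ==> ph (inv\<^bsub>G\<^esub> a) = - ph a"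
proof -
 assume a: "a \<in> carrier G"
 interpret group G by (rule group)
 have "ph (inv\<^bsub>G\<^esub> a) + ph a = 0" using ph_mult[of "inv\<^bsub>G\<^esub> a" a] a ph_one by simp
 then show ?thesis by (simp add: eq_neg_iff_add_eq_0)
qed

lemma ph_nat_pow: "a \<in> carrier G ==> ph (a [^]\<^bsub>G\<^esub> (n::nat)) = frag_cmul (int n) (ph a)"
proof (induction n)
 case (Suc n)
 interpret group G by (rule group)
 show ?case using Suc by (simp add: ph_mult frag_cmul_distrib)
next
 case 0
 interpret group G by (rule group)
 show ?case by (simp add: ph_one)
qed

lemma ph_int_pow: "a \<in> carrier G ==> ph (a [^]\<^bsub>G\<^esub> (n::int)) = frag_cmul n (ph a)"
proof -
 assume a: "a \<in> carrier G"
 interpret group G by (rule group)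
 show ?thesis using a by (cases n rule: int_cases2) (simp_all add: int_pow_int int_pow_neg_int ph_nat_pow ph_inv)
qed

lemma ph_finprod: "finite A ==> f \<in> A \<rightarrow> carrier G ==> ph (finprod G f A) = (\<Sum>a\<in>A. ph (f a))"
proof (induction A rule: finite_induct)
 case empty
 interpret comm_group G by (rule comm)
 show ?case by (simp add: ph_one)
next
 case (insert x A)
 interpret comm_group G by (rule comm)
 show ?case using insert by (simp add: ph_mult)
qed

lemma hom_coords:
 assumes K: "free_coords K L ka" and h: "h \<in> hom G K" and a: "a \<in> carrier G"
 shows "ka (h a) = frag_extend (\<lambda>j. ka (h (ps (frag_of j)))) (ph a)"
proof -
 interpret K: free_coords K L ka by (rule K)
 have "ka (h (ps x)) = frag_extend (\<lambda>j. ka (h (ps (frag_of j)))) x" if "supp x \<subseteq> J" for x using that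
 proof (induction rule: frag_closed_induct)
  case zero
  have "ps 0 = \<one>\<^bsub>G\<^esub>" using ps_ph[OF group.is_monoid[OF group, THEN monoid.one_closed]] ph_one by simp
  then show ?case using hom_one[OF h group K.group] K.ph_one by simp
 next
  case (diff x y)
  interpret group G by (rule group)
  have k: "supp (x - y) \<subseteq> J" using diff(1,2) keys_diff[of x y] by blast
  have "ps (x - y) = ps x \<otimes>\<^bsub>G\<^esub> inv\<^bsub>G\<^esub> (ps y)"
   by (rule ph_inj) (use diff(1,2) k in "auto simp: ps_in ph_ps ph_mult ph_inv")
  moreover have "group_hom G K h" using h group K.group by (simp add: group_hom_def group_hom_axioms_def)
  ultimately have "h (ps (x - y)) = h (ps x) \<otimes>\<^bsub>K\<^esub> inv\<^bsub>K\<^esub> (h (ps y))"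
   using ps_in[OF diff(1)] ps_in[OF diff(2)] by (simp add: group_hom.hom_inv hom_mult[OF h])
  moreover have "h (ps x) \<in> carrier K" "h (ps y) \<in> carrier K" using ps_in diff(1,2) hom_in_carrier[OF h] by blast+
  ultimately show ?case using diff(3,4) K.group by (simp add: K.ph_mult K.ph_inv frag_extend_diff)
 next
  case (one a)
  then show ?case by simp
 qed
 from this[OF ph_keys[OF a]] show ?thesis by (simp add: ps_ph[OF a])
qed

lemma coords_hom:
 assumes K: "free_coords K L ka" and f: "\<And>j. j \<in> J ==> supp (f j) \<subseteq> L"
  and h: "\<And>a. a \<in> carrier G ==> h a = free_coords.ps K ka (frag_extend f (ph a))"
 shows "h \<in> hom G K" "a \<in> carrier G ==> ka (h a) = frag_extend f (ph a)"
proof -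
 interpret K: free_coords K L ka by (rule K)
 interpret group G by (rule group)
 have k: "supp (frag_extend f (ph a)) \<subseteq> L" if "a \<in> carrier G" for a using keys_frag_extend[of f "ph a"] ph_keys[OF that] f by blast
 then show 1: "a \<in> carrier G ==> ka (h a) = frag_extend f (ph a)" for a by (simp add: h K.ph_ps)
 have hin: "a \<in> carrier G ==> h a \<in> carrier K" for a using k K.ps_in by (simp add: h)
 interpret K': group K by (rule K.group)
 show "h \<in> hom G K"
 proof (rule homI)
  fix a b assume ab: "a \<in> carrier G" "b \<in> carrier G"
  show "h (a \<otimes>\<^bsub>G\<^esub> b) = h a \<otimes>\<^bsub>K\<^esub> h b"
   by (rule K.ph_inj) (use ab hin in "auto simp: 1 K.ph_mult ph_mult frag_extend_add")
 qed (rule hin)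
qed

end

section \<open>Quotients of free abelian groups\<close>

lemma subgroup_frag:
 assumes "subgroup N (free_Abelian_group S)"
 shows "0 \<in> N" "x \<in> N ==> y \<in> N ==> x + y \<in> N" "x \<in> N ==> - x \<in> N" "x \<in> N ==> y \<in> N ==> x - y \<in> N"
  "x \<in> N ==> supp x \<subseteq> S"
proof -
 note s = subgroup.one_closed[OF assms] subgroup.m_closed[OF assms] subgroup.m_inv_closed[OF assms] subgroup.mem_carrier[OF assms]
 show "0 \<in> N" "x \<in> N ==> y \<in> N ==> x + y \<in> N" and k: "x \<in> N ==> supp x \<subseteq> S" for x y using s by auto
 show m: "x \<in> N ==> - x \<in> N" for x using s(3)[of x] k[of x] by simp
 show "x \<in> N ==> y \<in> N ==> x - y \<in> N" using s(2)[of x "- y"] m[of y] by simp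
qed

text \<open>All representatives of a coset have the same image, so that the choice does not matter.\<close>

definition qco :: "('s => 'j \<Rightarrow>\<^sub>0 int) => ('s \<Rightarrow>\<^sub>0 int) set => 'j \<Rightarrow>\<^sub>0 int" where
 "qco p X = frag_extend p (SOME x. x \<in> X)"

text \<open>Here \<open>p\<close> kills the relations, \<open>q\<close> lifts the basis, and each
  generator agrees modulo \<open>N\<close> with its image under \<open>p\<close> followed by
  \<open>q\<close>. Hence \<open>N\<close> is exactly the kernel of the extension of
  \<open>p\<close>, which gives coordinates on the quotient. Tensor products and Grothendieck groups
  are both treated in this way.\<close>

lemma
 assumes R: "R \<subseteq> carrier (free_Abelian_group S)" and N: "N = generate (free_Abelian_group S) R"
  and p: "\<And>s. s \<in> S ==> supp (p s) \<subseteq> J" and q: "\<And>j. j \<in> J ==> supp (q j) \<subseteq> S"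
  and pR: "\<And>r. r \<in> R ==> frag_extend p r = 0" and pq: "\<And>j. j \<in> J ==> frag_extend p (q j) = frag_of j"
  and qp: "\<And>s. s \<in> S ==> frag_of s - frag_extend q (p s) \<in> N"
 shows qco_coset: "supp x \<subseteq> S ==> qco p (N #>\<^bsub>free_Abelian_group S\<^esub> x) = frag_extend p x"
  and quotient_coords: "free_coords (free_Abelian_group S Mod N) J (qco p)"
proof -
 let ?F = "free_Abelian_group S"
 interpret F: comm_group ?F by (rule abelian_free_Abelian_group)
 have sg: "subgroup N ?F" unfolding N by (rule F.generate_is_subgroup[OF R])
 note sf = subgroup_frag[OF sg]
 have nm: "N \<lhd> ?F" by (rule F.subgroup_imp_normal[OF sg])
 have kerp: "frag_extend p x = 0" if "x \<in> N" for x using that unfolding N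
 proof (induction rule: generate.induct)
  case one
  show ?case by simp
 next
  case (incl h)
  then show ?case by (rule pR)
 next
  case (inv h)
  from subsetD[OF R inv] have "supp h \<subseteq> S" by simp
  then show ?case using pR[OF inv] by (simp add: frag_extend_minus)
 next
  case (eng h h')
  then show ?case by (simp add: frag_extend_add)
 qed
 have coset: "(N #>\<^bsub>?F\<^esub> x) = {n + x | n. n \<in> N}" for x by (auto simp: r_coset_def)
 have val: "qco p (N #>\<^bsub>?F\<^esub> x) = frag_extend p x" for x
 proof -
  have "(SOME y. y \<in> N #>\<^bsub>?F\<^esub> x) \<in> N #>\<^bsub>?F\<^esub> x" by (rule someI[of _ x]) (use sf(1) in "force simp: coset")
  then obtain n where "(SOME y. y \<in> N #>\<^bsub>?F\<^esub> x) = n + x" "n \<in> N" unfolding coset by blast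
  then show ?thesis unfolding qco_def by (simp add: frag_extend_add kerp)
 qed
 show "supp x \<subseteq> S ==> qco p (N #>\<^bsub>?F\<^esub> x) = frag_extend p x" by (rule val)
 have red: "x - frag_extend q (frag_extend p x) \<in> N" if "supp x \<subseteq> S" for x using that
 proof (induction rule: frag_closed_induct)
  case (diff x y)
  have "(x - y) - frag_extend q (frag_extend p (x - y)) =
   (x - frag_extend q (frag_extend p x)) - (y - frag_extend q (frag_extend p y))" by (simp add: frag_extend_diff)
  note eq = this
  show ?case unfolding eq by (rule sf(4)[OF diff(3,4)])
 qed (simp_all add: sf(1) qp)
 have ker: "x \<in> N" if "supp x \<subseteq> S" "frag_extend p x = 0" for x using red[OF that(1)] that(2) by simp
 have carr: "carrier (?F Mod N) = (\<lambda>x. N #>\<^bsub>?F\<^esub> x) ` {x. supp x \<subseteq> S}" by (auto simp: FactGroup_def RCOSETS_def)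
 have kp: "supp (frag_extend p x) \<subseteq> J" if "supp x \<subseteq> S" for x using keys_frag_extend[of p x] that p by blast
 have kq: "supp (frag_extend q x) \<subseteq> S" if "supp x \<subseteq> J" for x using keys_frag_extend[of q x] that q by blast
 show "free_coords (?F Mod N) J (qco p)" unfolding free_coords_def
 proof (rule conjI)
  show "comm_group (?F Mod N)" by (rule F.abelian_FactGroup[OF sg])
  have "qco p \<in> hom (?F Mod N) (free_Abelian_group J)"
  proof (rule homI)
   fix X assume "X \<in> carrier (?F Mod N)"
   then obtain x where x: "X = N #>\<^bsub>?F\<^esub> x" "supp x \<subseteq> S" unfolding carr by blast
   then show "qco p X \<in> carrier (free_Abelian_group J)" using kp by (simp add: val)
   fix Y assume "Y \<in> carrier (?F Mod N)"
   then obtain y where y: "Y = N #>\<^bsub>?F\<^esub> y" "supp y \<subseteq> S" unfolding carr by blast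
   have "X \<otimes>\<^bsub>?F Mod N\<^esub> Y = N #>\<^bsub>?F\<^esub> (x + y)" using normal.rcos_sum[OF nm, of x y] x y by (simp add: FactGroup_def)
   then show "qco p (X \<otimes>\<^bsub>?F Mod N\<^esub> Y) = qco p X \<otimes>\<^bsub>free_Abelian_group J\<^esub> qco p Y"
    using x y by (simp add: val frag_extend_add)
  qed
  moreover have "inj_on (qco p) (carrier (?F Mod N))"
  proof (rule inj_onI)
   fix X Y assume "X \<in> carrier (?F Mod N)" "Y \<in> carrier (?F Mod N)" and eq: "qco p X = qco p Y"
   then obtain x y where x: "X = N #>\<^bsub>?F\<^esub> x" "supp x \<subseteq> S" and y: "Y = N #>\<^bsub>?F\<^esub> y" "supp y \<subseteq> S"
    unfolding carr by blast
   have "x - y \<in> N" by (rule ker) (use x y eq keys_diff[of x y] in "auto simp: val frag_extend_diff")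
   then have "x \<in> N #>\<^bsub>?F\<^esub> y" unfolding coset by (intro CollectI exI[of _ "x - y"]) simp
   then show "X = Y" unfolding x(1) y(1) using F.repr_independence[OF _ _ sg] y(2) by simp
  qed
  moreover have "u \<in> qco p ` carrier (?F Mod N)" if u: "supp u \<subseteq> J" for u
  proof -
   have "frag_extend p (frag_extend q u) = u" using u by (induction rule: frag_closed_induct) (simp_all add: frag_extend_diff pq)
   then have "u = qco p (N #>\<^bsub>?F\<^esub> frag_extend q u)" by (simp add: val)
   then show ?thesis unfolding carr using kq[OF u] by blast
  qed
  ultimately show "qco p \<in> iso (?F Mod N) (free_Abelian_group J)" by (auto simp: iso_def bij_betw_def hom_def Pi_iff)
 qed
qed

text \<open>The integers with one basis element, so that integer-valued lifts such as the one in the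
  adjointness axiom are covered by \<open>tensor_lift_coords\<close>.\<close>

lemma free_coords_integer: "free_coords integer_group {()} (\<lambda>n. frag_cmul n (frag_of ()))"
proof -
 have e: "frag_cmul (coef x ()) (frag_of ()) = x" for x :: "unit \<Rightarrow>\<^sub>0 int" by (rule poly_mapping_eqI) auto
 have "bij_betw (\<lambda>n. frag_cmul n (frag_of ())) UNIV (UNIV :: (unit \<Rightarrow>\<^sub>0 int) set)"
  by (rule bij_betw_byWitness[where f' = "\<lambda>x. coef x ()"]) (auto simp: e)
 moreover have "{x :: unit \<Rightarrow>\<^sub>0 int. supp x \<subseteq> {()}} = UNIV" by auto
 ultimately have "(\<lambda>n. frag_cmul n (frag_of ())) \<in> iso integer_group (free_Abelian_group {()})"
  by (auto simp: iso_def hom_def integer_group_def free_Abelian_group_def frag_cmul_distrib)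
 then show ?thesis unfolding free_coords_def using abelian_integer_group by blast
qed

section \<open>Tensor products in coordinates\<close>

definition tco :: "('a => 'i \<Rightarrow>\<^sub>0 int) => ('b => 'j \<Rightarrow>\<^sub>0 int) => ('a \<times> 'b \<Rightarrow>\<^sub>0 int) set => 'i \<times> 'j \<Rightarrow>\<^sub>0 int" where
 "tco ph ch = qco (\<lambda>(a, b). tens (ph a) (ch b))"

text \<open>This is \<open>quotient_coords\<close> with \<open>p\<close> the tensor of coordinates
  and \<open>q\<close> the pairs of basis elements. What needs an argument is that
  \<open>(a, b)\<close> agrees with its expansion modulo the relations; \<open>red1\<close> expands
  the first entry and \<open>red2\<close> the second.\<close>

lemma
 fixes G :: "'a monoid" and H :: "'b monoid"
 assumes G: "free_coords G J ph" and H: "free_coords H L ch"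
 shows tensor_coords: "free_coords (tensor G H) (J \<times> L) (tco ph ch)"
  and tco_pure: "a \<in> carrier G ==> b \<in> carrier H ==> tco ph ch (pure_tensor G H a b) = tens (ph a) (ch b)"
  and pure_tensor_in: "a \<in> carrier G ==> b \<in> carrier H ==> pure_tensor G H a b \<in> carrier (tensor G H)"
proof -
 interpret G: free_coords G J ph by (rule G)
 interpret H: free_coords H L ch by (rule H)
 interpret G': comm_group G by (rule G.comm)
 interpret H': comm_group H by (rule H.comm)
 let ?S = "carrier G \<times> carrier H"
 let ?F = "free_Abelian_group ?S"
 let ?p = "\<lambda>(a, b). tens (ph a) (ch b)" and ?q = "\<lambda>(j, l). frag_of (G.ps (frag_of j), H.ps (frag_of l))"
 let ?N = "tensor_subgroup G H"
 interpret F: comm_group ?F by (rule abelian_free_Abelian_group)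
 have R: "tensor_rels G H \<subseteq> carrier ?F"
 proof -
  have "supp (frag_of u - (frag_of v + frag_of w)) \<subseteq> {u, v, w}" for u v w :: "'a \<times> 'b"
   by (rule order_trans[OF keys_diff]) (use keys_add[of "frag_of v" "frag_of w"] in "auto simp: keys_frag_of")
  note k = order_trans[OF this]
  have "supp r \<subseteq> ?S" if "r \<in> tensor_rels G H" for r using that unfolding tensor_rels_def
   by (elim UnE CollectE exE conjE; hypsubst; intro k) auto
  then show ?thesis by auto
 qed
 have sg: "subgroup ?N ?F" unfolding tensor_subgroup_def by (rule F.generate_is_subgroup[OF R])
 note sf = subgroup_frag[OF sg]
 have rel: "r \<in> ?N" if "r \<in> tensor_rels G H" for r unfolding tensor_subgroup_def using that by (rule generate.incl)
 have relG: "frag_of (a \<otimes>\<^bsub>G\<^esub> a', b) - (frag_of (a, b) + frag_of (a', b)) \<in> ?N"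
  if "a \<in> carrier G" "a' \<in> carrier G" "b \<in> carrier H" for a a' b by (rule rel) (use that in "unfold tensor_rels_def, blast")
 have relH: "frag_of (a, b \<otimes>\<^bsub>H\<^esub> b') - (frag_of (a, b) + frag_of (a, b')) \<in> ?N"
  if "a \<in> carrier G" "b \<in> carrier H" "b' \<in> carrier H" for a b b' by (rule rel) (use that in "unfold tensor_rels_def, blast")
 \<comment> \<open>Up to sign, this generator is the relation for \<open>1 * 1 = 1\<close> in the
   first entry.\<close>
 have one: "frag_of (\<one>\<^bsub>G\<^esub>, b) \<in> ?N" if "b \<in> carrier H" for b
 proof -
  have "frag_of (\<one>\<^bsub>G\<^esub> \<otimes>\<^bsub>G\<^esub> \<one>\<^bsub>G\<^esub>, b) - (frag_of (\<one>\<^bsub>G\<^esub>, b) + frag_of (\<one>\<^bsub>G\<^esub>, b)) \<in> ?N"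
   by (rule relG) (use that in auto)
  then show ?thesis using sf(3) by fastforce
 qed
 have one': "frag_of (a, \<one>\<^bsub>H\<^esub>) \<in> ?N" if "a \<in> carrier G" for a
 proof -
  have "frag_of (a, \<one>\<^bsub>H\<^esub> \<otimes>\<^bsub>H\<^esub> \<one>\<^bsub>H\<^esub>) - (frag_of (a, \<one>\<^bsub>H\<^esub>) + frag_of (a, \<one>\<^bsub>H\<^esub>)) \<in> ?N"
   by (rule relH) (use that in auto)
  then show ?thesis using sf(3) by fastforce
 qed
 have ps0: "G.ps 0 = \<one>\<^bsub>G\<^esub>" "H.ps 0 = \<one>\<^bsub>H\<^esub>" using G.ps_ph[of "\<one>\<^bsub>G\<^esub>"] H.ps_ph[of "\<one>\<^bsub>H\<^esub>"] by (simp_all add: G.ph_one H.ph_one)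
 have red1: "frag_of (G.ps x, b) - frag_extend (\<lambda>j. frag_of (G.ps (frag_of j), b)) x \<in> ?N"
  if "supp x \<subseteq> J" and b: "b \<in> carrier H" for x b using that(1)
 proof (induction rule: frag_closed_induct)
  case (diff x y)
  have k: "supp (x - y) \<subseteq> J" using diff(1,2) keys_diff[of x y] by blast
  \<comment> \<open>The relations speak of products, so the difference is reached through
    \<open>x = (x - y) + y\<close>.\<close>
  have "G.ps x = G.ps (x - y) \<otimes>\<^bsub>G\<^esub> G.ps y" by (rule G.ph_inj) (use diff(1,2) k in "auto simp: G.ps_in G.ph_ps G.ph_mult")
  moreover have "frag_of (G.ps (x - y) \<otimes>\<^bsub>G\<^esub> G.ps y, b) - (frag_of (G.ps (x - y), b) + frag_of (G.ps y, b)) \<in> ?N"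
   by (rule relG) (use diff(1,2) k b G.ps_in in auto)
  ultimately have "frag_of (G.ps x, b) - (frag_of (G.ps (x - y), b) + frag_of (G.ps y, b)) \<in> ?N" by simp
  from sf(4)[OF sf(4)[OF diff(3,4)] this] show ?case by (simp add: frag_extend_diff algebra_simps)
 qed (simp_all add: ps0 one[OF b] sf(1))
 have red2: "frag_of (a, H.ps x) - frag_extend (\<lambda>j. frag_of (a, H.ps (frag_of j))) x \<in> ?N"
  if "supp x \<subseteq> L" and b: "a \<in> carrier G" for x a using that(1)
 proof (induction rule: frag_closed_induct)
  case (diff x y)
  have k: "supp (x - y) \<subseteq> L" using diff(1,2) keys_diff[of x y] by blast
  have "H.ps x = H.ps (x - y) \<otimes>\<^bsub>H\<^esub> H.ps y" by (rule H.ph_inj) (use diff(1,2) k in "auto simp: H.ps_in H.ph_ps H.ph_mult")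
  moreover have "frag_of (a, H.ps (x - y) \<otimes>\<^bsub>H\<^esub> H.ps y) - (frag_of (a, H.ps (x - y)) + frag_of (a, H.ps y)) \<in> ?N"
   by (rule relH) (use diff(1,2) k b H.ps_in in auto)
  ultimately have "frag_of (a, H.ps x) - (frag_of (a, H.ps (x - y)) + frag_of (a, H.ps y)) \<in> ?N" by simp
  from sf(4)[OF sf(4)[OF diff(3,4)] this] show ?case by (simp add: frag_extend_diff algebra_simps)
 qed (simp_all add: ps0 one'[OF b] sf(1))
 have qp: "frag_of s - frag_extend ?q (?p s) \<in> ?N" if sS: "s \<in> ?S" for s
 proof -
  obtain a b where s: "s = (a, b)" "a \<in> carrier G" "b \<in> carrier H" using sS by blast
  have d: "frag_extend (\<lambda>j. frag_of (G.ps (frag_of j), b)) x - frag_extend ?q (tens x (ch b)) \<in> ?N" if "supp x \<subseteq> J" for x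
   using that
  proof (induction rule: frag_closed_induct)
   case (diff x y)
   from sf(4)[OF diff(3,4)] show ?case by (simp add: frag_extend_diff tens_diff algebra_simps)
  next
   case (one j)
   have "G.ps (frag_of j) \<in> carrier G" by (rule G.ps_in) (use one in simp)
   from red2[OF H.ph_keys[OF s(3)] this] show ?case by (simp add: frag_extend_tens H.ps_ph[OF s(3)])
  qed (simp add: sf(1))
  show ?thesis using sf(2)[OF red1[OF G.ph_keys[OF s(2)] s(3)] d[OF G.ph_keys[OF s(2)]]] by (simp add: s(1) G.ps_ph[OF s(2)])
 qed
 have pk: "supp (?p s) \<subseteq> J \<times> L" if "s \<in> ?S" for s using that keys_tens G.ph_keys H.ph_keys by fastforce
 have qk: "supp (?q s) \<subseteq> ?S" if "s \<in> J \<times> L" for s using that G.ps_in H.ps_in by (auto simp: keys_frag_of)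
 have pR: "frag_extend ?p r = 0" if "r \<in> tensor_rels G H" for r using that unfolding tensor_rels_def
  by (auto simp: frag_extend_diff frag_extend_add G.ph_mult H.ph_mult tens_add)
 have pq: "frag_extend ?p (?q s) = frag_of s" if "s \<in> J \<times> L" for s using that G.ph_ps H.ph_ps by (auto simp: keys_frag_of)
 note Q = R tensor_subgroup_def pk qk pR pq qp
 show "free_coords (tensor G H) (J \<times> L) (tco ph ch)" unfolding tensor_def tco_def by (rule quotient_coords[OF Q])
 assume ab: "a \<in> carrier G" "b \<in> carrier H"
 then have "supp (frag_of (a, b)) \<subseteq> ?S" by (simp add: keys_frag_of)
 from qco_coset[OF Q this] show "tco ph ch (pure_tensor G H a b) = tens (ph a) (ch b)" unfolding tco_def pure_tensor_def by simp
 show "pure_tensor G H a b \<in> carrier (tensor G H)" unfolding pure_tensor_def tensor_def FactGroup_def RCOSETS_def using ab by auto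
qed

text \<open>Coordinates define the lift on a basis of pure tensors, and its values there determine
  it, so the definite description in \<open>tensor_lift\<close> can be evaluated. The values on
  pairs of basis indices are listed by \<open>F\<close>.\<close>

lemma
 fixes G :: "'a monoid" and H :: "'b monoid" and K :: "'c monoid"
 assumes G: "free_coords G J ph" and H: "free_coords H L ch" and K: "free_coords K M ka"
  and be_in: "\<And>a b. a \<in> carrier G ==> b \<in> carrier H ==> be a b \<in> carrier K"
  and be: "\<And>a b. a \<in> carrier G ==> b \<in> carrier H ==> ka (be a b) = frag_extend F (tens (ph a) (ch b))"
  and F: "\<And>p. p \<in> J \<times> L ==> supp (F p) \<subseteq> M"
 shows tensor_lift_hom: "tensor_lift G H K be \<in> hom (tensor G H) K"
  and tensor_lift_coords: "t \<in> carrier (tensor G H) ==> ka (tensor_lift G H K be t) = frag_extend F (tco ph ch t)"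
proof -
 interpret G: free_coords G J ph by (rule G)
 interpret H: free_coords H L ch by (rule H)
 interpret K: free_coords K M ka by (rule K)
 interpret T: free_coords "tensor G H" "J \<times> L" "tco ph ch" by (rule tensor_coords[OF G H])
 define h where "h = (\<lambda>t\<in>carrier (tensor G H). K.ps (frag_extend F (tco ph ch t)))"
 have h: "h \<in> hom (tensor G H) K" "\<And>t. t \<in> carrier (tensor G H) ==> ka (h t) = frag_extend F (tco ph ch t)"
  by (rule T.coords_hom[OF K F]; simp add: h_def)+
 have pure: "h (pure_tensor G H a b) = be a b" if "a \<in> carrier G" "b \<in> carrier H" for a b
  by (rule K.ph_inj) (use that pure_tensor_in[OF G H that] hom_in_carrier[OF h(1)] in "auto simp: be_in be h(2) tco_pure[OF G H]")
 have "tensor_lift G H K be = h" unfolding tensor_lift_def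
 proof (rule the_equality)
  show "h \<in> hom (tensor G H) K \<and> h \<in> extensional (carrier (tensor G H)) \<and>
   (\<forall>a\<in>carrier G. \<forall>b\<in>carrier H. h (pure_tensor G H a b) = be a b)" using h(1) pure by (simp add: h_def)
  fix g assume g: "g \<in> hom (tensor G H) K \<and> g \<in> extensional (carrier (tensor G H)) \<and>
   (\<forall>a\<in>carrier G. \<forall>b\<in>carrier H. g (pure_tensor G H a b) = be a b)"
  show "g = h"
  proof (rule extensionalityI[of _ "carrier (tensor G H)"])
   fix t assume t: "t \<in> carrier (tensor G H)"
   have basis: "T.ps (frag_of p) = pure_tensor G H (G.ps (frag_of (fst p))) (H.ps (frag_of (snd p)))"
    and in': "G.ps (frag_of (fst p)) \<in> carrier G" "H.ps (frag_of (snd p)) \<in> carrier H" if "p \<in> J \<times> L" for p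
   proof -
    show i: "G.ps (frag_of (fst p)) \<in> carrier G" "H.ps (frag_of (snd p)) \<in> carrier H"
     by (rule G.ps_in H.ps_in, use that in "auto simp: keys_frag_of")+
    show "T.ps (frag_of p) = pure_tensor G H (G.ps (frag_of (fst p))) (H.ps (frag_of (snd p)))" by (rule T.ph_inj)
      (use that i in "auto simp: keys_frag_of T.ps_in T.ph_ps pure_tensor_in[OF G H] tco_pure[OF G H] G.ph_ps H.ph_ps")
   qed
   have "g (T.ps (frag_of p)) = h (T.ps (frag_of p))" if "p \<in> J \<times> L" for p unfolding basis[OF that] using g pure in'[OF that] by simp
   then have "ka (g t) = ka (h t)" unfolding T.hom_coords[OF K conjunct1[OF g] t] T.hom_coords[OF K h(1) t]
    using T.ph_keys[OF t] by (intro frag_extend_eq) auto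
   then show "g t = h t" using K.ph_inj hom_in_carrier[OF conjunct1[OF g] t] hom_in_carrier[OF h(1) t] by blast
  qed (use g in "auto simp: h_def")
 qed
 then show "tensor_lift G H K be \<in> hom (tensor G H) K"
  "t \<in> carrier (tensor G H) ==> ka (tensor_lift G H K be t) = frag_extend F (tco ph ch t)" using h by simp_all
qed

section \<open>Positive self-adjoint Hopf algebras from structure constants\<close>

lemma sum_supported:
 fixes F :: "'a => int"
 assumes "finite A" "finite B" "\<And>x. x \<in> A ==> x \<notin> B ==> F x = 0" "\<And>x. x \<in> B ==> x \<notin> A ==> F x = 0"
 shows "sum F A = sum F B"
proof -
 have "sum F A = sum F (A \<inter> B)" by (rule sum.mono_neutral_right) (use assms in auto)
 also have "\<dots> = sum F B" by (rule sum.mono_neutral_left) (use assms in auto)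
 finally show ?thesis .
qed

text \<open>What an SSH category yields on the level of numbers. All sums run over fixed or bounded
  degrees, where there are finitely many indices.\<close>

locale psh_data =
 fixes J :: "'j set" and deg :: "'j => nat" and c :: "'j => 'j => 'j => nat" and e :: 'j
 assumes fin: "finite {j\<in>J. deg j \<le> n}"
  and c_supp: "x \<in> J ==> y \<in> J ==> c x y z \<noteq> 0 ==> z \<in> J" "x \<in> J ==> y \<in> J ==> c x y z \<noteq> 0 ==> deg z = deg x + deg y"
  and e_in: "e \<in> J" and e_deg: "deg e = 0"
  and c_unit: "x \<in> J ==> c e x z = (if z = x then 1 else 0)"
  and c_counit: "x \<in> J ==> y \<in> J ==> c x y e = (if x = e \<and> y = e then 1 else 0)"
  and c_comm: "x \<in> J ==> y \<in> J ==> c x y z = c y x z"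
  and c_assoc: "x \<in> J ==> y \<in> J ==> z \<in> J ==>
   (\<Sum>w\<in>{j\<in>J. deg j = deg x + deg y}. c x y w * c w z v) = (\<Sum>w\<in>{j\<in>J. deg j = deg y + deg z}. c y z w * c x w v)"
  and c_hopf: "x \<in> J ==> y \<in> J ==> p \<in> J ==> q \<in> J ==>
   (\<Sum>z\<in>{j\<in>J. deg j = deg x + deg y}. c x y z * c p q z) =
   (\<Sum>a\<in>{j\<in>J. deg j \<le> deg x + deg y}. \<Sum>b\<in>{j\<in>J. deg j \<le> deg x + deg y}.
    \<Sum>a'\<in>{j\<in>J. deg j \<le> deg x + deg y}. \<Sum>b'\<in>{j\<in>J. deg j \<le> deg x + deg y}. c a b x * c a' b' y * c a a' p * c b b' q)"
begin

definition "Le n = {j\<in>J. deg j \<le> n}"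

lemma fin_Le: "finite (Le n)" unfolding Le_def by (rule fin)

lemma fin_eq: "finite {j\<in>J. deg j = n}" by (rule finite_subset[OF _ fin[of n]]) auto

lemma c_unit': "x \<in> J ==> c x e z = (if z = x then 1 else 0)" using c_unit[of x z] c_comm[of x e z] e_in by simp

lemma c_eq_0: "x \<in> J ==> y \<in> J ==> z \<notin> J \<or> deg z \<noteq> deg x + deg y ==> c x y z = 0" using c_supp[of x y z] by blast

definition mu :: "'j \<times> 'j => 'j \<Rightarrow>\<^sub>0 int" where
 "mu p = (\<Sum>z\<in>Le (deg (fst p) + deg (snd p)). frag_cmul (int (c (fst p) (snd p) z)) (frag_of z))"

text \<open>The transpose of \<open>mu\<close>: the comultiplication for which the basis is
  orthonormal and multiplication is adjoint. The range suffices because both factors of a product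
  containing \<open>z\<close> have degree at most \<open>deg z\<close>.\<close>

definition dl :: "'j => 'j \<times> 'j \<Rightarrow>\<^sub>0 int" where
 "dl z = (\<Sum>p\<in>Le (deg z) \<times> Le (deg z). frag_cmul (int (c (fst p) (snd p) z)) (frag_of p))"

lemma lookup_mu: "x \<in> J ==> y \<in> J ==> coef (mu (x, y)) z = int (c x y z)"
 unfolding mu_def lookup_sum_frag_of[OF fin_Le] using c_eq_0[of x y z] by (auto simp: Le_def)

lemma lookup_dl: "z \<in> J ==> coef (dl z) (x, y) = (if x \<in> J \<and> y \<in> J then int (c x y z) else 0)"
 unfolding dl_def lookup_sum_frag_of[OF finite_cartesian_product[OF fin_Le fin_Le]] using c_eq_0[of x y z] by (auto simp: Le_def)

lemma keys_mu: "supp (mu p) \<subseteq> Le (deg (fst p) + deg (snd p))"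
 by (auto simp: in_keys_iff mu_def lookup_sum_frag_of[OF fin_Le] split: if_splits)

lemma keys_mu_J: "supp (mu p) \<subseteq> J" using keys_mu[of p] by (auto simp: Le_def)

lemma keys_mu_deg: "x \<in> J ==> y \<in> J ==> z \<in> supp (mu (x, y)) ==> deg z = deg x + deg y"
 using c_supp(2)[of x y z] by (auto simp: in_keys_iff lookup_mu)

lemma keys_dl: "supp (dl z) \<subseteq> Le (deg z) \<times> Le (deg z)"
 by (auto simp: in_keys_iff dl_def lookup_sum_frag_of[OF finite_cartesian_product[OF fin_Le fin_Le]] split: if_splits)

lemma keys_dl_J: "supp (dl z) \<subseteq> J \<times> J" using keys_dl[of z] by (auto simp: Le_def)

lemma keys_dl_deg: "z \<in> J ==> (x, y) \<in> supp (dl z) ==> deg x + deg y = deg z"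
 using c_supp(2)[of x y z] by (auto simp: in_keys_iff lookup_dl split: if_splits)

lemma frag_extend_mu:
 assumes "x \<in> J" "y \<in> J" "deg x + deg y \<le> n"
 shows "frag_extend f (mu (x, y)) = (\<Sum>z\<in>Le n. frag_cmul (int (c x y z)) (f z))"
proof -
 have "mu (x, y) = (\<Sum>z\<in>Le n. frag_cmul (int (c x y z)) (frag_of z))"
 proof (rule poly_mapping_eqI)
  fix z
  have "c x y z = 0" if "z \<notin> Le n" using c_eq_0[OF assms(1,2), of z] assms(3) that by (auto simp: Le_def)
  then show "coef (mu (x, y)) z = coef (\<Sum>z\<in>Le n. frag_cmul (int (c x y z)) (frag_of z)) z"
   unfolding lookup_sum_frag_of[OF fin_Le] lookup_mu[OF assms(1,2)] by simp
 qed
 then show ?thesis by (simp add: frag_extend_sum_frag_of fin_Le)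
qed

lemma frag_extend_dl:
 assumes "z \<in> J" "deg z \<le> n"
 shows "frag_extend f (dl z) = (\<Sum>x\<in>Le n. \<Sum>y\<in>Le n. frag_cmul (int (c x y z)) (f (x, y)))"
proof -
 have "dl z = (\<Sum>p\<in>Le n \<times> Le n. frag_cmul (int (c (fst p) (snd p) z)) (frag_of p))"
 proof (rule poly_mapping_eqI)
  fix p :: "'j \<times> 'j"
  obtain x y where p: "p = (x, y)" by (cases p)
  have "c x y z = 0" if "x \<in> J" "y \<in> J" "\<not> (x \<in> Le n \<and> y \<in> Le n)"
   using c_eq_0[OF that(1,2), of z] assms(2) that by (auto simp: Le_def)
  then show "coef (dl z) p = coef (\<Sum>p\<in>Le n \<times> Le n. frag_cmul (int (c (fst p) (snd p) z)) (frag_of p)) p"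
   unfolding p lookup_sum_frag_of[OF finite_cartesian_product[OF fin_Le fin_Le]] lookup_dl[OF assms(1)] by (auto simp: Le_def)
 qed
 then show ?thesis by (simp add: frag_extend_sum_frag_of fin_Le sum.cartesian_product case_prod_unfold)
qed

lemma mu_comm: "x \<in> J ==> y \<in> J ==> mu (x, y) = mu (y, x)" by (rule poly_mapping_eqI) (simp add: lookup_mu c_comm)

lemma mu_unit: "x \<in> J ==> mu (e, x) = frag_of x" by (rule poly_mapping_eqI) (simp add: lookup_mu c_unit e_in)

definition mult :: "('j \<Rightarrow>\<^sub>0 int) => ('j \<Rightarrow>\<^sub>0 int) => 'j \<Rightarrow>\<^sub>0 int" where
 "mult x y = frag_extend mu (tens x y)"

lemma mult_diff: "mult (x - x') y = mult x y - mult x' y" "mult x (y - y') = mult x y - mult x y'"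
 and mult_add: "mult (x + x') y = mult x y + mult x' y" "mult x (y + y') = mult x y + mult x y'"
 and mult_0: "mult 0 y = 0" "mult x 0 = 0"
 and mult_of: "mult (frag_of i) (frag_of j) = mu (i, j)" by (simp_all add: mult_def tens_diff tens_add frag_extend_diff frag_extend_add)

lemma keys_mult: "supp (mult x y) \<subseteq> J" unfolding mult_def using keys_frag_extend[of mu "tens x y"] keys_mu_J by blast

lemma mult_comm:
 assumes "supp x \<subseteq> J" "supp y \<subseteq> J"
 shows "mult x y = mult y x" using assms(1)
proof (induction rule: frag_closed_induct)
 case (one i)
 show ?case using assms(2) by (induction rule: frag_closed_induct) (simp_all add: mult_diff mult_0 mult_of mu_comm one)
qed (simp_all add: mult_diff mult_0)

lemma mult_of_right: "mult x (frag_of j) = frag_extend (\<lambda>i. mu (i, j)) x"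
 and mult_of_left: "mult (frag_of i) x = frag_extend (\<lambda>j. mu (i, j)) x" by (simp_all add: mult_def frag_extend_tens)

lemma mult_unit:
 assumes "supp x \<subseteq> J"
 shows "mult (frag_of e) x = x" "mult x (frag_of e) = x"
proof -
 show "mult (frag_of e) x = x" using assms by (induction rule: frag_closed_induct) (simp_all add: mult_diff mult_0 mult_of mu_unit)
 then show "mult x (frag_of e) = x" using mult_comm[OF assms, of "frag_of e"] e_in by (simp add: keys_frag_of)
qed

lemma assoc_Le:
 assumes "x \<in> J" "y \<in> J" "z \<in> J" "deg x + deg y \<le> m" "deg y + deg z \<le> n"
 shows "(\<Sum>w\<in>Le m. int (c x y w) * int (c w z v)) = (\<Sum>w\<in>Le n. int (c y z w) * int (c x w v))"
proof -
 have "(\<Sum>w\<in>Le m. int (c x y w) * int (c w z v)) = (\<Sum>w\<in>{j\<in>J. deg j = deg x + deg y}. int (c x y w) * int (c w z v))"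
  by (rule sum_supported) (use assms c_eq_0[of x y] fin_Le fin_eq in "auto simp: Le_def")
 also have "\<dots> = (\<Sum>w\<in>{j\<in>J. deg j = deg y + deg z}. int (c y z w) * int (c x w v))"
  using arg_cong[OF c_assoc[OF assms(1-3), of v], of int] by simp
 also have "\<dots> = (\<Sum>w\<in>Le n. int (c y z w) * int (c x w v))"
  by (rule sum_supported) (use assms c_eq_0[of y z] fin_Le fin_eq in "auto simp: Le_def")
 finally show ?thesis .
qed

lemma mu_assoc:
 assumes "x \<in> J" "y \<in> J" "z \<in> J"
 shows "mult (mu (x, y)) (frag_of z) = mult (frag_of x) (mu (y, z))"
proof (rule poly_mapping_eqI)
 fix v
 have "coef (mult (mu (x, y)) (frag_of z)) v = (\<Sum>w\<in>Le (deg x + deg y). int (c x y w) * int (c w z v))"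
  unfolding mult_of_right frag_extend_mu[OF assms(1,2) order_refl] lookup_sum using assms by (intro sum.cong) (auto simp: lookup_mu Le_def)
 also have "\<dots> = (\<Sum>w\<in>Le (deg y + deg z). int (c y z w) * int (c x w v))" by (rule assoc_Le) (use assms in auto)
 also have "\<dots> = coef (mult (frag_of x) (mu (y, z))) v" unfolding mult_of_left frag_extend_mu[OF assms(2,3) order_refl] lookup_sum
  using assms by (intro sum.cong) (auto simp: lookup_mu Le_def)
 finally show "coef (mult (mu (x, y)) (frag_of z)) v = coef (mult (frag_of x) (mu (y, z))) v" .
qed

lemma mult_assoc:
 assumes "supp x \<subseteq> J" "supp y \<subseteq> J" "supp z \<subseteq> J"
 shows "mult (mult x y) z = mult x (mult y z)" using assms(1)
proof (induction rule: frag_closed_induct)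
 case i: (one i)
 show ?case using assms(2)
 proof (induction rule: frag_closed_induct)
  case j: (one j)
  show ?case using assms(3) by (induction rule: frag_closed_induct) (simp_all add: mult_diff mult_0 mult_of mu_assoc i j)
 qed (simp_all add: mult_diff mult_0)
qed (simp_all add: mult_diff mult_0)

section \<open>Axioms of the comultiplication\<close>

abbreviation "reassoc \<equiv> \<lambda>p. (fst (fst p), snd (fst p), snd p)"

lemma lookup_frag_extend_inj:
 assumes "inj f"
 shows "coef (frag_extend (\<lambda>p. frag_of (f p)) t) (f i) = coef t i"
proof -
 have "coef (frag_extend (\<lambda>p. frag_of (f p)) t) (f i) = (\<Sum>k\<in>supp t. if k = i then coef t i else 0)"
  unfolding lookup_frag_extend[OF finite_keys order_refl] using injD[OF assms] by (intro sum.cong) auto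
 then show ?thesis by (simp add: in_keys_iff)
qed

text \<open>Coefficient by coefficient this is associativity, with \<open>z\<close> as the output
  and \<open>a\<close>, \<open>b\<close>, \<open>d\<close> as the inputs.\<close>

lemma dl_coassoc:
 assumes z: "z \<in> J"
 shows "frag_extend (\<lambda>p. frag_of (reassoc p)) (frag_extend (\<lambda>p. tens (dl (fst p)) (frag_of (snd p))) (dl z)) =
  frag_extend (\<lambda>p. tens (frag_of (fst p)) (dl (snd p))) (dl z)" (is "?L = ?R")
proof (rule poly_mapping_eqI)
 fix abd :: "'j \<times> 'j \<times> 'j"
 obtain a b d where abd: "abd = (a, b, d)" by (cases abd)
 \<comment> \<open>A bound for all degrees involved, so that one range serves every sum and contains
   \<open>a\<close> and \<open>d\<close>.\<close>
 define n where "n = deg a + deg b + deg d + deg z"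
 have zn: "deg z \<le> n" by (simp add: n_def)
 have "abd = reassoc ((a, b), d)" by (simp add: abd)
 moreover have "inj reassoc" by (auto simp: inj_def prod_eq_iff)
 ultimately have "coef ?L abd = coef (frag_extend (\<lambda>p. tens (dl (fst p)) (frag_of (snd p))) (dl z)) ((a, b), d)"
  using lookup_frag_extend_inj[of reassoc _ "((a, b), d)"] by simp
 then have L: "coef ?L abd = (\<Sum>x\<in>Le n. \<Sum>y\<in>Le n. if d = y then int (c x y z) *
   (if a \<in> J \<and> b \<in> J then int (c a b x) else 0) else 0)" unfolding frag_extend_dl[OF z zn] lookup_sum
  by (auto simp: lookup_tens lookup_dl Le_def intro!: sum.cong)
 have R: "coef ?R abd = (\<Sum>x\<in>Le n. if a = x then (\<Sum>y\<in>Le n. int (c x y z) *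
   (if b \<in> J \<and> d \<in> J then int (c b d y) else 0)) else 0)" unfolding abd frag_extend_dl[OF z zn] lookup_sum
  by (auto simp: lookup_tens lookup_dl Le_def intro!: sum.cong sum.neutral)
 show "coef ?L abd = coef ?R abd"
 proof (cases "a \<in> J \<and> b \<in> J \<and> d \<in> J")
  case True
  then have mem: "a \<in> Le n" "d \<in> Le n" by (auto simp: Le_def n_def)
  have "coef ?L abd = (\<Sum>x\<in>Le n. int (c a b x) * int (c x d z))" unfolding L using True mem fin_Le by (intro sum.cong) (auto simp: sum.delta')
  also have "\<dots> = (\<Sum>y\<in>Le n. int (c b d y) * int (c a y z))" by (rule assoc_Le) (use True in "auto simp: n_def")
  also have "\<dots> = coef ?R abd" unfolding R using True mem fin_Le by (simp add: sum.delta' mult.commute)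
  finally show ?thesis .
 next
  case False
  then have "coef ?L abd = 0" unfolding L by (intro sum.neutral ballI) (auto simp: Le_def)
  moreover have "coef ?R abd = 0" unfolding R using False by (intro sum.neutral ballI) (auto simp: Le_def)
  ultimately show ?thesis by simp
 qed
qed

lemma dl_counit:
 assumes z: "z \<in> J"
 shows "frag_extend (\<lambda>p. if fst p = e then frag_of (snd p) else 0) (dl z) = frag_of z"
  and "frag_extend (\<lambda>p. if snd p = e then frag_of (fst p) else 0) (dl z) = frag_of z"
proof -
 have e: "e \<in> Le (deg z)" by (simp add: Le_def e_in e_deg)
 have zz: "z \<in> Le (deg z)" by (simp add: Le_def z)
 have "frag_extend (\<lambda>p. if fst p = e then frag_of (snd p) else 0) (dl z) =
   (\<Sum>x\<in>Le (deg z). if x = e then \<Sum>y\<in>Le (deg z). if y = z then frag_of y else 0 else 0)"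
  unfolding frag_extend_dl[OF z order_refl] by (intro sum.cong refl) (auto simp: c_unit Le_def intro!: sum.cong sum.neutral)
 then show "frag_extend (\<lambda>p. if fst p = e then frag_of (snd p) else 0) (dl z) = frag_of z" using e zz fin_Le by simp
 have "frag_extend (\<lambda>p. if snd p = e then frag_of (fst p) else 0) (dl z) =
   (\<Sum>x\<in>Le (deg z). \<Sum>y\<in>Le (deg z). if y = e then if x = z then frag_of x else 0 else 0)"
  unfolding frag_extend_dl[OF z order_refl] by (intro sum.cong refl) (auto simp: c_unit' Le_def)
 then show "frag_extend (\<lambda>p. if snd p = e then frag_of (fst p) else 0) (dl z) = frag_of z" using e zz fin_Le by simp
qed

text \<open>By \<open>c_counit\<close>, the unit occurs only in the product of \<open>e\<close> with
  itself.\<close>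

lemma dl_unit: "dl e = frag_of (e, e)"
proof (rule poly_mapping_eqI)
 fix p :: "'j \<times> 'j"
 obtain a b where p: "p = (a, b)" by (cases p)
 show "coef (dl e) p = coef (frag_of (e, e)) p" using c_counit[of a b] c_counit[of e e] e_in by (auto simp: p lookup_dl)
qed

text \<open>The coefficients of \<open>(p, q)\<close> on the two sides are the two sides of
  \<open>c_hopf\<close>.\<close>

lemma dl_mult:
 assumes x: "x \<in> J" and y: "y \<in> J"
 shows "frag_extend dl (mu (x, y)) =
  frag_extend (\<lambda>p. frag_extend (\<lambda>q. tens (mu (fst p, fst q)) (mu (snd p, snd q))) (dl y)) (dl x)" (is "?L = ?R")
proof (rule poly_mapping_eqI)
 fix pq :: "'j \<times> 'j"
 obtain p q where pq: "pq = (p, q)" by (cases pq)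
 define n where "n = deg x + deg y"
 have n: "deg x \<le> n" "deg y \<le> n" "deg x + deg y \<le> n" by (simp_all add: n_def)
 have L: "coef ?L pq = (\<Sum>z\<in>Le n. int (c x y z) * (if p \<in> J \<and> q \<in> J then int (c p q z) else 0))"
  unfolding pq frag_extend_mu[OF x y n(3)] lookup_sum by (intro sum.cong) (auto simp: lookup_dl Le_def)
 have R: "coef ?R pq = (\<Sum>a\<in>Le n. \<Sum>b\<in>Le n. \<Sum>a'\<in>Le n. \<Sum>b'\<in>Le n.
   int (c a b x * c a' b' y * c a a' p * c b b' q))" unfolding pq frag_extend_dl[OF x n(1)] frag_extend_dl[OF y n(2)] lookup_sum
  by (intro sum.cong refl) (auto simp: lookup_sum lookup_tens lookup_mu Le_def sum_distrib_left intro!: sum.cong)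
 show "coef ?L pq = coef ?R pq"
 proof (cases "p \<in> J \<and> q \<in> J")
  case True
  have "coef ?L pq = (\<Sum>z\<in>{j\<in>J. deg j = deg x + deg y}. int (c x y z * c p q z))"
   unfolding L by (rule trans[OF sum.cong[OF refl] sum_supported])
    (use True c_eq_0[OF x y] fin_Le fin_eq in "auto simp: Le_def n_def")
  also have "\<dots> = coef ?R pq" unfolding R n_def Le_def using arg_cong[OF c_hopf[OF x y conjunct1[OF True] conjunct2[OF True]], of int] by simp
  finally show ?thesis .
 next
  case False
  have "c a a' p * c b b' q = 0" if "a \<in> Le n" "b \<in> Le n" "a' \<in> Le n" "b' \<in> Le n" for a b a' b'
   using False c_eq_0[of a a' p] c_eq_0[of b b' q] that by (auto simp: Le_def)
  then have "coef ?R pq = 0" unfolding R by (intro sum.neutral ballI) (simp add: mult.assoc)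
  then show ?thesis unfolding L using False by auto
 qed
qed

text \<open>
 If \<open>x\<close> is a basis element of degree \<open>0\<close> other than the unit, then the Hopf axiom says that the matrix \<open>X\<close>
 of multiplication by \<open>x\<close> in degree \<open>0\<close> satisfies \<open>X\<^sup>T X \<ge> 1 + X X\<^sup>T\<close>; the traces contradict this.
\<close>

lemma connected:
 assumes "x \<in> J" "deg x = 0"
 shows "x = e"
proof (rule ccontr)
 assume ne: "x \<noteq> e"
 let ?L = "{j\<in>J. deg j = 0}"
 have finL: "finite ?L" by (rule fin_eq)
 have xL: "x \<in> ?L" "e \<in> ?L" using assms e_in e_deg by auto
 \<comment> \<open>All terms of the Hopf axiom with \<open>p = x\<close>, \<open>q = z\<close> and
   factors \<open>x\<close>, \<open>z\<close> are non-negative. Two kinds are kept: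
   \<open>(a, b, a', b') = (e, x, x, d)\<close> gives the squares and \<open>(x, e, e, z)\<close>
   gives 1. They differ in \<open>a\<close> because \<open>x\<close> is not
   \<open>e\<close>.\<close>
 have ge: "1 + (\<Sum>d\<in>?L. c x d z * c x d z) \<le> (\<Sum>u\<in>?L. c x z u * c x z u)" if z: "z \<in> ?L" for z
 proof -
  define F where "F = (\<lambda>a b a' b'. c a b x * c a' b' z * c a a' x * c b b' z)"
  have sub: "F a b a' b' \<le> (\<Sum>b\<in>?L. \<Sum>a'\<in>?L. \<Sum>b'\<in>?L. F a b a' b')" if "b \<in> ?L" "a' \<in> ?L" "b' \<in> ?L" for a b a' b'
  proof -
   have "F a b a' b' \<le> (\<Sum>b'\<in>?L. F a b a' b')" using that finL by (intro member_le_sum) auto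
   also have "\<dots> \<le> (\<Sum>a'\<in>?L. \<Sum>b'\<in>?L. F a b a' b')" using that finL by (intro member_le_sum[of a' ?L "\<lambda>a'. \<Sum>b'\<in>?L. F a b a' b'"]) auto
   also have "\<dots> \<le> (\<Sum>b\<in>?L. \<Sum>a'\<in>?L. \<Sum>b'\<in>?L. F a b a' b')"
    using that finL by (intro member_le_sum[of b ?L "\<lambda>b. \<Sum>a'\<in>?L. \<Sum>b'\<in>?L. F a b a' b'"]) auto
   finally show ?thesis .
  qed
  have "(\<Sum>b'\<in>?L. F e x x b') \<le> (\<Sum>a'\<in>?L. \<Sum>b'\<in>?L. F e x a' b')"
   using xL finL by (intro member_le_sum[of x ?L "\<lambda>a'. \<Sum>b'\<in>?L. F e x a' b'"]) auto
  also have "\<dots> \<le> (\<Sum>b\<in>?L. \<Sum>a'\<in>?L. \<Sum>b'\<in>?L. F e b a' b')"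
   using xL finL by (intro member_le_sum[of x ?L "\<lambda>b. \<Sum>a'\<in>?L. \<Sum>b'\<in>?L. F e b a' b'"]) auto
  finally have e: "(\<Sum>d\<in>?L. c x d z * c x d z) \<le> (\<Sum>b\<in>?L. \<Sum>a'\<in>?L. \<Sum>b'\<in>?L. F e b a' b')"
   using assms by (simp add: F_def c_unit)
  have "F x e e z = 1" using assms z e_in by (simp add: F_def c_unit c_unit')
  then have x: "1 \<le> (\<Sum>b\<in>?L. \<Sum>a'\<in>?L. \<Sum>b'\<in>?L. F x b a' b')" using sub[of e e z x] xL z by simp
  have "1 + (\<Sum>d\<in>?L. c x d z * c x d z) \<le> (\<Sum>a\<in>{x, e}. \<Sum>b\<in>?L. \<Sum>a'\<in>?L. \<Sum>b'\<in>?L. F a b a' b')"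
   using ne x e by simp
  also have "\<dots> \<le> (\<Sum>a\<in>?L. \<Sum>b\<in>?L. \<Sum>a'\<in>?L. \<Sum>b'\<in>?L. F a b a' b')" using xL finL by (intro sum_mono2) auto
  also have "\<dots> = (\<Sum>u\<in>?L. c x z u * c x z u)" using c_hopf[of x z x z] assms z by (simp add: F_def)
  finally show ?thesis .
 qed
 have "card ?L + (\<Sum>z\<in>?L. \<Sum>d\<in>?L. c x d z * c x d z) = (\<Sum>z\<in>?L. 1 + (\<Sum>d\<in>?L. c x d z * c x d z))"
  by (simp only: sum.distrib card_eq_sum)
 also have "\<dots> \<le> (\<Sum>z\<in>?L. \<Sum>u\<in>?L. c x z u * c x z u)" by (rule sum_mono) (rule ge)
 also have "\<dots> = (\<Sum>z\<in>?L. \<Sum>d\<in>?L. c x d z * c x d z)" by (rule sum.swap)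
 finally have "card ?L = 0" by simp
 then show False using finL xL by auto
qed

text \<open>The antipode is defined by recursion over degrees; the argument \<open>n\<close> bounds
  the degree and makes this a recursion over a natural number. In positive degree the equation
  solves the left antipode axiom for the term \<open>S z\<close>, all other terms having first
  entries of smaller degree.\<close>

primrec Sn :: "nat => 'j => 'j \<Rightarrow>\<^sub>0 int" where
 "Sn 0 z = frag_of z"
| "Sn (Suc n) z = (if deg z \<le> n then Sn n z else
  - (\<Sum>p\<in>{p \<in> Le (deg z) \<times> Le (deg z). deg (fst p) < deg z}. frag_cmul (int (c (fst p) (snd p) z)) (mult (Sn n (fst p)) (frag_of (snd p)))))"

definition S :: "'j => 'j \<Rightarrow>\<^sub>0 int" where
 "S z = Sn (deg z) z"

lemma Sn_eq: "deg z \<le> n ==> Sn n z = S z"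
proof (induction n)
 case (Suc n)
 then show ?case by (cases "deg z = Suc n") (simp_all add: S_def)
qed (simp add: S_def)

lemma S_rec:
 "S z = (if deg z = 0 then frag_of z else
  - (\<Sum>p\<in>{p \<in> Le (deg z) \<times> Le (deg z). deg (fst p) < deg z}. frag_cmul (int (c (fst p) (snd p) z)) (mult (S (fst p)) (frag_of (snd p)))))"
proof (cases "deg z")
 case (Suc n)
 have "Sn n (fst p) = S (fst p)" if "deg (fst p) < deg z" for p :: "'j \<times> 'j" using that Suc by (intro Sn_eq) simp
 then show ?thesis unfolding S_def[of z] Suc by (simp add: Suc cong: conj_cong)
qed (simp add: S_def)

lemma keys_S: "z \<in> J ==> supp (S z) \<subseteq> J"
proof -
 assume z: "z \<in> J"
 have "supp (\<Sum>p\<in>P. frag_cmul (a p) (mult (f p) (g p))) \<subseteq> J" for P :: "('j \<times> 'j) set" and a f g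
  by (rule order_trans[OF keys_sum], rule UN_least, rule order_trans[OF keys_cmul keys_mult])
 then show ?thesis using z by (subst S_rec) simp
qed

text \<open>For \<open>z\<close> of positive degree, connectedness leaves \<open>(z, e)\<close> as
  the only pair in \<open>dl z\<close> whose first entry has full degree. Its term is
  \<open>S z\<close>, and the recursion cancels it against all others.\<close>

lemma antipode_left:
 assumes z: "z \<in> J"
 shows "frag_extend (\<lambda>p. mult (S (fst p)) (frag_of (snd p))) (dl z) = (if z = e then frag_of e else 0)"
proof (cases "z = e")
 case True
 then show ?thesis using e_in e_deg by (simp add: dl_unit S_rec[of e] mult_of mu_unit)
next
 case False
 then have pos: "deg z \<noteq> 0" using connected[OF z] by blast
 let ?T = "\<lambda>p. frag_cmul (int (c (fst p) (snd p) z)) (mult (S (fst p)) (frag_of (snd p)))"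
 let ?P = "{p \<in> Le (deg z) \<times> Le (deg z). deg (fst p) < deg z}"
 have fin': "finite (Le (deg z) \<times> Le (deg z))" using fin_Le by simp
 have "frag_extend (\<lambda>p. mult (S (fst p)) (frag_of (snd p))) (dl z) = sum ?T (Le (deg z) \<times> Le (deg z))"
  unfolding frag_extend_dl[OF z order_refl] by (simp add: sum.cartesian_product case_prod_unfold)
 also have "\<dots> = sum ?T (insert (z, e) ?P)"
 proof (rule sum.mono_neutral_right[OF fin'])
  show "insert (z, e) ?P \<subseteq> Le (deg z) \<times> Le (deg z)" using z e_in e_deg by (auto simp: Le_def)
  show "\<forall>p\<in>Le (deg z) \<times> Le (deg z) - insert (z, e) ?P. ?T p = 0"
  proof
   fix p assume p: "p \<in> Le (deg z) \<times> Le (deg z) - insert (z, e) ?P"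
   obtain x y where xy: "p = (x, y)" by (cases p)
   have J: "x \<in> J" "y \<in> J" "deg x = deg z" using p xy by (auto simp: Le_def)
   have "c x y z = 0"
   proof (rule ccontr)
    assume nz: "c x y z \<noteq> 0"
    then have "y = e" using c_supp(2)[OF J(1,2) nz] J connected by simp
    then have "x = z" using nz c_unit'[OF J(1), of z] by (auto split: if_splits)
    then show False using p xy \<open>y = e\<close> by simp
   qed
   then show "?T p = 0" by (simp add: xy)
  qed
 qed
 also have "\<dots> = ?T (z, e) + sum ?T ?P" by (rule sum.insert) (use fin' in "auto intro: finite_subset")
 also have "?T (z, e) = S z" using z keys_S[OF z] by (simp add: c_unit' mult_unit)
 also have "S z + sum ?T ?P = 0" by (subst S_rec) (simp add: pos)
 finally show ?thesis using False by simp
qed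

text \<open>Commutativity of the product and of its structure constants exchanges the two entries
  and reduces this to the left axiom.\<close>

lemma antipode_right:
 assumes z: "z \<in> J"
 shows "frag_extend (\<lambda>p. mult (frag_of (fst p)) (S (snd p))) (dl z) = (if z = e then frag_of e else 0)"
proof -
 have "frag_extend (\<lambda>p. mult (frag_of (fst p)) (S (snd p))) (dl z) =
   (\<Sum>x\<in>Le (deg z). \<Sum>y\<in>Le (deg z). frag_cmul (int (c y x z)) (mult (S y) (frag_of x)))" unfolding frag_extend_dl[OF z order_refl]
 proof (intro sum.cong refl)
  fix x y assume "x \<in> Le (deg z)" "y \<in> Le (deg z)"
  then have "x \<in> J" "y \<in> J" by (simp_all add: Le_def)
  then show "frag_cmul (int (c x y z)) (mult (frag_of (fst (x, y))) (S (snd (x, y)))) = frag_cmul (int (c y x z)) (mult (S y) (frag_of x))"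
   using c_comm[of x y z] mult_comm[of "frag_of x" "S y"] keys_S[of y] by (simp add: keys_frag_of)
 qed
 also have "\<dots> = frag_extend (\<lambda>p. mult (S (fst p)) (frag_of (snd p))) (dl z)"
  unfolding frag_extend_dl[OF z order_refl] by (subst sum.swap) simp
 finally show ?thesis unfolding antipode_left[OF z] .
qed

end

subsection \<open>The standard inner product\<close>

definition ip :: "('i \<Rightarrow>\<^sub>0 int) => ('i \<Rightarrow>\<^sub>0 int) => int" where
 "ip x y = (\<Sum>i\<in>supp x. coef x i * coef y i)"

lemma ip_superset:
 assumes "finite I" "supp x \<subseteq> I"
 shows "ip x y = (\<Sum>i\<in>I. coef x i * coef y i)" unfolding ip_def using assms by (intro sum.mono_neutral_left) (auto simp: in_keys_iff)

lemma ip_commute: "ip x y = ip y x"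
proof -
 have "ip x y = (\<Sum>i\<in>supp x \<union> supp y. coef x i * coef y i)" by (rule ip_superset) auto
 also have "\<dots> = (\<Sum>i\<in>supp x \<union> supp y. coef y i * coef x i)" by (simp add: mult.commute)
 also have "\<dots> = ip y x" by (rule ip_superset[symmetric]) auto
 finally show ?thesis .
qed

lemma ip_add: "ip x (y + z) = ip x y + ip x z" "ip (y + z) x = ip y x + ip z x"
proof -
 show 1: "ip x (y + z) = ip x y + ip x z" for x y z :: "'a \<Rightarrow>\<^sub>0 int" by (simp add: ip_def lookup_add distrib_left sum.distrib)
 show "ip (y + z) x = ip y x + ip z x" using 1[of x y z] by (simp add: ip_commute)
qed

lemma ip_diff: "ip x (y - z) = ip x y - ip x z" "ip (y - z) x = ip y x - ip z x" using ip_add(1)[of x "y - z" z] ip_add(2)[of "y - z" z x] by simp_all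

lemma ip_0 [simp]: "ip 0 x = 0" "ip x 0 = 0" by (simp_all add: ip_def)

lemma ip_of: "ip (frag_of i) x = coef x i" "ip x (frag_of i) = coef x i"
proof -
 show 1: "ip (frag_of i) x = coef x i" by (simp add: ip_def keys_frag_of)
 show "ip x (frag_of i) = coef x i" using 1 by (simp add: ip_commute)
qed

lemma ip_pos: "x \<noteq> 0 ==> ip x x > 0" unfolding ip_def by (intro sum_pos) (auto simp: in_keys_iff zero_less_mult_iff)

lemma ip_tens: "ip (tens a b) (tens x y) = ip a x * ip b y"
proof -
 have "ip (tens a b) (tens x y) = (\<Sum>p\<in>supp a \<times> supp b. coef (tens a b) p * coef (tens x y) p)"
  by (rule ip_superset) (use keys_tens in auto)
 also have "\<dots> = ip a x * ip b y" by (auto simp: lookup_tens ip_def sum_product sum.cartesian_product intro!: sum.cong)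
 finally show ?thesis .
qed

lemma frag_extend_ip: "frag_extend (\<lambda>i. frag_cmul (coef x i) (frag_of ())) t = frag_cmul (ip t x) (frag_of ())"
 by (rule poly_mapping_eqI) (simp add: lookup_frag_extend[OF finite_keys order_refl] ip_def)

text \<open>Both sides are bilinear, and on basis elements both are the same structure
  constant.\<close>

lemma (in psh_data) mult_adjoint:
 assumes "supp t \<subseteq> J \<times> J" "supp z \<subseteq> J"
 shows "ip (frag_extend mu t) z = ip t (frag_extend dl z)" using assms(1)
proof (induction rule: frag_closed_induct)
 case p: (one p)
 show ?case using assms(2) by (induction rule: frag_closed_induct)
   (use p in "auto simp: ip_diff frag_extend_diff ip_of lookup_mu lookup_dl")
qed (simp_all add: ip_diff frag_extend_diff)

lemma frag_extend_tens_tens: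
 "frag_extend (\<lambda>p. tens (f (fst p)) (g (snd p))) (tens x y) = tens (frag_extend f x) (frag_extend g y)"
proof (rule frag_eq_on_basis[of x UNIV])
 fix i
 show "frag_extend (\<lambda>p. tens (f (fst p)) (g (snd p))) (tens (frag_of i) y) = tens (frag_extend f (frag_of i)) (frag_extend g y)"
  by (rule frag_eq_on_basis[of y UNIV]) (simp_all add: frag_extend_diff tens_diff)
qed (simp_all add: frag_extend_diff tens_diff)

lemma frag_extend_frag_of [simp]: "frag_extend frag_of x = x" by (rule frag_expansion[symmetric])

lemma tens_frag_of_left: "frag_extend (\<lambda>i. tens (frag_of i) y) x = tens x y"
 by (rule frag_eq_on_basis[of x UNIV]) (simp_all add: frag_extend_diff tens_diff)

lemma frag_extend_delta: "frag_extend (\<lambda>i. if i = k then y else 0) x = frag_cmul (coef x k) y" by (rule poly_mapping_eqI)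
  (auto simp: lookup_frag_extend[OF finite_keys order_refl] if_distrib[of "\<lambda>f. coef f _"]
   if_distrib[of "\<lambda>n. _ * n"] in_keys_iff cong: if_cong)

lemma frag_cmul_diff: "frag_cmul n (x - y) = frag_cmul n x - frag_cmul n y" by (rule poly_mapping_eqI) (simp add: lookup_minus right_diff_distrib)

lemma frag_extend_cmul_frag_of: "frag_extend (\<lambda>i. frag_cmul n (frag_of i)) x = frag_cmul n x"
 by (rule frag_eq_on_basis[of x UNIV]) (simp_all add: frag_extend_diff frag_cmul_diff)

section \<open>Bases and non-negative combinations in coordinates\<close>

context free_coords
begin

lemma ps_0: "ps 0 = \<one>\<^bsub>G\<^esub>" using ps_ph[of "\<one>\<^bsub>G\<^esub>"] ph_one group by (simp add: group.is_monoid)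

lemma ps_diff:
 assumes "supp x \<subseteq> J" "supp y \<subseteq> J"
 shows "ps (x - y) = ps x \<otimes>\<^bsub>G\<^esub> inv\<^bsub>G\<^esub> (ps y)"
proof -
 interpret group G by (rule group)
 have k: "supp (x - y) \<subseteq> J" using assms keys_diff[of x y] by blast
 show ?thesis by (rule ph_inj) (use assms k in "auto simp: ps_in ph_ps ph_mult ph_inv")
qed

lemma ps_in_subgroup:
 assumes N: "subgroup N G" and S: "S \<subseteq> J" "\<And>s. s \<in> S ==> ps (frag_of s) \<in> N" and x: "supp x \<subseteq> S"
 shows "ps x \<in> N" using x
proof (induction rule: frag_closed_induct)
 case zero
 show ?case by (simp add: ps_0 subgroup.one_closed[OF N])
next
 case (diff x y)
 have "ps (x - y) = ps x \<otimes>\<^bsub>G\<^esub> inv\<^bsub>G\<^esub> (ps y)" using diff(1,2) S(1) by (intro ps_diff) auto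
 then show ?case using diff(3,4) by (simp add: subgroup.m_closed[OF N] subgroup.m_inv_closed[OF N])
qed (rule S)

definition "bas j = ps (frag_of j)"

lemma bas_in: "j \<in> J ==> bas j \<in> carrier G" and ph_bas: "j \<in> J ==> ph (bas j) = frag_of j"
 by (simp_all add: bas_def ps_in ph_ps keys_frag_of)

lemma inj_bas: "inj_on bas J"
proof (rule inj_onI)
 fix i j assume "i \<in> J" "j \<in> J" "bas i = bas j"
 then have "frag_of i = frag_of j" using ph_bas by metis
 then show "i = j" by (simp add: frag_of_eq)
qed

text \<open>The multiples \<open>f b\<close> are left abstract so that powers with natural and with
  integer exponents are covered at once.\<close>

lemma lookup_comb:
 assumes B: "B \<subseteq> bas ` J" "finite B" and j: "j \<in> J" and a: "\<And>b. b \<in> B ==> ph (f b) = frag_cmul (a b) (ph b)" "f \<in> B \<rightarrow> carrier G"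
 shows "coef (ph (finprod G f B)) j = (if bas j \<in> B then a (bas j) else 0)"
proof -
 have "coef (ph (finprod G f B)) j = (\<Sum>b\<in>B. a b * coef (ph b) j)"
  unfolding ph_finprod[OF B(2) a(2)] lookup_sum by (rule sum.cong) (simp_all add: a)
 also have "\<dots> = (\<Sum>b\<in>B. if b = bas j then a (bas j) else 0)"
 proof (rule sum.cong[OF refl])
  fix b assume "b \<in> B"
  then have "b \<in> bas ` J" using B(1) by blast
  then obtain i where i: "b = bas i" "i \<in> J" by (rule imageE)
  then show "a b * coef (ph b) j = (if b = bas j then a (bas j) else 0)" using j inj_onD[OF inj_bas, of i j] by (auto simp: ph_bas)
 qed
 finally show ?thesis using B(2) by simp
qed

lemma lookup_outside: "a \<in> carrier G ==> j \<notin> J ==> coef (ph a) j = 0" using ph_keys[of a] by (meson in_keys_iff subsetD)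

lemma eq_lookupI:
 assumes "a \<in> carrier G" "b \<in> carrier G" "\<And>j. j \<in> J ==> coef (ph a) j = coef (ph b) j"
 shows "a = b"
proof (rule ph_inj[OF assms(1,2)], rule poly_mapping_eqI)
 fix j show "coef (ph a) j = coef (ph b) j"
  using assms(3)[of j] lookup_outside[OF assms(1)] lookup_outside[OF assms(2)] by (cases "j \<in> J") simp_all
qed

text \<open>Positivity becomes a sign condition on coordinates, for the group itself and for its
  tensor square alike.\<close>

lemma nonneg_combs_bas:
 "{finprod G (\<lambda>b. b [^]\<^bsub>G\<^esub> (f b :: nat)) B | f B. finite B \<and> B \<subseteq> bas ` J} = {a \<in> carrier G. \<forall>j. 0 \<le> coef (ph a) j}"
proof (intro equalityI subsetI)
 interpret comm_group G by (rule comm)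
 fix x assume "x \<in> {finprod G (\<lambda>b. b [^]\<^bsub>G\<^esub> (f b :: nat)) B | f B. finite B \<and> B \<subseteq> bas ` J}"
 then obtain f B where x: "x = finprod G (\<lambda>b. b [^]\<^bsub>G\<^esub> (f b :: nat)) B" and B: "finite B" "B \<subseteq> bas ` J" by blast
 have Bc: "B \<subseteq> carrier G" using B(2) bas_in by blast
 have xc: "x \<in> carrier G" unfolding x by (rule finprod_closed) (use Bc in auto)
 have "0 \<le> coef (ph x) j" for j
 proof (cases "j \<in> J")
  case True
  show ?thesis unfolding x by (subst lookup_comb[OF B(2,1) True, of _ "\<lambda>b. int (f b)"]) (use Bc in "auto simp: ph_nat_pow")
 next
  case False
  then show ?thesis by (simp add: lookup_outside[OF xc])
 qed
 then show "x \<in> {a \<in> carrier G. \<forall>j. 0 \<le> coef (ph a) j}" using xc by simp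
next
 interpret comm_group G by (rule comm)
 fix x assume "x \<in> {a \<in> carrier G. \<forall>j. 0 \<le> coef (ph a) j}"
 then have x: "x \<in> carrier G" "\<And>j. 0 \<le> coef (ph x) j" by simp_all
 define B where "B = bas ` supp (ph x)"
 have B: "B \<subseteq> bas ` J" "finite B" using ph_keys[OF x(1)] by (auto simp: B_def)
 have Bc: "B \<subseteq> carrier G" using B(1) bas_in by blast
 \<comment> \<open>The coordinates of \<open>bas j\<close> are a unit vector, so pairing with them
   extracts the coefficient at \<open>j\<close>.\<close>
 define f where "f = (\<lambda>b. nat (ip (ph x) (ph b)))"
 have "x = finprod G (\<lambda>b. b [^]\<^bsub>G\<^esub> f b) B"
 proof (rule eq_lookupI[OF x(1)])
  show "finprod G (\<lambda>b. b [^]\<^bsub>G\<^esub> f b) B \<in> carrier G" by (rule finprod_closed) (use Bc in auto)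
  fix j assume j: "j \<in> J"
  have "coef (ph (finprod G (\<lambda>b. b [^]\<^bsub>G\<^esub> f b) B)) j = (if bas j \<in> B then int (f (bas j)) else 0)"
   by (rule lookup_comb[OF B j]) (use Bc in "auto simp: ph_nat_pow")
  moreover have "bas j \<in> B \<longleftrightarrow> j \<in> supp (ph x)"
   unfolding B_def by (rule inj_on_image_mem_iff[OF inj_bas j ph_keys[OF x(1)]])
  ultimately show "coef (ph x) j = coef (ph (finprod G (\<lambda>b. b [^]\<^bsub>G\<^esub> f b) B)) j"
   using x(2)[of j] j by (simp add: f_def ph_bas ip_of in_keys_iff)
 qed
 then show "x \<in> {finprod G (\<lambda>b. b [^]\<^bsub>G\<^esub> (f b :: nat)) B | f B. finite B \<and> B \<subseteq> bas ` J}" using B by blast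
qed

lemma ex1_int_comb:
 assumes x: "x \<in> carrier G"
 shows "\<exists>!f :: 'a => int. {b. f b \<noteq> 0} \<subseteq> bas ` J \<and> finite {b. f b \<noteq> 0} \<and>
  x = finprod G (\<lambda>b. b [^]\<^bsub>G\<^esub> f b) {b. f b \<noteq> 0}"
proof -
 interpret comm_group G by (rule comm)
 let ?P = "\<lambda>f :: 'a => int. finprod G (\<lambda>b. b [^]\<^bsub>G\<^esub> f b) {b. f b \<noteq> 0}"
 have comb: "?P f \<in> carrier G" if "{b. f b \<noteq> 0} \<subseteq> bas ` J" for f by (rule finprod_closed) (use that bas_in in auto)
 have look: "coef (ph (?P f)) j = f (bas j)"
  if f: "{b. f b \<noteq> 0} \<subseteq> bas ` J" "finite {b. f b \<noteq> 0}" and j: "j \<in> J" for f j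
  by (subst lookup_comb[OF f j, of _ f]) (use f(1) bas_in in "auto simp: ph_int_pow")
 define f where "f = (\<lambda>b. if b \<in> bas ` J then ip (ph x) (ph b) else 0)"
 have fb: "f (bas j) = coef (ph x) j" if "j \<in> J" for j using that by (simp add: f_def ph_bas ip_of)
 have sub: "{b. f b \<noteq> 0} \<subseteq> bas ` J" by (auto simp: f_def split: if_splits)
 have "{b. f b \<noteq> 0} \<subseteq> bas ` supp (ph x)"
 proof
  fix b assume b: "b \<in> {b. f b \<noteq> 0}"
  then obtain j where "b = bas j" "j \<in> J" using subsetD[OF sub b] by (auto elim: imageE)
  then show "b \<in> bas ` supp (ph x)" using b fb by (auto simp: in_keys_iff)
 qed
 then have fin: "finite {b. f b \<noteq> 0}" by (rule finite_subset) simp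
 show ?thesis
 proof (rule ex1I[of _ f], intro conjI)
  show "x = ?P f" by (rule eq_lookupI[OF x comb[OF sub]]) (simp add: look[OF sub fin] fb)
  fix g :: "'a => int" assume g: "{b. g b \<noteq> 0} \<subseteq> bas ` J \<and> finite {b. g b \<noteq> 0} \<and> x = ?P g"
  show "g = f"
  proof
   fix b show "g b = f b"
   proof (cases "b \<in> bas ` J")
    case True
    then obtain j where j: "b = bas j" "j \<in> J" by (rule imageE)
    have "coef (ph (?P g)) j = g (bas j)" by (rule look) (use g j in auto)
    moreover have "?P g = x" using g by simp
    ultimately show ?thesis using fb j by simp
   next
    case False
    then have "g b = 0" using g by blast
    then show ?thesis using False by (simp add: f_def)
   qed
  qed
 qed (rule sub fin)+
qed

end

text \<open>The operations of \<open>A\<close> are prescribed through coordinates, so that each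
  axiom reduces to a statement about \<open>mult\<close>, \<open>dl\<close> and
  \<open>ip\<close>.\<close>

locale psh_coords = psh_data J deg c e + free_coords G J ph
 for J :: "'j set" and deg c e and G :: "'a monoid" and ph +
 fixes A :: "'a psh"
 assumes add_A: "additive_group A = G"
  and mult_A: "a \<in> carrier G ==> b \<in> carrier G ==> a \<otimes>\<^bsub>A\<^esub> b = ps (mult (ph a) (ph b))"
  and one_A: "\<one>\<^bsub>A\<^esub> = ps (frag_of e)"
  and comult_A: "a \<in> carrier G ==> comult A a = free_coords.ps (tensor G G) (tco ph ph) (frag_extend dl (ph a))"
  and counit_A: "a \<in> carrier G ==> counit A a = coef (ph a) e"
  and deg_A: "deg_part A n = {a \<in> carrier G. supp (ph a) \<subseteq> {j\<in>J. deg j = n}}"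
  and ip_A: "a \<in> carrier G ==> b \<in> carrier G ==> inner_prod A a b = ip (ph a) (ph b)"
  and basis_A: "basis A = bas ` J"
begin

section \<open>Verification of the axioms of a PSH algebra\<close>

interpretation G: comm_group G by (rule comm)

lemma A_simps: "carrier A = carrier G" "x \<oplus>\<^bsub>A\<^esub> y = x \<otimes>\<^bsub>G\<^esub> y" "\<zero>\<^bsub>A\<^esub> = \<one>\<^bsub>G\<^esub>"
 using add_A by (auto simp: additive_group_def)

abbreviation "T \<equiv> tensor G G"
abbreviation "ta \<equiv> tco ph ph"

lemma TC: "free_coords T (J \<times> J) ta" by (rule tensor_coords[OF free_coords_axioms free_coords_axioms])

interpretation T: free_coords T "J \<times> J" ta by (rule TC)

lemma pure_in: "a \<in> carrier G ==> b \<in> carrier G ==> pure_tensor G G a b \<in> carrier T"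
 and ta_pure: "a \<in> carrier G ==> b \<in> carrier G ==> ta (pure_tensor G G a b) = tens (ph a) (ph b)"
 by (rule pure_tensor_in[OF free_coords_axioms free_coords_axioms] tco_pure[OF free_coords_axioms free_coords_axioms]; assumption)+

lemma mult_closed: "a \<in> carrier G ==> b \<in> carrier G ==> a \<otimes>\<^bsub>A\<^esub> b \<in> carrier G"
 and ph_mult_A: "a \<in> carrier G ==> b \<in> carrier G ==> ph (a \<otimes>\<^bsub>A\<^esub> b) = mult (ph a) (ph b)"
 by (simp_all add: mult_A ps_in ph_ps keys_mult)

lemma one_closed_A: "\<one>\<^bsub>A\<^esub> \<in> carrier G" and ph_one_A: "ph \<one>\<^bsub>A\<^esub> = frag_of e"
 by (simp_all add: one_A ps_in ph_ps keys_frag_of e_in)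

lemma keys_dl_ext: "supp (frag_extend dl x) \<subseteq> J \<times> J" using keys_frag_extend[of dl x] keys_dl_J by blast

lemma comult_closed: "a \<in> carrier G ==> comult A a \<in> carrier T"
 and ta_comult: "a \<in> carrier G ==> ta (comult A a) = frag_extend dl (ph a)" by (simp_all add: comult_A T.ps_in T.ph_ps keys_dl_ext)

lemma ring_A: "ring A"
proof (rule ringI)
 show "abelian_group A"
 proof (rule abelian_groupI)
  fix x assume "x \<in> carrier A"
  then show "\<exists>y\<in>carrier A. y \<oplus>\<^bsub>A\<^esub> x = \<zero>\<^bsub>A\<^esub>" unfolding A_simps by (intro bexI[of _ "inv\<^bsub>G\<^esub> x"]) auto
 qed (auto simp: A_simps G.m_ac)
 show "Group.monoid A"
 proof (rule Group.monoidI)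
  fix x y z assume "x \<in> carrier A" "y \<in> carrier A" "z \<in> carrier A"
  then show "x \<otimes>\<^bsub>A\<^esub> y \<otimes>\<^bsub>A\<^esub> z = x \<otimes>\<^bsub>A\<^esub> (y \<otimes>\<^bsub>A\<^esub> z)" unfolding A_simps
   by (intro ph_inj) (auto simp: mult_closed ph_mult_A mult_assoc ph_keys)
 next
  fix x assume "x \<in> carrier A"
  then show "\<one>\<^bsub>A\<^esub> \<otimes>\<^bsub>A\<^esub> x = x" "x \<otimes>\<^bsub>A\<^esub> \<one>\<^bsub>A\<^esub> = x" unfolding A_simps
   by (intro ph_inj; simp add: mult_closed one_closed_A ph_mult_A ph_one_A mult_unit ph_keys)+
 qed (simp_all add: A_simps mult_closed one_closed_A)
 fix x y z assume "x \<in> carrier A" "y \<in> carrier A" "z \<in> carrier A"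
 then show "(x \<oplus>\<^bsub>A\<^esub> y) \<otimes>\<^bsub>A\<^esub> z = x \<otimes>\<^bsub>A\<^esub> z \<oplus>\<^bsub>A\<^esub> y \<otimes>\<^bsub>A\<^esub> z" "z \<otimes>\<^bsub>A\<^esub> (x \<oplus>\<^bsub>A\<^esub> y) = z \<otimes>\<^bsub>A\<^esub> x \<oplus>\<^bsub>A\<^esub> z \<otimes>\<^bsub>A\<^esub> y"
  unfolding A_simps by (intro ph_inj; simp add: mult_closed ph_mult_A ph_mult mult_add)+
qed

text \<open>Integer multiples in \<open>A\<close> are powers in \<open>add_monoid A\<close>, whose
  record type differs from that of \<open>G\<close>; the coordinate isomorphism is transferred to it
  first.\<close>

lemma scalar:
 fixes n :: int
 assumes "x \<in> carrier G"
 shows "[n] \<cdot>\<^bsub>A\<^esub> x \<in> carrier G" "ph ([n] \<cdot>\<^bsub>A\<^esub> x) = frag_cmul n (ph x)"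
proof -
 interpret A: ring A by (rule ring_A)
 have "ph \<in> iso (add_monoid A) (free_Abelian_group J)" using iso by (simp add: iso_def hom_def A_simps)
 then have "free_coords (add_monoid A) J ph" unfolding free_coords_def using A.a_comm_group by blast
 from free_coords.ph_int_pow[OF this, of x n] show "ph ([n] \<cdot>\<^bsub>A\<^esub> x) = frag_cmul n (ph x)"
  using assms by (simp add: add_pow_def A_simps)
 show "[n] \<cdot>\<^bsub>A\<^esub> x \<in> carrier G" using A.add.int_pow_closed[of x n] assms by (simp add: add_pow_def A_simps)
qed

lemma comult_hom: "comult A \<in> hom G T"
proof (rule homI)
 fix x y assume xy: "x \<in> carrier G" "y \<in> carrier G"
 show "comult A (x \<otimes>\<^bsub>G\<^esub> y) = comult A x \<otimes>\<^bsub>T\<^esub> comult A y"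
  by (rule T.ph_inj) (use xy in \<open>auto simp: comult_closed ta_comult ph_mult T.ph_mult frag_extend_add
   T.group[THEN group.is_monoid, THEN monoid.m_closed]\<close>)
qed (rule comult_closed)

lemma TGC: "free_coords (tensor T G) ((J \<times> J) \<times> J) (tco ta ph)"
 and GTC: "free_coords (tensor G T) (J \<times> J \<times> J) (tco ph ta)"
 by (rule tensor_coords[OF TC free_coords_axioms] tensor_coords[OF free_coords_axioms TC])+

lemma keys_tens_sub: "supp x \<subseteq> X ==> supp y \<subseteq> Y ==> supp (tens x y) \<subseteq> X \<times> Y" using keys_tens[of x y] by blast

text \<open>Each lift involved is computed by \<open>tensor_lift_coords\<close>: \<open>?F1\<close>
  and \<open>?F2\<close> describe the comultiplication on one factor, \<open>?F3\<close> and
  \<open>?F4\<close> the inner and the outer lift of the reassociation. What remains is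
  \<open>dl_coassoc\<close>.\<close>

lemma coassoc:
 assumes x: "x \<in> carrier G"
 shows "tensor_assoc G G G (tensor_map G G T G (comult A) (\<lambda>a. a) (comult A x)) = tensor_map G G G T (\<lambda>a. a) (comult A) (comult A x)"
proof -
 note F = free_coords_axioms
 note pT = tco_pure[OF TC F] pure_tensor_in[OF TC F] tco_pure[OF F TC] pure_tensor_in[OF F TC]
 interpret GT: free_coords "tensor G T" "J \<times> J \<times> J" "tco ph ta" by (rule GTC)
 let ?F1 = "\<lambda>p. tens (dl (fst p)) (frag_of (snd p))" and ?F2 = "\<lambda>p. tens (frag_of (fst p)) (dl (snd p))"
  and ?F3 = "\<lambda>c p. tens (frag_of (fst p)) (tens (frag_of (snd p)) (ph c))" and ?F4 = "\<lambda>q. frag_of (reassoc q)"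
 have i1: "pure_tensor T G (comult A a) b \<in> carrier (tensor T G)"
  and b1: "tco ta ph (pure_tensor T G (comult A a) b) = frag_extend ?F1 (tens (ph a) (ph b))"
  if "a \<in> carrier G" "b \<in> carrier G" for a b using that by (simp_all add: pT comult_closed ta_comult frag_extend_tens_tens[of dl frag_of])
 have k1: "supp (?F1 p) \<subseteq> (J \<times> J) \<times> J" if "p \<in> J \<times> J" for p
  using that by (intro keys_tens_sub keys_dl_J) (auto simp: keys_frag_of)
 have L1: "tensor_map G G T G (comult A) (\<lambda>a. a) \<in> hom T (tensor T G)"
  "t \<in> carrier T ==> tco ta ph (tensor_map G G T G (comult A) (\<lambda>a. a) t) = frag_extend ?F1 (ta t)" for t unfolding tensor_map_def
  by (rule tensor_lift_hom[where F = ?F1, OF F F TGC i1 b1 k1] tensor_lift_coords[where F = ?F1, OF F F TGC i1 b1 k1]; assumption)+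
 have i2: "pure_tensor G T a (comult A b) \<in> carrier (tensor G T)"
  and b2: "tco ph ta (pure_tensor G T a (comult A b)) = frag_extend ?F2 (tens (ph a) (ph b))"
  if "a \<in> carrier G" "b \<in> carrier G" for a b using that by (simp_all add: pT comult_closed ta_comult frag_extend_tens_tens[of frag_of dl])
 have k2: "supp (?F2 p) \<subseteq> J \<times> J \<times> J" if "p \<in> J \<times> J" for p
  using that by (intro keys_tens_sub keys_dl_J) (auto simp: keys_frag_of)
 have R: "tensor_map G G G T (\<lambda>a. a) (comult A) \<in> hom T (tensor G T)"
  "t \<in> carrier T ==> tco ph ta (tensor_map G G G T (\<lambda>a. a) (comult A) t) = frag_extend ?F2 (ta t)" for t unfolding tensor_map_def
  by (rule tensor_lift_hom[where F = ?F2, OF F F GTC i2 b2 k2] tensor_lift_coords[where F = ?F2, OF F F GTC i2 b2 k2]; assumption)+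
 define be where "be = (\<lambda>c a b. pure_tensor G T a (pure_tensor G G b c))"
 have i3: "be c a b \<in> carrier (tensor G T)"
  and b3: "tco ph ta (be c a b) = frag_extend (?F3 c) (tens (ph a) (ph b))"
  if "c \<in> carrier G" "a \<in> carrier G" "b \<in> carrier G" for c a b
  using that by (simp_all add: be_def pT pure_in ta_pure frag_extend_tens_tens[of frag_of "\<lambda>j. tens (frag_of j) (ph c)"] tens_frag_of_left)
 have k3: "supp (?F3 c p) \<subseteq> J \<times> J \<times> J" if "c \<in> carrier G" "p \<in> J \<times> J" for c p
  using that by (intro keys_tens_sub ph_keys) (auto simp: keys_frag_of)
 have I: "tensor_lift G G (tensor G T) (be c) \<in> hom T (tensor G T)"
  "t \<in> carrier T ==> tco ph ta (tensor_lift G G (tensor G T) (be c) t) = frag_extend (?F3 c) (ta t)"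
  if c: "c \<in> carrier G" for c t by (rule tensor_lift_hom[where F = "?F3 c", OF F F GTC i3[OF c] b3[OF c] k3[OF c]]
    tensor_lift_coords[where F = "?F3 c", OF F F GTC i3[OF c] b3[OF c] k3[OF c]]; assumption)+
 have re: "frag_extend (\<lambda>p. tens (frag_of (fst p)) (tens (frag_of (snd p)) z)) t = frag_extend (\<lambda>q. frag_of (reassoc q)) (tens t z)"
  for t :: "'j \<times> 'j \<Rightarrow>\<^sub>0 int" and z :: "'j \<Rightarrow>\<^sub>0 int"
 proof (rule frag_eq_on_basis[of t UNIV])
  fix p :: "'j \<times> 'j"
  show "frag_extend (\<lambda>p. tens (frag_of (fst p)) (tens (frag_of (snd p)) z)) (frag_of p) = frag_extend (\<lambda>q. frag_of (reassoc q)) (tens (frag_of p) z)"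
   by (rule frag_eq_on_basis[of z UNIV]) (simp_all add: frag_extend_diff tens_diff)
 qed (simp_all add: frag_extend_diff tens_diff)
 have i4: "tensor_lift G G (tensor G T) (be c) t \<in> carrier (tensor G T)"
  and b4: "tco ph ta (tensor_lift G G (tensor G T) (be c) t) = frag_extend ?F4 (tens (ta t) (ph c))"
  if "t \<in> carrier T" "c \<in> carrier G" for t c using that by (simp_all add: I re hom_in_carrier[OF I(1)])
 have k4: "supp (?F4 q) \<subseteq> J \<times> J \<times> J" if "q \<in> (J \<times> J) \<times> J" for q using that by (auto simp: keys_frag_of)
 have L2': "tensor_lift T G (tensor G T) (\<lambda>t c. tensor_lift G G (tensor G T) (be c) t) \<in> hom (tensor T G) (tensor G T)"
  "t \<in> carrier (tensor T G) ==> tco ph ta (tensor_lift T G (tensor G T) (\<lambda>t c. tensor_lift G G (tensor G T) (be c) t) t) = frag_extend ?F4 (tco ta ph t)" for t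
  by (rule tensor_lift_hom[where F = ?F4, OF TC F GTC i4 b4 k4] tensor_lift_coords[where F = ?F4, OF TC F GTC i4 b4 k4]; assumption)+
 have L2: "tensor_assoc G G G \<in> hom (tensor T G) (tensor G T)"
  "t \<in> carrier (tensor T G) ==> tco ph ta (tensor_assoc G G G t) = frag_extend ?F4 (tco ta ph t)" for t
  using L2' unfolding tensor_assoc_def be_def by blast+
 have xT: "comult A x \<in> carrier T" by (rule comult_closed[OF x])
 show ?thesis
 proof (rule GT.ph_inj)
  show "tensor_assoc G G G (tensor_map G G T G (comult A) (\<lambda>a. a) (comult A x)) \<in> carrier (tensor G T)"
   by (rule hom_in_carrier[OF L2(1) hom_in_carrier[OF L1(1) xT]])
  show "tensor_map G G G T (\<lambda>a. a) (comult A) (comult A x) \<in> carrier (tensor G T)" by (rule hom_in_carrier[OF R(1) xT])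
  show "tco ph ta (tensor_assoc G G G (tensor_map G G T G (comult A) (\<lambda>a. a) (comult A x))) =
    tco ph ta (tensor_map G G G T (\<lambda>a. a) (comult A) (comult A x))"
   unfolding L2(2)[OF hom_in_carrier[OF L1(1) xT]] L1(2)[OF xT] R(2)[OF xT] ta_comult[OF x]
   using ph_keys[OF x] by (induction rule: frag_closed_induct) (simp_all add: frag_extend_diff dl_coassoc)
 qed
qed

lemma counital:
 assumes x: "x \<in> carrier G"
 shows "tensor_lift G G G (\<lambda>a b. [counit A a] \<cdot>\<^bsub>A\<^esub> b) (comult A x) = x"
  "tensor_lift G G G (\<lambda>a b. [counit A b] \<cdot>\<^bsub>A\<^esub> a) (comult A x) = x"
proof -
 note F = free_coords_axioms
 have xT: "comult A x \<in> carrier T" by (rule comult_closed[OF x])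
 let ?F = "\<lambda>p. if fst p = e then frag_of (snd p) else 0" and ?F' = "\<lambda>p. if snd p = e then frag_of (fst p) else 0"
 have F1: "frag_extend ?F (tens u v) = frag_cmul (coef u e) v" for u v :: "'j \<Rightarrow>\<^sub>0 int"
 proof -
  have "frag_extend ?F (tens u v) = frag_extend (\<lambda>i. if i = e then v else 0) u"
   unfolding frag_extend_tens by (intro frag_extend_eq) (simp add: frag_extend_eq_0)
  then show ?thesis by (simp add: frag_extend_delta)
 qed
 have F2: "frag_extend ?F' (tens u v) = frag_cmul (coef v e) u" for u v :: "'j \<Rightarrow>\<^sub>0 int"
 proof -
  have "frag_extend ?F' (tens u v) = frag_extend (\<lambda>i. frag_extend (\<lambda>j. if j = e then frag_of i else 0) v) u"
   unfolding frag_extend_tens fst_conv snd_conv by (rule refl)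
  then show ?thesis by (simp add: frag_extend_delta frag_extend_cmul_frag_of)
 qed
 have i1: "[counit A a] \<cdot>\<^bsub>A\<^esub> b \<in> carrier G" and b1: "ph ([counit A a] \<cdot>\<^bsub>A\<^esub> b) = frag_extend ?F (tens (ph a) (ph b))"
  if "a \<in> carrier G" "b \<in> carrier G" for a b using that by (simp_all add: scalar counit_A F1)
 have i2: "[counit A b] \<cdot>\<^bsub>A\<^esub> a \<in> carrier G" and b2: "ph ([counit A b] \<cdot>\<^bsub>A\<^esub> a) = frag_extend ?F' (tens (ph a) (ph b))"
  if "a \<in> carrier G" "b \<in> carrier G" for a b using that by (simp_all add: scalar counit_A F2)
 have k: "supp (?F p) \<subseteq> J" "supp (?F' p) \<subseteq> J" if "p \<in> J \<times> J" for p using that by (auto simp: keys_frag_of)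
 have 1: "tensor_lift G G G (\<lambda>a b. [counit A a] \<cdot>\<^bsub>A\<^esub> b) \<in> hom T G"
  "t \<in> carrier T ==> ph (tensor_lift G G G (\<lambda>a b. [counit A a] \<cdot>\<^bsub>A\<^esub> b) t) = frag_extend ?F (ta t)" for t
  by (rule tensor_lift_hom[where F = ?F, OF F F F i1 b1 k(1)] tensor_lift_coords[where F = ?F, OF F F F i1 b1 k(1)]; assumption)+
 have 2: "tensor_lift G G G (\<lambda>a b. [counit A b] \<cdot>\<^bsub>A\<^esub> a) \<in> hom T G"
  "t \<in> carrier T ==> ph (tensor_lift G G G (\<lambda>a b. [counit A b] \<cdot>\<^bsub>A\<^esub> a) t) = frag_extend ?F' (ta t)" for t
  by (rule tensor_lift_hom[where F = ?F', OF F F F i2 b2 k(2)] tensor_lift_coords[where F = ?F', OF F F F i2 b2 k(2)]; assumption)+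
 have "frag_extend ?F (frag_extend dl (ph x)) = ph x" "frag_extend ?F' (frag_extend dl (ph x)) = ph x"
  using ph_keys[OF x] by (induction rule: frag_closed_induct) (simp_all add: frag_extend_diff dl_counit)
 then show "tensor_lift G G G (\<lambda>a b. [counit A a] \<cdot>\<^bsub>A\<^esub> b) (comult A x) = x"
  "tensor_lift G G G (\<lambda>a b. [counit A b] \<cdot>\<^bsub>A\<^esub> a) (comult A x) = x"
  using ph_inj[OF hom_in_carrier[OF 1(1) xT] x] ph_inj[OF hom_in_carrier[OF 2(1) xT] x] 1(2)[OF xT] 2(2)[OF xT] ta_comult[OF x] by simp_all
qed

text \<open>Two lifts are nested. The value of the inner one at \<open>comult A y\<close> is
  bilinear in the coordinates of \<open>a\<close> and \<open>b\<close>, which by \<open>FI\<close>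
  makes the outer one computable; the rest is \<open>dl_mult\<close>.\<close>

lemma comult_mult:
 assumes x: "x \<in> carrier G" and y: "y \<in> carrier G"
 shows "comult A (x \<otimes>\<^bsub>A\<^esub> y) = tensor_lift G G T (\<lambda>a b. tensor_lift G G T
   (\<lambda>c d. pure_tensor G G (a \<otimes>\<^bsub>A\<^esub> c) (b \<otimes>\<^bsub>A\<^esub> d)) (comult A y)) (comult A x)"
proof -
 note F = free_coords_axioms
 have xT: "comult A x \<in> carrier T" and yT: "comult A y \<in> carrier T" by (rule comult_closed x y)+
 define be where "be = (\<lambda>a b. tensor_lift G G T (\<lambda>c d. pure_tensor G G (a \<otimes>\<^bsub>A\<^esub> c) (b \<otimes>\<^bsub>A\<^esub> d)))"
 let ?I = "\<lambda>u v q. tens (mult u (frag_of (fst q))) (mult v (frag_of (snd q)))"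
 have mul: "frag_extend (\<lambda>j. mult u (frag_of j)) v = mult u v" for u v
  by (rule frag_eq_on_basis[of v UNIV]) (simp_all add: frag_extend_diff mult_diff mult_0)
 have I: "be a b \<in> hom T T" "t \<in> carrier T ==> ta (be a b t) = frag_extend (?I (ph a) (ph b)) (ta t)"
  if ab: "a \<in> carrier G" "b \<in> carrier G" for a b t
 proof -
  have i: "pure_tensor G G (a \<otimes>\<^bsub>A\<^esub> c) (b \<otimes>\<^bsub>A\<^esub> d) \<in> carrier T"
   and b: "ta (pure_tensor G G (a \<otimes>\<^bsub>A\<^esub> c) (b \<otimes>\<^bsub>A\<^esub> d)) = frag_extend (?I (ph a) (ph b)) (tens (ph c) (ph d))"
   if "c \<in> carrier G" "d \<in> carrier G" for c d using that ab by (simp_all add: mult_closed pure_in ta_pure ph_mult_A mul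
     frag_extend_tens_tens[of "\<lambda>j. mult (ph a) (frag_of j)" "\<lambda>j. mult (ph b) (frag_of j)"])
  have k: "supp (?I (ph a) (ph b) p) \<subseteq> J \<times> J" if "p \<in> J \<times> J" for p by (rule keys_tens_sub[OF keys_mult keys_mult])
  note L = tensor_lift_hom[where F = "?I (ph a) (ph b)", OF F F TC i b k] tensor_lift_coords[where F = "?I (ph a) (ph b)", OF F F TC i b k]
  show "be a b \<in> hom T T" "t \<in> carrier T ==> ta (be a b t) = frag_extend (?I (ph a) (ph b)) (ta t)" unfolding be_def by (rule L; assumption)+
 qed
 define t where "t = frag_extend dl (ph y)"
 let ?F = "\<lambda>p. frag_extend (\<lambda>q. tens (mu (fst p, fst q)) (mu (snd p, snd q))) t"
 have FI: "frag_extend (?I u v) t = frag_extend ?F (tens u v)" for u v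
 proof (rule frag_eq_on_basis[of u UNIV])
  fix i
  show "frag_extend (?I (frag_of i) v) t = frag_extend ?F (tens (frag_of i) v)" by (rule frag_eq_on_basis[of v UNIV])
    (simp_all add: frag_extend_diff frag_extend_fun_diff tens_diff mult_diff mult_0 mult_of frag_extend_eq_0)
 qed (simp_all add: frag_extend_diff frag_extend_fun_diff tens_diff mult_diff mult_0 frag_extend_eq_0)
 have kF: "supp (?F p) \<subseteq> J \<times> J" for p
  by (rule order_trans[OF keys_frag_extend], rule UN_least) (rule keys_tens_sub[OF keys_mu_J keys_mu_J])
 have i: "be a b (comult A y) \<in> carrier T" and b: "ta (be a b (comult A y)) = frag_extend ?F (tens (ph a) (ph b))"
  if "a \<in> carrier G" "b \<in> carrier G" for a b using that by (simp_all add: I(2) yT ta_comult y t_def[symmetric] FI hom_in_carrier[OF I(1) yT])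
 have O: "tensor_lift G G T (\<lambda>a b. be a b (comult A y)) \<in> hom T T"
  "t \<in> carrier T ==> ta (tensor_lift G G T (\<lambda>a b. be a b (comult A y)) t) = frag_extend ?F (ta t)" for t
  by (rule tensor_lift_hom[where F = ?F, OF F F TC i b kF] tensor_lift_coords[where F = ?F, OF F F TC i b kF]; assumption)+
 have eq: "frag_extend dl (mult (ph x) (ph y)) = frag_extend ?F (frag_extend dl (ph x))" unfolding t_def using ph_keys[OF x]
 proof (induction rule: frag_closed_induct)
  case i: (one i)
  show ?case using ph_keys[OF y] by (induction rule: frag_closed_induct)
    (simp_all add: mult_0 mult_diff frag_extend_diff frag_extend_fun_diff frag_extend_eq_0 mult_of dl_mult i)
 qed (simp_all add: mult_0 mult_diff frag_extend_diff)
 have "comult A (x \<otimes>\<^bsub>A\<^esub> y) = tensor_lift G G T (\<lambda>a b. be a b (comult A y)) (comult A x)" by (rule T.ph_inj)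
   (simp_all add: x y xT comult_closed mult_closed hom_in_carrier[OF O(1) xT] ta_comult ph_mult_A O(2) eq)
 then show ?thesis by (simp add: be_def)
qed

lemma counit_mult:
 assumes "x \<in> carrier G" "y \<in> carrier G"
 shows "counit A (x \<otimes>\<^bsub>A\<^esub> y) = counit A x * counit A y"
proof -
 have "coef (mult u v) e = coef u e * coef v e"
  if "supp u \<subseteq> J" "supp v \<subseteq> J" for u v using that(1)
 proof (induction rule: frag_closed_induct)
  case i: (one i)
  show ?case using that(2) by (induction rule: frag_closed_induct)
    (simp_all add: mult_0 mult_diff lookup_minus mult_of lookup_mu c_counit i right_diff_distrib)
 qed (simp_all add: mult_0 mult_diff lookup_minus left_diff_distrib)
 then show ?thesis using assms by (simp add: counit_A mult_closed ph_mult_A ph_keys)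
qed

lemma antipode:
 "\<exists>S\<in>hom G G. \<forall>x\<in>carrier A.
   tensor_lift G G G (\<lambda>a b. S a \<otimes>\<^bsub>A\<^esub> b) (comult A x) = [counit A x] \<cdot>\<^bsub>A\<^esub> \<one>\<^bsub>A\<^esub> \<and>
   tensor_lift G G G (\<lambda>a b. a \<otimes>\<^bsub>A\<^esub> S b) (comult A x) = [counit A x] \<cdot>\<^bsub>A\<^esub> \<one>\<^bsub>A\<^esub>"
proof -
 note F = free_coords_axioms
 define s where "s = (\<lambda>a. ps (frag_extend S (ph a)))"
 have s: "s \<in> hom G G" "\<And>a. a \<in> carrier G ==> ph (s a) = frag_extend S (ph a)" by (rule coords_hom[OF F, of S]; simp add: keys_S s_def)+
 note sc = hom_in_carrier[OF s(1)]
 let ?L = "\<lambda>p. mult (S (fst p)) (frag_of (snd p))" and ?R = "\<lambda>p. mult (frag_of (fst p)) (S (snd p))"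
 have bil: "frag_extend (\<lambda>p. mult (f (fst p)) (g (snd p))) (tens u v) = mult (frag_extend f u) (frag_extend g v)" for f g u v
 proof (rule frag_eq_on_basis[of u UNIV])
  fix i
  show "frag_extend (\<lambda>p. mult (f (fst p)) (g (snd p))) (tens (frag_of i) v) = mult (frag_extend f (frag_of i)) (frag_extend g v)"
   by (rule frag_eq_on_basis[of v UNIV]) (simp_all add: frag_extend_diff tens_diff mult_diff mult_0)
 qed (simp_all add: frag_extend_diff tens_diff mult_diff mult_0)
 have i: "s a \<otimes>\<^bsub>A\<^esub> b \<in> carrier G" "a \<otimes>\<^bsub>A\<^esub> s b \<in> carrier G"
  and b: "ph (s a \<otimes>\<^bsub>A\<^esub> b) = frag_extend ?L (tens (ph a) (ph b))" "ph (a \<otimes>\<^bsub>A\<^esub> s b) = frag_extend ?R (tens (ph a) (ph b))"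
  if "a \<in> carrier G" "b \<in> carrier G" for a b using that by (simp_all add: mult_closed sc s(2) ph_mult_A bil[of S frag_of] bil[of frag_of S])
 have L: "tensor_lift G G G (\<lambda>a b. s a \<otimes>\<^bsub>A\<^esub> b) \<in> hom T G"
  "t \<in> carrier T ==> ph (tensor_lift G G G (\<lambda>a b. s a \<otimes>\<^bsub>A\<^esub> b) t) = frag_extend ?L (ta t)" for t
  by (rule tensor_lift_hom[where F = ?L, OF F F F i(1) b(1) keys_mult] tensor_lift_coords[where F = ?L, OF F F F i(1) b(1) keys_mult]; assumption)+
 have R: "tensor_lift G G G (\<lambda>a b. a \<otimes>\<^bsub>A\<^esub> s b) \<in> hom T G"
  "t \<in> carrier T ==> ph (tensor_lift G G G (\<lambda>a b. a \<otimes>\<^bsub>A\<^esub> s b) t) = frag_extend ?R (ta t)" for t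
  by (rule tensor_lift_hom[where F = ?R, OF F F F i(2) b(2) keys_mult] tensor_lift_coords[where F = ?R, OF F F F i(2) b(2) keys_mult]; assumption)+
 show ?thesis
 proof (rule bexI[OF _ s(1)], rule ballI)
  fix x assume "x \<in> carrier A"
  then have x: "x \<in> carrier G" by (simp add: A_simps)
  have xT: "comult A x \<in> carrier T" by (rule comult_closed[OF x])
  have "frag_extend ?L (frag_extend dl (ph x)) = frag_extend (\<lambda>z. if z = e then frag_of e else 0) (ph x)"
   "frag_extend ?R (frag_extend dl (ph x)) = frag_extend (\<lambda>z. if z = e then frag_of e else 0) (ph x)"
   using ph_keys[OF x] by (induction rule: frag_closed_induct; simp add: frag_extend_diff antipode_left antipode_right)+
  then show "tensor_lift G G G (\<lambda>a b. s a \<otimes>\<^bsub>A\<^esub> b) (comult A x) = [counit A x] \<cdot>\<^bsub>A\<^esub> \<one>\<^bsub>A\<^esub> \<and>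
   tensor_lift G G G (\<lambda>a b. a \<otimes>\<^bsub>A\<^esub> s b) (comult A x) = [counit A x] \<cdot>\<^bsub>A\<^esub> \<one>\<^bsub>A\<^esub>"
   by (intro conjI ph_inj)
    (simp_all add: hom_in_carrier[OF L(1) xT] hom_in_carrier[OF R(1) xT] L(2)[OF xT] R(2)[OF xT] scalar one_closed_A ph_one_A
     counit_A x ta_comult[OF x] frag_extend_delta)
 qed
qed

lemma hopf: "hopf_algebra A"
proof -
 have ep: "counit A \<in> hom G integer_group" by (rule homI) (simp_all add: counit_A ph_mult lookup_add integer_group_def)
 have De1: "comult A \<one>\<^bsub>A\<^esub> = pure_tensor G G \<one>\<^bsub>A\<^esub> \<one>\<^bsub>A\<^esub>"
  by (rule T.ph_inj) (simp_all add: comult_closed pure_in one_closed_A ta_comult ta_pure ph_one_A dl_unit)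
 have ep1: "counit A \<one>\<^bsub>A\<^esub> = 1" by (simp add: counit_A one_closed_A ph_one_A)
 show ?thesis unfolding hopf_algebra_def Let_def add_A A_simps
  by (intro conjI ballI ring_A comult_hom ep coassoc counital De1 ep1 comult_mult counit_mult antipode[unfolded A_simps])
qed

lemma deg_subgroup: "subgroup (deg_part A n) G"
proof (rule G.subgroupI)
 show "deg_part A n \<noteq> {}" using ph_one G.one_closed by (auto simp: deg_A intro!: exI[of _ "\<one>\<^bsub>G\<^esub>"])
 fix a b assume "a \<in> deg_part A n" "b \<in> deg_part A n"
 then show "a \<otimes>\<^bsub>G\<^esub> b \<in> deg_part A n" using keys_add[of "ph a" "ph b"] by (auto simp: deg_A ph_mult)
qed (auto simp: deg_A ph_inv)

lemma graded: "graded_hopf A" unfolding graded_hopf_def Let_def add_A A_simps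
proof (intro conjI allI ballI impI)
 fix n show "subgroup (deg_part A n) G" by (rule deg_subgroup)
next
 fix x assume x: "x \<in> carrier G"
 \<comment> \<open>The projection to the homogeneous component of degree \<open>n\<close>, in
   coordinates.\<close>
 define pt where "pt = (\<lambda>n. frag_extend (\<lambda>j. if deg j = n then frag_of j else 0))"
 have lpt: "coef (pt n u) j = (if deg j = n then coef u j else 0)" for n u j
 proof -
  have "coef (pt n u) j = (\<Sum>i\<in>supp u. if i = j then if deg j = n then coef u j else 0 else 0)"
   unfolding pt_def lookup_frag_extend[OF finite_keys order_refl] by (intro sum.cong) auto
  then show ?thesis by (simp add: in_keys_iff)
 qed
 define f where "f = (\<lambda>n. ps (pt n (ph x)))"
 have kpt: "supp (pt n (ph x)) \<subseteq> {j\<in>J. deg j = n}" for n using ph_keys[OF x] by (auto simp: in_keys_iff lpt split: if_splits)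
 then have kpt': "supp (pt n (ph x)) \<subseteq> J" for n by blast
 have fdeg: "f n \<in> deg_part A n" for n using kpt[of n] kpt'[of n] by (simp add: deg_A f_def ps_in ph_ps)
 have phf: "ph (f n) = pt n (ph x)" for n using kpt'[of n] by (simp add: f_def ph_ps)
 \<comment> \<open>In a sum of homogeneous elements the coefficient at \<open>j\<close> comes from
   degree \<open>deg j\<close> alone; both existence and uniqueness of the decomposition
   follow.\<close>
 have key: "coef (ph (finprod G g {n. g n \<noteq> \<one>\<^bsub>G\<^esub>})) j = coef (ph (g (deg j))) j"
  if g: "\<And>n. g n \<in> deg_part A n" "finite {n. g n \<noteq> \<one>\<^bsub>G\<^esub>}" for g j
 proof -
  have "g \<in> {n. g n \<noteq> \<one>\<^bsub>G\<^esub>} \<rightarrow> carrier G" using g(1) by (auto simp: deg_A)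
  then have "coef (ph (finprod G g {n. g n \<noteq> \<one>\<^bsub>G\<^esub>})) j = (\<Sum>n\<in>{n. g n \<noteq> \<one>\<^bsub>G\<^esub>}. coef (ph (g n)) j)"
   by (simp add: ph_finprod[OF g(2)] lookup_sum)
  also have "\<dots> = (\<Sum>n\<in>{n. g n \<noteq> \<one>\<^bsub>G\<^esub>}. if n = deg j then coef (ph (g (deg j))) j else 0)"
  proof (rule sum.cong[OF refl])
   fix n
   have "supp (ph (g n)) \<subseteq> {j\<in>J. deg j = n}" using g(1)[of n] by (simp add: deg_A)
   then show "coef (ph (g n)) j = (if n = deg j then coef (ph (g (deg j))) j else 0)" by (auto simp: in_keys_iff)
  qed
  also have "\<dots> = coef (ph (g (deg j))) j" using g(2) ph_one by auto
  finally show ?thesis .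
 qed
 have "f n = \<one>\<^bsub>G\<^esub>" if "n \<notin> deg ` supp (ph x)" for n
 proof -
  have "pt n (ph x) = 0" by (rule poly_mapping_eqI) (use that in "auto simp: lpt in_keys_iff")
  then show ?thesis by (simp add: f_def ps_0)
 qed
 then have "{n. f n \<noteq> \<one>\<^bsub>G\<^esub>} \<subseteq> deg ` supp (ph x)" by blast
 then have fin: "finite {n. f n \<noteq> \<one>\<^bsub>G\<^esub>}" by (rule finite_subset) simp
 have comb: "finprod G g {n. g n \<noteq> \<one>\<^bsub>G\<^esub>} \<in> carrier G" if "\<And>n. g n \<in> deg_part A n" for g
  by (rule G.finprod_closed) (use that in "auto simp: deg_A")
 show "\<exists>!f :: nat => 'a. (\<forall>n. f n \<in> deg_part A n) \<and> finite {n. f n \<noteq> \<one>\<^bsub>G\<^esub>} \<and> x = finprod G f {n. f n \<noteq> \<one>\<^bsub>G\<^esub>}"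
 proof (rule ex1I[of _ f], intro conjI allI)
  show "x = finprod G f {n. f n \<noteq> \<one>\<^bsub>G\<^esub>}" by (rule eq_lookupI[OF x comb[OF fdeg]]) (simp add: key[OF fdeg fin] phf lpt)
  fix g assume g: "(\<forall>n. g n \<in> deg_part A n) \<and> finite {n. g n \<noteq> \<one>\<^bsub>G\<^esub>} \<and> x = finprod G g {n. g n \<noteq> \<one>\<^bsub>G\<^esub>}"
  then have g': "\<And>n. g n \<in> deg_part A n" "finite {n. g n \<noteq> \<one>\<^bsub>G\<^esub>}" "finprod G g {n. g n \<noteq> \<one>\<^bsub>G\<^esub>} = x" by simp_all
  show "g = f"
  proof
   fix n
   have gn: "g n \<in> carrier G" "supp (ph (g n)) \<subseteq> {j\<in>J. deg j = n}" using g'(1)[of n] by (simp_all add: deg_A)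
   show "g n = f n"
   proof (rule eq_lookupI[OF gn(1)])
    show "f n \<in> carrier G" using fdeg[of n] by (simp add: deg_A)
    fix j
    show "coef (ph (g n)) j = coef (ph (f n)) j" using gn(2) key[OF g'(1,2), of j, unfolded g'(3)] by (auto simp: phf lpt in_keys_iff)
   qed
  qed
 qed (rule fdeg fin)+
next
 show "\<one>\<^bsub>A\<^esub> \<in> deg_part A 0" by (simp add: deg_A one_closed_A ph_one_A keys_frag_of e_in e_deg)
next
 fix m n x y assume xy: "x \<in> deg_part A m" "y \<in> deg_part A n"
 then have c: "x \<in> carrier G" "y \<in> carrier G" by (simp_all add: deg_A)
 have "supp (mult (ph x) (ph y)) \<subseteq> (\<Union>p\<in>supp (tens (ph x) (ph y)). supp (mu p))" unfolding mult_def by (rule keys_frag_extend)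
 also have "\<dots> \<subseteq> {j\<in>J. deg j = m + n}"
 proof (rule UN_least)
  fix p assume "p \<in> supp (tens (ph x) (ph y))"
  then have "p \<in> supp (ph x) \<times> supp (ph y)" using keys_tens by blast
  then obtain i j where p: "p = (i, j)" "i \<in> J" "deg i = m" "j \<in> J" "deg j = n" using xy by (auto simp: deg_A)
  show "supp (mu p) \<subseteq> {j\<in>J. deg j = m + n}" using keys_mu_J[of p] keys_mu_deg[OF p(2,4)] p by blast
 qed
 finally show "x \<otimes>\<^bsub>A\<^esub> y \<in> deg_part A (m + n)" using c by (simp add: deg_A mult_closed ph_mult_A)
next
 fix n x assume x: "x \<in> deg_part A n"
 then have xc: "x \<in> carrier G" by (simp add: deg_A)
 let ?P = "{pure_tensor G G a b | a b i j. i + j = n \<and> a \<in> deg_part A i \<and> b \<in> deg_part A j}"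
 let ?S = "{p \<in> J \<times> J. deg (fst p) + deg (snd p) = n}"
 have "?P \<subseteq> carrier T" using pure_in by (auto simp: deg_A)
 then have sg: "subgroup (generate T ?P) T" by (rule group.generate_is_subgroup[OF T.group])
 have "supp (frag_extend dl (ph x)) \<subseteq> (\<Union>z\<in>supp (ph x). supp (dl z))" by (rule keys_frag_extend)
 also have "\<dots> \<subseteq> ?S"
 proof (intro UN_least subsetI)
  fix z p assume z: "z \<in> supp (ph x)" and p: "p \<in> supp (dl z)"
  have "z \<in> J" "deg z = n" using z x by (auto simp: deg_A)
  then show "p \<in> ?S" using keys_dl_J[of z] keys_dl_deg[of z "fst p" "snd p"] p by auto
 qed
 finally have k: "supp (frag_extend dl (ph x)) \<subseteq> ?S" .
 show "comult A x \<in> generate T ?P" unfolding comult_A[OF xc]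
 proof (rule T.ps_in_subgroup[OF sg _ _ k])
  show "?S \<subseteq> J \<times> J" by blast
  fix p assume p: "p \<in> ?S"
  have b: "bas (fst p) \<in> deg_part A (deg (fst p))" "bas (snd p) \<in> deg_part A (deg (snd p))"
   using p by (auto simp: deg_A bas_in ph_bas keys_frag_of)
  have "T.ps (frag_of p) = pure_tensor G G (bas (fst p)) (bas (snd p))"
   by (rule T.ph_inj) (use p in "auto simp: T.ps_in T.ph_ps keys_frag_of pure_in bas_in ta_pure ph_bas")
  then show "T.ps (frag_of p) \<in> generate T ?P" using b p by (auto intro!: generate.incl)
 qed
next
 fix n :: nat and x assume n: "0 < n" and x: "x \<in> deg_part A n"
 then have "e \<notin> supp (ph x)" using e_deg by (auto simp: deg_A)
 then show "counit A x = 0" using x by (simp add: deg_A counit_A in_keys_iff)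
qed

text \<open>By \<open>connected\<close>, degree 0 is spanned by the unit, so taking multiples of the
  unit and applying the counit are inverse to each other.\<close>

lemma connected_A: "connected_hopf A"
proof -
 let ?A0 = "G\<lparr>carrier := deg_part A 0\<rparr>"
 have "{j\<in>J. deg j = 0} = {e}" using connected e_in e_deg by blast
 then have A0: "deg_part A 0 = {a \<in> carrier G. supp (ph a) \<subseteq> {e}}" by (simp add: deg_A)
 have sc: "[n] \<cdot>\<^bsub>A\<^esub> \<one>\<^bsub>A\<^esub> \<in> deg_part A 0" "counit A ([n] \<cdot>\<^bsub>A\<^esub> \<one>\<^bsub>A\<^esub>) = n" for n :: int
  by (auto simp: A0 scalar one_closed_A ph_one_A keys_frag_of counit_A)
 have unsc: "[counit A a] \<cdot>\<^bsub>A\<^esub> \<one>\<^bsub>A\<^esub> = a" if aA: "a \<in> deg_part A 0" for a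
 proof (rule eq_lookupI)
  show a: "a \<in> carrier G" using aA by (simp add: A0)
  show "[counit A a] \<cdot>\<^bsub>A\<^esub> \<one>\<^bsub>A\<^esub> \<in> carrier G" by (rule scalar[OF one_closed_A])
  fix j show "coef (ph ([counit A a] \<cdot>\<^bsub>A\<^esub> \<one>\<^bsub>A\<^esub>)) j = coef (ph a) j"
   using aA by (cases "j = e") (auto simp: A0 scalar one_closed_A ph_one_A counit_A in_keys_iff)
 qed
 have b: "bij_betw (\<lambda>n::int. [n] \<cdot>\<^bsub>A\<^esub> \<one>\<^bsub>A\<^esub>) UNIV (deg_part A 0)"
  by (rule bij_betw_byWitness[where f' = "counit A"]) (auto simp: sc unsc)
 have b': "bij_betw (counit A) (deg_part A 0) UNIV"
  by (rule bij_betw_byWitness[where f' = "\<lambda>n::int. [n] \<cdot>\<^bsub>A\<^esub> \<one>\<^bsub>A\<^esub>"]) (auto simp: sc unsc)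
 have h: "(\<lambda>n::int. [n] \<cdot>\<^bsub>A\<^esub> \<one>\<^bsub>A\<^esub>) \<in> hom integer_group ?A0"
 proof (rule homI)
  fix n m :: int
  show "[(n \<otimes>\<^bsub>integer_group\<^esub> m)] \<cdot>\<^bsub>A\<^esub> \<one>\<^bsub>A\<^esub> = [n] \<cdot>\<^bsub>A\<^esub> \<one>\<^bsub>A\<^esub> \<otimes>\<^bsub>?A0\<^esub> [m] \<cdot>\<^bsub>A\<^esub> \<one>\<^bsub>A\<^esub>"
   by (rule ph_inj) (auto simp: scalar one_closed_A ph_mult frag_cmul_distrib integer_group_def)
 qed (simp add: sc)
 have h': "counit A \<in> hom ?A0 integer_group" by (rule homI) (auto simp: A0 counit_A ph_mult lookup_add integer_group_def)
 show ?thesis unfolding connected_hopf_def Let_def add_A iso_def using b b' h h' by simp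
qed

lemma nonneg: "nonneg_combs G (basis A) = {a \<in> carrier G. \<forall>j. 0 \<le> coef (ph a) j}"
 unfolding basis_A nonneg_combs_def by (rule nonneg_combs_bas)

text \<open>Puts the positivity axiom for the comultiplication into the scope of
  \<open>nonneg_combs_bas\<close> on the tensor square.\<close>

lemma pure_basis: "{pure_tensor G G u v | u v. u \<in> basis A \<and> v \<in> basis A} = T.bas ` (J \<times> J)"
proof -
 have "pure_tensor G G (bas i) (bas j) = T.bas (i, j)" if "i \<in> J" "j \<in> J" for i j
  by (rule T.ph_inj) (use that in "auto simp: T.bas_in T.ph_bas pure_in bas_in ta_pure ph_bas")
 then show ?thesis unfolding basis_A by (auto simp: image_iff) metis+
qed

lemma lookup_ext_nonneg:
 assumes "\<And>i. 0 \<le> coef x i" "\<And>i. i \<in> supp x ==> 0 \<le> coef (f i) j"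
 shows "0 \<le> coef (frag_extend f x) j" unfolding lookup_frag_extend[OF finite_keys order_refl] using assms by (intro sum_nonneg) auto

text \<open>By \<open>ip_tens\<close> the lifted functional is the pairing with the tensor of
  \<open>x\<close> and \<open>y\<close>, and \<open>mult_adjoint\<close> moves the comultiplication
  to the other side.\<close>

lemma adjoint:
 assumes "x \<in> carrier G" "y \<in> carrier G" "z \<in> carrier G"
 shows "inner_prod A (x \<otimes>\<^bsub>A\<^esub> y) z = tensor_lift G G integer_group (\<lambda>a b. inner_prod A x a * inner_prod A y b) (comult A z)"
proof -
 note F = free_coords_axioms
 let ?F = "\<lambda>p. frag_cmul (coef (tens (ph x) (ph y)) p) (frag_of ())"
 have "frag_cmul (tensor_lift G G integer_group (\<lambda>a b. inner_prod A x a * inner_prod A y b) (comult A z)) (frag_of ()) =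
   frag_extend ?F (ta (comult A z))" by (rule tensor_lift_coords[OF F F free_coords_integer])
   (use assms in "auto simp: integer_group_def frag_extend_ip ip_tens ip_A ip_commute comult_closed")
 also have "\<dots> = frag_cmul (ip (frag_extend dl (ph z)) (tens (ph x) (ph y))) (frag_of ())" by (simp add: ta_comult assms frag_extend_ip)
 finally have "tensor_lift G G integer_group (\<lambda>a b. inner_prod A x a * inner_prod A y b) (comult A z) = ip (frag_extend dl (ph z)) (tens (ph x) (ph y))"
  by (metis (mono_tags, lifting) lookup_frag_cmul lookup_frag_of mult.right_neutral)
 also have "\<dots> = ip (mult (ph x) (ph y)) (ph z)"
  unfolding mult_def using mult_adjoint[OF keys_tens_sub[OF ph_keys[OF assms(1)] ph_keys[OF assms(2)]] ph_keys[OF assms(3)]] by (simp add: ip_commute)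
 finally show ?thesis using assms by (simp add: ip_A mult_closed ph_mult_A)
qed

theorem PSH: "PSH_algebra A" unfolding PSH_algebra_def Let_def add_A A_simps
proof (intro conjI ballI impI allI)
 show "hopf_algebra A" "graded_hopf A" "connected_hopf A" by (rule hopf graded connected_A)+
 show "is_Z_basis G (basis A)" unfolding is_Z_basis_def basis_A by (intro conjI ballI ex1_int_comb) (use bas_in in blast)
 show "basis A \<subseteq> (\<Union>n. deg_part A n)" by (auto simp: basis_A deg_A bas_in ph_bas keys_frag_of)
 fix n
 have "basis A \<inter> deg_part A n \<subseteq> bas ` {j\<in>J. deg j = n}" by (auto simp: basis_A deg_A ph_bas keys_frag_of)
 then show "finite (basis A \<inter> deg_part A n)" by (rule finite_subset) (simp add: fin_eq)
next
 fix x y assume "x \<in> carrier G" "y \<in> carrier G"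
 then show "inner_prod A x y = inner_prod A y x" by (simp add: ip_A ip_commute)
next
 fix x y z assume "x \<in> carrier G" "y \<in> carrier G" "z \<in> carrier G"
 then show "inner_prod A (x \<otimes>\<^bsub>G\<^esub> y) z = inner_prod A x z + inner_prod A y z" by (simp add: ip_A ph_mult ip_add)
next
 fix x assume "x \<in> carrier G" "x \<noteq> \<one>\<^bsub>G\<^esub>"
 then show "0 < inner_prod A x x" using ph_inj[of x "\<one>\<^bsub>G\<^esub>"] by (auto simp: ip_A ph_one intro!: ip_pos)
next
 fix u v assume "u \<in> basis A" "v \<in> basis A" "u \<noteq> v"
 then show "inner_prod A u v = 0" by (auto simp: basis_A ip_A bas_in ph_bas ip_of)
next
 fix x y z assume "x \<in> carrier G" "y \<in> carrier G" "z \<in> carrier G"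
 then show "inner_prod A (x \<otimes>\<^bsub>A\<^esub> y) z = tensor_lift G G integer_group (\<lambda>a b. inner_prod A x a * inner_prod A y b) (comult A z)"
  by (rule adjoint)
next
 fix x y assume "x \<in> nonneg_combs G (basis A)" "y \<in> nonneg_combs G (basis A)"
 then have xy: "x \<in> carrier G" "y \<in> carrier G" "\<And>j. 0 \<le> coef (ph x) j" "\<And>j. 0 \<le> coef (ph y) j" by (simp_all add: nonneg)
 have "0 \<le> coef (mult (ph x) (ph y)) j" for j unfolding mult_def
 proof (rule lookup_ext_nonneg)
  show "0 \<le> coef (tens (ph x) (ph y)) p" for p using xy by (cases p) (simp add: lookup_tens)
  fix p assume "p \<in> supp (tens (ph x) (ph y))"
  then have "p \<in> J \<times> J" using keys_tens_sub[OF ph_keys[OF xy(1)] ph_keys[OF xy(2)]] by blast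
  then show "0 \<le> coef (mu p) j" by (cases p) (simp add: lookup_mu)
 qed
 then show "x \<otimes>\<^bsub>A\<^esub> y \<in> nonneg_combs G (basis A)" using xy by (simp add: nonneg mult_closed ph_mult_A)
next
 fix x assume "x \<in> nonneg_combs G (basis A)"
 then have x: "x \<in> carrier G" "\<And>j. 0 \<le> coef (ph x) j" by (simp_all add: nonneg)
 have "0 \<le> coef (frag_extend dl (ph x)) p" for p
 proof (rule lookup_ext_nonneg[OF x(2)])
  fix z assume "z \<in> supp (ph x)"
  then have "z \<in> J" using ph_keys[OF x(1)] by blast
  then show "0 \<le> coef (dl z) p" by (cases p) (simp add: lookup_dl)
 qed
 then show "comult A x \<in> nonneg_combs T {pure_tensor G G u v | u v. u \<in> basis A \<and> v \<in> basis A}"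
  unfolding pure_basis nonneg_combs_def T.nonneg_combs_bas using x by (simp add: comult_closed ta_comult)
qed

end

declare One_nat_def [simp del]

lemma ex_psh_coords:
 fixes G :: "'a monoid"
 assumes "psh_data J deg c e" "free_coords G J ph"
 shows "\<exists>A. psh_coords J deg c e G ph A"
proof -
 interpret psh_data J deg c e by fact
 interpret free_coords G J ph by fact
 define A :: "'a psh" where "A = \<lparr>carrier = carrier G, monoid.mult = (\<lambda>a b. ps (mult (ph a) (ph b))), one = ps (frag_of e),
  zero = \<one>\<^bsub>G\<^esub>, add = monoid.mult G,
  comult = (\<lambda>a. free_coords.ps (tensor G G) (tco ph ph) (frag_extend dl (ph a))), counit = (\<lambda>a. coef (ph a) e),
  deg_part = (\<lambda>n. {a \<in> carrier G. supp (ph a) \<subseteq> {j\<in>J. deg j = n}}),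
  inner_prod = (\<lambda>a b. ip (ph a) (ph b)), basis = bas ` J\<rparr>"
 have "additive_group A = G" by (rule monoid.equality) (simp_all add: additive_group_def A_def)
 then have "psh_coords J deg c e G ph A" by unfold_locales (simp_all add: A_def)
 then show ?thesis ..
qed

section \<open>The Grothendieck group in coordinates\<close>

text \<open>The class of \<open>x\<close> in coordinates: its multiplicities as an element of the
  free group on the simple objects.\<close>

definition kd :: "('o, 'm, 'k::field_char_0) gcat => (nat => 'o) => nat \<times> nat \<Rightarrow>\<^sub>0 int" where
 "kd C x = (\<Sum>j\<in>{j. gd C x j \<noteq> 0}. frag_cmul (int (gd C x j)) (frag_of j))"

context
 fixes C :: "('o, 'm, 'k::field_char_0) gcat" assumes C: "graded_2vect C"
begin

interpretation matcat "tot C" "gJ C" "gd C" "gr C" by (rule matcat_gpres[OF C])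

lemma lookup_kd:
 assumes "x \<in> Obj (tot C)" shows "coef (kd C x) j = int (gd C x j)" unfolding kd_def lookup_sum_frag_of[OF dim_finite[OF assms]] by simp

lemma keys_kd: "x \<in> Obj (tot C) ==> supp (kd C x) = {j. gd C x j \<noteq> 0}" by (auto simp: in_keys_iff lookup_kd)

lemma keys_kd_sub: "x \<in> Obj (tot C) ==> supp (kd C x) \<subseteq> gJ C" using keys_kd dim_support by blast

lemma kd_gs: "j \<in> gJ C ==> kd C (gs C j) = frag_of j" by (rule poly_mapping_eqI) (simp add: lookup_kd gs_Obj[OF C] gd_gs[OF C] kdelta_def)

abbreviation "KR \<equiv> {frag_of (Tgt (tot C) f) - (frag_of (Src (tot C) f) + frag_of (Tgt (tot C) g)) | f g. short_exact (tot C) f g}"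

lemma KR_carrier: "KR \<subseteq> carrier (free_Abelian_group (Obj (tot C)))"
proof
 fix r assume "r \<in> KR"
 then obtain f g where r: "r = frag_of (Tgt (tot C) f) - (frag_of (Src (tot C) f) + frag_of (Tgt (tot C) g))" and "short_exact (tot C) f g"
  by (elim CollectE exE conjE)
 then have "f \<in> Arr (tot C)" "g \<in> Arr (tot C)" by (simp_all add: short_exact_def is_kernel_def)
 then have "{Tgt (tot C) f, Src (tot C) f, Tgt (tot C) g} \<subseteq> Obj (tot C)" using Arr_ends by blast
 moreover have "supp (frag_of u - (frag_of v + frag_of w)) \<subseteq> {u, v, w}" for u v w :: "nat => 'o"
  by (rule order_trans[OF keys_diff]) (use keys_add[of "frag_of v" "frag_of w"] in "auto simp: keys_frag_of")
 ultimately show "r \<in> carrier (free_Abelian_group (Obj (tot C)))" unfolding r carrier_free_Abelian_group_iff by (rule order_trans[rotated])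
qed

lemma K_subgroup: "subgroup (K_subgroup C) (free_Abelian_group (Obj (tot C)))"
 unfolding K_subgroup_def by (rule group.generate_is_subgroup[OF group_free_Abelian_group KR_carrier])

lemma kd_rel:
 assumes "r \<in> KR" shows "frag_extend (kd C) r = 0"
proof -
 obtain f g where r: "r = frag_of (Tgt (tot C) f) - (frag_of (Src (tot C) f) + frag_of (Tgt (tot C) g))" and se: "short_exact (tot C) f g"
  using assms by (elim CollectE exE conjE)
 obtain r' s where sp: "split_seq (tot C) (Src (tot C) f) (Src (tot C) g) (Tgt (tot C) g) f g r' s" using short_exact_split[OF se] by blast
 then have h: "f \<in> Homs (tot C) (Src (tot C) f) (Src (tot C) g)" "g \<in> Homs (tot C) (Src (tot C) g) (Tgt (tot C) g)" by (simp_all add: split_seq_def)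
 have t: "Tgt (tot C) f = Src (tot C) g" using h(1) by (simp add: Homs_def)
 have "kd C (Src (tot C) g) = kd C (Src (tot C) f) + kd C (Tgt (tot C) g)"
  by (rule poly_mapping_eqI) (use hom_ends[OF h(1)] hom_ends[OF h(2)] in "simp add: lookup_kd lookup_add split_seq_dims[OF sp]")
 then show ?thesis unfolding r t by (simp add: frag_extend_diff frag_extend_add)
qed

lemma K_split:
 assumes "x \<in> Obj (tot C)" "y \<in> Obj (tot C)" "z \<in> Obj (tot C)" "\<And>j. gd C y j = gd C x j + gd C z j"
 shows "frag_of y - (frag_of x + frag_of z) \<in> K_subgroup C"
proof -
 obtain f g r s where sp: "split_seq (tot C) x y z f g r s" using ex_split_seq[OF assms] by blast
 then have "Src (tot C) f = x" "Tgt (tot C) f = y" "Tgt (tot C) g = z" by (simp_all add: split_seq_def Homs_def)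
 then have "frag_of y - (frag_of x + frag_of z) \<in> KR" using split_seq_short_exact[OF sp] by blast
 then show ?thesis unfolding K_subgroup_def by (rule generate.incl)
qed

text \<open>Induction on the total dimension: \<open>K_split\<close> separates one simple object
  from \<open>x\<close> at a time.\<close>

lemma K_red: "x \<in> Obj (tot C) ==> frag_of x - frag_extend (\<lambda>j. frag_of (gs C j)) (kd C x) \<in> K_subgroup C"
proof (induction "\<Sum>j | gd C x j \<noteq> 0. gd C x j" arbitrary: x rule: less_induct)
 case less
 note x = less.prems
 note sf = subgroup_frag[OF K_subgroup]
 show ?case
 proof (cases "\<forall>j. gd C x j = 0")
  case True
  \<comment> \<open>A zero object is an extension of itself by itself, so its class
    vanishes.\<close>
  have "frag_of x - (frag_of x + frag_of x) \<in> K_subgroup C" by (rule K_split) (use x True in auto)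
  from sf(3)[OF this] have "frag_of x \<in> K_subgroup C" by simp
  moreover have "kd C x = 0" by (rule poly_mapping_eqI) (simp add: lookup_kd[OF x] True[rule_format])
  ultimately show ?thesis by simp
 next
  case False
  then obtain j where j: "gd C x j \<noteq> 0" by blast
  then have jJ: "j \<in> gJ C" by (rule dim_support[OF x])
  define n where "n = (\<lambda>i. gd C x i - kdelta j i)"
  have sub: "{i. n i \<noteq> 0} \<subseteq> {i. gd C x i \<noteq> 0}" by (auto simp: n_def)
  have fin: "finite {i. n i \<noteq> 0}" "{i. n i \<noteq> 0} \<subseteq> gJ C"
   using finite_subset[OF sub dim_finite[OF x]] sub dim_support[OF x] by blast+
  define y where "y = ob n"
  have y: "y \<in> Obj (tot C)" "gd C y = n" unfolding y_def by (rule ob_Obj[OF fin], rule dim_ob[OF fin])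
  have sum: "gd C x i = gd C (gs C j) i + gd C y i" for i using j by (simp add: y(2) gd_gs[OF C jJ] n_def kdelta_def)
  have "(\<Sum>i | gd C y i \<noteq> 0. gd C y i) = (\<Sum>i | gd C x i \<noteq> 0. n i)"
   unfolding y(2) using dim_finite[OF x] by (intro sum.mono_neutral_left) (auto simp: n_def)
  also have "\<dots> < (\<Sum>i | gd C x i \<noteq> 0. gd C x i)"
  proof (rule sum_strict_mono_ex1[OF dim_finite[OF x]])
   show "\<forall>i\<in>{i. gd C x i \<noteq> 0}. n i \<le> gd C x i" by (simp add: n_def)
   show "\<exists>i\<in>{i. gd C x i \<noteq> 0}. n i < gd C x i" by (rule bexI[of _ j]) (use j in "simp_all add: n_def kdelta_def")
  qed
  finally have IH: "frag_of y - frag_extend (\<lambda>j. frag_of (gs C j)) (kd C y) \<in> K_subgroup C" by (rule less.hyps[OF _ y(1)])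
  have "kd C x = frag_of j + kd C y" by (rule poly_mapping_eqI) (simp add: lookup_kd x y(1) lookup_add sum gd_gs[OF C jJ] kdelta_def)
  then have "frag_of x - frag_extend (\<lambda>j. frag_of (gs C j)) (kd C x) =
    (frag_of x - (frag_of (gs C j) + frag_of y)) + (frag_of y - frag_extend (\<lambda>j. frag_of (gs C j)) (kd C y))" by (simp add: frag_extend_add)
  note eq = this
  show ?thesis unfolding eq by (rule sf(2)[OF K_split[OF gs_Obj[OF C jJ] x y(1) sum] IH])
 qed
qed

text \<open>This is \<open>quotient_coords\<close> with \<open>p\<close> the dimension vector and
  \<open>q\<close> the simple objects.\<close>

lemma K_coords: "free_coords (K_group C) (gJ C) (qco (kd C))"
 and qco_K_class: "x \<in> Obj (tot C) ==> qco (kd C) (K_class C x) = kd C x"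
 and K_class_in: "x \<in> Obj (tot C) ==> K_class C x \<in> carrier (K_group C)"
proof -
 have q: "supp (frag_of (gs C j)) \<subseteq> Obj (tot C)" if "j \<in> gJ C" for j using gs_Obj[OF C that] by (simp add: keys_frag_of)
 have pq: "frag_extend (kd C) (frag_of (gs C j)) = frag_of j" if "j \<in> gJ C" for j using kd_gs[OF that] by simp
 note Q = KR_carrier K_subgroup_def keys_kd_sub q kd_rel pq K_red
 show "free_coords (K_group C) (gJ C) (qco (kd C))" unfolding K_group_def by (rule quotient_coords[OF Q])
 show "x \<in> Obj (tot C) ==> qco (kd C) (K_class C x) = kd C x"
  unfolding K_class_def using qco_coset[OF Q, of "frag_of x"] by (simp add: keys_frag_of)
 show "x \<in> Obj (tot C) ==> K_class C x \<in> carrier (K_group C)"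
  unfolding K_class_def K_group_def FactGroup_def RCOSETS_def by (auto simp: keys_frag_of)
qed

lemma K_class_simple:
 assumes "j \<in> gJ C" shows "K_class C (gs C j) = free_coords.bas (K_group C) (qco (kd C)) j"
proof -
 interpret K: free_coords "K_group C" "gJ C" "qco (kd C)" by (rule K_coords)
 show ?thesis by (rule K.ph_inj)
   (use assms gs_Obj[OF C assms] in "simp_all add: K.bas_in K.ph_bas K_class_in qco_K_class kd_gs")
qed

lemma K_basis: "{K_class C x | x. is_simple (tot C) x} = free_coords.bas (K_group C) (qco (kd C)) ` gJ C"
proof -
 interpret K: free_coords "K_group C" "gJ C" "qco (kd C)" by (rule K_coords)
 have "K_class C x = K.bas j" if "x \<in> Obj (tot C)" "gd C x = kdelta j" "j \<in> gJ C" for x j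
 proof -
  have "kd C x = frag_of j" by (rule poly_mapping_eqI) (simp add: lookup_kd that kdelta_def)
  then show ?thesis by (intro K.ph_inj) (use that in "simp_all add: K.bas_in K.ph_bas K_class_in qco_K_class")
 qed
 note 1 = this
 show ?thesis
 proof (intro equalityI subsetI)
  fix k assume "k \<in> {K_class C x | x. is_simple (tot C) x}"
  then obtain x where "k = K_class C x" "is_simple (tot C) x" by blast
  then show "k \<in> K.bas ` gJ C" using 1 unfolding is_simple_iff by blast
 next
  fix k assume "k \<in> K.bas ` gJ C"
  then obtain j where j: "k = K.bas j" "j \<in> gJ C" by (rule imageE)
  have "is_simple (tot C) (gs C j)" unfolding is_simple_iff using gs_Obj[OF C j(2)] gd_gs[OF C j(2)] j(2) by blast
  then show "k \<in> {K_class C x | x. is_simple (tot C) x}" using K_class_simple[OF j(2)] j(1) by (intro CollectI exI[of _ "gs C j"]) simp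
 qed
qed

text \<open>The right-hand side is a subgroup that contains the generators; conversely, its elements
  are integer combinations of classes of simple objects of degree \<open>n\<close>.\<close>

lemma K_deg_part:
 "generate (K_group C) {K_class C x | x. x \<in> Obj (tot C) \<and> gsupp C x \<subseteq> {n}} =
  {a \<in> carrier (K_group C). supp (qco (kd C) a) \<subseteq> {j\<in>gJ C. fst j = n}}" (is "generate _ ?X = ?D")
proof -
 interpret K: free_coords "K_group C" "gJ C" "qco (kd C)" by (rule K_coords)
 interpret G: comm_group "K_group C" by (rule K.comm)
 have D: "subgroup ?D (K_group C)"
 proof (rule G.subgroupI)
  show "?D \<noteq> {}" using K.ph_one by (auto intro!: exI[of _ "\<one>\<^bsub>K_group C\<^esub>"])
  fix a b assume "a \<in> ?D" "b \<in> ?D"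
  then show "a \<otimes>\<^bsub>K_group C\<^esub> b \<in> ?D" using keys_add[of "qco (kd C) a" "qco (kd C) b"] by (auto simp: K.ph_mult)
 qed (auto simp: K.ph_inv)
 have XD: "?X \<subseteq> ?D"
 proof
  fix a assume "a \<in> ?X"
  then obtain x where x: "a = K_class C x" "x \<in> Obj (tot C)" "gsupp C x \<subseteq> {n}" by blast
  have "j \<in> gJ C \<and> fst j = n" if "gd C x j \<noteq> 0" for j using dim_support[OF x(2) that] gsupp_gd[OF C x(2)] x(3) that by blast
  then show "a \<in> ?D" using x(1,2) by (auto simp: K_class_in qco_K_class keys_kd)
 qed
 have X: "?X \<subseteq> carrier (K_group C)" using XD by blast
 show ?thesis
 proof (rule equalityI)
  show "generate (K_group C) ?X \<subseteq> ?D" by (rule G.generate_subgroup_incl[OF XD D])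
  show "?D \<subseteq> generate (K_group C) ?X"
  proof
   fix a assume a: "a \<in> ?D"
   have "K.ps (qco (kd C) a) \<in> generate (K_group C) ?X"
   proof (rule K.ps_in_subgroup[OF G.generate_is_subgroup[OF X], of "{j\<in>gJ C. fst j = n}"])
    fix j assume j: "j \<in> {j\<in>gJ C. fst j = n}"
    then have jJ: "j \<in> gJ C" by simp
    have "gsupp C (gs C j) \<subseteq> {n}" using j unfolding gsupp_gd[OF C gs_Obj[OF C jJ]] gd_gs[OF C jJ] by (auto simp: kdelta_def split: if_splits)
    then have "K_class C (gs C j) \<in> ?X" using gs_Obj[OF C jJ] by blast
    then show "K.ps (frag_of j) \<in> generate (K_group C) ?X" unfolding K.bas_def[symmetric] K_class_simple[OF jJ, symmetric] by (rule generate.incl)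
   qed (use a in auto)
   then show "a \<in> generate (K_group C) ?X" using a K.ps_ph by simp
  qed
 qed
qed

lemma ip_kd:
 assumes "x \<in> Obj (tot C)" "y \<in> Obj (tot C)"
 shows "ip (kd C x) (kd C y) = int (hom_dim (tot C) x y)" unfolding hom_dim_eq[OF assms] ip_def keys_kd[OF assms(1)] by (simp add: lookup_kd assms)

end

lemma coords_iso:
 fixes G :: "'a monoid" and K :: "'b monoid"
 assumes G: "free_coords G J ph" and K: "free_coords K L ka" and f: "bij_betw f J L"
 shows "(\<lambda>a. free_coords.ps K ka (frag_extend (\<lambda>j. frag_of (f j)) (ph a))) \<in> iso G K"
  and "a \<in> carrier G ==> ka (free_coords.ps K ka (frag_extend (\<lambda>j. frag_of (f j)) (ph a))) = frag_extend (\<lambda>j. frag_of (f j)) (ph a)"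
proof -
 interpret G: free_coords G J ph by (rule G)
 interpret K: free_coords K L ka by (rule K)
 let ?h = "\<lambda>a. K.ps (frag_extend (\<lambda>j. frag_of (f j)) (ph a))"
 define g where "g = inv_into J f"
 have fL: "f j \<in> L" "g (f j) = j" if "j \<in> J" for j using that f by (auto simp: g_def bij_betw_def inv_into_f_f)
 have gJ: "g l \<in> J" "f (g l) = l" if "l \<in> L" for l using that f by (auto simp: g_def bij_betw_def inv_into_into f_inv_into_f)
 have kf: "supp (frag_of (f j)) \<subseteq> L" if "j \<in> J" for j using fL that by (simp add: keys_frag_of)
 have h: "?h \<in> hom G K" "\<And>a. a \<in> carrier G ==> ka (?h a) = frag_extend (\<lambda>j. frag_of (f j)) (ph a)"
  by (rule G.coords_hom[OF K kf, where h = ?h]; simp)+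
 then show "a \<in> carrier G ==> ka (?h a) = frag_extend (\<lambda>j. frag_of (f j)) (ph a)" by blast
 have gf: "frag_extend (\<lambda>l. frag_of (g l)) (frag_extend (\<lambda>j. frag_of (f j)) x) = x" if "supp x \<subseteq> J" for x
  using that by (induction rule: frag_closed_induct) (simp_all add: frag_extend_diff fL)
 have fg: "frag_extend (\<lambda>j. frag_of (f j)) (frag_extend (\<lambda>l. frag_of (g l)) x) = x" if "supp x \<subseteq> L" for x
  using that by (induction rule: frag_closed_induct) (simp_all add: frag_extend_diff gJ)
 have kg: "supp (frag_extend (\<lambda>l. frag_of (g l)) x) \<subseteq> J" if "supp x \<subseteq> L" for x
  by (rule order_trans[OF keys_frag_extend], rule UN_least) (use that gJ in "auto simp: keys_frag_of")
 have "bij_betw ?h (carrier G) (carrier K)"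
 proof (rule bij_betw_byWitness[where f' = "\<lambda>b. G.ps (frag_extend (\<lambda>l. frag_of (g l)) (ka b))"])
  show "\<forall>a\<in>carrier G. G.ps (frag_extend (\<lambda>l. frag_of (g l)) (ka (?h a))) = a" by (simp add: h(2) gf G.ph_keys G.ps_ph)
  show "\<forall>b\<in>carrier K. ?h (G.ps (frag_extend (\<lambda>l. frag_of (g l)) (ka b))) = b" by (simp add: G.ph_ps kg K.ph_keys fg K.ps_ph)
  show "?h ` carrier G \<subseteq> carrier K" using hom_in_carrier[OF h(1)] by blast
  show "(\<lambda>b. G.ps (frag_extend (\<lambda>l. frag_of (g l)) (ka b))) ` carrier K \<subseteq> carrier G" by (auto simp: G.ps_in kg K.ph_keys)
 qed
 then show "?h \<in> iso G K" using h(1) by (simp add: iso_def)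
qed

section \<open>The Hopf algebra of an SSH category\<close>

lemma is_functor_Obj: "is_functor C D F ==> a \<in> Obj C ==> fob F a \<in> Obj D" by (simp add: is_functor_def)

section \<open>Comparison of the structure constants with the Grothendieck group\<close>

context ssh
begin

text \<open>Since \<open>y\<close> is the only tuple of simple objects whose image contains
  \<open>s\<close>, the expansion \<open>N_expand\<close> has a single term.\<close>

lemma gd_separated:
 assumes f: "f \<in> fs_hom S T ph" and j: "j \<in> fs_idx T" and x: "x \<in> Obj (prod_cat (fib ph j) (\<lambda>i. tot (fam S i)))"
  and N: "\<And>t. t \<in> (\<Pi>\<^sub>E i\<in>fib ph j. gJ (fam S i)) ==> N f j s t = (if t = y then 1 else 0)"
  and y: "y \<in> extensional (fib ph j)"
 shows "gd (fam T j) (fob (arH H f j) x) s = (\<Prod>i\<in>fib ph j. gd (fam S i) (x i) (y i))"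
proof -
 let ?P = "\<lambda>i. {k. gd (fam S i) (x i) k \<noteq> 0}"
 have P: "finite (?P i)" "?P i \<subseteq> gJ (fam S i)" if i: "i \<in> fib ph j" for i
 proof -
  interpret matcat "tot (fam S i)" "gJ (fam S i)" "gd (fam S i)" "gr (fam S i)" by (rule matcat_gpres[OF fib_g2[OF f i]])
  have "x i \<in> Obj (tot (fam S i))" using x i by (auto simp: prod_cat_simps PiE_iff)
  then show "finite (?P i)" "?P i \<subseteq> gJ (fam S i)" using dim_finite dim_support by blast+
 qed
 have "gd (fam T j) (fob (arH H f j) x) s = (\<Sum>t\<in>(\<Pi>\<^sub>E i\<in>fib ph j. ?P i). (\<Prod>i\<in>fib ph j. gd (fam S i) (x i) (t i)) * N f j s t)"
  by (rule N_expand[OF f j x]) (use P in blast)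
 also have "\<dots> = (\<Sum>t\<in>(\<Pi>\<^sub>E i\<in>fib ph j. ?P i). (\<Prod>i\<in>fib ph j. gd (fam S i) (x i) (t i)) * (if t = y then 1 else 0))"
 proof (rule sum.cong[OF refl])
  fix t assume "t \<in> (\<Pi>\<^sub>E i\<in>fib ph j. ?P i)"
  then have "t \<in> (\<Pi>\<^sub>E i\<in>fib ph j. gJ (fam S i))" by (rule subsetD[OF PiE_mono[OF P(2)], rotated])
  from N[OF this] show "(\<Prod>i\<in>fib ph j. gd (fam S i) (x i) (t i)) * N f j s t = (\<Prod>i\<in>fib ph j. gd (fam S i) (x i) (t i)) * (if t = y then 1 else 0)"
   by simp
 qed
 also have "\<dots> = (\<Prod>i\<in>fib ph j. gd (fam S i) (x i) (y i))"
 proof (rule sum_PiE_delta[OF fib_finite[OF f] P(1)])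
  show "y \<in> (\<Pi>\<^sub>E i\<in>fib ph j. ?P i) \<or> (\<Prod>i\<in>fib ph j. gd (fam S i) (x i) (y i)) = 0"
  proof (cases "\<forall>i\<in>fib ph j. y i \<in> ?P i")
   case True
   then show ?thesis using y by (simp add: PiE_iff)
  next
   case False
   then obtain i where "i \<in> fib ph j" "gd (fam S i) (x i) (y i) = 0" by auto
   then have "(\<Prod>i\<in>fib ph j. gd (fam S i) (x i) (y i)) = 0" by (intro prod_zero[OF fib_finite[OF f]] bexI)
   then show ?thesis by (rule disjI2)
  qed
 qed
 finally show ?thesis .
qed

lemma gd_proj:
 assumes "finite U" "u \<in> U" "y \<in> J1" "x \<in> Obj (tot (fam (fs_disc U) u))"
 shows "gd (fam (fs_disc {1}) 1) (fob (arH H (proj U u) 1) (\<lambda>_\<in>{u}. x)) y = gd (fam (fs_disc U) u) x (sg U u y)"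
proof -
 have hom: "proj U u \<in> fs_hom (fs_disc U) (fs_disc {1}) (pbase {u} (\<lambda>_. 1))" using assms by (intro disc_map_hom) auto
 have fib: "fib (pbase {u} (\<lambda>_. 1)) 1 = {u}" by (auto simp: fib_pbase)
 have "gd (fam (fs_disc {1}) 1) (fob (arH H (proj U u) 1) (\<lambda>_\<in>{u}. x)) y =
   (\<Prod>i\<in>{u}. gd (fam (fs_disc U) i) ((\<lambda>_\<in>{u}. x) i) (tup U {u} (\<lambda>_. y) i))"
  by (rule gd_separated[OF hom, of 1, unfolded fib]) (use assms proj_separates[OF assms(1-3)] in "auto simp: prod_cat_simps extensional_def")
 then show ?thesis by simp
qed

lemma gd_box:
 assumes U: "finite U" and y: "y \<in> tuples U" and x: "x \<in> (\<Pi>\<^sub>E u\<in>U. Obj (tot (fam (fs_disc U) u)))"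
 shows "gd (fam (fs_one U) 1) (fob (arH H (box U) 1) x) (bx U y) = (\<Prod>u\<in>U. gd (fam (fs_disc U) u) (x u) (sg U u (y u)))"
proof -
 have fib: "fib (pbase U (\<lambda>_. 1)) 1 = U" by (auto simp: fib_pbase)
 have "gd (fam (fs_one U) 1) (fob (arH H (box U) 1) x) (bx U y) = (\<Prod>i\<in>U. gd (fam (fs_disc U) i) (x i) (tup U U y i))"
  by (rule gd_separated[OF box_hom[OF U], of 1, unfolded fib]) (use x box_separates[OF U y] in "auto simp: prod_cat_simps extensional_def")
 also have "\<dots> = (\<Prod>u\<in>U. gd (fam (fs_disc U) u) (x u) (sg U u (y u)))" by (rule prod.cong) auto
 finally show ?thesis .
qed

lemma gd_unary:
 assumes U: "finite U" and W: "finite W" and f: "f \<in> U \<rightarrow> W" and x: "x \<in> Obj (tot (H_set H U))"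
 shows "gd (H_set H W) (fob (unary (arH H (fs_one_map U W f))) x) s = (\<Sum>k | gd (H_set H U) x k \<noteq> 0. gd (H_set H U) x k * M U W f s k)"
  and "fob (unary (arH H (fs_one_map U W f))) x \<in> Obj (tot (H_set H W))"
proof -
 have g: "graded_2vect (H_set H U)" using one_g2[OF U] by (simp add: H_set_def)
 interpret matcat "tot (H_set H U)" "gJ (H_set H U)" "gd (H_set H U)" "gr (H_set H U)" by (rule matcat_gpres[OF g])
 let ?P = "{k. gd (H_set H U) x k \<noteq> 0}"
 have P: "finite ?P" "?P \<subseteq> gJ (H_set H U)" using dim_finite[OF x] dim_support[OF x] by blast+
 note hom = one_map_hom[OF U W f]
 have xO: "(\<lambda>_\<in>{1}. x) \<in> Obj (prod_cat {1} (\<lambda>i. tot (fam (fs_one U) i)))" using x by (auto simp: prod_cat_simps H_set_def)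
 have "gd (H_set H W) (fob (unary (arH H (fs_one_map U W f))) x) s = gd (fam (fs_one W) 1) (fob (arH H (fs_one_map U W f) 1) (\<lambda>_\<in>{1}. x)) s"
  by (simp add: unary_def H_set_def)
 also have "\<dots> = (\<Sum>t\<in>(\<Pi>\<^sub>E i\<in>{1}. ?P). (\<Prod>i\<in>{1}. gd (fam (fs_one U) i) ((\<lambda>_\<in>{1}. x) i) (t i)) * N (fs_one_map U W f) 1 s t)"
  by (rule N_expand[OF hom, of 1 "\<lambda>_\<in>{1}. x" "\<lambda>_. ?P", unfolded fib_one]) (use xO P in "auto simp: H_set_def")
 also have "\<dots> = (\<Sum>k\<in>?P. \<Sum>t\<in>(\<Pi>\<^sub>E i\<in>{}. ?P). (\<Prod>i\<in>{1}. gd (fam (fs_one U) i) ((\<lambda>_\<in>{1}. x) i) ((t(1 := k)) i)) * N (fs_one_map U W f) 1 s (t(1 := k)))"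
  by (rule sum_PiE_insert) simp
 also have "\<dots> = (\<Sum>k\<in>?P. gd (H_set H U) x k * M U W f s k)"
 proof (rule sum.cong[OF refl])
  fix k
  have "N (fs_one_map U W f) 1 s (t(1 := k)) = M U W f s k" for t :: "nat => nat \<times> nat" by (rule N_cong) (simp add: fib_one)
  then show "(\<Sum>t\<in>(\<Pi>\<^sub>E i\<in>{}. ?P). (\<Prod>i\<in>{1}. gd (fam (fs_one U) i) ((\<lambda>_\<in>{1}. x) i) ((t(1 := k)) i)) * N (fs_one_map U W f) 1 s (t(1 := k))) =
    gd (H_set H U) x k * M U W f s k" by (simp add: H_set_def)
 qed
 finally show "gd (H_set H W) (fob (unary (arH H (fs_one_map U W f))) x) s = (\<Sum>k | gd (H_set H U) x k \<noteq> 0. gd (H_set H U) x k * M U W f s k)" .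
 have "is_functor (prod_cat {1} (\<lambda>i. tot (fam (fs_one U) i))) (tot (fam (fs_one W) 1)) (arH H (fs_one_map U W f) 1)"
  using arr_me[OF hom, of 1, unfolded fib_one] by (simp add: multi_exact_def)
 then have "fob (arH H (fs_one_map U W f) 1) (\<lambda>_\<in>{1}. x) \<in> Obj (tot (fam (fs_one W) 1))" using xO by (rule is_functor_Obj)
 then show "fob (unary (arH H (fs_one_map U W f))) x \<in> Obj (tot (H_set H W))" by (simp add: unary_def H_set_def)
qed

lemma fob_proj_Obj:
 assumes "finite U" "u \<in> U" "x \<in> Obj (tot (fam (fs_disc U) u))"
 shows "fob (arH H (proj U u) 1) (\<lambda>_\<in>{u}. x) \<in> Obj (tot (fam (fs_disc {1}) 1))"
proof -
 have hom: "proj U u \<in> fs_hom (fs_disc U) (fs_disc {1}) (pbase {u} (\<lambda>_. 1))" using assms by (intro disc_map_hom) auto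
 have fib: "fib (pbase {u} (\<lambda>_. 1)) 1 = {u}" by (auto simp: fib_pbase)
 have "is_functor (prod_cat {u} (\<lambda>i. tot (fam (fs_disc U) i))) (tot (fam (fs_disc {1}) 1)) (arH H (proj U u) 1)"
  using arr_me[OF hom, of 1, unfolded fib] by (simp add: multi_exact_def)
 moreover have "(\<lambda>_\<in>{u}. x) \<in> Obj (prod_cat {u} (\<lambda>i. tot (fam (fs_disc U) i)))" using assms(3) by (auto simp: prod_cat_simps)
 ultimately show ?thesis by (rule is_functor_Obj)
qed

lemma fob_box_Obj:
 assumes U: "finite U" and x: "x \<in> (\<Pi>\<^sub>E u\<in>U. Obj (tot (fam (fs_disc U) u)))"
 shows "fob (arH H (box U) 1) x \<in> Obj (tot (fam (fs_one U) 1))"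
proof -
 have fib: "fib (pbase U (\<lambda>_. 1)) 1 = U" by (auto simp: fib_pbase)
 have "is_functor (prod_cat U (\<lambda>i. tot (fam (fs_disc U) i))) (tot (fam (fs_one U) 1)) (arH H (box U) 1)"
  using arr_me[OF box_hom[OF U], of 1, unfolded fib] by (simp add: multi_exact_def)
 then show ?thesis by (rule is_functor_Obj) (use x in "simp add: prod_cat_simps")
qed

lemma psh_data_c2: "psh_data J1 fst c2 e"
proof
 show "finite {j \<in> J1. fst j \<le> n}" for n by (rule finite_J1_deg)
 show "x \<in> J1 ==> y \<in> J1 ==> c2 x y z \<noteq> 0 ==> z \<in> J1" "x \<in> J1 ==> y \<in> J1 ==> c2 x y z \<noteq> 0 ==> fst z = fst x + fst y" for x y z
  by (rule c2_degree; assumption)+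
 show "e \<in> J1" "fst e = 0" by (rule e_in e_deg)+
 show "x \<in> J1 ==> c2 e x z = (if z = x then 1 else 0)" for x z by (simp add: c2_unit kdelta_def)
 show "x \<in> J1 ==> y \<in> J1 ==> c2 x y e = (if x = e \<and> y = e then 1 else 0)" for x y by (simp add: c2_counit kdelta_def)
qed (fact c2_comm c2_assoc c2_hopf)+

text \<open>The bijection of bases behind the comparison isomorphism in
  \<open>K_box\<close>.\<close>

lemma bij_bx_pr: "bij_betw (\<lambda>p. bx {1,2} (pr (fst p) (snd p))) (J1 \<times> J1) (JS {1,2})"
proof -
 have "bij_betw (\<lambda>p. pr (fst p) (snd p)) (J1 \<times> J1) (tuples {1,2})"
 proof (rule bij_betw_byWitness[where f' = "\<lambda>t :: nat => nat \<times> nat. (t 1, t 2)"])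
  show "\<forall>p\<in>J1 \<times> J1. (pr (fst p) (snd p) 1, pr (fst p) (snd p) 2) = p" by (simp add: pr_simps)
  show "\<forall>t\<in>tuples {1,2}. pr (fst (t 1, t 2)) (snd (t 1, t 2)) = t"
  proof
   fix t :: "nat => nat \<times> nat" assume t: "t \<in> tuples {1,2}"
   show "pr (fst (t 1, t 2)) (snd (t 1, t 2)) = t" using t by (intro ext) (auto simp: pr_def PiE_iff extensional_def)
  qed
  show "(\<lambda>p. pr (fst p) (snd p)) ` (J1 \<times> J1) \<subseteq> tuples {1,2}" by (rule image_subsetI, rule pr_in) auto
  show "(\<lambda>t. (t 1, t 2)) ` tuples {1,2} \<subseteq> J1 \<times> J1" by (rule image_subsetI) (simp add: PiE_iff)
 qed
 from bij_betw_trans[OF this bx_bij] show ?thesis by (simp add: comp_def)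
qed

text \<open>The algebra is built from the constants \<open>c2\<close>, and \<open>PSH\<close>
  supplies its axioms; it remains to see that its product is the one induced by the functors. All
  groups involved have coordinates, so this is a comparison of multiplicities.\<close>

theorem PSH_structure: "\<exists>A. PSH_algebra A \<and> PSH_structure_of H A"
proof -
 let ?C = "fam (fs_disc {1}) 1" and ?D = "fam (fs_one {1,2}) 1"
 let ?G = "K_group ?C" and ?ph = "qco (kd ?C)" and ?ch = "qco (kd ?D)"
 have HC: "H_set H {1} = ?C" and HD: "H_set H {1,2} = ?D" by (simp_all add: H_set_def fs_disc_1)
 have gC: "graded_2vect ?C" by (rule disc_g2) auto
 have gD: "graded_2vect ?D" by (rule one_g2) auto
 note GC = K_coords[OF gC] and DC = K_coords[OF gD]
 obtain A where A: "psh_coords J1 fst c2 e ?G ?ph A" using ex_psh_coords[OF psh_data_c2 GC] by blast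
 interpret psh_coords J1 fst c2 e ?G ?ph A by (rule A)
 interpret D: free_coords "K_group ?D" "JS {1,2}" ?ch by (rule DC)
 interpret TT: free_coords "tensor ?G ?G" "J1 \<times> J1" "tco ?ph ?ph" by (rule TC)
 let ?f = "\<lambda>p. bx {1,2} (pr (fst p) (snd p))"
 \<comment> \<open>The comparison isomorphism: pairs of simple objects are relabelled as simple
   objects of the tensor square, extended additively.\<close>
 define ka where "ka = (\<lambda>t. D.ps (frag_extend (\<lambda>p. frag_of (?f p)) (tco ?ph ?ph t)))"
 have ka: "ka \<in> iso (tensor ?G ?G) (K_group ?D)"
  "\<And>t. t \<in> carrier (tensor ?G ?G) ==> ?ch (ka t) = frag_extend (\<lambda>p. frag_of (?f p)) (tco ?ph ?ph t)"
  unfolding ka_def by (rule coords_iso[OF TC DC bij_bx_pr]; assumption?)+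
 have ka_in: "ka t \<in> carrier (K_group ?D)" if "t \<in> carrier (tensor ?G ?G)" for t using ka(1) that by (auto simp: iso_def hom_def)
 let ?m = "unary (arH H (fs_one_map {1,2} {1} (\<lambda>_. 1)))"
 have mO: "fob ?m x \<in> Obj (tot ?C)" and md: "gd ?C (fob ?m x) z = (\<Sum>k | gd ?D x k \<noteq> 0. gd ?D x k * M {1,2} {1} (\<lambda>_. 1) z k)"
  if "x \<in> Obj (tot ?D)" for x z using gd_unary[of "{1,2}" "{1}" "\<lambda>_. 1", unfolded HC HD, OF _ _ _ that] by simp_all
 have ms: "gd ?C (fob ?m (gs ?D s)) z = M {1,2} {1} (\<lambda>_. 1) z s" for s z using unary_M[of "{1}" "{1,2}" "\<lambda>_. 1" s z] unfolding HC HD .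
 \<comment> \<open>The homomorphism is prescribed on classes of simple objects;
   \<open>mm_class\<close> shows that it agrees with the functor on all objects.\<close>
 define mm where "mm = (\<lambda>a. ps (frag_extend (\<lambda>s. kd ?C (fob ?m (gs ?D s))) (?ch a)))"
 have mm: "mm \<in> hom (K_group ?D) ?G"
  "\<And>a. a \<in> carrier (K_group ?D) ==> ?ph (mm a) = frag_extend (\<lambda>s. kd ?C (fob ?m (gs ?D s))) (?ch a)"
  by (rule D.coords_hom[OF GC, of "\<lambda>s. kd ?C (fob ?m (gs ?D s))"];
   simp add: mm_def keys_kd_sub[OF gC mO[OF gs_Obj[OF gD]]])+
 have mm_class: "mm (K_class ?D x) = K_class ?C (fob ?m x)" if x: "x \<in> Obj (tot ?D)" for x
 proof (rule ph_inj)
  interpret mD: matcat "tot ?D" "gJ ?D" "gd ?D" "gr ?D" by (rule matcat_gpres[OF gD])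
  have xD: "K_class ?D x \<in> carrier (K_group ?D)" by (rule K_class_in[OF gD x])
  show "mm (K_class ?D x) \<in> carrier ?G" by (rule hom_in_carrier[OF mm(1) xD])
  show "K_class ?C (fob ?m x) \<in> carrier ?G" by (rule K_class_in[OF gC mO[OF x]])
  show "?ph (mm (K_class ?D x)) = ?ph (K_class ?C (fob ?m x))"
  proof (rule poly_mapping_eqI)
   fix z
   have "coef (?ph (mm (K_class ?D x))) z =
     (\<Sum>s | gd ?D x s \<noteq> 0. int (gd ?D x s) * coef (kd ?C (fob ?m (gs ?D s))) z)" unfolding mm(2)[OF xD] qco_K_class[OF gD x]
    by (subst lookup_frag_extend[OF mD.dim_finite[OF x]]) (simp_all add: keys_kd[OF gD x] lookup_kd[OF gD x])
   also have "\<dots> = (\<Sum>s | gd ?D x s \<noteq> 0. int (gd ?D x s * M {1,2} {1} (\<lambda>_. 1) z s))"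
   proof (rule sum.cong[OF refl])
    fix s assume "s \<in> {s. gd ?D x s \<noteq> 0}"
    then have "s \<in> gJ ?D" using mD.dim_support[OF x] by simp
    from lookup_kd[OF gC mO[OF gs_Obj[OF gD this]], of z]
    show "int (gd ?D x s) * coef (kd ?C (fob ?m (gs ?D s))) z = int (gd ?D x s * M {1,2} {1} (\<lambda>_. 1) z s)" by (simp add: ms)
   qed
   also have "\<dots> = coef (?ph (K_class ?C (fob ?m x))) z" unfolding qco_K_class[OF gC mO[OF x]] lookup_kd[OF gC mO[OF x]] md[OF x] by simp
   finally show "coef (?ph (mm (K_class ?D x))) z = coef (?ph (K_class ?C (fob ?m x))) z" .
  qed
 qed
 have kd_mu: "kd ?C (fob ?m (gs ?D (?f p))) = mu p" if p: "p \<in> J1 \<times> J1" for p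
 proof (rule poly_mapping_eqI)
  fix z
  obtain x y where xy: "p = (x, y)" "x \<in> J1" "y \<in> J1" using p by (rule SigmaE)
  have s: "bx {1,2} (pr x y) \<in> gJ ?D" by (rule bx_pr[OF xy(2,3)])
  have "M {1,2} {1} (\<lambda>_. 1) z (bx {1,2} (pr x y)) = c {1,2} (pr x y) z" by (rule M_fold[OF _ pr_in[OF xy(2,3)]]) simp
  also have "\<dots> = c2 (pr x y 1) (pr x y 2) z" by (rule c_pair) (use xy in "simp_all add: pr_simps")
  finally have "M {1,2} {1} (\<lambda>_. 1) z (bx {1,2} (pr x y)) = c2 x y z" by (simp add: pr_simps)
  then show "coef (kd ?C (fob ?m (gs ?D (?f p)))) z = coef (mu p) z"
   using lookup_kd[OF gC mO[OF gs_Obj[OF gD s]], of z] by (simp add: xy ms lookup_mu)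
 qed
 have prod: "a \<otimes>\<^bsub>A\<^esub> b = mm (ka (pure_tensor ?G ?G a b))" if ab: "a \<in> carrier ?G" "b \<in> carrier ?G" for a b
 proof (rule ph_inj)
  have p: "pure_tensor ?G ?G a b \<in> carrier (tensor ?G ?G)" by (rule pure_in[OF ab])
  show "a \<otimes>\<^bsub>A\<^esub> b \<in> carrier ?G" by (rule mult_closed[OF ab])
  show "mm (ka (pure_tensor ?G ?G a b)) \<in> carrier ?G" by (rule hom_in_carrier[OF mm(1) ka_in[OF p]])
  have k: "supp (tens (?ph a) (?ph b)) \<subseteq> J1 \<times> J1" by (rule keys_tens_sub[OF ph_keys[OF ab(1)] ph_keys[OF ab(2)]])
  have "?ph (mm (ka (pure_tensor ?G ?G a b))) =
    frag_extend (\<lambda>s. kd ?C (fob ?m (gs ?D s))) (frag_extend (\<lambda>p. frag_of (?f p)) (tens (?ph a) (?ph b)))"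
   unfolding mm(2)[OF ka_in[OF p]] ka(2)[OF p] ta_pure[OF ab] ..
  also have "\<dots> = frag_extend mu (tens (?ph a) (?ph b))" using k by (induction rule: frag_closed_induct) (simp_all add: frag_extend_diff kd_mu)
  finally show "?ph (a \<otimes>\<^bsub>A\<^esub> b) = ?ph (mm (ka (pure_tensor ?G ?G a b)))" by (simp add: ph_mult_A[OF ab] mult_def)
 qed
 have pair: "fs_pair = fs_disc {1,2}" by (simp add: fs_pair_def fs_disc_def)
 have fs_proj: "fs_proj i = proj {1,2} i" for i by (auto simp: fs_proj_def disc_map_def pair fs_disc_1[symmetric] pbase_def fun_eq_iff)
 have fs_box: "fs_box = box {1,2}" by (auto simp: fs_box_def box_def pair pbase_def fun_eq_iff)
 have "K_box H ka" unfolding K_box_def Let_def HC HD pair fs_proj fs_box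
 proof (intro conjI ballI)
  show "ka \<in> iso (tensor ?G ?G) (K_group ?D)" by (rule ka(1))
  fix x y assume x: "x \<in> Obj (tot (fam (fs_disc {1,2}) 1))" and y: "y \<in> Obj (tot (fam (fs_disc {1,2}) 2))"
  let ?x = "fob (arH H (proj {1,2} 1) 1) (\<lambda>_\<in>{1}. x)" and ?y = "fob (arH H (proj {1,2} 2) 1) (\<lambda>_\<in>{2}. y)"
  let ?t = "\<lambda>i\<in>{1,2}. if i = 1 then x else y"
  let ?b = "fob (arH H (box {1,2}) 1) ?t"
  have xO: "?x \<in> Obj (tot ?C)" and yO: "?y \<in> Obj (tot ?C)" by (rule fob_proj_Obj; use x y in simp)+
  have t: "?t \<in> (\<Pi>\<^sub>E u\<in>{1,2}. Obj (tot (fam (fs_disc {1,2}) u)))" using x y by auto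
  have bO: "?b \<in> Obj (tot ?D)" by (rule fob_box_Obj[OF _ t]) simp
  note cx = K_class_in[OF gC xO] and cy = K_class_in[OF gC yO]
  have p: "pure_tensor ?G ?G (K_class ?C ?x) (K_class ?C ?y) \<in> carrier (tensor ?G ?G)" by (rule pure_in[OF cx cy])
  show "ka (pure_tensor ?G ?G (K_class ?C ?x) (K_class ?C ?y)) = K_class ?D ?b"
  proof (rule D.eq_lookupI[OF ka_in[OF p] K_class_in[OF gD bO]])
   fix s assume "s \<in> JS {1,2}"
   then have "s \<in> ?f ` (J1 \<times> J1)" using bij_betw_imp_surj_on[OF bij_bx_pr] by simp
   then obtain q where q: "s = ?f q" "q \<in> J1 \<times> J1" by (rule imageE)
   obtain u v where uv: "q = (u, v)" "u \<in> J1" "v \<in> J1" using q(2) by (rule SigmaE)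
   have kx: "supp (tens (kd ?C ?x) (kd ?C ?y)) \<subseteq> J1 \<times> J1" by (rule keys_tens_sub[OF keys_kd_sub[OF gC xO] keys_kd_sub[OF gC yO]])
   \<comment> \<open>The relabelling \<open>?f\<close> is injective on pairs, so the coefficient at
     \<open>s\<close> is the coefficient at its only preimage \<open>q\<close>.\<close>
   have "coef (frag_extend (\<lambda>p. frag_of (?f p)) w) s = coef w q" if "supp w \<subseteq> J1 \<times> J1" for w using that
   proof (induction rule: frag_closed_induct)
    case (one r)
    have "?f q = ?f r \<longleftrightarrow> q = r" by (rule inj_on_eq_iff[OF bij_betw_imp_inj_on[OF bij_bx_pr] q(2) one])
    then show ?case by (simp add: q(1))
   qed (simp_all add: frag_extend_diff lookup_minus)
   then have "coef (?ch (ka (pure_tensor ?G ?G (K_class ?C ?x) (K_class ?C ?y)))) s =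
     int (gd ?C ?x u) * int (gd ?C ?y v)" unfolding ka(2)[OF p] ta_pure[OF cx cy] qco_K_class[OF gC xO] qco_K_class[OF gC yO]
    using kx by (simp add: uv(1) lookup_tens lookup_kd[OF gC xO] lookup_kd[OF gC yO])
   \<comment> \<open>The multiplicities of \<open>?x\<close> and \<open>?y\<close> are those of
     \<open>x\<close> and \<open>y\<close>, relabelled by \<open>sg\<close>, and
     \<open>gd_box\<close> multiplies exactly these.\<close>
   also have "\<dots> = int (gd ?D ?b s)"
    using gd_proj[of "{1,2}" 1 u x] gd_proj[of "{1,2}" 2 v y] gd_box[OF _ pr_in[OF uv(2,3)] t] x y uv q(1) by (simp add: pr_simps)
   also have "\<dots> = coef (?ch (K_class ?D ?b)) s" by (simp add: qco_K_class[OF gD bO] lookup_kd[OF gD bO])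
   finally show "coef (?ch (ka (pure_tensor ?G ?G (K_class ?C ?x) (K_class ?C ?y)))) s = coef (?ch (K_class ?D ?b)) s" .
  qed
 qed
 moreover have "K_induced ?D ?C ?m mm" unfolding K_induced_def using mm(1) mm_class by blast
 ultimately have "PSH_structure_of H A" unfolding PSH_structure_of_def Let_def HC HD A_simps
  using add_A K_deg_part[OF gC] deg_A prod K_basis[OF gC] basis_A ip_kd[OF gC]
  by (intro conjI exI[of _ ka] exI[of _ mm] ballI allI) (simp_all add: ip_A K_class_in[OF gC] qco_K_class[OF gC])
 then show ?thesis using PSH by blast
qed

end

text \<open>A constant sequence is non-zero in every degree, as the test category requires: changing
  an object of \<open>tot\<close> to \<open>a\<close> in degree \<open>n\<close> keeps its support
  finite.\<close>

lemma ex_degree: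
 fixes V :: "('o, 'm, 'k::field_char_0) lcat"
 assumes V: "two_vector_space V" and a: "a \<in> Obj V" "\<not> is_zero_obj V a"
 shows "graded_2vect (\<lambda>_. V)" "\<exists>k. (n, k) \<in> gJ (\<lambda>_. V)"
proof -
 let ?Z = "\<lambda>_::nat. V"
 show g: "graded_2vect ?Z" using V by (simp add: graded_2vect_def)
 interpret matcat "tot ?Z" "gJ ?Z" "gd ?Z" "gr ?Z" by (rule matcat_gpres[OF g])
 obtain x where x: "x \<in> Obj (tot ?Z)" using ex_zero_obj by blast
 have xs: "x m \<in> Obj V" "finite (gsupp ?Z x)" for m using x by (auto simp: Obj_tot)
 define y where "y = x(n := a)"
 have "gsupp ?Z y \<subseteq> insert n (gsupp ?Z x)" by (auto simp: gsupp_def y_def)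
 then have "y \<in> Obj (tot ?Z)" using xs a(1) finite_subset by (fastforce simp: Obj_tot y_def)
 moreover have "n \<in> gsupp ?Z y" using a(2) by (simp add: gsupp_def y_def)
 ultimately obtain j where "gd ?Z y j \<noteq> 0" "fst j = n" using gsupp_gd[OF g, of y] by auto
 then show "\<exists>k. (n, k) \<in> gJ ?Z" using dim_support[OF \<open>y \<in> Obj (tot ?Z)\<close>, of j] by (metis prod.collapse)
qed

theorem corollary3p20:
 fixes H :: "('o, 'm, 'k::field_char_0) psfun"
 assumes "\<exists>V :: ('o, 'm, 'k) lcat. linear_category V \<and> linear_equivalent V (Vect :: (nat, 'k mat, 'k) lcat)"
  and "SSH_category H"
 shows "\<exists>A. PSH_algebra A \<and> PSH_structure_of H A"
proof -
 obtain V :: "('o, 'm, 'k) lcat" where "linear_category V" "linear_equivalent V (Vect :: (nat, 'k mat, 'k) lcat)" using assms(1) by blast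
 from ex_nonzero_two_vector_space[OF this] obtain a where V: "two_vector_space V" "a \<in> Obj V" "\<not> is_zero_obj V a" by blast
 interpret ssh H "\<lambda>_. V" by unfold_locales (rule assms(2) ex_degree[OF V])+
 show ?thesis by (rule PSH_structure)
qed

end
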